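(* Assume that $R$ is equipped with a ring homomorphism $\varepsilon_R:R\to\mathbb Z$ such that $\varepsilon_R(G)=\{1\}$. Then the functor $\mathsf{Mag}:\mathsf{Cob}_G\to\mathsf{pLagr}_R$ descends to the quotient $\mathsf{Cob}_G/\!\sim_H$; that is, if $(M_1,\varphi_1),(M_2,\varphi_2):(g_-,\varphi_-)\to(g_+,\varphi_+)$ are homology concordant morphisms of $\mathsf{Cob}_G$, then $\mathsf{Mag}(M_1,\varphi_1)=\mathsf{Mag}(M_2,\varphi_2)$.
   Context: **Ring data.** $R$ is a commutative ring without zero-divisors with $2\neq0$; $G\subset R^\times$ is a multiplicative subgroup; $R$ has an involutive ring endomorphism $r\mapsto\overline r$ with $\overline x=x^{-1}$ for $x\in G$. $Q$ is the field of fractions of $R$. **Category $\mathsf{Cob}_G$.** $F_g$ is a fixed compact connected oriented surface of genus $g\ge0$ with one boundary component identified with $S^1$, base point $\star\in\partial F_g$. A cobordism from $F_{g_-}$ to $F_{g_+}$ is a compact connected oriented 3-manifold $M$ with an orientation-preserving homeomorphism $m:-F_{g_-}\cup_{S^1\times\{-1\}}(S^1\times[-1,1])\cup_{S^1\times\{1\}}F_{g_+}\to\partial M$, considered up to homeomorphism compatible with the parametrizations; $m_\pm:F_{g_\pm}\to M$ are its restrictions. Objects of $\mathsf{Cob}_G$: pairs $(g,\varphi)$, $\varphi:H_1(F_g)\to G$ a homomorphism. Morphisms $(g_-,\varphi_-)\to(g_+,\varphi_+)$: pairs $(M,\varphi)$, $M$ a cobordism, $\varphi:H_1(M)\to G$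 a homomorphism with $\varphi\circ m_\pm=\varphi_\pm$. Composition is by gluing. **Homology concordance.** $(M_1,\varphi_1)\sim_H(M_2,\varphi_2)$ if there is a compact connected oriented 4-manifold $W$ with $\partial W=M_1\cup_{m_1\circ m_2^{-1}}(-M_2)$ such that the inclusions $i_k:M_k\hookrightarrow W$ induce isomorphisms on $H(\cdot;\mathbb Z)$ and $\varphi_1\circ(i_1)^{-1}=\varphi_2\circ(i_2)^{-1}:H_1(W)\to G$. This is a congruence relation on $\mathsf{Cob}_G$. **Twisted homology.** $H_1^\varphi(X,\star)$ is the first homology of $R\otimes_{\mathbb Z[H_1(X)]}C(\widehat X,p^{-1}(\star))$, $p:\widehat X\to X$ the maximal abelian cover, $\varphi:H_1(X)\to G$ extended linearly to $\mathbb Z[H_1(X)]\to R$. Base points $m_\pm(\star)$ are identified along $m(\{\star\}\times[-1,1])$. **The functor $\mathsf{Mag}$.** On objects, $\mathsf{Mag}(g,\varphi)=(H_1^\varphi(F_g,\star),\langle\cdot,\cdot\rangle_s,\nu/2)$, where $\langle\cdot,\cdot\rangle_s$ is a certain non-degenerate skew-Hermitian form (depending only on $(g,\varphi)$) and $\nu/2\in Q\otimes_RH_1^\varphi(F_g,\star)$ is half of the boundary class. On morphisms, $\mathsf{Mag}(M,\varphi)=\operatorname{cl}\big(\ker((-m_-)\oplus m_+:H_1^{\varphi_-}(F_{g_-},\star)\oplus H_1^{\varphi_+}(F_{g_+},\star)\to H_1^\varphi(M,\star))\big)$, where $\operatorname{cl}(A)=\{x:\exists r\in R\setminus\{0\},\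 rx\in A\}$. $\mathsf{pLagr}_R$ is the category of pointed skew-Hermitian $R$-modules and pointed Lagrangian relations: morphisms between two objects are certain submodules of the direct sum of the underlying modules, and two morphisms are equal iff they are equal as submodules. *)

theory Defs
  imports "HOL-Homology.Homology" "HOL-Algebra.Module"
begin

section \<open>Gluing of topological spaces\<close>

definition disjoint_sum :: "'a topology \<Rightarrow> 'b topology \<Rightarrow> ('a + 'b) topology" where
  "disjoint_sum X Y = topology (\<lambda>U. openin X (Inl -` U) \<and> openin Y (Inr -` U))"

lemma openin_disjoint_sum:
  "openin (disjoint_sum X Y) U \<longleftrightarrow> openin X (Inl -` U) \<and> openin Y (Inr -` U)"
proof -
  have "istopology (\<lambda>U. openin X (Inl -` U) \<and> openin Y (Inr -` U))"
    by (auto simp: istopology_def vimage_Union vimage_Int)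
  then show ?thesis
    by (simp add: disjoint_sum_def topology_inverse')
qed

text \<open>The equivalence relation on the points of \<open>X\<close> generated by the pairs in \<open>E\<close>.\<close>

definition gluing :: "'a topology \<Rightarrow> ('a \<times> 'a) set \<Rightarrow> ('a \<times> 'a) set" where
  "gluing X E = {(x, y). x \<in> topspace X \<and> y \<in> topspace X \<and> (x, y) \<in> (E \<union> E\<inverse>)\<^sup>*}"

definition quotient_space :: "'a topology \<Rightarrow> ('a \<times> 'a) set \<Rightarrow> 'a set topology" where
  "quotient_space X E =
     topology (\<lambda>U. U \<subseteq> topspace X // gluing X E \<and> openin X (\<Union>U))"

lemma equiv_gluing: "equiv (topspace X) (gluing X E)"
proof (rule equivI)
  show "gluing X E \<subseteq> topspace X \<times> topspace X"
    by (auto simp: gluing_def)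
  show "refl_on (topspace X) (gluing X E)"
    by (auto simp: gluing_def refl_on_def)
  have "sym ((E \<union> E\<inverse>)\<^sup>*)"
    by (rule sym_rtrancl) (auto simp: sym_def)
  then show "sym (gluing X E)"
    by (auto simp: gluing_def sym_def)
  show "trans (gluing X E)"
    by (auto simp: gluing_def trans_def)
qed

lemma openin_quotient_space:
  "openin (quotient_space X E) U \<longleftrightarrow> U \<subseteq> topspace X // gluing X E \<and> openin X (\<Union>U)"
proof -
  let ?Q = "topspace X // gluing X E"
  have "\<Union>(S \<inter> T) = \<Union>S \<inter> \<Union>T" if "S \<subseteq> ?Q" "T \<subseteq> ?Q" for S T
  proof
    show "\<Union>S \<inter> \<Union>T \<subseteq> \<Union>(S \<inter> T)"
    proof
      fix x assume "x \<in> \<Union>S \<inter> \<Union>T"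
      then obtain A B where "A \<in> S" "x \<in> A" "B \<in> T" "x \<in> B" by blast
      moreover from this have "A = B"
        using quotient_disj[OF equiv_gluing, of A X E B] that by blast
      ultimately show "x \<in> \<Union>(S \<inter> T)" by blast
    qed
  qed blast
  moreover have "openin X (\<Union>(\<Union>K))" if "\<forall>U\<in>K. openin X (\<Union>U)" for K :: "'a set set set"
  proof -
    have "\<Union>(\<Union>K) = (\<Union>U\<in>K. \<Union>U)" by blast
    then show ?thesis using that by (auto intro: openin_Union)
  qed
  ultimately have "istopology (\<lambda>U. U \<subseteq> ?Q \<and> openin X (\<Union>U))"
    unfolding istopology_def by (auto intro!: openin_Int)
  then show ?thesis
    by (simp add: quotient_space_def topology_inverse')
qed

definition glue_class :: "'a topology \<Rightarrow> ('a \<times> 'a) set \<Rightarrow> 'a \<Rightarrow> 'a set" where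
  "glue_class X E x = gluing X E `` {x}"


section \<open>Compact oriented topological manifolds with boundary\<close>

definition half_space :: "nat \<Rightarrow> (nat \<Rightarrow> real) topology" where
  "half_space n = subtopology (Euclidean_space n) {x. 0 \<le> x 0}"

definition locally_like :: "(nat \<Rightarrow> real) topology \<Rightarrow> 'a topology \<Rightarrow> 'a \<Rightarrow> bool" where
  "locally_like E X x \<longleftrightarrow>
     (\<exists>U V. openin X U \<and> x \<in> U \<and> openin E V \<and>
            subtopology X U homeomorphic_space subtopology E V)"

text \<open>Meant for \<open>n \<ge> 1\<close>. Second countability follows from compactness.\<close>

definition compact_manifold :: "nat \<Rightarrow> 'a topology \<Rightarrow> bool" where
  "compact_manifold n X \<longleftrightarrow> compact_space X \<and> Hausdorff_space X \<and>
     (\<forall>x \<in> topspace X. locally_like (half_space n) X x)"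

definition mfd_interior :: "nat \<Rightarrow> 'a topology \<Rightarrow> 'a set" where
  "mfd_interior n X = {x \<in> topspace X. locally_like (Euclidean_space n) X x}"

definition mfd_boundary :: "nat \<Rightarrow> 'a topology \<Rightarrow> 'a set" where
  "mfd_boundary n X = topspace X - mfd_interior n X"

text \<open>An orientation of a compact \<open>n\<close>-manifold \<open>X\<close>, given by its fundamental class in
  \<open>H\<^sub>n(X, \<partial>X; \<int>)\<close>: a class restricting to a generator of the local homology at every interior
  point. The opposite orientation is the inverse class.\<close>

definition orientation :: "nat \<Rightarrow> 'a topology \<Rightarrow> 'a chain set \<Rightarrow> bool" where
  "orientation n X \<mu> \<longleftrightarrow>
     \<mu> \<in> carrier (relative_homology_group (int n) X (mfd_boundary n X)) \<and>
     (\<forall>x \<in> mfd_interior n X.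
        generate (relative_homology_group (int n) X (topspace X - {x}))
          {hom_induced (int n) X (mfd_boundary n X) X (topspace X - {x}) id \<mu>} =
        carrier (relative_homology_group (int n) X (topspace X - {x})))"

definition opposite :: "nat \<Rightarrow> 'a topology \<Rightarrow> 'a chain set \<Rightarrow> 'a chain set" where
  "opposite n X \<mu> = inv\<^bsub>relative_homology_group (int n) X (mfd_boundary n X)\<^esub> \<mu>"

text \<open>The class \<open>\<nu> \<in> H\<^sub>n(N)\<close> of a closed \<open>n\<close>-manifold \<open>N\<close> induces the class \<open>\<mu>\<close> on the
  codimension-zero piece \<open>k : X \<rightarrow> N\<close>: both have the same image in \<open>H\<^sub>n(N, N - k(int X))\<close>, a group
  identified with \<open>H\<^sub>n(X, \<partial>X)\<close> by excision.\<close>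

definition induces_on ::
  "nat \<Rightarrow> 'b topology \<Rightarrow> 'b chain set \<Rightarrow> ('a \<Rightarrow> 'b) \<Rightarrow> 'a topology \<Rightarrow> 'a chain set \<Rightarrow> bool" where
  "induces_on n N \<nu> k X \<mu> \<longleftrightarrow>
     hom_induced (int n) N {} N (topspace N - k ` mfd_interior n X) id \<nu> =
     hom_induced (int n) X (mfd_boundary n X) N (topspace N - k ` mfd_interior n X) k \<mu>"

text \<open>\<open>j\<close> is an orientation-preserving homeomorphism from the closed \<open>n\<close>-manifold \<open>N\<close> with
  fundamental class \<open>\<nu>\<close> onto the boundary of the \<open>(n+1)\<close>-manifold \<open>W\<close> with fundamental
  class \<open>\<mu>\<close>.\<close>

definition oriented_boundary_map ::
  "nat \<Rightarrow> 'b topology \<Rightarrow> 'b chain set \<Rightarrow> 'a topology \<Rightarrow> 'a chain set \<Rightarrow> ('b \<Rightarrow> 'a) \<Rightarrow> bool" where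
  "oriented_boundary_map n N \<nu> W \<mu> j \<longleftrightarrow>
     (let B = mfd_boundary (Suc n) W in
        homeomorphic_map N (subtopology W B) j \<and>
        hom_induced (int n) N {} (subtopology W B) {} j \<nu> = hom_boundary (int (Suc n)) W B \<mu>)"


section \<open>The surfaces $F_g$\<close>

definition circle :: "complex topology" where
  "circle = subtopology euclidean (sphere 0 1)"

definition nonseparating_curves :: "'a topology \<Rightarrow> nat \<Rightarrow> bool" where
  "nonseparating_curves X k \<longleftrightarrow>
     (\<exists>C :: nat \<Rightarrow> 'a set.
        (\<forall>i<k. C i \<subseteq> mfd_interior 2 X \<and> subtopology X (C i) homeomorphic_space circle) \<and>
        (\<forall>i<k. \<forall>j<k. i \<noteq> j \<longrightarrow> C i \<inter> C j = {}) \<and>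
        connected_space (subtopology X (topspace X - (\<Union>i<k. C i))))"

text \<open>The genus is the largest number of disjoint simple closed curves whose union does not
  separate the surface.\<close>

definition has_genus :: "'a topology \<Rightarrow> nat \<Rightarrow> bool" where
  "has_genus X g \<longleftrightarrow>
     nonseparating_curves X g \<and> (\<forall>k. nonseparating_curves X k \<longrightarrow> k \<le> g)"

record 'f surface =
  surf_space :: "'f topology"
  surf_orient :: "'f chain set"
  surf_bdry :: "complex \<Rightarrow> 'f"

text \<open>\<open>F g\<close> is the fixed surface of genus \<open>g\<close>; its oriented boundary is identified with the
  circle, oriented by the generator \<open>\<omega>\<close> of \<open>H\<^sub>1(S\<^sup>1)\<close>. The base point of \<open>F g\<close> is the point
  corresponding to \<open>s \<in> S\<^sup>1\<close>.\<close>

definition model_surfaces :: "(nat \<Rightarrow> 'f surface) \<Rightarrow> complex \<Rightarrow> bool" where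
  "model_surfaces F s \<longleftrightarrow>
     s \<in> topspace circle \<and>
     (\<exists>\<omega> \<in> carrier (homology_group 1 circle).
        generate (homology_group 1 circle) {\<omega>} = carrier (homology_group 1 circle) \<and>
        (\<forall>g. compact_manifold 2 (surf_space (F g)) \<and> connected_space (surf_space (F g)) \<and>
             orientation 2 (surf_space (F g)) (surf_orient (F g)) \<and>
             has_genus (surf_space (F g)) g \<and>
             oriented_boundary_map 1 circle \<omega>
               (surf_space (F g)) (surf_orient (F g)) (surf_bdry (F g))))"

abbreviation base_pt :: "'f surface \<Rightarrow> complex \<Rightarrow> 'f" where
  "base_pt S s \<equiv> surf_bdry S s"


section \<open>Cobordisms\<close>

type_synonym 'f pieces = "'f + ((complex \<times> real) + 'f)"

definition pieces :: "(nat \<Rightarrow> 'f surface) \<Rightarrow> nat \<Rightarrow> nat \<Rightarrow> 'f pieces topology" where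
  "pieces F gm gp =
     disjoint_sum (surf_space (F gm))
       (disjoint_sum (prod_topology circle (subtopology euclideanreal {-1..1}))
          (surf_space (F gp)))"

definition pieces_glue :: "(nat \<Rightarrow> 'f surface) \<Rightarrow> nat \<Rightarrow> nat \<Rightarrow> ('f pieces \<times> 'f pieces) set" where
  "pieces_glue F gm gp =
     {(Inl (surf_bdry (F gm) z), Inr (Inl (z, -1))) | z. z \<in> topspace circle} \<union>
     {(Inr (Inr (surf_bdry (F gp) z)), Inr (Inl (z, 1))) | z. z \<in> topspace circle}"

text \<open>The closed surface $-F_{g_-}\cup_{S^1\times\{-1\}}(S^1\times[-1,1])\cup_{S^1\times\{1\}}F_{g_+}$.\<close>

definition bdry_surface :: "(nat \<Rightarrow> 'f surface) \<Rightarrow> nat \<Rightarrow> nat \<Rightarrow> 'f pieces set topology" where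
  "bdry_surface F gm gp = quotient_space (pieces F gm gp) (pieces_glue F gm gp)"

definition in_bottom :: "(nat \<Rightarrow> 'f surface) \<Rightarrow> nat \<Rightarrow> nat \<Rightarrow> 'f \<Rightarrow> 'f pieces set" where
  "in_bottom F gm gp x = glue_class (pieces F gm gp) (pieces_glue F gm gp) (Inl x)"

definition in_side :: "(nat \<Rightarrow> 'f surface) \<Rightarrow> nat \<Rightarrow> nat \<Rightarrow> complex \<times> real \<Rightarrow> 'f pieces set" where
  "in_side F gm gp x = glue_class (pieces F gm gp) (pieces_glue F gm gp) (Inr (Inl x))"

definition in_top :: "(nat \<Rightarrow> 'f surface) \<Rightarrow> nat \<Rightarrow> nat \<Rightarrow> 'f \<Rightarrow> 'f pieces set" where
  "in_top F gm gp x = glue_class (pieces F gm gp) (pieces_glue F gm gp) (Inr (Inr x))"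

text \<open>The boundary surface is connected, so its orientation is determined by the orientations
  induced on the two surface pieces.\<close>

definition bdry_surface_orientation ::
  "(nat \<Rightarrow> 'f surface) \<Rightarrow> nat \<Rightarrow> nat \<Rightarrow> 'f pieces set chain set \<Rightarrow> bool" where
  "bdry_surface_orientation F gm gp \<sigma> \<longleftrightarrow>
     orientation 2 (bdry_surface F gm gp) \<sigma> \<and>
     induces_on 2 (bdry_surface F gm gp) \<sigma> (in_bottom F gm gp) (surf_space (F gm))
       (opposite 2 (surf_space (F gm)) (surf_orient (F gm))) \<and>
     induces_on 2 (bdry_surface F gm gp) \<sigma> (in_top F gm gp) (surf_space (F gp))
       (surf_orient (F gp))"

record ('f, 'm) cobordism =
  cob_space :: "'m topology"
  cob_orient :: "'m chain set"
  cob_param :: "'f pieces set \<Rightarrow> 'm"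

definition is_cobordism ::
  "(nat \<Rightarrow> 'f surface) \<Rightarrow> nat \<Rightarrow> nat \<Rightarrow> ('f, 'm) cobordism \<Rightarrow> bool" where
  "is_cobordism F gm gp M \<longleftrightarrow>
     compact_manifold 3 (cob_space M) \<and> connected_space (cob_space M) \<and>
     orientation 3 (cob_space M) (cob_orient M) \<and>
     (\<exists>\<sigma>. bdry_surface_orientation F gm gp \<sigma> \<and>
          oriented_boundary_map 2 (bdry_surface F gm gp) \<sigma>
            (cob_space M) (cob_orient M) (cob_param M))"

definition m_minus :: "(nat \<Rightarrow> 'f surface) \<Rightarrow> nat \<Rightarrow> nat \<Rightarrow> ('f, 'm) cobordism \<Rightarrow> 'f \<Rightarrow> 'm" where
  "m_minus F gm gp M = cob_param M \<circ> in_bottom F gm gp"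

definition m_side ::
  "(nat \<Rightarrow> 'f surface) \<Rightarrow> nat \<Rightarrow> nat \<Rightarrow> ('f, 'm) cobordism \<Rightarrow> complex \<times> real \<Rightarrow> 'm" where
  "m_side F gm gp M = cob_param M \<circ> in_side F gm gp"

definition m_plus :: "(nat \<Rightarrow> 'f surface) \<Rightarrow> nat \<Rightarrow> nat \<Rightarrow> ('f, 'm) cobordism \<Rightarrow> 'f \<Rightarrow> 'm" where
  "m_plus F gm gp M = cob_param M \<circ> in_top F gm gp"


section \<open>Ring data and the category $\mathsf{Cob}_G$\<close>

definition unital_ring_hom :: "('a::comm_ring_1 \<Rightarrow> 'b::comm_ring_1) \<Rightarrow> bool" where
  "unital_ring_hom f \<longleftrightarrow> f 1 = 1 \<and> (\<forall>x y. f (x + y) = f x + f y) \<and> (\<forall>x y. f (x * y) = f x * f y)"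

definition unit_group :: "'r::comm_ring_1 monoid" where
  "unit_group = \<lparr>carrier = {x. x dvd 1}, monoid.mult = (*), one = 1\<rparr>"

definition ring_data :: "'r::idom set \<Rightarrow> ('r \<Rightarrow> 'r) \<Rightarrow> bool" where
  "ring_data G bar \<longleftrightarrow>
     (2 :: 'r) \<noteq> 0 \<and> subgroup G (unit_group :: 'r monoid) \<and>
     unital_ring_hom bar \<and> (\<forall>r. bar (bar r) = r) \<and> (\<forall>x\<in>G. bar x = inv\<^bsub>unit_group\<^esub> x)"

definition H1_homs :: "'a topology \<Rightarrow> 'r::comm_ring_1 set \<Rightarrow> ('a chain set \<Rightarrow> 'r) set" where
  "H1_homs X G = hom (homology_group 1 X) (unit_group\<lparr>carrier := G\<rparr>)"

type_synonym ('f, 'r) cob_object = "nat \<times> ('f chain set \<Rightarrow> 'r)"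
type_synonym ('f, 'm, 'r) cob_morphism = "('f, 'm) cobordism \<times> ('m chain set \<Rightarrow> 'r)"

definition is_cob_object ::
  "(nat \<Rightarrow> 'f surface) \<Rightarrow> 'r::comm_ring_1 set \<Rightarrow> ('f, 'r) cob_object \<Rightarrow> bool" where
  "is_cob_object F G = (\<lambda>(g, \<phi>). \<phi> \<in> H1_homs (surf_space (F g)) G)"

definition is_cob_morphism ::
  "(nat \<Rightarrow> 'f surface) \<Rightarrow> 'r::comm_ring_1 set \<Rightarrow>
     ('f, 'r) cob_object \<Rightarrow> ('f, 'r) cob_object \<Rightarrow> ('f, 'm, 'r) cob_morphism \<Rightarrow> bool" where
  "is_cob_morphism F G = (\<lambda>(gm, \<phi>m) (gp, \<phi>p) (M, \<phi>).
     is_cob_object F G (gm, \<phi>m) \<and> is_cob_object F G (gp, \<phi>p) \<and>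
     is_cobordism F gm gp M \<and> \<phi> \<in> H1_homs (cob_space M) G \<and>
     (\<forall>x \<in> carrier (homology_group 1 (surf_space (F gm))).
        \<phi> (hom_induced 1 (surf_space (F gm)) {} (cob_space M) {} (m_minus F gm gp M) x) = \<phi>m x) \<and>
     (\<forall>x \<in> carrier (homology_group 1 (surf_space (F gp))).
        \<phi> (hom_induced 1 (surf_space (F gp)) {} (cob_space M) {} (m_plus F gm gp M) x) = \<phi>p x))"


section \<open>Homology concordance\<close>

definition double_glue ::
  "(nat \<Rightarrow> 'f surface) \<Rightarrow> nat \<Rightarrow> nat \<Rightarrow> ('f, 'm) cobordism \<Rightarrow> ('f, 'n) cobordism \<Rightarrow>
     (('m + 'n) \<times> ('m + 'n)) set" where
  "double_glue F gm gp M1 M2 =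
     {(Inl (cob_param M1 x), Inr (cob_param M2 x)) | x. x \<in> topspace (bdry_surface F gm gp)}"

text \<open>The closed 3-manifold $M_1\cup_{m_1\circ m_2^{-1}}(-M_2)$, the inclusions of its two pieces,
  and its orientation.\<close>

definition double ::
  "(nat \<Rightarrow> 'f surface) \<Rightarrow> nat \<Rightarrow> nat \<Rightarrow> ('f, 'm) cobordism \<Rightarrow> ('f, 'n) cobordism \<Rightarrow>
     ('m + 'n) set topology" where
  "double F gm gp M1 M2 =
     quotient_space (disjoint_sum (cob_space M1) (cob_space M2)) (double_glue F gm gp M1 M2)"

definition in_first ::
  "(nat \<Rightarrow> 'f surface) \<Rightarrow> nat \<Rightarrow> nat \<Rightarrow> ('f, 'm) cobordism \<Rightarrow> ('f, 'n) cobordism \<Rightarrow>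
     'm \<Rightarrow> ('m + 'n) set" where
  "in_first F gm gp M1 M2 x =
     glue_class (disjoint_sum (cob_space M1) (cob_space M2)) (double_glue F gm gp M1 M2) (Inl x)"

definition in_second ::
  "(nat \<Rightarrow> 'f surface) \<Rightarrow> nat \<Rightarrow> nat \<Rightarrow> ('f, 'm) cobordism \<Rightarrow> ('f, 'n) cobordism \<Rightarrow>
     'n \<Rightarrow> ('m + 'n) set" where
  "in_second F gm gp M1 M2 x =
     glue_class (disjoint_sum (cob_space M1) (cob_space M2)) (double_glue F gm gp M1 M2) (Inr x)"

definition double_orientation ::
  "(nat \<Rightarrow> 'f surface) \<Rightarrow> nat \<Rightarrow> nat \<Rightarrow> ('f, 'm) cobordism \<Rightarrow> ('f, 'n) cobordism \<Rightarrow>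
     ('m + 'n) set chain set \<Rightarrow> bool" where
  "double_orientation F gm gp M1 M2 \<nu> \<longleftrightarrow>
     orientation 3 (double F gm gp M1 M2) \<nu> \<and>
     induces_on 3 (double F gm gp M1 M2) \<nu> (in_first F gm gp M1 M2)
       (cob_space M1) (cob_orient M1) \<and>
     induces_on 3 (double F gm gp M1 M2) \<nu> (in_second F gm gp M1 M2)
       (cob_space M2) (opposite 3 (cob_space M2) (cob_orient M2))"

definition homology_iso :: "'a topology \<Rightarrow> 'b topology \<Rightarrow> ('a \<Rightarrow> 'b) \<Rightarrow> bool" where
  "homology_iso X Y f \<longleftrightarrow> continuous_map X Y f \<and>
     (\<forall>p. hom_induced p X {} Y {} f \<in> iso (homology_group p X) (homology_group p Y))"

text \<open>The first argument only fixes the type of points of the 4-manifold \<open>W\<close>, over which one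
  cannot quantify existentially inside a formula. The maps \<open>i1\<close>, \<open>i2\<close> are the inclusions of the
  pieces of \<open>\<partial>W\<close>.\<close>

definition homology_concordant ::
  "'w itself \<Rightarrow> (nat \<Rightarrow> 'f surface) \<Rightarrow> nat \<Rightarrow> nat \<Rightarrow>
     ('f, 'm, 'r) cob_morphism \<Rightarrow> ('f, 'n, 'r) cob_morphism \<Rightarrow> bool" where
  "homology_concordant _ F gm gp = (\<lambda>(M1, \<phi>1) (M2, \<phi>2).
     \<exists>(W :: 'w topology) \<mu> \<nu> j.
       compact_manifold 4 W \<and> connected_space W \<and> orientation 4 W \<mu> \<and>
       double_orientation F gm gp M1 M2 \<nu> \<and>
       oriented_boundary_map 3 (double F gm gp M1 M2) \<nu> W \<mu> j \<and>
       (let X1 = cob_space M1; X2 = cob_space M2;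
            i1 = j \<circ> in_first F gm gp M1 M2; i2 = j \<circ> in_second F gm gp M1 M2 in
        homology_iso X1 W i1 \<and> homology_iso X2 W i2 \<and>
        (\<forall>h \<in> carrier (homology_group 1 W).
           \<phi>1 (inv_into (carrier (homology_group 1 X1)) (hom_induced 1 X1 {} W {} i1) h) =
           \<phi>2 (inv_into (carrier (homology_group 1 X2)) (hom_induced 1 X2 {} W {} i2) h))))"


section \<open>The maximal abelian cover\<close>

definition path_chain :: "(real \<Rightarrow> 'a) \<Rightarrow> 'a chain" where
  "path_chain \<gamma> = frag_of (restrict (\<lambda>x. \<gamma> (x 1)) (standard_simplex 1))"

definition paths_from :: "'a topology \<Rightarrow> 'a \<Rightarrow> (real \<Rightarrow> 'a) set" where
  "paths_from X x0 = {\<gamma>. pathin X \<gamma> \<and> \<gamma> 0 = x0}"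

text \<open>The points of the maximal abelian cover of \<open>(X, x0)\<close> are the paths from \<open>x0\<close> modulo the
  relation \<open>\<gamma> \<sim> \<gamma>'\<close> iff they have the same endpoint and the loop \<open>\<gamma>\<close> followed by the reverse
  of \<open>\<gamma>'\<close> is trivial in \<open>H\<^sub>1(X) = \<pi>\<^sub>1(X)\<^sup>a\<^sup>b\<close>, that is, \<open>\<gamma> - \<gamma>'\<close> is a singular boundary.\<close>

definition path_class :: "'a topology \<Rightarrow> (real \<Rightarrow> 'a) \<Rightarrow> (real \<Rightarrow> 'a) set" where
  "path_class X \<gamma> =
     {\<gamma>'. pathin X \<gamma>' \<and> \<gamma>' 0 = \<gamma> 0 \<and> \<gamma>' 1 = \<gamma> 1 \<and>
          homologous_rel 1 X {} (path_chain \<gamma>') (path_chain \<gamma>)}"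

text \<open>The basic open sets: the classes of \<open>\<gamma>\<close> followed by a path in the open set \<open>U\<close>.\<close>

definition cover_sheet :: "'a topology \<Rightarrow> 'a set \<Rightarrow> (real \<Rightarrow> 'a) \<Rightarrow> (real \<Rightarrow> 'a) set set" where
  "cover_sheet X U \<gamma> =
     {path_class X \<gamma>' | \<gamma>'. \<gamma>' \<in> paths_from X (\<gamma> 0) \<and>
        (\<exists>\<eta>. pathin (subtopology X U) \<eta> \<and> \<eta> 0 = \<gamma> 1 \<and> \<eta> 1 = \<gamma>' 1 \<and>
             homologous_rel 1 X {} (path_chain \<gamma>') (path_chain \<gamma> + path_chain \<eta>))}"

definition abelian_cover :: "'a topology \<Rightarrow> 'a \<Rightarrow> (real \<Rightarrow> 'a) set topology" where
  "abelian_cover X x0 =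
     topology_generated_by
       {cover_sheet X U \<gamma> | U \<gamma>. openin X U \<and> \<gamma> \<in> paths_from X x0 \<and> \<gamma> 1 \<in> U}"

definition cover_fibre :: "'a topology \<Rightarrow> 'a \<Rightarrow> 'a set \<Rightarrow> (real \<Rightarrow> 'a) set set" where
  "cover_fibre X x0 A = {path_class X \<gamma> | \<gamma>. \<gamma> \<in> paths_from X x0 \<and> \<gamma> 1 \<in> A}"

text \<open>The covering transformation of \<open>h \<in> H\<^sub>1(X)\<close>: precompose a path with a loop of class \<open>h\<close>.\<close>

definition deck :: "'a topology \<Rightarrow> 'a chain set \<Rightarrow> (real \<Rightarrow> 'a) set \<Rightarrow> (real \<Rightarrow> 'a) set" where
  "deck X h e =
     {\<gamma>'. pathin X \<gamma>' \<and>
        (\<exists>\<gamma>\<in>e. \<gamma>' 0 = \<gamma> 0 \<and> \<gamma>' 1 = \<gamma> 1 \<and>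
             homologous_rel_set 1 X {} (path_chain \<gamma>' - path_chain \<gamma>) = h)}"

text \<open>The lift of \<open>f : X \<rightarrow> Y\<close> to the maximal abelian covers, where \<open>\<alpha>\<close> is a path from the base
  point of \<open>Y\<close> to the image of the base point of \<open>X\<close>: the class of \<open>\<gamma>\<close> is sent to the class of
  \<open>\<alpha>\<close> followed by \<open>f \<circ> \<gamma>\<close>.\<close>

definition cover_lift ::
  "'b topology \<Rightarrow> ('a \<Rightarrow> 'b) \<Rightarrow> (real \<Rightarrow> 'b) \<Rightarrow> (real \<Rightarrow> 'a) set \<Rightarrow> (real \<Rightarrow> 'b) set" where
  "cover_lift Y f \<alpha> e =
     {\<gamma>'. pathin Y \<gamma>' \<and> \<gamma>' 0 = \<alpha> 0 \<and>
        (\<exists>\<gamma>\<in>e. \<gamma>' 1 = f (\<gamma> 1) \<and>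
             homologous_rel 1 Y {} (path_chain \<gamma>') (path_chain \<alpha> + path_chain (f \<circ> \<gamma>)))}"


section \<open>Twisted homology\<close>

definition scale :: "'r::comm_ring_1 \<Rightarrow> ('c \<Rightarrow>\<^sub>0 'r) \<Rightarrow> ('c \<Rightarrow>\<^sub>0 'r)" where
  "scale r z = Poly_Mapping.map (\<lambda>a. r * a) z"

lemma lookup_scale [simp]: "Poly_Mapping.lookup (scale r z) c = r * Poly_Mapping.lookup z c"
  by (simp add: scale_def Poly_Mapping.map.rep_eq when_def)

lemma module_scale: "Modules.module (scale :: 'r::comm_ring_1 \<Rightarrow> ('c \<Rightarrow>\<^sub>0 'r) \<Rightarrow> _)"
  by unfold_locales (auto intro!: poly_mapping_eqI simp: lookup_add algebra_simps)

text \<open>Let \<open>E\<close> be the maximal abelian cover of \<open>(X, x0)\<close> and \<open>A \<subseteq> X\<close>. The \<open>R\<close>-module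
  \<open>R \<otimes> C\<^sub>p(E, p\<^sup>-\<^sup>1(A))\<close>, tensored over \<open>\<int>[H\<^sub>1(X)]\<close>, is presented as the free \<open>R\<close>-module on the
  singular \<open>p\<close>-chains \<open>c\<close> of \<open>E\<close>, with \<open>single c r\<close> standing for \<open>r \<otimes> [c]\<close>, modulo the
  following relations: additivity in \<open>c\<close>, \<open>r \<otimes> h c = r \<phi>(h) \<otimes> c\<close> for \<open>h \<in> H\<^sub>1(X)\<close>, and vanishing
  of the chains lying in the preimage of \<open>A\<close>. (Additivity in \<open>r\<close> holds in the free module.)\<close>

type_synonym ('a, 'r) tchain = "((real \<Rightarrow> 'a) set chain) \<Rightarrow>\<^sub>0 'r"

definition tensor_relations ::
  "nat \<Rightarrow> 'a topology \<Rightarrow> 'a \<Rightarrow> 'a set \<Rightarrow> ('a chain set \<Rightarrow> 'r::comm_ring_1) \<Rightarrow> ('a, 'r) tchain set"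
  where
  "tensor_relations p X x0 A \<phi> =
     (let E = abelian_cover X x0 in
      Modules.module.span scale
        ({Poly_Mapping.single (c + c') 1 - Poly_Mapping.single c 1 - Poly_Mapping.single c' 1
            | c c'. singular_chain p E c \<and> singular_chain p E c'} \<union>
         {Poly_Mapping.single (chain_map p (deck X h) c) 1 - Poly_Mapping.single c (\<phi> h)
            | h c. h \<in> carrier (homology_group 1 X) \<and> singular_chain p E c} \<union>
         {Poly_Mapping.single c 1
            | c. singular_chain p (subtopology E (cover_fibre X x0 A)) c}))"

definition tensor_gens :: "nat \<Rightarrow> 'a topology \<Rightarrow> 'a \<Rightarrow> ('a, 'r::comm_ring_1) tchain set" where
  "tensor_gens p X x0 = {z. \<forall>c \<in> Poly_Mapping.keys z. singular_chain p (abelian_cover X x0) c}"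

text \<open>The \<open>R\<close>-linear map sending \<open>r \<otimes> c\<close> to \<open>r \<otimes> f c\<close>.\<close>

definition tensor_map :: "('c \<Rightarrow> 'd) \<Rightarrow> ('c \<Rightarrow>\<^sub>0 'r::comm_ring_1) \<Rightarrow> ('d \<Rightarrow>\<^sub>0 'r)" where
  "tensor_map f z = (\<Sum>c \<in> Poly_Mapping.keys z. Poly_Mapping.single (f c) (Poly_Mapping.lookup z c))"

definition tcycles1 ::
  "'a topology \<Rightarrow> 'a \<Rightarrow> 'a set \<Rightarrow> ('a chain set \<Rightarrow> 'r::comm_ring_1) \<Rightarrow> ('a, 'r) tchain set" where
  "tcycles1 X x0 A \<phi> =
     {z \<in> tensor_gens 1 X x0. tensor_map (chain_boundary 1) z \<in> tensor_relations 0 X x0 A \<phi>}"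

definition tboundaries1 ::
  "'a topology \<Rightarrow> 'a \<Rightarrow> 'a set \<Rightarrow> ('a chain set \<Rightarrow> 'r::comm_ring_1) \<Rightarrow> ('a, 'r) tchain set" where
  "tboundaries1 X x0 A \<phi> =
     {tensor_map (chain_boundary 2) w + n | w n.
        w \<in> tensor_gens 2 X x0 \<and> n \<in> tensor_relations 1 X x0 A \<phi>}"

text \<open>\<open>twisted_H1 X x0 A \<phi>\<close> is \<open>H\<^sub>1\<^sup>\<phi>(X, A)\<close>, where \<open>x0\<close> is the base point of the cover, as a
  module of cosets modulo boundaries. The module records of \<open>HOL-Algebra\<close> extend ring records;
  the multiplicative fields play no role.\<close>

definition twisted_H1 ::
  "'a topology \<Rightarrow> 'a \<Rightarrow> 'a set \<Rightarrow> ('a chain set \<Rightarrow> 'r::comm_ring_1) \<Rightarrow>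
     ('r, ('a, 'r) tchain set) module" where
  "twisted_H1 X x0 A \<phi> =
     (let B = tboundaries1 X x0 A \<phi> in
      \<lparr>carrier = {(+) z ` B | z. z \<in> tcycles1 X x0 A \<phi>},
       monoid.mult = undefined, one = undefined,
       zero = B,
       add = (\<lambda>K L. {a + b | a b. a \<in> K \<and> b \<in> L}),
       smult = (\<lambda>r K. {scale r a + b | a b. a \<in> K \<and> b \<in> B})\<rparr>)"

text \<open>The map on twisted homology induced by \<open>f : (X, A) \<rightarrow> (Y, A')\<close> and the path \<open>\<alpha>\<close> joining
  the base point \<open>y0\<close> of \<open>Y\<close> to the image of that of \<open>X\<close>.\<close>

definition twisted_induced ::
  "'b topology \<Rightarrow> 'b \<Rightarrow> 'b set \<Rightarrow> ('b chain set \<Rightarrow> 'r::comm_ring_1) \<Rightarrow> ('a \<Rightarrow> 'b) \<Rightarrow> (real \<Rightarrow> 'b) \<Rightarrow>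
     ('a, 'r) tchain set \<Rightarrow> ('b, 'r) tchain set" where
  "twisted_induced Y y0 A' \<phi> f \<alpha> K =
     {tensor_map (chain_map 1 (cover_lift Y f \<alpha>)) z + b | z b.
        z \<in> K \<and> b \<in> tboundaries1 Y y0 A' \<phi>}"


section \<open>The functor $\mathsf{Mag}$ on morphisms\<close>

definition module_sum :: "('r, 'a) module \<Rightarrow> ('r, 'b) module \<Rightarrow> ('r, 'a \<times> 'b) module" where
  "module_sum M N =
     \<lparr>carrier = carrier M \<times> carrier N, monoid.mult = undefined, one = undefined,
      zero = (\<zero>\<^bsub>M\<^esub>, \<zero>\<^bsub>N\<^esub>),
      add = (\<lambda>(x, y) (x', y'). (x \<oplus>\<^bsub>M\<^esub> x', y \<oplus>\<^bsub>N\<^esub> y')),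
      smult = (\<lambda>r (x, y). (r \<odot>\<^bsub>M\<^esub> x, r \<odot>\<^bsub>N\<^esub> y))\<rparr>"

definition submodule_cl :: "('r::comm_ring_1, 'a) module \<Rightarrow> 'a set \<Rightarrow> 'a set" where
  "submodule_cl M A = {x \<in> carrier M. \<exists>r. r \<noteq> 0 \<and> r \<odot>\<^bsub>M\<^esub> x \<in> A}"

definition surf_H1 ::
  "'f surface \<Rightarrow> complex \<Rightarrow> ('f chain set \<Rightarrow> 'r::comm_ring_1) \<Rightarrow> ('r, ('f, 'r) tchain set) module" where
  "surf_H1 S s \<phi> = twisted_H1 (surf_space S) (base_pt S s) {base_pt S s} \<phi>"

text \<open>In \<open>M\<close> the two base points are identified along the arc $m(\{\star\}\times[-1,1])$:
  $H_1^\varphi(M,\star)$ is the twisted homology of \<open>M\<close> relative to this arc. The cover of \<open>M\<close> is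
  based at the endpoint $m_-(\star)$, which is joined to $m_-(\star)$ by the constant path and to
  $m_+(\star)$ by the arc.\<close>

definition cob_arc :: "(nat \<Rightarrow> 'f surface) \<Rightarrow> complex \<Rightarrow> nat \<Rightarrow> nat \<Rightarrow> ('f, 'm) cobordism \<Rightarrow> 'm set" where
  "cob_arc F s gm gp M = (\<lambda>t. m_side F gm gp M (s, t)) ` {-1..1}"

definition cob_H1 ::
  "(nat \<Rightarrow> 'f surface) \<Rightarrow> complex \<Rightarrow> nat \<Rightarrow> nat \<Rightarrow> ('f, 'm) cobordism \<Rightarrow>
     ('m chain set \<Rightarrow> 'r::comm_ring_1) \<Rightarrow> ('r, ('m, 'r) tchain set) module" where
  "cob_H1 F s gm gp M \<phi> =
     twisted_H1 (cob_space M) (m_minus F gm gp M (base_pt (F gm) s)) (cob_arc F s gm gp M) \<phi>"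

definition m_minus_star ::
  "(nat \<Rightarrow> 'f surface) \<Rightarrow> complex \<Rightarrow> nat \<Rightarrow> nat \<Rightarrow> ('f, 'm) cobordism \<Rightarrow>
     ('m chain set \<Rightarrow> 'r::comm_ring_1) \<Rightarrow> ('f, 'r) tchain set \<Rightarrow> ('m, 'r) tchain set" where
  "m_minus_star F s gm gp M \<phi> =
     twisted_induced (cob_space M) (m_minus F gm gp M (base_pt (F gm) s)) (cob_arc F s gm gp M) \<phi>
       (m_minus F gm gp M) (\<lambda>t. m_minus F gm gp M (base_pt (F gm) s))"

definition m_plus_star ::
  "(nat \<Rightarrow> 'f surface) \<Rightarrow> complex \<Rightarrow> nat \<Rightarrow> nat \<Rightarrow> ('f, 'm) cobordism \<Rightarrow>
     ('m chain set \<Rightarrow> 'r::comm_ring_1) \<Rightarrow> ('f, 'r) tchain set \<Rightarrow> ('m, 'r) tchain set" where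
  "m_plus_star F s gm gp M \<phi> =
     twisted_induced (cob_space M) (m_minus F gm gp M (base_pt (F gm) s)) (cob_arc F s gm gp M) \<phi>
       (m_plus F gm gp M) (\<lambda>t. m_side F gm gp M (s, 2 * t - 1))"

definition Mag ::
  "(nat \<Rightarrow> 'f surface) \<Rightarrow> complex \<Rightarrow> ('f, 'r::idom) cob_object \<Rightarrow> ('f, 'r) cob_object \<Rightarrow>
     ('f, 'm, 'r) cob_morphism \<Rightarrow> (('f, 'r) tchain set \<times> ('f, 'r) tchain set) set" where
  "Mag F s = (\<lambda>(gm, \<phi>m) (gp, \<phi>p) (M, \<phi>).
     let D = module_sum (surf_H1 (F gm) s \<phi>m) (surf_H1 (F gp) s \<phi>p);
         H = cob_H1 F s gm gp M \<phi>
     in submodule_cl D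
          {(x, y) \<in> carrier D.
             (\<ominus>\<^bsub>H\<^esub> m_minus_star F s gm gp M \<phi> x) \<oplus>\<^bsub>H\<^esub> m_plus_star F s gm gp M \<phi> y = \<zero>\<^bsub>H\<^esub>})"

end

theory Submission
  imports Defs "Jordan_Normal_Form.Char_Poly" "HOL-Analysis.Abstract_Topological_Spaces"
begin

text \<open>Let \<open>M\<close> be one of the two cobordisms and \<open>i : M \<rightarrow> W\<close> its inclusion. The characters of \<open>M1\<close> and
  \<open>M2\<close> both come from a character \<open>\<theta>\<close> of \<open>W\<close>, so a relation between twisted cycles of the two surfaces
  that bounds in \<open>M1\<close> bounds in \<open>W\<close>; it is enough that a twisted 1-cycle of \<open>M\<close> bounding in \<open>W\<close> is
  killed by a nonzero scalar in the homology of \<open>M\<close>.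

  The relative chain complex of \<open>(W, M)\<close>, realised as a mapping cone, is acyclic over the integers. A
  contraction of it, transported basis element by basis element to the twisted complex, yields an
  endomorphism \<open>N\<close> that acts as the identity on relative homology and whose matrix entries lie in the
  kernel of \<open>\<epsilon>\<close>. As \<open>W\<close> and \<open>M\<close> are compact and locally contractible, after subdivision a relative
  2-cycle is determined, up to a boundary, by finitely many nerve data, so \<open>N\<close> may be replaced by a
  finite matrix \<open>f\<close> with entries in the kernel of \<open>\<epsilon>\<close>. If \<open>p\<close> is its characteristic polynomial, then
  \<open>p(1)\<close> annihilates the class by Cayley--Hamilton, and \<open>\<epsilon>(p(1)) = 1\<close>, whence \<open>p(1) \<noteq> 0\<close>.

  All this happens on twisted chains of \<open>X\<close> itself, free on singular simplices. They agree with chains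
  of the maximal abelian cover because simplices lift and two lifts differ by a covering
  transformation.\<close>

subsection \<open>Linear maps between free modules\<close>

text \<open>A topological 4-manifold \<open>W\<close> need not be triangulable, whereas a
  determinant needs a finite matrix. The nerve of a fine cover supplies one, in the single degree
  that matters: a 1-cycle of \<open>M\<close> bounding in \<open>W\<close> is a relative 2-cycle.
  The entries in the kernel of \<open>\<epsilon>\<close> have this origin: since
  \<open>\<epsilon>\<close> sends \<open>G\<close> to 1, reducing the twisted complex gives the
  integral one, which has a contraction s; lift s coefficientwise to R. Then
  \<open>id - (d s + s d)\<close> agrees with the identity on cycles up to boundaries, yet reduces
  to 0. Subdivision and passage to the nerve also fix homology classes, so the composite of all
  these maps fixes the class of the given cycle, and a polynomial p in it acts on that class as the
  scalar p(1). This scalar need not be a unit, so the class is shown to be torsion rather than zero.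
  That is enough: \<open>Mag\<close> is closed under division by nonzero scalars, and products of
  nonzero scalars stay nonzero in R. One inclusion between the two values of \<open>Mag\<close>
  suffices, the situation being symmetric in \<open>M1\<close> and \<open>M2\<close>.\<close>

abbreviation lk where "lk \<equiv> Poly_Mapping.lookup"
abbreviation sg where "sg \<equiv> Poly_Mapping.single"
abbreviation ks where "ks \<equiv> Poly_Mapping.keys"

lemma scale_add: "scale r (a + b) = scale r a + scale r b"
  by (auto intro!: poly_mapping_eqI simp: lookup_add algebra_simps)
lemma scale_diff: "scale r (a - b) = scale r a - scale r b"
  by (auto intro!: poly_mapping_eqI simp: lookup_minus right_diff_distrib)
lemma scale_minus: "scale r (- b) = - scale r b"
  by (auto intro!: poly_mapping_eqI)
lemma scale_plus_left: "scale (r + s) a = scale r a + scale s a"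
  by (auto intro!: poly_mapping_eqI simp: lookup_add algebra_simps)
lemma scale_scale [simp]: "scale r (scale s a) = scale (r * s) a"
  by (auto intro!: poly_mapping_eqI simp: algebra_simps)
lemma scale_0 [simp]: "scale 0 a = 0" "scale r 0 = 0"
  by (auto intro!: poly_mapping_eqI)
lemma scale_1 [simp]: "scale 1 a = a"
  by (auto intro!: poly_mapping_eqI)
lemma scale_m1: "scale (- 1) a = - a"
  by (auto intro!: poly_mapping_eqI)
lemma scale_sum: "scale r (sum f A) = (\<Sum>a\<in>A. scale r (f a))"
  by (induction A rule: infinite_finite_induct) (auto simp: scale_add)
lemma scale_single [simp]: "scale r (sg a s) = sg a (r * s)"
  by (auto intro!: poly_mapping_eqI simp: lookup_single when_def)
lemma keys_scale: "ks (scale r a) \<subseteq> ks a"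
  by (auto simp: in_keys_iff)
lemma frag_cmul_scale: "frag_cmul k c = scale k c"
  by (auto intro!: poly_mapping_eqI)

lemma keys_subset_add: "ks a \<subseteq> S \<Longrightarrow> ks b \<subseteq> S \<Longrightarrow> ks (a + b) \<subseteq> S"
  using keys_add[of a b] by blast
lemma keys_subset_diff: "ks a \<subseteq> S \<Longrightarrow> ks b \<subseteq> S \<Longrightarrow> ks (a - b) \<subseteq> S"
  for a :: "'a \<Rightarrow>\<^sub>0 'b::ab_group_add"
  using keys_diff[of a b] by blast
lemma keys_uminus: "ks (- a) = ks a"
  for a :: "'a \<Rightarrow>\<^sub>0 'b::ab_group_add"
  by (auto simp: in_keys_iff)
lemma keys_subset_scale: "ks a \<subseteq> S \<Longrightarrow> ks (scale r a) \<subseteq> S"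
  using keys_scale[of r a] by blast
lemma keys_subset_sum: "(\<And>i. i \<in> A \<Longrightarrow> ks (f i) \<subseteq> S) \<Longrightarrow> ks (sum f A) \<subseteq> S"
  by (induction A rule: infinite_finite_induct) (simp_all add: keys_subset_add)

lemma urh_simps:
  assumes "unital_ring_hom \<rho>"
  shows "\<rho> 1 = 1" "\<rho> (x + y) = \<rho> x + \<rho> y" "\<rho> (x * y) = \<rho> x * \<rho> y" "\<rho> 0 = 0"
    "\<rho> (- x) = - \<rho> x" "\<rho> (x - y) = \<rho> x - \<rho> y"
proof -
  show 1: "\<rho> 1 = 1" and 2: "\<And>x y. \<rho> (x + y) = \<rho> x + \<rho> y" and "\<rho> (x * y) = \<rho> x * \<rho> y"
    using assms by (auto simp: unital_ring_hom_def)
  show 0: "\<rho> 0 = 0" using 2[of 0 0] by simp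
  show m: "\<And>x. \<rho> (- x) = - \<rho> x" using 2[of _ "- _"] by (metis 0 add.inverse_unique add.right_inverse 2)
  show "\<rho> (x - y) = \<rho> x - \<rho> y" using 2[of x "-y"] m by simp
qed

lemma urh_id: "unital_ring_hom (\<lambda>x. x)" and urh_of_int: "unital_ring_hom of_int"
  by (auto simp: unital_ring_hom_def)

lemma urh_of_int_eq:
  assumes "unital_ring_hom \<rho>" shows "\<rho> (of_int k) = of_int k"
proof -
  have nat: "\<rho> (of_nat n) = of_nat n" for n
    by (induction n) (simp_all add: urh_simps[OF assms])
  show ?thesis
    by (cases k rule: int_cases2) (simp_all add: nat urh_simps[OF assms])
qed

lemma urh_sum: "unital_ring_hom \<rho> \<Longrightarrow> \<rho> (sum f A) = (\<Sum>a\<in>A. \<rho> (f a))"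
  by (induction A rule: infinite_finite_induct) (auto simp: urh_simps)

text \<open>Semilinear extension along a ring map: with the identity it gives linear maps, with
  \<open>of_int\<close> the passage from integral to twisted chains, with \<open>\<epsilon>\<close>
  the reduction to integral chains.\<close>

definition lext :: "('s::comm_ring_1 \<Rightarrow> 'r::comm_ring_1) \<Rightarrow> ('a \<Rightarrow> ('b \<Rightarrow>\<^sub>0 'r)) \<Rightarrow> ('a \<Rightarrow>\<^sub>0 's) \<Rightarrow> ('b \<Rightarrow>\<^sub>0 'r)"
  where "lext \<rho> F c = (\<Sum>a\<in>ks c. scale (\<rho> (lk c a)) (F a))"

abbreviation lin where "lin \<equiv> lext (\<lambda>x. x)"

lemma lext_alt:
  assumes "unital_ring_hom \<rho>" "finite A" "ks c \<subseteq> A"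
  shows "lext \<rho> F c = (\<Sum>a\<in>A. scale (\<rho> (lk c a)) (F a))"
  unfolding lext_def using assms
  by (intro sum.mono_neutral_left) (auto simp: in_keys_iff urh_simps)

lemma lext_0 [simp]: "lext \<rho> F 0 = 0"
  by (simp add: lext_def)

lemma lext_add:
  assumes "unital_ring_hom \<rho>"
  shows "lext \<rho> F (c + d) = lext \<rho> F c + lext \<rho> F d"
proof -
  let ?A = "ks c \<union> ks d"
  have "ks (c + d) \<subseteq> ?A" by (rule keys_add)
  then show ?thesis
    using assms by (simp add: lext_alt[of \<rho> ?A] lookup_add urh_simps scale_plus_left sum.distrib)
qed

lemma lext_single: "unital_ring_hom \<rho> \<Longrightarrow> lext \<rho> F (sg a r) = scale (\<rho> r) (F a)"
  by (simp add: lext_alt[of \<rho> "{a}"])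

lemma lext_scale: "unital_ring_hom \<rho> \<Longrightarrow> lext \<rho> F (scale r c) = scale (\<rho> r) (lext \<rho> F c)"
  using lext_alt[of \<rho> "ks c" "scale r c" F] keys_scale[of r c]
  by (simp add: urh_simps lext_def scale_sum)

lemma lext_minus: "unital_ring_hom \<rho> \<Longrightarrow> lext \<rho> F (- c) = - lext \<rho> F c"
  using lext_scale[of \<rho> F "-1" c] by (simp add: scale_m1 urh_simps)

lemma lext_diff: "unital_ring_hom \<rho> \<Longrightarrow> lext \<rho> F (c - d) = lext \<rho> F c - lext \<rho> F d"
  using lext_add[of \<rho> F c "-d"] by (simp add: lext_minus)

lemma lext_sum: "unital_ring_hom \<rho> \<Longrightarrow> lext \<rho> F (sum f A) = (\<Sum>a\<in>A. lext \<rho> F (f a))"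
  by (induction A rule: infinite_finite_induct) (auto simp: lext_add)

lemma lext_cong: "(\<And>a. a \<in> ks c \<Longrightarrow> F a = G a) \<Longrightarrow> lext \<rho> F c = lext \<rho> G c"
  by (simp add: lext_def)

lemma lext_lext:
  assumes "unital_ring_hom \<rho>"
  shows "lext \<rho> F (lext \<rho>' G c) = lext (\<lambda>x. \<rho> (\<rho>' x)) (\<lambda>a. lext \<rho> F (G a)) c"
  unfolding lext_def[of \<rho>'] lext_sum[OF assms] lext_scale[OF assms]
  by (simp add: lext_def)

lemma lext_fun_add: "lext \<rho> (\<lambda>a. F a + G a) c = lext \<rho> F c + lext \<rho> G c"
  by (simp add: lext_def scale_add sum.distrib)
lemma lext_fun_diff: "lext \<rho> (\<lambda>a. F a - G a) c = lext \<rho> F c - lext \<rho> G c"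
  by (simp add: lext_def scale_diff sum_subtractf)
lemma lext_fun_minus: "lext \<rho> (\<lambda>a. - F a) c = - lext \<rho> F c"
  by (simp add: lext_def scale_minus sum_negf)
lemma lext_fun_0: "lext \<rho> (\<lambda>a. 0) c = 0"
  by (simp add: lext_def)

lemma lin_id: "lin (\<lambda>a. sg a 1) c = c"
  by (intro poly_mapping_eqI)
     (auto simp: lext_def lookup_sum lookup_single when_def in_keys_iff)

lemma keys_lext: "(\<And>a. a \<in> ks c \<Longrightarrow> ks (F a) \<subseteq> S) \<Longrightarrow> ks (lext \<rho> F c) \<subseteq> S"
  unfolding lext_def by (intro keys_subset_sum keys_subset_scale)

lemma lext_frag_extend:
  assumes "unital_ring_hom \<rho>"
  shows "lext \<rho> F (frag_extend G c) = lext \<rho> (\<lambda>a. lext \<rho> F (G a)) c"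
  unfolding frag_extend_def frag_cmul_scale lext_sum[OF assms] lext_scale[OF assms]
  by (simp add: lext_def)

lemma lext_frag_of: "unital_ring_hom \<rho> \<Longrightarrow> lext \<rho> F (frag_of a) = F a"
  by (simp add: lext_single urh_simps)

lemma frag_extend_lin: "frag_extend F c = lin F c"
  by (simp add: frag_extend_def lext_def frag_cmul_scale)

lemmas lin_simps = lext_add[OF urh_id] lext_diff[OF urh_id] lext_minus[OF urh_id]
  lext_single[OF urh_id] lext_scale[OF urh_id] lext_sum[OF urh_id]
lemmas lin_lext = lext_lext[OF urh_id]

lemma lext_lin: "unital_ring_hom \<rho> \<Longrightarrow> lext \<rho> F (lin G c) = lext \<rho> (\<lambda>a. lext \<rho> F (G a)) c"
  by (simp add: lext_lext)

section \<open>Polynomials in a linear endomorphism and the determinant trick\<close>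

definition pact :: "(('j \<Rightarrow>\<^sub>0 'r::comm_ring_1) \<Rightarrow> ('j \<Rightarrow>\<^sub>0 'r)) \<Rightarrow> 'r poly \<Rightarrow> ('j \<Rightarrow>\<^sub>0 'r) \<Rightarrow> ('j \<Rightarrow>\<^sub>0 'r)"
  where "pact F p v = (\<Sum>i\<le>degree p. scale (coeff p i) ((F ^^ i) v))"

lemma pact_alt: "degree p \<le> n \<Longrightarrow> pact F p v = (\<Sum>i\<le>n. scale (coeff p i) ((F ^^ i) v))"
  unfolding pact_def by (intro sum.mono_neutral_left) (auto simp: coeff_eq_0)

lemma pact_add: "pact F (p + q) v = pact F p v + pact F q v"
proof -
  let ?n = "max (degree p) (degree q)"
  have "degree (p + q) \<le> ?n" by (rule degree_add_le_max)
  then show ?thesis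
    by (simp add: pact_alt[of p ?n] pact_alt[of q ?n] pact_alt[of "p+q" ?n] scale_plus_left sum.distrib)
qed

lemma pact_0 [simp]: "pact F 0 v = 0"
  by (simp add: pact_def)

lemma pact_sum: "pact F (sum g A) v = (\<Sum>a\<in>A. pact F (g a) v)"
  by (induction A rule: infinite_finite_induct) (auto simp: pact_add)

lemma pact_pCons:
  "pact (lin f) (pCons a p) v = scale a v + lin f (pact (lin f) p v)"
proof -
  have "pact (lin f) (pCons a p) v = (\<Sum>i\<le>Suc (degree p). scale (coeff (pCons a p) i) ((lin f ^^ i) v))"
    by (rule pact_alt) (rule degree_pCons_le)
  also have "\<dots> = scale a v + (\<Sum>i\<le>degree p. scale (coeff p i) ((lin f ^^ Suc i) v))"
    by (subst sum.atMost_Suc_shift) simp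
  finally show ?thesis by (simp add: pact_def lin_simps)
qed

lemma pact_smult: "pact (lin f) (Polynomial.smult a p) v = scale a (pact (lin f) p v)"
  by (induction p) (auto simp: pact_pCons lin_simps scale_add)

text \<open>The free module becomes a module over \<open>'r poly\<close>, with X acting as
  \<open>lin f\<close>, so that matrices over \<open>'r poly\<close> can be applied to tuples of
  basis vectors.\<close>

lemma pact_mult: "pact (lin f) (p * q) v = pact (lin f) p (pact (lin f) q v)"
  by (induction p) (auto simp: pact_pCons pact_add pact_smult)

lemma pact_lin_add: "pact (lin f) p (v + w) = pact (lin f) p v + pact (lin f) p w"
  by (induction p) (auto simp: pact_pCons lin_simps scale_add)

lemma pact_lin_scale: "pact (lin f) p (scale r v) = scale r (pact (lin f) p v)"
  by (induction p) (auto simp: pact_pCons lin_simps scale_add mult.commute)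

lemma pact_lin_0: "pact (lin f) p 0 = 0"
  by (induction p) (auto simp: pact_pCons)

lemma pact_lin_sum: "pact (lin f) p (sum g A) = (\<Sum>a\<in>A. pact (lin f) p (g a))"
  by (induction A rule: infinite_finite_induct) (auto simp: pact_lin_add pact_lin_0)

text \<open>The determinant trick: the matrix of \<open>X - f\<close> annihilates the basis vectors, hence so does its
  determinant, whose value at \<open>X = 1\<close> reduces to the determinant of the identity matrix.\<close>

lemma determinant_trick:
  fixes f :: "'j \<Rightarrow> ('j \<Rightarrow>\<^sub>0 'r::comm_ring_1)" and \<epsilon> :: "'r \<Rightarrow> int"
  assumes J: "finite J" "\<And>j. j \<in> J \<Longrightarrow> ks (f j) \<subseteq> J"
    and \<epsilon>: "unital_ring_hom \<epsilon>" and f0: "\<And>j k. j \<in> J \<Longrightarrow> \<epsilon> (lk (f j) k) = 0"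
  shows "\<exists>p. \<epsilon> (poly p 1) = 1 \<and> (\<forall>x. ks x \<subseteq> J \<longrightarrow> pact (lin f) p x = 0)"
proof -
  define n where "n = card J"
  obtain e where e: "bij_betw e {..<n} J"
    using ex_bij_betw_nat_finite[OF J(1)] by (auto simp: n_def atLeast0LessThan)
  define B :: "'r poly mat" where
    "B = mat n n (\<lambda>(j,k). (if j = k then [:0,1:] else 0) - [:lk (f (e j)) (e k):])"
  have B: "B \<in> carrier_mat n n" by (simp add: B_def)
  let ?p = "det B"
  let ?v = "\<lambda>k. sg (e k) (1::'r)"
  have fe: "(\<Sum>k<n. scale (lk (f (e j)) (e k)) (?v k)) = f (e j)" if "j < n" for j
  proof -
    have "e j \<in> J" using e that by (auto simp: bij_betw_def)
    then have "f (e j) = (\<Sum>a\<in>J. scale (lk (f (e j)) a) (sg a 1))"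
      using lext_alt[OF urh_id, of J "f (e j)" "\<lambda>a. sg a 1"] J lin_id[of "f (e j)"] by metis
    also have "\<dots> = (\<Sum>k<n. scale (lk (f (e j)) (e k)) (?v k))"
      using sum.reindex_bij_betw[OF e, of "\<lambda>a. scale (lk (f (e j)) a) (sg a 1)"] by simp
    finally show ?thesis by simp
  qed
  \<comment> \<open>X carries the basis vector at \<open>e j\<close> to \<open>f (e j)\<close>, and
    the constant entries subtract its expansion, so each row of \<open>B\<close> kills the tuple of
    basis vectors.\<close>
  have row: "(\<Sum>k<n. pact (lin f) (B $$ (j,k)) (?v k)) = 0" if "j < n" for j
  proof -
    have "pact (lin f) (B $$ (j,k)) (?v k) =
       (if k = j then f (e j) else 0) - scale (lk (f (e j)) (e k)) (?v k)" if "k < n" for k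
    proof -
      have "B $$ (j,k) = (if j = k then [:0,1:] else 0) + [:- lk (f (e j)) (e k):]"
        using that \<open>j < n\<close> by (simp add: B_def)
      moreover have "pact (lin f) [:- lk (f (e j)) (e k):] (?v k) = - scale (lk (f (e j)) (e k)) (?v k)"
        by (simp add: pact_pCons single_uminus)
      moreover have "pact (lin f) [:0,1:] (?v k) = f (e k)"
        by (simp add: pact_pCons lin_simps)
      ultimately show ?thesis
        by (cases "j = k") (simp_all only: if_True if_False pact_add pact_0 simp_thms refl, auto)
    qed
    then have "(\<Sum>k<n. pact (lin f) (B $$ (j,k)) (?v k)) =
       (\<Sum>k<n. (if k = j then f (e j) else 0)) - (\<Sum>k<n. scale (lk (f (e j)) (e k)) (?v k))"
      unfolding sum_subtractf[symmetric] by (intro sum.cong) auto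
    then show ?thesis using fe[OF that] that by simp
  qed
  \<comment> \<open>Multiplying these relations by the adjugate of \<open>B\<close> leaves
    \<open>det B\<close> on the diagonal.\<close>
  have ann: "pact (lin f) ?p (?v l) = 0" if l: "l < n" for l
  proof -
    have A: "adj_mat B \<in> carrier_mat n n" "adj_mat B * B = ?p \<cdot>\<^sub>m 1\<^sub>m n"
      using adj_mat[OF B] by auto
    have "(\<Sum>j<n. adj_mat B $$ (l,j) * B $$ (j,k)) = (if l = k then ?p else 0)" if "k < n" for k
    proof -
      have "(adj_mat B * B) $$ (l,k) = (\<Sum>j<n. adj_mat B $$ (l,j) * B $$ (j,k))"
        using A(1) B l that by (simp add: scalar_prod_def atLeast0LessThan)
      then show ?thesis using A(2) l that by (cases "l = k") auto
    qed
    then have "(\<Sum>k<n. pact (lin f) (if l = k then ?p else 0) (?v k)) =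
      (\<Sum>k<n. pact (lin f) (\<Sum>j<n. adj_mat B $$ (l,j) * B $$ (j,k)) (?v k))"
      by (intro sum.cong) auto
    also have "\<dots> = (\<Sum>j<n. \<Sum>k<n. pact (lin f) (adj_mat B $$ (l,j)) (pact (lin f) (B $$ (j,k)) (?v k)))"
      by (subst sum.swap) (simp add: pact_sum pact_mult)
    also have "\<dots> = 0"
      by (intro sum.neutral) (auto simp: pact_lin_sum[symmetric] row pact_lin_0)
    also have "(\<Sum>k<n. pact (lin f) (if l = k then ?p else 0) (?v k)) = pact (lin f) ?p (?v l)"
      using l by (subst sum.remove[of _ l]) auto
    finally show ?thesis .
  qed
  have "pact (lin f) ?p x = 0" if "ks x \<subseteq> J" for x
  proof -
    have "x = (\<Sum>a\<in>J. scale (lk x a) (sg a 1))"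
      using lext_alt[OF urh_id J(1) that, of "\<lambda>a. sg a 1"] lin_id[of x] by simp
    then have "pact (lin f) ?p x = pact (lin f) ?p (\<Sum>a\<in>J. scale (lk x a) (sg a 1))"
      by (rule arg_cong)
    also have "\<dots> = (\<Sum>a\<in>J. scale (lk x a) (pact (lin f) ?p (sg a 1)))"
      by (simp only: pact_lin_sum pact_lin_scale)
    also have "\<dots> = 0"
    proof (intro sum.neutral ballI)
      fix a assume "a \<in> J"
      then obtain l where "l < n" "a = e l" using e by (auto simp: bij_betw_def)
      then show "scale (lk x a) (pact (lin f) ?p (sg a 1)) = 0" using ann by simp
    qed
    finally show ?thesis .
  qed
  \<comment> \<open>Evaluation at 1 followed by \<open>\<epsilon>\<close> is a ring homomorphism, so
    it commutes with determinants; it turns \<open>B\<close> into the identity matrix because the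
    entries of \<open>f\<close> reduce to 0.\<close>
  moreover have "\<epsilon> (poly ?p 1) = 1"
  proof -
    interpret h: comm_ring_hom "\<lambda>p. \<epsilon> (poly p 1)"
      by unfold_locales (auto simp: urh_simps[OF \<epsilon>])
    have "map_mat (\<lambda>p. \<epsilon> (poly p 1)) B = 1\<^sub>m n"
    proof (rule eq_matI)
      fix i j assume "i < dim_row (1\<^sub>m n :: int mat)" "j < dim_col (1\<^sub>m n :: int mat)"
      moreover from this have "e i \<in> J" using e by (auto simp: bij_betw_def)
      ultimately show "map_mat (\<lambda>p. \<epsilon> (poly p 1)) B $$ (i, j) = 1\<^sub>m n $$ (i, j)"
        using f0 by (auto simp: B_def urh_simps[OF \<epsilon>])
    qed (auto simp: B_def)
    then show ?thesis using h.hom_det[of B] by simp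
  qed
  ultimately show ?thesis by blast
qed

subsection \<open>Twisted chains\<close>

type_synonym 'a simplex = "(nat \<Rightarrow> real) \<Rightarrow> 'a"
type_synonym ('a, 'r) twchain = "'a simplex \<Rightarrow>\<^sub>0 'r"

definition vx :: "nat \<Rightarrow> nat \<Rightarrow> real" where
  "vx k = (\<lambda>i. if i = k then 1 else 0)"

lemma vx_in [simp]: "vx k \<in> standard_simplex p \<longleftrightarrow> k \<le> p"
  by (simp add: vx_def)

text \<open>\<open>standard_simplex 1\<close> is contained in every larger standard simplex, so the
  edge joining the first two vertices is a plain restriction, without reparametrisation.\<close>

definition edge :: "'a simplex \<Rightarrow> 'a simplex" where
  "edge \<sigma> = restrict \<sigma> (standard_simplex 1)"

lemma edge_vx [simp]: "edge \<sigma> (vx 0) = \<sigma> (vx 0)" "edge \<sigma> (vx 1) = \<sigma> (vx 1)"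
  "edge \<sigma> (vx (Suc 0)) = \<sigma> (vx (Suc 0))"
  by (simp_all add: edge_def)

lemma singular_simplex_edge:
  assumes "singular_simplex p X \<sigma>" "1 \<le> p"
  shows "singular_simplex 1 X (edge \<sigma>)"
  using assms standard_simplex_mono[OF assms(2)] unfolding singular_simplex_def edge_def
  by (auto intro: continuous_map_eq continuous_map_from_subtopology_mono)

lemma edge_self: "singular_simplex 1 X \<sigma> \<Longrightarrow> edge \<sigma> = \<sigma>"
  unfolding edge_def singular_simplex_def by (auto simp: extensional_restrict)

lemma edge_simplex_map:
  "1 \<le> p \<Longrightarrow> edge (simplex_map p h \<tau>) = simplex_map 1 h (edge \<tau>)"
  using standard_simplex_mono[of 1 p] by (auto simp: edge_def simplex_map_def restrict_def fun_eq_iff)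

text \<open>The k-th face omits vertex k, so only the zeroth face has another first vertex. Beyond
  its last vertex a face is \<open>undefined\<close>, being extensional.\<close>

lemma face_vx:
  assumes "1 \<le> p" "k \<le> p"
  shows "singular_face p k \<sigma> (vx j) = (if j \<le> p - 1 then \<sigma> (vx (if j < k then j else Suc j)) else undefined)"
proof -
  have "simplical_face k (vx j) = vx (if j < k then j else Suc j)"
    by (auto simp: simplical_face_def vx_def fun_eq_iff)
  then show ?thesis by (auto simp: singular_face_def)
qed

lemma face_simplex_map:
  assumes "1 \<le> p" "k \<le> p"
  shows "singular_face p k (simplex_map p h \<tau>) = simplex_map (p - 1) h (singular_face p k \<tau>)"
  using assms by (fastforce simp add: singular_face_def simplex_map_def simplical_face_in_standard_simplex)

text \<open>A simplex of \<open>X\<close> stands for a lift with prescribed first vertex. Only the face opposite to that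
  vertex acquires a new base point, hence the weight of the first edge.\<close>

definition tface :: "('a chain \<Rightarrow> 'r::comm_ring_1) \<Rightarrow> nat \<Rightarrow> 'a simplex \<Rightarrow> ('a, 'r) twchain" where
  "tface \<theta> p \<sigma> = (\<Sum>k\<le>p. sg (singular_face p k \<sigma>)
      ((-1) ^ k * (if k = 0 then \<theta> (frag_of (edge \<sigma>)) else 1)))"

definition tbd :: "('a chain \<Rightarrow> 'r::comm_ring_1) \<Rightarrow> nat \<Rightarrow> ('a, 'r) twchain \<Rightarrow> ('a, 'r) twchain" where
  "tbd \<theta> p = lin (tface \<theta> p)"

abbreviation tch :: "nat \<Rightarrow> 'a topology \<Rightarrow> ('a simplex \<Rightarrow>\<^sub>0 'r::zero) \<Rightarrow> bool" where
  "tch p X c \<equiv> ks c \<subseteq> singular_simplex_set p X"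

lemma tbd_simps:
  "tbd \<theta> p (a + b) = tbd \<theta> p a + tbd \<theta> p b" "tbd \<theta> p (a - b) = tbd \<theta> p a - tbd \<theta> p b"
  "tbd \<theta> p (- a) = - tbd \<theta> p a" "tbd \<theta> p 0 = 0" "tbd \<theta> p (scale r a) = scale r (tbd \<theta> p a)"
  "tbd \<theta> p (sg \<sigma> r) = scale r (tface \<theta> p \<sigma>)" "tbd \<theta> p (sum f A) = (\<Sum>a\<in>A. tbd \<theta> p (f a))"
  by (simp_all add: tbd_def lin_simps)

lemma tbd_lext: "unital_ring_hom \<rho> \<Longrightarrow> tbd \<theta> p (lext \<rho> F c) = lext \<rho> (\<lambda>a. tbd \<theta> p (F a)) c"
  unfolding tbd_def by (rule lin_lext)

lemma tch_tface: "singular_simplex p X \<sigma> \<Longrightarrow> 1 \<le> p \<Longrightarrow> tch (p - 1) X (tface \<theta> p \<sigma>)"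
  unfolding tface_def by (rule keys_subset_sum) (auto intro: singular_simplex_singular_face)

lemma tch_tbd: "tch p X c \<Longrightarrow> 1 \<le> p \<Longrightarrow> tch (p - 1) X (tbd \<theta> p c)"
  unfolding tbd_def using tch_tface[where 'a='a] by (intro keys_lext) blast

text \<open>The trivial character gives back the ordinary singular complex; identities between
  integral chains can then be carried to twisted ones by \<open>push\<close>.\<close>

lemma tbd_int: "1 \<le> p \<Longrightarrow> tbd (\<lambda>_. 1) p c = chain_boundary p c"
  unfolding tbd_def chain_boundary_def frag_extend_lin frag_cmul_scale
  by (simp add: tface_def[abs_def])

lemma tface_1: "singular_simplex 1 X \<sigma> \<Longrightarrow>
   tface \<theta> 1 \<sigma> = sg (restrict (\<lambda>_. \<sigma> (vx 1)) (standard_simplex 0)) (\<theta> (frag_of \<sigma>))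
     - sg (restrict (\<lambda>_. \<sigma> (vx 0)) (standard_simplex 0)) 1"
proof -
  assume s: "singular_simplex 1 X \<sigma>"
  have "singular_face 1 k \<sigma> = restrict (\<lambda>_. \<sigma> (vx (if k = 0 then 1 else 0))) (standard_simplex 0)"
    if "k \<le> 1" for k
  proof -
    have v: "standard_simplex 0 = {vx 0}" by (auto simp: standard_simplex_0 vx_def)
    show ?thesis
      using face_vx[of 1 k \<sigma> 0] that
      by (cases k) (auto simp: v fun_eq_iff, auto simp: singular_face_def v)
  qed
  then have "singular_face 1 0 \<sigma> = restrict (\<lambda>_. \<sigma> (vx 1)) (standard_simplex 0)"
    "singular_face 1 1 \<sigma> = restrict (\<lambda>_. \<sigma> (vx 0)) (standard_simplex 0)"
    by auto
  then show ?thesis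
    by (simp add: tface_def edge_self[OF s] single_uminus[symmetric])
qed

text \<open>Transport along \<open>h\<close>, with coefficients changed by \<open>\<rho>\<close> and
  each simplex rescaled by the value of \<open>f\<close> at its first vertex. Inclusions take
  \<open>f = 1\<close>; the projection of the cover and the parametrisation of a single simplex take
  a holonomy for \<open>f\<close>.\<close>

definition push :: "('s::comm_ring_1 \<Rightarrow> 'r::comm_ring_1) \<Rightarrow> nat \<Rightarrow> ('a \<Rightarrow> 'b) \<Rightarrow> ('a \<Rightarrow> 'r) \<Rightarrow>
    ('a, 's) twchain \<Rightarrow> ('b, 'r) twchain" where
  "push \<rho> p h f = lext \<rho> (\<lambda>\<tau>. sg (simplex_map p h \<tau>) (f (\<tau> (vx 0))))"

text \<open>\<open>f\<close> is a change of gauge: it intertwines the holonomies of source and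
  target along every edge. This is what makes \<open>push\<close> commute with boundaries.\<close>

definition compatible :: "('s::comm_ring_1 \<Rightarrow> 'r::comm_ring_1) \<Rightarrow> 'a topology \<Rightarrow> ('a chain \<Rightarrow> 's) \<Rightarrow>
    ('b chain \<Rightarrow> 'r) \<Rightarrow> ('a \<Rightarrow> 'b) \<Rightarrow> ('a \<Rightarrow> 'r) \<Rightarrow> bool" where
  "compatible \<rho> U \<theta>U \<theta> h f \<longleftrightarrow> (\<forall>\<alpha>. singular_simplex 1 U \<alpha> \<longrightarrow>
     f (\<alpha> (vx 0)) * \<theta> (frag_of (simplex_map 1 h \<alpha>)) = \<rho> (\<theta>U (frag_of \<alpha>)) * f (\<alpha> (vx 1)))"

text \<open>Only the zeroth face starts at a new vertex, and compatibility along the first edge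
  compensates for the different value of \<open>f\<close> there.\<close>

lemma tface_push:
  assumes \<rho>: "unital_ring_hom \<rho>" and p: "1 \<le> p" and \<tau>: "singular_simplex p U \<tau>"
    and co: "compatible \<rho> U \<theta>U \<theta> h f"
  shows "scale (f (\<tau> (vx 0))) (tface \<theta> p (simplex_map p h \<tau>)) = push \<rho> (p - 1) h f (tface \<theta>U p \<tau>)"
proof -
  have e: "f (\<tau> (vx 0)) * \<theta> (frag_of (simplex_map 1 h (edge \<tau>))) = \<rho> (\<theta>U (frag_of (edge \<tau>))) * f (\<tau> (vx 1))"
    using co singular_simplex_edge[OF \<tau> p] by (auto simp: compatible_def)
  have pw: "\<rho> ((-1) ^ k) = (-1) ^ k" for k
    by (induction k) (auto simp: urh_simps[OF \<rho>])
  have "f (\<tau> (vx 0)) * ((- 1) ^ k * (if k = 0 then \<theta> (frag_of (edge (simplex_map p h \<tau>))) else 1)) =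
     \<rho> ((- 1) ^ k * (if k = 0 then \<theta>U (frag_of (edge \<tau>)) else 1)) * f (singular_face p k \<tau> (vx 0))"
    if k: "k \<le> p" for k
    using p e face_vx[OF p k, of \<tau> 0]
    by (auto simp: edge_simplex_map urh_simps[OF \<rho>] pw mult_ac)
  then show ?thesis
    unfolding tface_def push_def scale_sum lext_sum[OF \<rho>] lext_single[OF \<rho>] scale_single
    by (intro sum.cong refl) (auto simp: face_simplex_map[OF p] simp del: One_nat_def)
qed

lemma tbd_push:
  assumes \<rho>: "unital_ring_hom \<rho>" and p: "1 \<le> p" and c: "tch p U c"
    and co: "compatible \<rho> U \<theta>U \<theta> h f"
  shows "tbd \<theta> p (push \<rho> p h f c) = push \<rho> (p - 1) h f (tbd \<theta>U p c)"
proof -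
  have "tbd \<theta> p (push \<rho> p h f c) = lext \<rho> (\<lambda>\<tau>. scale (f (\<tau> (vx 0))) (tface \<theta> p (simplex_map p h \<tau>))) c"
    unfolding push_def tbd_lext[OF \<rho>] tbd_simps ..
  also have "\<dots> = lext \<rho> (\<lambda>\<tau>. push \<rho> (p - 1) h f (tface \<theta>U p \<tau>)) c"
    using tface_push[OF \<rho> p _ co] c by (intro lext_cong) blast
  also have "\<dots> = push \<rho> (p - 1) h f (tbd \<theta>U p c)"
    unfolding push_def tbd_def lext_lin[OF \<rho>] ..
  finally show ?thesis .
qed

lemma tch_push:
  assumes "tch p U c" "continuous_map U X h"
  shows "tch p X (push \<rho> p h f c)"
  unfolding push_def using assms
  by (intro keys_lext) (auto intro: singular_simplex_simplex_map split: if_splits)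

lemma push_simps:
  assumes "unital_ring_hom \<rho>"
  shows "push \<rho> p h f (a + b) = push \<rho> p h f a + push \<rho> p h f b"
    "push \<rho> p h f (a - b) = push \<rho> p h f a - push \<rho> p h f b"
    "push \<rho> p h f (- a) = - push \<rho> p h f a" "push \<rho> p h f 0 = 0"
    "push \<rho> p h f (scale r a) = scale (\<rho> r) (push \<rho> p h f a)"
    "push \<rho> p h f (sg \<tau> r) = sg (simplex_map p h \<tau>) (\<rho> r * f (\<tau> (vx 0)))"
  by (simp_all add: push_def lext_add lext_diff lext_minus lext_scale lext_single assms)

lemma push_lext: "unital_ring_hom \<rho> \<Longrightarrow>
   push \<rho> p h f (lext \<rho>' F c) = lext (\<lambda>x. \<rho> (\<rho>' x)) (\<lambda>a. push \<rho> p h f (F a)) c"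
  unfolding push_def by (rule lext_lext)

text \<open>A flat local system of rank one in chain form: holonomies are prescribed on all 1-chains
  and not just on cycles, so that single edges have weights. Restricted to cycles it is a character
  of the first homology group.\<close>

definition char_sys :: "'a topology \<Rightarrow> ('a chain \<Rightarrow> 'r::comm_ring_1) \<Rightarrow> bool" where
  "char_sys X \<theta> \<longleftrightarrow> \<theta> 0 = 1 \<and>
     (\<forall>a b. singular_chain 1 X a \<longrightarrow> singular_chain 1 X b \<longrightarrow> \<theta> (a + b) = \<theta> a * \<theta> b) \<and>
     (\<forall>c. singular_chain 2 X c \<longrightarrow> \<theta> (chain_boundary 2 c) = 1)"

lemma char_add: "char_sys X \<theta> \<Longrightarrow> singular_chain 1 X a \<Longrightarrow> singular_chain 1 X b \<Longrightarrow> \<theta> (a + b) = \<theta> a * \<theta> b"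
  and char_0: "char_sys X \<theta> \<Longrightarrow> \<theta> 0 = 1"
  by (simp_all add: char_sys_def)

lemma char_minus: "char_sys X \<theta> \<Longrightarrow> singular_chain 1 X a \<Longrightarrow> \<theta> a * \<theta> (- a) = 1"
  using char_add[of X \<theta> a "-a"] by (simp add: char_0 singular_chain_minus)

lemma char_minus': "char_sys X \<theta> \<Longrightarrow> singular_chain 1 X a \<Longrightarrow> \<theta> (- a) * \<theta> a = 1"
  by (metis char_minus mult.commute)

lemma char_homologous:
  assumes "char_sys X \<theta>" "homologous_rel 1 X {} a b" "singular_chain 1 X b"
  shows "\<theta> a = \<theta> b"
proof -
  obtain d where d: "singular_chain 2 X d" "chain_boundary 2 d = a - b"
    using assms(2) unfolding homologous_rel_def singular_boundary by (auto simp: numeral_2_eq_2)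
  have "singular_chain 1 X (chain_boundary 2 d)"
    using singular_chain_boundary[OF d(1)] by simp
  then have "\<theta> (b + (a - b)) = \<theta> b * 1"
    using assms d by (metis char_add char_sys_def)
  then show ?thesis by simp
qed

lemma char_sys_pullback:
  assumes "char_sys X \<theta>" "continuous_map Y X h"
  shows "char_sys Y (\<lambda>c. \<theta> (chain_map 1 h c))"
  unfolding char_sys_def
proof (intro conjI allI impI)
  fix c assume c: "singular_chain 2 Y c"
  have "chain_map 1 h (chain_boundary 2 c) = chain_boundary 2 (chain_map 2 h c)"
    using chain_boundary_chain_map[OF c, of h] by simp
  then show "\<theta> (chain_map 1 h (chain_boundary 2 c)) = 1"
    using assms singular_chain_chain_map[OF c assms(2)] by (simp add: char_sys_def)
qed (use assms singular_chain_chain_map[OF _ assms(2)] in \<open>auto simp: chain_map_add char_sys_def\<close>)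

lemma char_sys_subtopology:
  assumes "char_sys X \<theta>" shows "char_sys (subtopology X S) \<theta>"
  using assms unfolding char_sys_def singular_chain_subtopology by auto

section \<open>Spaces acyclic in degrees 0 and 1; paths as singular 1-simplices\<close>

definition acyc :: "'a topology \<Rightarrow> bool" where
  "acyc V \<longleftrightarrow> path_connected_space V \<and> (\<forall>c. singular_relcycle 1 V {} c \<longrightarrow> singular_relboundary 1 V {} c)"

text \<open>The dimension 1 occurs literally in groups and simplices and must not be rewritten to
  \<open>Suc 0\<close>.\<close>

declare One_nat_def [simp del]

definition psimp :: "(real \<Rightarrow> 'a) \<Rightarrow> 'a simplex" where
  "psimp g = restrict (\<lambda>x. g (x 1)) (standard_simplex 1)"

lemma path_chain_psimp: "path_chain g = frag_of (psimp g)"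
  by (simp add: path_chain_def psimp_def)

lemma psimp_vx [simp]: "psimp g (vx 0) = g 0" "psimp g (vx 1) = g 1" "psimp g (vx (Suc 0)) = g 1"
  using vx_in[of 0 1] vx_in[of 1 1] unfolding psimp_def by (auto simp: vx_def restrict_def)

lemma singular_simplex_psimp:
  assumes "pathin X g" shows "singular_simplex 1 X (psimp g)"
proof -
  have "continuous_map (subtopology (powertop_real UNIV) (standard_simplex 1)) (top_of_set {0..1::real}) (\<lambda>x. x 1)"
    by (auto simp: continuous_map_in_subtopology standard_simplex_def
        intro!: continuous_map_from_subtopology continuous_map_product_projection)
  then have "continuous_map (subtopology (powertop_real UNIV) (standard_simplex 1)) X (g \<circ> (\<lambda>x. x 1))"
    using assms unfolding pathin_def by (rule continuous_map_compose)
  then show ?thesis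
    unfolding singular_simplex_def psimp_def
    by (auto intro: continuous_map_eq)
qed

definition pt :: "'a \<Rightarrow> 'a simplex" where
  "pt x = restrict (\<lambda>_. x) (standard_simplex 0)"

lemma pt_vx [simp]: "pt x (vx 0) = x"
  by (simp add: pt_def)

lemma simplex_map_vx [simp]: "k \<le> p \<Longrightarrow> simplex_map p h \<sigma> (vx k) = h (\<sigma> (vx k))"
  by (simp add: simplex_map_def)

lemma singular_simplex_vx: "singular_simplex p X \<sigma> \<Longrightarrow> k \<le> p \<Longrightarrow> \<sigma> (vx k) \<in> topspace X"
  by (force simp: singular_simplex_def continuous_map_def)

lemma tface_path: "singular_simplex 1 X \<sigma> \<Longrightarrow>
   tface \<theta> 1 \<sigma> = sg (pt (\<sigma> (vx 1))) (\<theta> (frag_of \<sigma>)) - sg (pt (\<sigma> (vx 0))) 1"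
  using tface_1[of X \<sigma> \<theta>] by (simp add: pt_def)

lemma tbd_path: "singular_simplex 1 X \<sigma> \<Longrightarrow>
   tbd \<theta> 1 (sg \<sigma> r) = sg (pt (\<sigma> (vx 1))) (r * \<theta> (frag_of \<sigma>)) - sg (pt (\<sigma> (vx 0))) r"
  unfolding tbd_simps by (subst tface_path) (auto simp: scale_diff)

lemma boundary_path: "singular_simplex 1 X \<sigma> \<Longrightarrow>
   chain_boundary 1 (frag_of \<sigma>) = frag_of (pt (\<sigma> (vx 1))) - frag_of (pt (\<sigma> (vx 0)))"
  using tbd_path[of X \<sigma> "\<lambda>_. 1 :: int" 1] by (simp add: tbd_int)

text \<open>\<open>a + b - c\<close> is a 1-cycle of the acyclic \<open>V\<close>, hence a boundary,
  and \<open>\<theta>\<close> does not distinguish homologous chains.\<close>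

lemma char_triangle:
  assumes "acyc V" "char_sys V \<theta>" "singular_simplex 1 V a" "singular_simplex 1 V b" "singular_simplex 1 V c"
    "c (vx 0) = a (vx 0)" "b (vx 0) = a (vx 1)" "c (vx 1) = b (vx 1)"
  shows "\<theta> (frag_of a) * \<theta> (frag_of b) = \<theta> (frag_of c)"
proof -
  have ch: "singular_chain 1 V (frag_of a)" "singular_chain 1 V (frag_of b)" "singular_chain 1 V (frag_of c)"
    using assms by (simp_all add: singular_chain_of)
  have "chain_boundary 1 (frag_of a + frag_of b - frag_of c) = 0"
    using assms by (simp add: chain_boundary_add chain_boundary_diff boundary_path[of V] del: One_nat_def)
  then have "singular_relboundary 1 V {} (frag_of a + frag_of b - frag_of c)"
    using assms(1) ch unfolding acyc_def singular_cycle
    by (meson singular_chain_add singular_chain_diff)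
  then have "homologous_rel 1 V {} (frag_of a + frag_of b) (frag_of c)"
    by (simp add: homologous_rel_def)
  then have "\<theta> (frag_of a + frag_of b) = \<theta> (frag_of c)"
    using char_homologous assms(2) ch by blast
  then show ?thesis using char_add assms(2) ch by metis
qed

text \<open>The triangle identity for \<open>a\<close>, \<open>a\<close>, \<open>a\<close> makes the
  holonomy idempotent; being a unit, it is 1.\<close>

lemma char_const:
  assumes "char_sys V \<theta>" "singular_simplex 1 V a" "acyc V" "a (vx 0) = a (vx 1)"
  shows "\<theta> (frag_of a) = 1"
proof -
  have ch: "singular_chain 1 V (frag_of a)" using assms by (simp add: singular_chain_of)
  have "\<theta> (frag_of a) * \<theta> (frag_of a) = \<theta> (frag_of a)"
    using char_triangle[of V \<theta> a a a] assms by auto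
  then have "\<theta> (- frag_of a) * \<theta> (frag_of a) * \<theta> (frag_of a) = \<theta> (- frag_of a) * \<theta> (frag_of a)"
    by (simp add: mult.assoc)
  then show ?thesis using char_minus'[OF assms(1) ch] by simp
qed

lemma acyc_path:
  assumes "acyc V" "x \<in> topspace V" "y \<in> topspace V"
  shows "\<exists>\<sigma>. singular_simplex 1 V \<sigma> \<and> \<sigma> (vx 0) = x \<and> \<sigma> (vx 1) = y"
proof -
  obtain g where "pathin V g" "g 0 = x" "g 1 = y"
    using assms unfolding acyc_def path_connected_space_def by metis
  then show ?thesis by (intro exI[of _ "psimp g"]) (auto simp: singular_simplex_psimp)
qed

lemma simplex_map_id': "singular_simplex p V \<tau> \<Longrightarrow> simplex_map p (\<lambda>x. x) \<tau> = \<tau>"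
  by (rule simplex_map_id_gen) auto

text \<open>On an acyclic space a character is a coboundary, so twisted and ordinary chains agree.\<close>

lemma acyc_fill:
  fixes \<theta> :: "'a chain \<Rightarrow> 'r::comm_ring_1"
  assumes V: "acyc V" and \<theta>: "char_sys V \<theta>" and z: "tch 1 V z" "tbd \<theta> 1 z = 0"
  shows "\<exists>w. tch 2 V w \<and> tbd \<theta> 2 w = z"
proof (cases "topspace V = {}")
  case True
  then have "z = 0"
    using z(1) by (metis (no_types, lifting) Collect_empty_eq singular_simplex_empty subset_empty keys_eq_empty)
  then show ?thesis by (intro exI[of _ 0]) (simp add: tbd_simps)
next
  case False
  then obtain v where v: "v \<in> topspace V" by blast
  obtain \<gamma> where \<gamma>: "\<And>x. x \<in> topspace V \<Longrightarrow>
      singular_simplex 1 V (\<gamma> x) \<and> \<gamma> x (vx 0) = v \<and> \<gamma> x (vx 1) = x"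
    using acyc_path[OF V v] by metis
  \<comment> \<open>\<open>f\<close> is the holonomy from \<open>v\<close> along the chosen paths
    and \<open>f'\<close> its inverse; \<open>f\<close> trivialises \<open>\<theta>\<close> on
    \<open>V\<close>.\<close>
  define f where "f x = \<theta> (frag_of (\<gamma> x))" for x
  define f' where "f' x = \<theta> (- frag_of (\<gamma> x))" for x
  have ff': "f x * f' x = 1" "f' x * f x = 1" if "x \<in> topspace V" for x
    using char_minus[OF \<theta>, of "frag_of (\<gamma> x)"] char_minus'[OF \<theta>, of "frag_of (\<gamma> x)"] \<gamma>[OF that]
    by (auto simp: f_def f'_def singular_chain_of)
  have co: "compatible of_int V (\<lambda>_. 1) \<theta> (\<lambda>x. x) f"
    unfolding compatible_def
  proof (intro allI impI)
    fix \<alpha> assume \<alpha>: "singular_simplex 1 V \<alpha>"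
    then have "\<alpha> (vx 0) \<in> topspace V" "\<alpha> (vx 1) \<in> topspace V"
      using singular_simplex_vx[OF \<alpha>] by auto
    then show "f (\<alpha> (vx 0)) * \<theta> (frag_of (simplex_map 1 (\<lambda>x. x) \<alpha>)) = of_int 1 * f (\<alpha> (vx 1))"
      unfolding f_def simplex_map_id'[OF \<alpha>]
      using char_triangle[OF V \<theta>, of "\<gamma> (\<alpha> (vx 0))" \<alpha> "\<gamma> (\<alpha> (vx 1))"] \<gamma> \<alpha> by simp
  qed
  \<comment> \<open>The loop that runs from \<open>v\<close> to an edge, along it and back is filled
    over the integers; the twisted filling will be its image under \<open>push\<close>.\<close>
  have "\<exists>\<beta>. singular_chain 2 V \<beta> \<and>
      chain_boundary 2 \<beta> = frag_of (\<gamma> (\<tau> (vx 0))) + frag_of \<tau> - frag_of (\<gamma> (\<tau> (vx 1)))"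
    if \<tau>: "singular_simplex 1 V \<tau>" for \<tau>
  proof -
    let ?c = "frag_of (\<gamma> (\<tau> (vx 0))) + frag_of \<tau> - frag_of (\<gamma> (\<tau> (vx 1)))"
    have t: "\<tau> (vx 0) \<in> topspace V" "\<tau> (vx 1) \<in> topspace V"
      using singular_simplex_vx[OF \<tau>] by auto
    have "singular_chain 1 V ?c"
      using \<gamma> t \<tau> by (intro singular_chain_add singular_chain_diff) (auto simp: singular_chain_of)
    moreover have "chain_boundary 1 ?c = 0"
      using \<gamma> t \<tau> by (simp add: chain_boundary_add chain_boundary_diff boundary_path[of V] del: One_nat_def)
    ultimately have "singular_relboundary 1 V {} ?c"
      using V by (auto simp: acyc_def singular_cycle)
    then show ?thesis by (auto simp: singular_boundary numeral_2_eq_2)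
  qed
  then obtain \<beta> where \<beta>: "\<And>\<tau>. singular_simplex 1 V \<tau> \<Longrightarrow> singular_chain 2 V (\<beta> \<tau>) \<and>
      chain_boundary 2 (\<beta> \<tau>) = frag_of (\<gamma> (\<tau> (vx 0))) + frag_of \<tau> - frag_of (\<gamma> (\<tau> (vx 1)))"
    by metis
  let ?P = "\<lambda>p. push (of_int :: int \<Rightarrow> 'r) p (\<lambda>x. x) f"
  \<comment> \<open>The factor \<open>f'\<close> normalises the coefficient of \<open>\<tau>\<close>
    to 1. The path terms that remain depend on end points only, so they combine to a linear image of
    \<open>tbd \<theta> 1 z\<close>, which is 0.\<close>
  define w where "w = lin (\<lambda>\<tau>. scale (f' (\<tau> (vx 0))) (?P 2 (\<beta> \<tau>))) z"
  have "tch 2 V w"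
    unfolding w_def using \<beta> z(1)
    by (intro keys_lext keys_subset_scale tch_push) (auto simp: singular_chain_def)
  moreover have "tbd \<theta> 2 w = z"
  proof -
    define H where "H x = sg (\<gamma> x) (f' x)" for x
    have 1: "tbd \<theta> 2 (scale (f' (\<tau> (vx 0))) (?P 2 (\<beta> \<tau>))) =
       sg \<tau> 1 - scale (f v) (lin (\<lambda>\<pi>. H (\<pi> (vx 0))) (tface \<theta> 1 \<tau>))"
      if \<tau>: "singular_simplex 1 V \<tau>" for \<tau>
    proof -
      have t: "\<tau> (vx 0) \<in> topspace V" "\<tau> (vx 1) \<in> topspace V"
        using singular_simplex_vx[OF \<tau>] by auto
      have ed: "\<theta> (frag_of \<tau>) * f' (\<tau> (vx 1)) = f' (\<tau> (vx 0))"
      proof -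
        have "f' (\<tau> (vx 0)) * (f (\<tau> (vx 0)) * \<theta> (frag_of \<tau>)) * f' (\<tau> (vx 1)) =
           f' (\<tau> (vx 0)) * (f (\<tau> (vx 1)) * f' (\<tau> (vx 1)))"
          using co[unfolded compatible_def, rule_format, OF \<tau>] simplex_map_id'[OF \<tau>]
          by (simp add: mult.assoc[symmetric])
        moreover have "f' (\<tau> (vx 0)) * (f (\<tau> (vx 0)) * \<theta> (frag_of \<tau>)) * f' (\<tau> (vx 1)) =
           (f' (\<tau> (vx 0)) * f (\<tau> (vx 0))) * (\<theta> (frag_of \<tau>) * f' (\<tau> (vx 1)))"
          by (simp only: mult.assoc)
        ultimately show ?thesis using ff'[OF t(1)] ff'[OF t(2)] by simp
      qed
      have "tbd \<theta> 2 (?P 2 (\<beta> \<tau>)) = ?P 1 (chain_boundary 2 (\<beta> \<tau>))"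
        using tbd_push[OF urh_of_int _ _ co, of 2 "\<beta> \<tau>"] \<beta>[OF \<tau>] by (simp add: tbd_int singular_chain_def One_nat_def)
      also have "\<dots> = sg (\<gamma> (\<tau> (vx 0))) (f v) + sg \<tau> (f (\<tau> (vx 0))) - sg (\<gamma> (\<tau> (vx 1))) (f v)"
        using \<beta>[OF \<tau>] \<gamma> t simplex_map_id'[OF \<tau>] simplex_map_id'[of 1 V]
        by (simp add: push_simps[OF urh_of_int] del: One_nat_def)
      finally have "tbd \<theta> 2 (scale (f' (\<tau> (vx 0))) (?P 2 (\<beta> \<tau>))) =
          scale (f v) (sg (\<gamma> (\<tau> (vx 0))) (f' (\<tau> (vx 0)))) + sg \<tau> 1
           - scale (f v) (sg (\<gamma> (\<tau> (vx 1))) (f' (\<tau> (vx 0))))"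
        using ff'[OF t(1)] by (simp add: tbd_simps scale_add scale_diff mult.commute[of "f' _" "f _"] mult.commute[of "f' _" "f v"])
      moreover have "lin (\<lambda>\<pi>. H (\<pi> (vx 0))) (tface \<theta> 1 \<tau>) =
          sg (\<gamma> (\<tau> (vx 1))) (f' (\<tau> (vx 0))) - sg (\<gamma> (\<tau> (vx 0))) (f' (\<tau> (vx 0)))"
        by (simp add: tface_path[OF \<tau>] lin_simps H_def ed del: One_nat_def)
      ultimately show ?thesis by (simp add: scale_diff del: scale_single)
    qed
    have "tbd \<theta> 2 w = lin (\<lambda>\<tau>. sg \<tau> 1 - scale (f v) (lin (\<lambda>\<pi>. H (\<pi> (vx 0))) (tface \<theta> 1 \<tau>))) z"
      unfolding w_def tbd_lext[OF urh_id] using 1 z(1) by (intro lext_cong) blast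
    also have "\<dots> = z - lin (\<lambda>\<tau>. scale (f v) (lin (\<lambda>\<pi>. H (\<pi> (vx 0))) (tface \<theta> 1 \<tau>))) z"
      by (simp add: lext_fun_diff lin_id)
    also have "lin (\<lambda>\<tau>. scale (f v) (lin (\<lambda>\<pi>. H (\<pi> (vx 0))) (tface \<theta> 1 \<tau>))) z =
        lin (\<lambda>x. scale (f v) (H (x (vx 0)))) (tbd \<theta> 1 z)"
      unfolding tbd_def lin_lext
      by (rule lext_cong) (simp add: lext_def scale_sum mult.commute)
    also have "\<dots> = 0" using z(2) by simp
    finally show ?thesis by simp
  qed
  ultimately show ?thesis by blast
qed

text \<open>A null-homotopy makes a 1-cycle homologous to its image in a single point, where cycles
  of positive degree bound.\<close>

lemma contractible_imp_acyc:
  assumes "contractible_space V" shows "acyc V"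
  unfolding acyc_def
proof (intro conjI allI impI)
  show "path_connected_space V" using assms by (rule contractible_imp_path_connected_space)
  fix c assume c: "singular_relcycle 1 V {} c"
  show "singular_relboundary 1 V {} c"
  proof (cases "topspace V = {}")
    case True
    then show ?thesis using c by (simp add: singular_cycle singular_chain_empty)
  next
    case False
    then obtain a where a0: "a \<in> topspace V" by blast
    then have a: "a \<in> topspace V" "homotopic_with (\<lambda>x. True) V V id (\<lambda>x. a)"
      using iffD1[OF contractible_space_alt assms] by simp_all
    have h: "homologous_rel 1 V {} (chain_map 1 id c) (chain_map 1 (\<lambda>x. a) c)"
      by (rule homotopic_imp_homologous_rel_chain_maps[OF _ c]) (use a in auto)
    have "singular_relcycle 1 (subtopology V {a}) {} (chain_map 1 (\<lambda>x. a) c)"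
      by (rule singular_relcycle_chain_map[OF c]) (use a in \<open>auto simp: continuous_map_in_subtopology\<close>)
    then have "singular_relboundary 1 (subtopology V {a}) {} (chain_map 1 (\<lambda>x. a) c)"
      using singular_boundary_eq_cycle_singleton[of "subtopology V {a}" a 1] a by auto
    then have "singular_relboundary 1 V {} (chain_map 1 (\<lambda>x. a) c)"
      using singular_boundary_mono[of "{a}" UNIV] by (simp add: subtopology_UNIV)
    then show ?thesis
      using h c singular_relboundary_add[of 1 V "{}" "chain_map 1 id c - chain_map 1 (\<lambda>x. a) c" "chain_map 1 (\<lambda>x. a) c"]
      by (simp add: homologous_rel_def chain_map_ident[of 1 V] singular_cycle)
  qed
qed

text \<open>The straight-line contraction to a point of \<open>S\<close> is continuous coordinate by
  coordinate, which is all that the product topology asks for.\<close>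

lemma contractible_convex:
  fixes S :: "('i \<Rightarrow> real) set"
  assumes S: "\<And>x y u. x \<in> S \<Longrightarrow> y \<in> S \<Longrightarrow> 0 \<le> u \<Longrightarrow> u \<le> 1 \<Longrightarrow> (\<lambda>i. (1 - u) * x i + u * y i) \<in> S"
  shows "contractible_space (subtopology (powertop_real UNIV) S)"
proof (cases "S = {}")
  case False
  then obtain a where a: "a \<in> S" by blast
  let ?X = "subtopology (powertop_real UNIV) S"
  let ?h = "\<lambda>(u, x). \<lambda>i. (1 - u) * x i + u * a i"
  let ?P = "prod_topology (top_of_set {0..1::real}) ?X"
  have u: "continuous_map ?P euclideanreal fst"
    by (metis continuous_map_fst continuous_map_into_fulltopology)
  have "continuous_map ?P euclideanreal (\<lambda>z. snd z i)" for i
  proof -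
    have "continuous_map ?X euclideanreal (\<lambda>x. x i)"
      by (intro continuous_map_from_subtopology continuous_map_product_projection) auto
    from continuous_map_compose[OF continuous_map_snd this] show ?thesis by (simp add: o_def)
  qed
  then have "continuous_map ?P euclideanreal (\<lambda>z. (1 - fst z) * snd z i + fst z * a i)" for i
    using u by (intro continuous_intros) auto
  then have "continuous_map ?P (powertop_real UNIV) ?h"
    unfolding continuous_map_componentwise_UNIV by (simp add: case_prod_unfold)
  moreover have "?h \<in> topspace ?P \<rightarrow> S"
    using S a by auto
  ultimately have "continuous_map ?P ?X ?h"
    by (auto simp: continuous_map_in_subtopology)
  then have "homotopic_with (\<lambda>x. True) ?X ?X id (\<lambda>x. a)"
    unfolding homotopic_with_def by (intro exI[of _ ?h]) auto
  then show ?thesis unfolding contractible_space_def by blast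
qed auto

subsection \<open>Subdivision\<close>

abbreviation simplex_space :: "nat \<Rightarrow> (nat \<Rightarrow> real) topology" where
  "simplex_space p \<equiv> subtopology (powertop_real UNIV) (standard_simplex p)"

lemma acyc_simplex_space: "acyc (simplex_space p)"
  by (intro contractible_imp_acyc contractible_convex convex_standard_simplex)

definition iota :: "nat \<Rightarrow> (nat \<Rightarrow> real) simplex" where
  "iota p = restrict id (standard_simplex p)"

definition seg :: "(nat \<Rightarrow> real) \<Rightarrow> (nat \<Rightarrow> real) simplex" where
  "seg y = psimp (\<lambda>t i. (1 - t) * vx 0 i + t * y i)"

text \<open>Holonomy along the image of the straight segment from the first vertex to
  \<open>y\<close>: the gauge that trivialises the coefficients pulled back to the standard
  simplex.\<close>

definition transp :: "('a chain \<Rightarrow> 'r) \<Rightarrow> 'a simplex \<Rightarrow> (nat \<Rightarrow> real) \<Rightarrow> 'r" where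
  "transp \<theta> \<sigma> y = \<theta> (frag_of (simplex_map 1 \<sigma> (seg y)))"

lemma seg_vx [simp]: "seg y (vx 0) = vx 0" "seg y (vx 1) = y"
  by (auto simp: seg_def)

lemma singular_simplex_seg:
  assumes "y \<in> standard_simplex p" shows "singular_simplex 1 (simplex_space p) (seg y)"
proof -
  have "continuous_map (top_of_set {0..1::real}) (powertop_real UNIV) (\<lambda>t i. (1 - t) * vx 0 i + t * y i)"
    unfolding continuous_map_componentwise by (force intro: continuous_intros)
  then have "pathin (simplex_space p) (\<lambda>t i. (1 - t) * vx 0 i + t * y i)"
    using assms convex_standard_simplex[of "vx 0" p y]
    by (auto simp: pathin_def continuous_map_in_subtopology)
  then show ?thesis unfolding seg_def by (rule singular_simplex_psimp)
qed

lemma simplex_cont: "singular_simplex p X \<sigma> \<Longrightarrow> continuous_map (simplex_space p) X \<sigma>"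
  by (simp add: singular_simplex_def)

lemma singular_simplex_iota: "singular_simplex p (simplex_space p) (iota p)"
  unfolding iota_def singular_simplex_def
  by (auto intro: continuous_map_eq[of _ _ id])

lemma simplex_map_iota: "singular_simplex p X \<sigma> \<Longrightarrow> simplex_map p \<sigma> (iota p) = \<sigma>"
  unfolding iota_def simplex_map_def singular_simplex_def
  by (auto simp: extensional_def restrict_def fun_eq_iff)

text \<open>The standard simplex is acyclic, so the two segments from its first vertex and the edge
  \<open>\<alpha>\<close> obey the triangle identity.\<close>

lemma compatible_transp:
  assumes \<theta>: "char_sys X \<theta>" and \<sigma>: "singular_simplex p X \<sigma>"
  shows "compatible of_int (simplex_space p) (\<lambda>_. 1) \<theta> \<sigma> (transp \<theta> \<sigma>)"
  unfolding compatible_def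
proof (intro allI impI)
  fix \<alpha> assume \<alpha>: "singular_simplex 1 (simplex_space p) \<alpha>"
  have v: "\<alpha> (vx 0) \<in> standard_simplex p" "\<alpha> (vx 1) \<in> standard_simplex p"
    using singular_simplex_vx[OF \<alpha>] by auto
  have "char_sys (simplex_space p) (\<lambda>c. \<theta> (chain_map 1 \<sigma> c))"
    using char_sys_pullback[OF \<theta> simplex_cont[OF \<sigma>]] .
  from char_triangle[OF acyc_simplex_space this singular_simplex_seg[OF v(1)] \<alpha> singular_simplex_seg[OF v(2)]]
  show "transp \<theta> \<sigma> (\<alpha> (vx 0)) * \<theta> (frag_of (simplex_map 1 \<sigma> \<alpha>)) = of_int 1 * transp \<theta> \<sigma> (\<alpha> (vx 1))"
    by (simp add: transp_def)
qed

lemma transp_0: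
  assumes \<theta>: "char_sys X \<theta>" and \<sigma>: "singular_simplex p X \<sigma>"
  shows "transp \<theta> \<sigma> (vx 0) = 1"
proof -
  have "char_sys (simplex_space p) (\<lambda>c. \<theta> (chain_map 1 \<sigma> c))"
    using char_sys_pullback[OF \<theta> simplex_cont[OF \<sigma>]] .
  from char_const[OF this singular_simplex_seg[of "vx 0"] acyc_simplex_space]
  show ?thesis by (simp add: transp_def)
qed

text \<open>Every simplex is the transported image of the universal one. Hence an identity between
  integral chains of the standard simplex yields an identity between twisted chains of
  \<open>X\<close>.\<close>

lemma push_iota:
  assumes \<theta>: "char_sys X \<theta>" and \<sigma>: "singular_simplex p X \<sigma>"
  shows "push of_int p \<sigma> (transp \<theta> \<sigma>) (frag_of (iota p)) = sg \<sigma> 1"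
  using transp_0[OF assms] simplex_map_iota[OF \<sigma>]
  by (simp add: push_simps[OF urh_of_int] iota_def)

text \<open>Barycentric subdivision of the universal simplex, each small piece being weighted by the
  holonomy from the old first vertex to its own.\<close>

definition sdiv :: "('a chain \<Rightarrow> 'r::comm_ring_1) \<Rightarrow> nat \<Rightarrow> ('a, 'r) twchain \<Rightarrow> ('a, 'r) twchain" where
  "sdiv \<theta> p = lin (\<lambda>\<sigma>. push of_int p \<sigma> (transp \<theta> \<sigma>) (singular_subdivision p (frag_of (iota p))))"

lemma sub_iota: "singular_chain p (simplex_space p) (singular_subdivision p (frag_of (iota p)))"
  by (intro singular_chain_singular_subdivision) (simp add: singular_chain_of singular_simplex_iota)

text \<open>At the first vertex y of a small piece, compatibility along the image of the segment
  from the old first vertex to y moves the factor \<open>f\<close> from one end of the segment to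
  the other.\<close>

lemma sdiv_push:
  assumes \<rho>: "unital_ring_hom \<rho>" and c: "tch p U c" and co: "compatible \<rho> U \<theta>U \<theta> h f"
  shows "sdiv \<theta> p (push \<rho> p h f c) = push \<rho> p h f (sdiv \<theta>U p c)"
proof -
  let ?S = "singular_subdivision p (frag_of (iota p))"
  have "scale (f (\<tau> (vx 0))) (push of_int p (simplex_map p h \<tau>) (transp \<theta> (simplex_map p h \<tau>)) ?S)
      = push \<rho> p h f (push of_int p \<tau> (transp \<theta>U \<tau>) ?S)" if \<tau>: "singular_simplex p U \<tau>" for \<tau>
  proof -
    have "f (\<tau> (vx 0)) * transp \<theta> (simplex_map p h \<tau>) (\<mu> (vx 0)) =
       \<rho> (transp \<theta>U \<tau> (\<mu> (vx 0))) * f (simplex_map p \<tau> \<mu> (vx 0))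
       \<and> simplex_map p (simplex_map p h \<tau>) \<mu> = simplex_map p h (simplex_map p \<tau> \<mu>)"
      if "\<mu> \<in> ks ?S" for \<mu>
    proof -
      have \<mu>: "singular_simplex p (simplex_space p) \<mu>"
        using sub_iota that by (auto simp: singular_chain_def)
      have y: "\<mu> (vx 0) \<in> standard_simplex p" using singular_simplex_vx[OF \<mu>, of 0] by simp
      have \<mu>i: "x \<in> standard_simplex p \<Longrightarrow> \<mu> x \<in> standard_simplex p" for x
        using \<mu> by (auto simp: singular_simplex_def continuous_map_def)
      let ?a = "simplex_map 1 \<tau> (seg (\<mu> (vx 0)))"
      have a: "singular_simplex 1 U ?a"
        by (rule singular_simplex_simplex_map[OF singular_simplex_seg[OF y] simplex_cont[OF \<tau>]])
      have si: "seg (\<mu> (vx 0)) x \<in> standard_simplex p" if "x \<in> standard_simplex 1" for x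
        using singular_simplex_seg[OF y] that by (auto simp: singular_simplex_def continuous_map_def)
      have "simplex_map 1 (simplex_map p h \<tau>) (seg (\<mu> (vx 0))) = simplex_map 1 h ?a"
        using si by (auto simp: simplex_map_def fun_eq_iff restrict_def)
      moreover have "simplex_map p (simplex_map p h \<tau>) \<mu> = simplex_map p h (simplex_map p \<tau> \<mu>)"
        using \<mu>i by (auto simp: simplex_map_def fun_eq_iff restrict_def)
      ultimately show ?thesis
        using co[unfolded compatible_def, rule_format, OF a] by (simp add: transp_def)
    qed
    note eq = this
    show ?thesis
      unfolding push_def lext_lext[OF \<rho>] urh_of_int_eq[OF \<rho>] lext_single[OF \<rho>]
      unfolding lext_def scale_sum
    proof (intro sum.cong refl)
      fix \<mu> assume "\<mu> \<in> ks ?S"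
      note m = this
      let ?k = "of_int (lk ?S \<mu>) :: 'b"
      have "f (\<tau> (vx 0)) * (?k * transp \<theta> (simplex_map p h \<tau>) (\<mu> (vx 0))) =
        ?k * (f (\<tau> (vx 0)) * transp \<theta> (simplex_map p h \<tau>) (\<mu> (vx 0)))"
        by (rule mult.left_commute)
      then show "scale (f (\<tau> (vx 0))) (scale ?k (sg (simplex_map p (simplex_map p h \<tau>) \<mu>)
          (transp \<theta> (simplex_map p h \<tau>) (\<mu> (vx 0))))) =
        scale ?k (scale (\<rho> (transp \<theta>U \<tau> (\<mu> (vx 0)))) (sg (simplex_map p h (simplex_map p \<tau> \<mu>))
          (f (simplex_map p \<tau> \<mu> (vx 0)))))"
        using eq[OF m] by simp
    qed
  qed
  then have "lext \<rho> (\<lambda>\<tau>. scale (f (\<tau> (vx 0))) (push of_int p (simplex_map p h \<tau>) (transp \<theta> (simplex_map p h \<tau>)) ?S)) c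
    = lext \<rho> (\<lambda>\<tau>. push \<rho> p h f (push of_int p \<tau> (transp \<theta>U \<tau>) ?S)) c"
    using c by (intro lext_cong) blast
  then show ?thesis
    unfolding sdiv_def push_lext[OF \<rho>]
    by (simp add: push_def[of \<rho>] lin_lext lin_simps)
qed

text \<open>Both sides push forward the subdivided universal simplex, and with trivial holonomy all
  weights are 1.\<close>

lemma sdiv_int:
  assumes "singular_chain p X c"
  shows "sdiv (\<lambda>_. 1) p c = singular_subdivision p c"
proof -
  have "push of_int p \<sigma> (transp (\<lambda>_. 1) \<sigma>) (singular_subdivision p (frag_of (iota p))) =
     chain_map p \<sigma> (simplicial_subdivision p (frag_of (restrict id (standard_simplex p))))" for \<sigma> :: "'a simplex"
  proof -
    have "singular_subdivision p (frag_of (iota p)) = simplicial_subdivision p (frag_of (restrict id (standard_simplex p)))"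
      using singular_subdivision_simplicial_simplex[of p "standard_simplex p" "frag_of (iota p)"]
      by (simp add: iota_def)
    then show ?thesis
      by (simp add: push_def chain_map_def frag_extend_lin transp_def o_def of_int_eq_id id_def)
  qed
  then show ?thesis
    unfolding sdiv_def singular_subdivision_def frag_extend_lin by (intro lext_cong) simp
qed

lemma sdiv_simps:
  "sdiv \<theta> p (a + b) = sdiv \<theta> p a + sdiv \<theta> p b" "sdiv \<theta> p (a - b) = sdiv \<theta> p a - sdiv \<theta> p b"
  "sdiv \<theta> p 0 = 0" "sdiv \<theta> p (scale r a) = scale r (sdiv \<theta> p a)"
  by (simp_all add: sdiv_def lin_simps)

lemma tch_sdiv: "tch p X c \<Longrightarrow> tch p X (sdiv \<theta> p c)"
  unfolding sdiv_def
  by (intro keys_lext tch_push[OF sub_iota[unfolded singular_chain_def]] simplex_cont) blast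

text \<open>On the universal simplex this is the integral statement; \<open>sdiv_push\<close> then
  identifies the transported subdivided boundary with the subdivision of the twisted
  boundary.\<close>

lemma tbd_sdiv:
  assumes \<theta>: "char_sys X \<theta>" and c: "tch p X c" and p: "1 \<le> p"
  shows "tbd \<theta> p (sdiv \<theta> p c) = sdiv \<theta> (p - 1) (tbd \<theta> p c)"
proof -
  let ?i = "frag_of (iota p)"
  have ch: "singular_chain p (simplex_space p) ?i"
    by (simp add: singular_chain_of singular_simplex_iota)
  have "tbd \<theta> p (push of_int p \<sigma> (transp \<theta> \<sigma>) (singular_subdivision p ?i)) = sdiv \<theta> (p - 1) (tface \<theta> p \<sigma>)"
    if \<sigma>: "singular_simplex p X \<sigma>" for \<sigma>
  proof -
    note co = compatible_transp[OF \<theta> \<sigma>]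
    have "tbd \<theta> p (push of_int p \<sigma> (transp \<theta> \<sigma>) (singular_subdivision p ?i)) =
        push of_int (p - 1) \<sigma> (transp \<theta> \<sigma>) (chain_boundary p (singular_subdivision p ?i))"
      using tbd_push[OF urh_of_int p sub_iota[unfolded singular_chain_def] co] p by (simp add: tbd_int)
    also have "\<dots> = push of_int (p - 1) \<sigma> (transp \<theta> \<sigma>) (sdiv (\<lambda>_. 1) (p - 1) (chain_boundary p ?i))"
      using chain_boundary_singular_subdivision[OF ch] sdiv_int[OF singular_chain_boundary[OF ch]]
      by (simp add: One_nat_def)
    also have "\<dots> = sdiv \<theta> (p - 1) (push of_int (p - 1) \<sigma> (transp \<theta> \<sigma>) (chain_boundary p ?i))"
      using singular_chain_boundary[OF ch]
      by (intro sdiv_push[OF urh_of_int _ co, symmetric]) (simp add: singular_chain_def One_nat_def)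
    also have "push of_int (p - 1) \<sigma> (transp \<theta> \<sigma>) (chain_boundary p ?i) = tbd \<theta> p (sg \<sigma> 1)"
      using tbd_push[OF urh_of_int p ch[unfolded singular_chain_def] co] p push_iota[OF \<theta> \<sigma>]
      by (simp add: tbd_int)
    finally show ?thesis by (simp add: tbd_simps)
  qed
  then have "tbd \<theta> p (sdiv \<theta> p c) = lin (\<lambda>\<sigma>. sdiv \<theta> (p - 1) (tface \<theta> p \<sigma>)) c"
    using c unfolding sdiv_def[of \<theta> p] tbd_lext[OF urh_id] by (intro lext_cong) blast
  then show ?thesis by (simp add: tbd_def sdiv_def lin_lext)
qed

text \<open>Valid for every 1-chain, because subdivision is the identity in degree 0: the universal
  edge minus its subdivision is then a cycle of the acyclic \<open>simplex_space 1\<close>, and one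
  filling of it serves all edges of \<open>X\<close>.\<close>

lemma sdiv_homotopy:
  assumes \<theta>: "char_sys X \<theta>" and z: "tch 1 X z"
  shows "\<exists>w. tch 2 X w \<and> tbd \<theta> 2 w = z - sdiv \<theta> 1 z"
proof -
  let ?i = "frag_of (iota 1)" and ?D = "simplex_space 1"
  have ch: "singular_chain 1 ?D ?i"
    by (simp add: singular_chain_of singular_simplex_iota)
  have "chain_boundary 1 (singular_subdivision 1 ?i) = singular_subdivision 0 (chain_boundary 1 ?i)"
    using chain_boundary_singular_subdivision[OF ch] by simp
  also have "\<dots> = chain_boundary 1 ?i"
    using singular_subdivision_zero[of ?D "chain_boundary 1 ?i"] singular_chain_boundary[OF ch] by simp
  finally have "singular_relcycle 1 ?D {} (?i - singular_subdivision 1 ?i)"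
    unfolding singular_cycle using ch sub_iota by (auto simp: chain_boundary_diff singular_chain_diff)
  then have "singular_relboundary 1 ?D {} (?i - singular_subdivision 1 ?i)"
    using acyc_simplex_space unfolding acyc_def by blast
  then obtain \<beta> where \<beta>: "singular_chain 2 ?D \<beta>" "chain_boundary 2 \<beta> = ?i - singular_subdivision 1 ?i"
    by (auto simp: singular_boundary numeral_2_eq_2 One_nat_def)
  define w where "w = lin (\<lambda>\<sigma>. push of_int 2 \<sigma> (transp \<theta> \<sigma>) \<beta>) z"
  have "tch 2 X w"
    unfolding w_def using z
    by (intro keys_lext tch_push[OF \<beta>(1)[unfolded singular_chain_def]] simplex_cont) blast
  moreover have "tbd \<theta> 2 (push of_int 2 \<sigma> (transp \<theta> \<sigma>) \<beta>) =
      sg \<sigma> 1 - push of_int 1 \<sigma> (transp \<theta> \<sigma>) (singular_subdivision 1 ?i)"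
    if "\<sigma> \<in> ks z" for \<sigma>
  proof -
    have \<sigma>: "singular_simplex 1 X \<sigma>" using that z by auto
    show ?thesis
      using tbd_push[OF urh_of_int, of 2 \<beta> ?D "\<lambda>_. 1" \<theta> \<sigma>] compatible_transp[OF \<theta> \<sigma>] \<beta> push_iota[OF \<theta> \<sigma>]
      by (simp add: tbd_int singular_chain_def push_simps(2)[OF urh_of_int] One_nat_def)
  qed
  then have "tbd \<theta> 2 w = lin (\<lambda>\<sigma>. sg \<sigma> 1 - push of_int 1 \<sigma> (transp \<theta> \<sigma>) (singular_subdivision 1 ?i)) z"
    unfolding w_def tbd_lext[OF urh_id] by (intro lext_cong)
  then have "tbd \<theta> 2 w = z - sdiv \<theta> 1 z"
    by (simp add: lext_fun_diff lin_id sdiv_def)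
  ultimately show ?thesis by blast
qed

lemma sdiv_pow_lin: "(sdiv \<theta> p ^^ n) = lin (\<lambda>\<sigma>. (sdiv \<theta> p ^^ n) (sg \<sigma> 1))"
proof (induction n)
  case 0 show ?case by (auto simp: lin_id fun_eq_iff)
next
  case (Suc n)
  show ?case
    by (rule HOL.ext) (simp, subst Suc, simp add: sdiv_def lin_lext)
qed

definition small :: "nat \<Rightarrow> 'a set set \<Rightarrow> ('a simplex \<Rightarrow>\<^sub>0 'r::zero) \<Rightarrow> bool" where
  "small p \<U> c \<longleftrightarrow> (\<forall>\<sigma>\<in>ks c. \<exists>U\<in>\<U>. \<sigma> ` standard_simplex p \<subseteq> U)"

text \<open>For a single simplex the cover is pulled back to the compact standard simplex. Smallness
  is asked of all later subdivisions too, so that the finitely many simplices of \<open>c\<close>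
  share one exponent.\<close>

lemma sdiv_small:
  assumes \<theta>: "char_sys X \<theta>" and c: "tch p X c"
    and \<U>: "\<And>U. U \<in> \<U> \<Longrightarrow> openin X U" "topspace X \<subseteq> \<Union>\<U>"
  shows "\<exists>n. \<forall>m\<ge>n. small p \<U> ((sdiv \<theta> p ^^ m) c)"
proof -
  have "\<exists>n. \<forall>m\<ge>n. small p \<U> ((sdiv \<theta> p ^^ m) (sg \<sigma> 1))" if "\<sigma> \<in> ks c" for \<sigma>
  proof -
    have \<sigma>: "singular_simplex p X \<sigma>" using that c by auto
    note co = compatible_transp[OF \<theta> \<sigma>] and cont = simplex_cont[OF \<sigma>]
    let ?D = "simplex_space p" and ?i = "frag_of (iota p)"
    have ch: "singular_chain p ?D ((singular_subdivision p ^^ m) ?i)" for m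
      by (induction m) (auto simp: singular_chain_of singular_simplex_iota singular_chain_singular_subdivision)
    have pow: "(sdiv \<theta> p ^^ m) (sg \<sigma> 1) = push of_int p \<sigma> (transp \<theta> \<sigma>) ((singular_subdivision p ^^ m) ?i)" for m
    proof (induction m)
      case 0 show ?case using push_iota[OF \<theta> \<sigma>] by simp
    next
      case (Suc m)
      then show ?case
        using sdiv_push[OF urh_of_int ch[of m, unfolded singular_chain_def] co] sdiv_int[OF ch[of m]] by simp
    qed
    let ?C = "(\<lambda>U. {x \<in> standard_simplex p. \<sigma> x \<in> U}) ` \<U>"
    have 1: "openin ?D V" if V: "V \<in> ?C" for V
    proof -
      obtain U where "U \<in> \<U>" "V = {x \<in> topspace ?D. \<sigma> x \<in> U}" using V by auto
      then show ?thesis using openin_continuous_map_preimage[OF cont \<U>(1)[of U]] by simp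
    qed
    have "\<sigma> x \<in> topspace X" if "x \<in> standard_simplex p" for x
      using cont that by (auto simp: continuous_map_def)
    then have 2: "topspace ?D \<subseteq> \<Union>?C" using \<U>(2) by fastforce
    obtain n where n: "\<And>m f. n \<le> m \<Longrightarrow> f \<in> ks ((singular_subdivision p ^^ m) ?i)
       \<Longrightarrow> \<exists>V\<in>?C. f \<in> standard_simplex p \<rightarrow> V"
      using sufficient_iterated_singular_subdivision_exists[OF 1 2 ch[of 0, simplified]] by blast
    have "small p \<U> ((sdiv \<theta> p ^^ m) (sg \<sigma> 1))" if m: "m \<ge> n" for m
      unfolding small_def
    proof
      fix \<tau> assume "\<tau> \<in> ks ((sdiv \<theta> p ^^ m) (sg \<sigma> 1))"
      also have "\<dots> \<subseteq> simplex_map p \<sigma> ` ks ((singular_subdivision p ^^ m) ?i)"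
        unfolding pow push_def by (rule keys_lext) auto
      finally obtain f where "f \<in> ks ((singular_subdivision p ^^ m) ?i)" "\<tau> = simplex_map p \<sigma> f" by blast
      moreover obtain U where "U \<in> \<U>" "f \<in> standard_simplex p \<rightarrow> {x \<in> standard_simplex p. \<sigma> x \<in> U}"
        using n[OF m calculation(1)] by auto
      ultimately show "\<exists>U\<in>\<U>. \<tau> ` standard_simplex p \<subseteq> U"
        by (intro bexI[of _ U]) (auto simp: simplex_map_def)
    qed
    then show ?thesis by blast
  qed
  then obtain N where N: "\<And>\<sigma> m. \<sigma> \<in> ks c \<Longrightarrow> m \<ge> N \<sigma> \<Longrightarrow> small p \<U> ((sdiv \<theta> p ^^ m) (sg \<sigma> 1))"
    by metis
  define n where "n = Max (insert 0 (N ` ks c))"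
  have "small p \<U> ((sdiv \<theta> p ^^ m) c)" if "m \<ge> n" for m
  proof -
    have "N \<sigma> \<le> m" if "\<sigma> \<in> ks c" for \<sigma>
      using that \<open>m \<ge> n\<close> by (simp add: n_def)
    then have "ks ((sdiv \<theta> p ^^ m) (sg \<sigma> 1)) \<subseteq> {\<tau>. \<exists>U\<in>\<U>. \<tau> ` standard_simplex p \<subseteq> U}" if "\<sigma> \<in> ks c" for \<sigma>
      using N that unfolding small_def by blast
    then have "ks ((sdiv \<theta> p ^^ m) c) \<subseteq> {\<tau>. \<exists>U\<in>\<U>. \<tau> ` standard_simplex p \<subseteq> U}"
      by (subst sdiv_pow_lin) (rule keys_lext)
    then show ?thesis by (auto simp: small_def)
  qed
  then show ?thesis by blast
qed

subsection \<open>Acyclic covers and their nerves\<close>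

definition loc_acyc :: "'a topology \<Rightarrow> bool" where
  "loc_acyc X \<longleftrightarrow> (\<forall>x\<in>topspace X. \<forall>U. openin X U \<longrightarrow> x \<in> U \<longrightarrow>
     (\<exists>V. openin X V \<and> x \<in> V \<and> V \<subseteq> U \<and> acyc (subtopology X V)))"

definition open_cover :: "'a topology \<Rightarrow> 'a set set \<Rightarrow> bool" where
  "open_cover X \<U> \<longleftrightarrow> (\<forall>U\<in>\<U>. openin X U) \<and> topspace X \<subseteq> \<Union>\<U>"

definition acyc_family :: "'a topology \<Rightarrow> 'a set set \<Rightarrow> bool" where
  "acyc_family X \<U> \<longleftrightarrow> (\<forall>U\<in>\<U>. acyc (subtopology X U))"

definition star_refines :: "'a set set \<Rightarrow> 'a set set \<Rightarrow> bool" where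
  "star_refines \<V> \<U> \<longleftrightarrow> (\<forall>V\<in>\<V>. V \<noteq> {} \<longrightarrow> (\<exists>U\<in>\<U>. \<forall>V'\<in>\<V>. V' \<inter> V \<noteq> {} \<longrightarrow> V' \<subseteq> U))"

lemma star_refinesD:
  assumes "star_refines \<V> \<U>" "V \<in> \<V>" "x \<in> V"
  obtains U where "U \<in> \<U>" "V \<subseteq> U" "\<And>V' y. V' \<in> \<V> \<Longrightarrow> y \<in> V \<Longrightarrow> y \<in> V' \<Longrightarrow> V' \<subseteq> U"
proof -
  have "V \<noteq> {}" using assms(3) by blast
  then obtain U where U: "U \<in> \<U>" "\<forall>V'\<in>\<V>. V' \<inter> V \<noteq> {} \<longrightarrow> V' \<subseteq> U"
    using assms(1,2) unfolding star_refines_def by meson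
  have "V' \<subseteq> U" if "V' \<in> \<V>" "y \<in> V" "y \<in> V'" for V' y
    using that U(2) by blast
  then show thesis using that U(1) assms(2,3) by metis
qed

text \<open>The cover is shrunk to finitely many sets \<open>Q a\<close> with closure in
  \<open>U a\<close>. The set \<open>W x\<close> lies in \<open>U a\<close> if x is in the closure
  of \<open>Q a\<close> and avoids that closure otherwise; a point y of \<open>Q a\<close> therefore
  forces every \<open>W x\<close> containing y into \<open>U a\<close>.\<close>

lemma barycentric_refinement:
  assumes X: "compact_space X" "Hausdorff_space X" and \<U>: "open_cover X \<U>"
  obtains \<V> where "open_cover X \<V>"
    "\<And>y. y \<in> topspace X \<Longrightarrow> \<exists>U\<in>\<U>. \<forall>V\<in>\<V>. y \<in> V \<longrightarrow> V \<subseteq> U"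
proof -
  have reg: "regular_space X" using X compact_Hausdorff_imp_regular_space by blast
  have "\<exists>U Q. U \<in> \<U> \<and> openin X Q \<and> x \<in> Q \<and> X closure_of Q \<subseteq> U" if x: "x \<in> topspace X" for x
  proof -
    obtain U where U: "U \<in> \<U>" "x \<in> U" "openin X U" using \<U> x by (auto simp: open_cover_def)
    have "neighbourhood_base_of (closedin X) X" using reg by (simp add: neighbourhood_base_of_closedin)
    then obtain Q C where Q: "openin X Q" "closedin X C" "x \<in> Q" "Q \<subseteq> C" "C \<subseteq> U"
      using U unfolding neighbourhood_base_of by metis
    then have "X closure_of Q \<subseteq> U" using closure_of_minimal by blast
    then show ?thesis using Q U by blast
  qed
  then obtain U Q where UQ: "\<And>x. x \<in> topspace X \<Longrightarrow> U x \<in> \<U> \<and> openin X (Q x) \<and> x \<in> Q x \<and> X closure_of Q x \<subseteq> U x"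
    by metis
  have "\<exists>\<F>. finite \<F> \<and> \<F> \<subseteq> Q ` topspace X \<and> topspace X \<subseteq> \<Union>\<F>"
    using X(1) UQ by (intro compact_space_alt[THEN iffD1, rule_format]) auto
  then obtain F where F: "finite F" "F \<subseteq> topspace X" "topspace X \<subseteq> \<Union>(Q ` F)"
    using finite_subset_image by metis
  define W where "W x = topspace X \<inter> (\<Inter>a\<in>F. if x \<in> X closure_of Q a then U a else topspace X - X closure_of Q a)" for x
  have Wo: "openin X (W x)" for x
  proof -
    have "openin X (topspace X \<inter> \<Inter>((\<lambda>a. if x \<in> X closure_of Q a then U a else topspace X - X closure_of Q a) ` F))"
    proof (cases "F = {}")
      case False
      show ?thesis
        using F(1,2) UQ \<U> False by (intro openin_Int openin_Inter) (auto simp: open_cover_def)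
    qed auto
    then show ?thesis by (simp add: W_def)
  qed
  have Wx: "x \<in> W x" if "x \<in> topspace X" for x
    using that F UQ by (auto simp: W_def)
  have "\<exists>U\<in>\<U>. \<forall>V\<in>W ` topspace X. y \<in> V \<longrightarrow> V \<subseteq> U" if y: "y \<in> topspace X" for y
  proof -
    obtain a where a: "a \<in> F" "y \<in> Q a" using F(3) y by blast
    have a': "a \<in> topspace X" using F(2) a by blast
    then have ya: "y \<in> X closure_of Q a"
      using a UQ closure_of_subset openin_subset by (metis subsetD)
    have "W x \<subseteq> U a" if "y \<in> W x" for x
    proof -
      have sub: "W x \<subseteq> (if x \<in> X closure_of Q a then U a else topspace X - X closure_of Q a)"
        using a(1) unfolding W_def by blast
      then have "x \<in> X closure_of Q a" using that ya by (auto split: if_splits)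
      then show ?thesis using sub by simp
    qed
    then show ?thesis using UQ[OF a'] by (intro bexI[of _ "U a"]) auto
  qed
  moreover have "open_cover X (W ` topspace X)"
    unfolding open_cover_def using Wo Wx by auto
  ultimately show thesis using that by metis
qed

text \<open>Two barycentric refinements give a star refinement: the finer one puts two meeting
  members into one set, the coarser one puts all such sets through a fixed point into one member of
  \<open>\<U>\<close>. Acyclic subsets are taken last, since shrinking the members preserves this
  property.\<close>

lemma star_refinement:
  assumes X: "compact_space X" "Hausdorff_space X" "loc_acyc X" and \<U>: "open_cover X \<U>"
  shows "\<exists>\<V>. open_cover X \<V> \<and> acyc_family X \<V> \<and> star_refines \<V> \<U>"
proof -
  obtain \<U>' where 1: "open_cover X \<U>'" "\<And>y. y \<in> topspace X \<Longrightarrow> \<exists>U\<in>\<U>. \<forall>V\<in>\<U>'. y \<in> V \<longrightarrow> V \<subseteq> U"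
    using barycentric_refinement[OF X(1,2) \<U>] by metis
  obtain \<V> where 2: "open_cover X \<V>" "\<And>y. y \<in> topspace X \<Longrightarrow> \<exists>U\<in>\<U>'. \<forall>V\<in>\<V>. y \<in> V \<longrightarrow> V \<subseteq> U"
    using barycentric_refinement[OF X(1,2) 1(1)] by metis
  define \<W> where "\<W> = {A. openin X A \<and> acyc (subtopology X A) \<and> (\<exists>V\<in>\<V>. A \<subseteq> V)}"
  have "topspace X \<subseteq> \<Union>\<W>"
  proof
    fix x assume x: "x \<in> topspace X"
    then obtain V where "V \<in> \<V>" "x \<in> V" "openin X V" using 2 by (auto simp: open_cover_def)
    then obtain A where "openin X A" "x \<in> A" "A \<subseteq> V" "acyc (subtopology X A)"
      using X(3) x unfolding loc_acyc_def by blast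
    then show "x \<in> \<Union>\<W>" using \<open>V \<in> \<V>\<close> by (auto simp: \<W>_def)
  qed
  moreover have "star_refines \<W> \<U>"
    unfolding star_refines_def
  proof (intro ballI impI)
    fix V assume V: "V \<in> \<W>" "V \<noteq> {}"
    then obtain x where x: "x \<in> V" by blast
    have "x \<in> topspace X" using V x openin_subset by (auto simp: \<W>_def)
    then obtain U where U: "U \<in> \<U>" "\<And>V. V \<in> \<U>' \<Longrightarrow> x \<in> V \<Longrightarrow> V \<subseteq> U" using 1(2) by metis
    have "V' \<subseteq> U" if V': "V' \<in> \<W>" "V' \<inter> V \<noteq> {}" for V'
    proof -
      obtain y where y: "y \<in> V" "y \<in> V'" using V' by blast
      then have "y \<in> topspace X" using V openin_subset by (auto simp: \<W>_def)
      then obtain U' where U': "U' \<in> \<U>'" "\<And>V. V \<in> \<V> \<Longrightarrow> y \<in> V \<Longrightarrow> V \<subseteq> U'" using 2(2) by metis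
      have "A \<subseteq> U'" if "A \<in> \<W>" "y \<in> A" for A
        using that U'(2) unfolding \<W>_def by blast
      then have "V \<subseteq> U'" "V' \<subseteq> U'" using V V' y by auto
      then show ?thesis using U(2)[OF U'(1)] x by blast
    qed
    then show "\<exists>U\<in>\<U>. \<forall>V'\<in>\<W>. V' \<inter> V \<noteq> {} \<longrightarrow> V' \<subseteq> U" using U(1) by metis
  qed
  ultimately show ?thesis
    by (intro exI[of _ \<W>]) (auto simp: \<W>_def open_cover_def acyc_family_def)
qed

lemma open_cover_Int:
  assumes "open_cover X \<U>" "open_cover X \<V>"
  shows "open_cover X {U \<inter> V | U V. U \<in> \<U> \<and> V \<in> \<V>}"
  using assms unfolding open_cover_def by blast

lemma star_refines_mono:
  assumes "star_refines \<W> \<U>'" "\<And>U. U \<in> \<U>' \<Longrightarrow> \<exists>V\<in>\<U>. U \<subseteq> V"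
  shows "star_refines \<W> \<U>"
  using assms unfolding star_refines_def by (meson order_trans)

lemma open_cover_preimage:
  assumes "continuous_map X Y h" "open_cover Y \<U>"
  shows "open_cover X ((\<lambda>U. {x \<in> topspace X. h x \<in> U}) ` \<U>)"
  using assms openin_continuous_map_preimage[OF assms(1)]
  by (fastforce simp: open_cover_def continuous_map_def)

definition close :: "'a set set \<Rightarrow> 'a \<Rightarrow> 'a \<Rightarrow> bool" where
  "close \<U> p q \<longleftrightarrow> (\<exists>U\<in>\<U>. p \<in> U \<and> q \<in> U)"

definition close3 :: "'a set set \<Rightarrow> 'a \<Rightarrow> 'a \<Rightarrow> 'a \<Rightarrow> bool" where
  "close3 \<U> p q r \<longleftrightarrow> (\<exists>U\<in>\<U>. p \<in> U \<and> q \<in> U \<and> r \<in> U)"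

text \<open>\<open>P\<close> consists of centres, \<open>D x\<close> is a short path from \<open>x\<close> to the centre \<open>c x\<close> assigned to it, and
  \<open>\<kappa> p q\<close> is a short path between neighbouring centres.\<close>

locale nerve_data =
  fixes X :: "'a topology" and \<theta> :: "'a chain \<Rightarrow> 'r::comm_ring_1"
    and \<U>0 \<U>1 \<U>2 :: "'a set set" and P :: "'a set"
    and c :: "'a \<Rightarrow> 'a" and D :: "'a \<Rightarrow> 'a simplex" and \<kappa> :: "'a \<Rightarrow> 'a \<Rightarrow> 'a simplex"
  assumes \<theta>: "char_sys X \<theta>"
    and acyc2: "acyc_family X \<U>2"
    and star0: "star_refines \<U>0 \<U>1" and star1: "star_refines \<U>1 \<U>2"
    and cP: "\<And>x. x \<in> topspace X \<Longrightarrow> c x \<in> P"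
    and D: "\<And>x. x \<in> topspace X \<Longrightarrow> singular_simplex 1 X (D x)"
      "\<And>x. x \<in> topspace X \<Longrightarrow> D x (vx 0) = x" "\<And>x. x \<in> topspace X \<Longrightarrow> D x (vx 1) = c x"
      "\<And>x. x \<in> topspace X \<Longrightarrow> \<exists>U\<in>\<U>0. D x ` standard_simplex 1 \<subseteq> U"
    and \<kappa>: "\<And>p q. p \<in> P \<Longrightarrow> q \<in> P \<Longrightarrow> close \<U>1 p q \<Longrightarrow> singular_simplex 1 X (\<kappa> p q)"
      "\<And>p q. p \<in> P \<Longrightarrow> q \<in> P \<Longrightarrow> close \<U>1 p q \<Longrightarrow> \<kappa> p q (vx 0) = p"
      "\<And>p q. p \<in> P \<Longrightarrow> q \<in> P \<Longrightarrow> close \<U>1 p q \<Longrightarrow> \<kappa> p q (vx 1) = q"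
      "\<And>p q. p \<in> P \<Longrightarrow> q \<in> P \<Longrightarrow> close \<U>1 p q \<Longrightarrow> \<exists>U\<in>\<U>1. \<kappa> p q ` standard_simplex 1 \<subseteq> U"
begin

abbreviation "sm p \<sigma> \<equiv> \<exists>U\<in>\<U>0. \<sigma> ` standard_simplex p \<subseteq> U"

lemma vx_image: "k \<le> p \<Longrightarrow> \<sigma> (vx k) \<in> \<sigma> ` standard_simplex p"
  by simp

text \<open>The paths \<open>D\<close> from the vertices lie in members of \<open>\<U>0\<close> that
  meet the one containing \<open>\<sigma>\<close>, so star refinement gathers them all in a member
  of \<open>\<U>1\<close>.\<close>

lemma nbhd1:
  assumes \<sigma>: "singular_simplex p X \<sigma>" "sm p \<sigma>"
  shows "\<exists>V\<in>\<U>1. \<sigma> ` standard_simplex p \<subseteq> V \<and> (\<forall>k\<le>p. D (\<sigma> (vx k)) ` standard_simplex 1 \<subseteq> V)"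
proof -
  obtain U where U: "U \<in> \<U>0" "\<sigma> ` standard_simplex p \<subseteq> U" using \<sigma> by blast
  have "\<sigma> (vx 0) \<in> U" using U vx_image[of 0 p \<sigma>] by blast
  then obtain V where V: "V \<in> \<U>1" "U \<subseteq> V" "\<And>V' y. V' \<in> \<U>0 \<Longrightarrow> y \<in> U \<Longrightarrow> y \<in> V' \<Longrightarrow> V' \<subseteq> V"
    using star_refinesD[OF star0 U(1)] by metis
  have "D (\<sigma> (vx k)) ` standard_simplex 1 \<subseteq> V" if k: "k \<le> p" for k
  proof -
    have t: "\<sigma> (vx k) \<in> topspace X" using singular_simplex_vx[OF \<sigma>(1) k] .
    then obtain U' where U': "U' \<in> \<U>0" "D (\<sigma> (vx k)) ` standard_simplex 1 \<subseteq> U'" using D(4) by blast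
    then have "\<sigma> (vx k) \<in> U'" using D(2)[OF t] vx_image[of 0 1 "D (\<sigma> (vx k))"] by auto
    moreover have "\<sigma> (vx k) \<in> U" using U vx_image[OF k, of \<sigma>] by blast
    ultimately have "U' \<subseteq> V" using V(3) U'(1) by metis
    then show ?thesis using U' by blast
  qed
  then show ?thesis using V(1,2) U(2) by (intro bexI[of _ V]) auto
qed

lemma close_c:
  assumes \<sigma>: "singular_simplex p X \<sigma>" "sm p \<sigma>" and "i \<le> p" "j \<le> p"
  shows "close \<U>1 (c (\<sigma> (vx i))) (c (\<sigma> (vx j)))"
    "k \<le> p \<Longrightarrow> close3 \<U>1 (c (\<sigma> (vx i))) (c (\<sigma> (vx j))) (c (\<sigma> (vx k)))"
proof -
  obtain V where V: "V \<in> \<U>1" "\<And>k. k \<le> p \<Longrightarrow> D (\<sigma> (vx k)) ` standard_simplex 1 \<subseteq> V"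
    using nbhd1[OF \<sigma>] by blast
  have "c (\<sigma> (vx k)) \<in> V" if "k \<le> p" for k
    using V(2)[OF that] D(3)[OF singular_simplex_vx[OF \<sigma>(1) that]]
      vx_image[of 1 1 "D (\<sigma> (vx k))"] by auto
  then show "close \<U>1 (c (\<sigma> (vx i))) (c (\<sigma> (vx j)))"
    "k \<le> p \<Longrightarrow> close3 \<U>1 (c (\<sigma> (vx i))) (c (\<sigma> (vx j))) (c (\<sigma> (vx k)))"
    using V(1) assms unfolding close_def close3_def by blast+
qed

context
  fixes \<sigma> :: "'a simplex"
  assumes \<sigma>: "singular_simplex 1 X \<sigma>" "sm 1 \<sigma>"
begin

lemma vertices: "\<sigma> (vx 0) \<in> topspace X" "\<sigma> (vx 1) \<in> topspace X"
  using singular_simplex_vx[OF \<sigma>(1)] by auto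

lemmas \<kappa>' = \<kappa>[OF cP[OF vertices(1)] cP[OF vertices(2)] close_c(1)[OF \<sigma>, of 0 1, simplified]]

text \<open>The chord between the two centres may leave the member of \<open>\<U>1\<close> found
  before, but its own member meets that one in a centre; a second star refinement leads to the
  acyclic level \<open>\<U>2\<close>.\<close>

lemma nbhd2:
  "\<exists>W\<in>\<U>2. singular_simplex 1 (subtopology X W) \<sigma> \<and> singular_simplex 1 (subtopology X W) (D (\<sigma> (vx 0)))
     \<and> singular_simplex 1 (subtopology X W) (D (\<sigma> (vx 1)))
     \<and> singular_simplex 1 (subtopology X W) (\<kappa> (c (\<sigma> (vx 0))) (c (\<sigma> (vx 1))))"
proof -
  obtain V where V: "V \<in> \<U>1" "\<sigma> ` standard_simplex 1 \<subseteq> V"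
    "\<And>k. k \<le> 1 \<Longrightarrow> D (\<sigma> (vx k)) ` standard_simplex 1 \<subseteq> V"
    using nbhd1[OF \<sigma>] by blast
  obtain V' where V': "V' \<in> \<U>1" "\<kappa> (c (\<sigma> (vx 0))) (c (\<sigma> (vx 1))) ` standard_simplex 1 \<subseteq> V'"
    using \<kappa>'(4) by metis
  have "c (\<sigma> (vx 0)) \<in> V" "c (\<sigma> (vx 0)) \<in> V'"
    using V(3)[of 0] D(3)[OF vertices(1)] V' \<kappa>'(2) vx_image[of 1 1 "D (\<sigma> (vx 0))"]
      vx_image[of 0 1 "\<kappa> (c (\<sigma> (vx 0))) (c (\<sigma> (vx 1)))"] by auto
  then obtain W where "W \<in> \<U>2" "V \<subseteq> W" "V' \<subseteq> W"
    using star_refinesD[OF star1 V(1)] V'(1) by metis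
  moreover have "D (\<sigma> (vx 0)) ` standard_simplex 1 \<subseteq> V" "D (\<sigma> (vx 1)) ` standard_simplex 1 \<subseteq> V"
    using V(3)[of 0] V(3)[of 1] by auto
  ultimately show ?thesis
    using \<sigma>(1) V(2) V'(2) D(1)[OF vertices(1)] D(1)[OF vertices(2)] \<kappa>'(1)
    unfolding singular_simplex_subtopology by (meson order_trans)
qed

text \<open>Both routes from \<open>\<sigma> (vx 0)\<close> to the centre of
  \<open>\<sigma> (vx 1)\<close> are compared with a third path between these points inside one
  acyclic set.\<close>

lemma holonomy:
  "\<theta> (frag_of (D (\<sigma> (vx 0)))) * \<theta> (frag_of (\<kappa> (c (\<sigma> (vx 0))) (c (\<sigma> (vx 1))))) =
   \<theta> (frag_of \<sigma>) * \<theta> (frag_of (D (\<sigma> (vx 1))))"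
proof -
  obtain W where W: "W \<in> \<U>2" and s: "singular_simplex 1 (subtopology X W) \<sigma>"
     "singular_simplex 1 (subtopology X W) (D (\<sigma> (vx 0)))"
     "singular_simplex 1 (subtopology X W) (D (\<sigma> (vx 1)))"
     "singular_simplex 1 (subtopology X W) (\<kappa> (c (\<sigma> (vx 0))) (c (\<sigma> (vx 1))))"
    using nbhd2 by blast
  have a: "acyc (subtopology X W)" using acyc2 W by (simp add: acyc_family_def)
  note ch = char_sys_subtopology[OF \<theta>, of W]
  have "\<sigma> (vx 0) \<in> topspace (subtopology X W)" "c (\<sigma> (vx 1)) \<in> topspace (subtopology X W)"
    using singular_simplex_vx[OF s(1), of 0] singular_simplex_vx[OF s(3), of 1] D(3)[OF vertices(2)] by auto
  then obtain e where e: "singular_simplex 1 (subtopology X W) e" "e (vx 0) = \<sigma> (vx 0)" "e (vx 1) = c (\<sigma> (vx 1))"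
    using acyc_path[OF a] by blast
  show ?thesis
    using char_triangle[OF a ch s(2) s(4) e(1)] char_triangle[OF a ch s(1) s(3) e(1)]
      e D(2,3)[OF vertices(1)] D(2,3)[OF vertices(2)] \<kappa>'(2,3) by simp
qed

text \<open>The quadrilateral formed by \<open>\<sigma>\<close>, the chord and the two paths
  \<open>D\<close> is a twisted cycle by \<open>holonomy\<close>, and it lies in an acyclic
  set.\<close>

lemma fill1:
  "\<exists>d. tch 2 X d \<and> tbd \<theta> 2 d = sg \<sigma> 1 - sg (\<kappa> (c (\<sigma> (vx 0))) (c (\<sigma> (vx 1)))) (\<theta> (frag_of (D (\<sigma> (vx 0)))))
     + (sg (D (\<sigma> (vx 1))) (\<theta> (frag_of \<sigma>)) - sg (D (\<sigma> (vx 0))) 1)"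
proof -
  let ?z = "sg \<sigma> 1 - sg (\<kappa> (c (\<sigma> (vx 0))) (c (\<sigma> (vx 1)))) (\<theta> (frag_of (D (\<sigma> (vx 0)))))
     + (sg (D (\<sigma> (vx 1))) (\<theta> (frag_of \<sigma>)) - sg (D (\<sigma> (vx 0))) 1)"
  obtain W where W: "W \<in> \<U>2" and s: "singular_simplex 1 (subtopology X W) \<sigma>"
     "singular_simplex 1 (subtopology X W) (D (\<sigma> (vx 0)))"
     "singular_simplex 1 (subtopology X W) (D (\<sigma> (vx 1)))"
     "singular_simplex 1 (subtopology X W) (\<kappa> (c (\<sigma> (vx 0))) (c (\<sigma> (vx 1))))"
    using nbhd2 by blast
  have a: "acyc (subtopology X W)" using acyc2 W by (simp add: acyc_family_def)
  have "tch 1 (subtopology X W) ?z"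
    using s by (intro keys_subset_add keys_subset_diff) auto
  moreover have "tbd \<theta> 1 ?z = 0"
    using D(2,3)[OF vertices(1)] D(2,3)[OF vertices(2)] \<kappa>'(2,3) holonomy
    by (simp add: tbd_simps(1,2) tbd_path[OF s(1)] tbd_path[OF s(2)] tbd_path[OF s(3)] tbd_path[OF s(4)])
  ultimately obtain d where "tch 2 (subtopology X W) d" "tbd \<theta> 2 d = ?z"
    using acyc_fill[OF a char_sys_subtopology[OF \<theta>]] by blast
  then show ?thesis
    by (intro exI[of _ d]) (auto simp: singular_simplex_subtopology subset_iff)
qed

end

text \<open>The chords start in the common member of \<open>\<U>1\<close>, so star refinement puts
  the whole triangle into an acyclic set, where its twisted boundary can be filled.\<close>

lemma fill2:
  assumes P: "p \<in> P" "q \<in> P" "r \<in> P" and cl: "close3 \<U>1 p q r"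
  shows "\<exists>K. tch 2 X K \<and> tbd \<theta> 2 K = sg (\<kappa> q r) (\<theta> (frag_of (\<kappa> p q))) - sg (\<kappa> p r) 1 + sg (\<kappa> p q) 1"
proof -
  let ?z = "sg (\<kappa> q r) (\<theta> (frag_of (\<kappa> p q))) - sg (\<kappa> p r) 1 + sg (\<kappa> p q) 1"
  obtain U where U: "U \<in> \<U>1" "p \<in> U" "q \<in> U" "r \<in> U" using cl by (auto simp: close3_def)
  then have cl': "close \<U>1 p q" "close \<U>1 q r" "close \<U>1 p r" by (auto simp: close_def)
  note pq = \<kappa>[OF P(1,2) cl'(1)] and qr = \<kappa>[OF P(2,3) cl'(2)] and pr = \<kappa>[OF P(1,3) cl'(3)]
  obtain W where W: "W \<in> \<U>2" "U \<subseteq> W" "\<And>V' y. V' \<in> \<U>1 \<Longrightarrow> y \<in> U \<Longrightarrow> y \<in> V' \<Longrightarrow> V' \<subseteq> W"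
    using star_refinesD[OF star1 U(1,2)] by metis
  have sub: "\<alpha> ` standard_simplex 1 \<subseteq> W" if "\<exists>V\<in>\<U>1. \<alpha> ` standard_simplex 1 \<subseteq> V" "\<alpha> (vx 0) \<in> U" for \<alpha> :: "'a simplex"
    using that W(3) vx_image[of 0 1 \<alpha>] by (meson le0 order_trans subsetD)
  have s: "singular_simplex 1 (subtopology X W) (\<kappa> p q)" "singular_simplex 1 (subtopology X W) (\<kappa> q r)"
    "singular_simplex 1 (subtopology X W) (\<kappa> p r)"
    using pq qr pr U sub unfolding singular_simplex_subtopology by auto
  have a: "acyc (subtopology X W)" using acyc2 W by (simp add: acyc_family_def)
  have h: "\<theta> (frag_of (\<kappa> p q)) * \<theta> (frag_of (\<kappa> q r)) = \<theta> (frag_of (\<kappa> p r))"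
    using char_triangle[OF a char_sys_subtopology[OF \<theta>] s] pq qr pr by auto
  have "tch 1 (subtopology X W) ?z"
    using s by (intro keys_subset_add keys_subset_diff) auto
  moreover have "tbd \<theta> 1 ?z = 0"
    using pq(2,3) qr(2,3) pr(2,3) h
    by (simp add: tbd_simps(1,2) tbd_path[OF s(1)] tbd_path[OF s(2)] tbd_path[OF s(3)])
  ultimately obtain d where "tch 2 (subtopology X W) d" "tbd \<theta> 2 d = ?z"
    using acyc_fill[OF a char_sys_subtopology[OF \<theta>]] by blast
  then show ?thesis
    by (intro exI[of _ d]) (auto simp: singular_simplex_subtopology subset_iff)
qed

text \<open>A filling chosen once for each triple of centres. That it depends on the triple alone is
  what makes the passage to the nerve factor through a free module of finite rank.\<close>

definition K :: "'a \<Rightarrow> 'a \<Rightarrow> 'a \<Rightarrow> ('a, 'r) twchain" where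
  "K p q r = (SOME k. tch 2 X k \<and>
     tbd \<theta> 2 k = sg (\<kappa> q r) (\<theta> (frag_of (\<kappa> p q))) - sg (\<kappa> p r) 1 + sg (\<kappa> p q) 1)"

lemma K:
  assumes "p \<in> P" "q \<in> P" "r \<in> P" "close3 \<U>1 p q r"
  shows "tch 2 X (K p q r)"
    "tbd \<theta> 2 (K p q r) = sg (\<kappa> q r) (\<theta> (frag_of (\<kappa> p q))) - sg (\<kappa> p r) 1 + sg (\<kappa> p q) 1"
  using someI_ex[OF fill2[OF assms]] unfolding K_def by auto

text \<open>\<open>q0\<close>, \<open>q1\<close>, \<open>q2\<close> realise the nerve map on small
  simplices in degrees 0, 1, 2. The common weight is the holonomy from the first vertex to its
  centre, the new base point.\<close>

definition q0 :: "'a simplex \<Rightarrow> ('a, 'r) twchain" where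
  "q0 \<pi> = sg (pt (c (\<pi> (vx 0)))) (\<theta> (frag_of (D (\<pi> (vx 0)))))"
definition q1 :: "'a simplex \<Rightarrow> ('a, 'r) twchain" where
  "q1 \<sigma> = sg (\<kappa> (c (\<sigma> (vx 0))) (c (\<sigma> (vx 1)))) (\<theta> (frag_of (D (\<sigma> (vx 0)))))"
definition q2 :: "'a simplex \<Rightarrow> ('a, 'r) twchain" where
  "q2 \<sigma> = scale (\<theta> (frag_of (D (\<sigma> (vx 0))))) (K (c (\<sigma> (vx 0))) (c (\<sigma> (vx 1))) (c (\<sigma> (vx 2))))"

lemma tbd_q1:
  assumes "tch 1 X z" "small 1 \<U>0 z"
  shows "tbd \<theta> 1 (lin q1 z) = lin q0 (tbd \<theta> 1 z)"
proof -
  have "tbd \<theta> 1 (q1 \<sigma>) = lin q0 (tface \<theta> 1 \<sigma>)" if "\<sigma> \<in> ks z" for \<sigma>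
  proof -
    have \<sigma>: "singular_simplex 1 X \<sigma>" "sm 1 \<sigma>" using that assms by (auto simp: small_def)
    show ?thesis
      unfolding q1_def tbd_path[OF \<kappa>'(1)[OF \<sigma>]] tface_path[OF \<sigma>(1)]
      using \<kappa>'(2,3)[OF \<sigma>] holonomy[OF \<sigma>] by (simp add: lin_simps q0_def)
  qed
  then have "tbd \<theta> 1 (lin q1 z) = lin (\<lambda>\<sigma>. lin q0 (tface \<theta> 1 \<sigma>)) z"
    unfolding tbd_lext[OF urh_id] by (rule lext_cong)
  then show ?thesis by (simp add: tbd_def lin_lext)
qed

text \<open>In the twisted boundary the face opposite to the first vertex carries the weight of the
  first edge; \<open>holonomy\<close> for that edge converts it into the weight of the chord that
  occurs in the boundary of \<open>K\<close>.\<close>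

lemma tbd_q2:
  assumes "tch 2 X w" "small 2 \<U>0 w"
  shows "tbd \<theta> 2 (lin q2 w) = lin q1 (tbd \<theta> 2 w)"
proof -
  have "tbd \<theta> 2 (q2 \<sigma>) = lin q1 (tface \<theta> 2 \<sigma>)" if "\<sigma> \<in> ks w" for \<sigma>
  proof -
    have \<sigma>: "singular_simplex 2 X \<sigma>" "sm 2 \<sigma>" using that assms by (auto simp: small_def)
    have e: "singular_simplex 1 X (edge \<sigma>)" using singular_simplex_edge[OF \<sigma>(1)] by simp
    have "sm 1 (edge \<sigma>)"
    proof -
      obtain U where "U \<in> \<U>0" "\<sigma> ` standard_simplex 2 \<subseteq> U" using \<sigma>(2) by blast
      moreover have "edge \<sigma> ` standard_simplex 1 \<subseteq> \<sigma> ` standard_simplex 2"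
        using standard_simplex_mono[of 1 2] by (auto simp: edge_def)
      ultimately show ?thesis by (meson order_trans)
    qed
    from holonomy[OF e this]
    have h: "\<theta> (frag_of (edge \<sigma>)) * \<theta> (frag_of (D (\<sigma> (vx 1)))) =
       \<theta> (frag_of (D (\<sigma> (vx 0)))) * \<theta> (frag_of (\<kappa> (c (\<sigma> (vx 0))) (c (\<sigma> (vx 1)))))" by simp
    have t: "\<sigma> (vx k) \<in> topspace X" if "k \<le> 2" for k using singular_simplex_vx[OF \<sigma>(1) that] .
    have KK: "tbd \<theta> 2 (K (c (\<sigma> (vx 0))) (c (\<sigma> (vx 1))) (c (\<sigma> (vx 2)))) =
       sg (\<kappa> (c (\<sigma> (vx 1))) (c (\<sigma> (vx 2)))) (\<theta> (frag_of (\<kappa> (c (\<sigma> (vx 0))) (c (\<sigma> (vx 1))))))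
       - sg (\<kappa> (c (\<sigma> (vx 0))) (c (\<sigma> (vx 2)))) 1 + sg (\<kappa> (c (\<sigma> (vx 0))) (c (\<sigma> (vx 1)))) 1"
      using close_c(2)[OF \<sigma>, of 0 1 2] cP t by (intro K) auto
    have f: "singular_face 2 0 \<sigma> (vx 0) = \<sigma> (vx 1)" "singular_face 2 0 \<sigma> (vx 1) = \<sigma> (vx 2)"
      "singular_face 2 1 \<sigma> (vx 0) = \<sigma> (vx 0)" "singular_face 2 1 \<sigma> (vx 1) = \<sigma> (vx 2)"
      "singular_face 2 2 \<sigma> (vx 0) = \<sigma> (vx 0)" "singular_face 2 2 \<sigma> (vx 1) = \<sigma> (vx 1)"
      using face_vx[of 2 0 \<sigma> 0] face_vx[of 2 0 \<sigma> 1] face_vx[of 2 1 \<sigma> 0] face_vx[of 2 1 \<sigma> 1]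
        face_vx[of 2 2 \<sigma> 0] face_vx[of 2 2 \<sigma> 1] by (simp_all add: numeral_2_eq_2 One_nat_def)
    have s: "{..2::nat} = {0,1,2}" by auto
    have tf: "tface \<theta> 2 \<sigma> = sg (singular_face 2 0 \<sigma>) (\<theta> (frag_of (edge \<sigma>)))
        - sg (singular_face 2 1 \<sigma>) 1 + sg (singular_face 2 2 \<sigma>) 1"
      by (simp add: tface_def s single_uminus[symmetric])
    show ?thesis
      unfolding q2_def tf tbd_simps KK using h f
      by (simp add: lin_simps q1_def scale_add scale_diff)
  qed
  then have "tbd \<theta> 2 (lin q2 w) = lin (\<lambda>\<sigma>. lin q1 (tface \<theta> 2 \<sigma>)) w"
    unfolding tbd_lext[OF urh_id] by (rule lext_cong)
  then show ?thesis by (simp add: tbd_def lin_lext)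
qed

text \<open>Summing \<open>fill1\<close> over the edges of \<open>z\<close>, the paths
  \<open>D\<close> depend on end points only and combine to a linear image of
  \<open>tbd \<theta> 1 z\<close>; they disappear because \<open>z\<close> is a cycle.\<close>

lemma q1_homologous:
  assumes z: "tch 1 X z" "small 1 \<U>0 z" "tbd \<theta> 1 z = 0"
  shows "\<exists>d. tch 2 X d \<and> tbd \<theta> 2 d = z - lin q1 z"
proof -
  have "\<exists>d. tch 2 X d \<and> tbd \<theta> 2 d = sg \<sigma> 1 - q1 \<sigma> + (sg (D (\<sigma> (vx 1))) (\<theta> (frag_of \<sigma>)) - sg (D (\<sigma> (vx 0))) 1)"
    if "\<sigma> \<in> ks z" for \<sigma>
    unfolding q1_def using that z by (intro fill1) (auto simp: small_def)
  then obtain d where d: "\<And>\<sigma>. \<sigma> \<in> ks z \<Longrightarrow> tch 2 X (d \<sigma>)"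
    "\<And>\<sigma>. \<sigma> \<in> ks z \<Longrightarrow> tbd \<theta> 2 (d \<sigma>) = sg \<sigma> 1 - q1 \<sigma> + (sg (D (\<sigma> (vx 1))) (\<theta> (frag_of \<sigma>)) - sg (D (\<sigma> (vx 0))) 1)"
    by metis
  have "tbd \<theta> 2 (lin d z) = lin (\<lambda>\<sigma>. sg \<sigma> 1 - q1 \<sigma> + (sg (D (\<sigma> (vx 1))) (\<theta> (frag_of \<sigma>)) - sg (D (\<sigma> (vx 0))) 1)) z"
    unfolding tbd_lext[OF urh_id] using d by (intro lext_cong)
  also have "\<dots> = z - lin q1 z + lin (\<lambda>\<sigma>. sg (D (\<sigma> (vx 1))) (\<theta> (frag_of \<sigma>)) - sg (D (\<sigma> (vx 0))) 1) z"
    by (simp only: lext_fun_add lext_fun_diff lin_id)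
  also have "lin (\<lambda>\<sigma>. sg (D (\<sigma> (vx 1))) (\<theta> (frag_of \<sigma>)) - sg (D (\<sigma> (vx 0))) 1) z =
      lin (\<lambda>\<sigma>. lin (\<lambda>\<pi>. sg (D (\<pi> (vx 0))) 1) (tface \<theta> 1 \<sigma>)) z"
    using z(1) by (intro lext_cong) (auto simp: tface_path lin_simps)
  also have "\<dots> = lin (\<lambda>\<pi>. sg (D (\<pi> (vx 0))) 1) (tbd \<theta> 1 z)"
    by (simp add: tbd_def lin_lext)
  finally have "tbd \<theta> 2 (lin d z) = z - lin q1 z" using z(3) by simp
  moreover have "tch 2 X (lin d z)" using d(1) by (rule keys_lext)
  ultimately show ?thesis by blast
qed

end

section \<open>Linear operators, and coefficients in the kernel of \<open>\<epsilon>\<close>\<close>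

definition lmap :: "(('a \<Rightarrow>\<^sub>0 'r::comm_ring_1) \<Rightarrow> ('b \<Rightarrow>\<^sub>0 'r)) \<Rightarrow> bool" where
  "lmap T \<longleftrightarrow> (\<forall>x y. T (x + y) = T x + T y) \<and> (\<forall>r x. T (scale r x) = scale r (T x))"

lemma lmap_simps:
  assumes "lmap T"
  shows "T (x + y) = T x + T y" "T (scale r x) = scale r (T x)" "T 0 = 0"
    "T (- x) = - T x" "T (x - y) = T x - T y"
proof -
  show 1: "T (x + y) = T x + T y" and 2: "T (scale r x) = scale r (T x)" for x y r
    using assms by (auto simp: lmap_def)
  show "T 0 = 0" using 2[of 0 0] by simp
  show 3: "T (- x) = - T x" for x using 2[of "-1" x] by (simp add: scale_m1)
  show "T (x - y) = T x - T y" using 1[of x "-y"] 3 by simp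
qed

lemma lmap_sum: "lmap T \<Longrightarrow> T (sum f A) = (\<Sum>a\<in>A. T (f a))"
  by (induction A rule: infinite_finite_induct) (auto simp: lmap_simps)

lemma lmap_lin: "lmap (lin F)"
  by (simp add: lmap_def lin_simps)

lemma lmap_comp: "lmap S \<Longrightarrow> lmap T \<Longrightarrow> lmap (\<lambda>x. S (T x))"
  by (simp add: lmap_def)

lemma lmap_pow: fixes T :: "('a \<Rightarrow>\<^sub>0 'r::comm_ring_1) \<Rightarrow> ('a \<Rightarrow>\<^sub>0 'r)" shows "lmap T \<Longrightarrow> lmap (T ^^ n)"
  by (induction n) (auto simp: lmap_def)

lemma lmap_eq_lin: "lmap T \<Longrightarrow> T c = lin (\<lambda>a. T (sg a 1)) c"
  using lmap_sum[of T "\<lambda>a. scale (lk c a) (sg a 1)" "ks c"] lin_id[of c]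
  by (simp add: lext_def lmap_simps(2) del: scale_single)

lemma lk_lin: "lk (lin F c) k = (\<Sum>a\<in>ks c. lk c a * lk (F a) k)"
  by (simp add: lext_def lookup_sum)

text \<open>The kernel of \<open>\<epsilon>\<close> is an ideal, and every coefficient of
  \<open>T c\<close> is a linear combination of coefficients of \<open>c\<close>.\<close>

lemma lmap_kernel:
  assumes "lmap T" "unital_ring_hom \<epsilon>" "\<And>k. \<epsilon> (lk c k) = 0"
  shows "\<epsilon> (lk (T c) k) = 0"
  unfolding lmap_eq_lin[OF assms(1), of c] lk_lin
  by (simp add: urh_sum[OF assms(2)] urh_simps[OF assms(2)] assms(3))

lemma lk_red:
  assumes "unital_ring_hom \<epsilon>"
  shows "lk (lext \<epsilon> (\<lambda>a. sg a 1) c) k = \<epsilon> (lk c k)"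
  by (cases "k \<in> ks c")
     (auto simp: lext_def lookup_sum lookup_single when_def in_keys_iff urh_simps[OF assms])

text \<open>A contraction of the augmented (integral) complex in low degrees lifts, basis element by basis
  element, to an operator that is the identity on cycles up to boundaries but vanishes after
  augmentation.\<close>

lemma contraction_lift:
  fixes \<delta> :: "nat \<Rightarrow> 'b \<Rightarrow> ('b \<Rightarrow>\<^sub>0 'r::comm_ring_1)" and d :: "nat \<Rightarrow> 'b \<Rightarrow> ('b \<Rightarrow>\<^sub>0 int)"
    and B :: "nat \<Rightarrow> 'b set" and \<epsilon> :: "'r \<Rightarrow> int"
  assumes \<epsilon>: "unital_ring_hom \<epsilon>"
    and ks: "\<And>p b. 1 \<le> p \<Longrightarrow> b \<in> B p \<Longrightarrow> ks (\<delta> p b) \<subseteq> B (p - 1)"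
    and red: "\<And>p b. 1 \<le> p \<Longrightarrow> b \<in> B p \<Longrightarrow> lext \<epsilon> (\<lambda>a. sg a 1) (\<delta> p b) = d p b"
    and ex0: "\<And>c. ks c \<subseteq> B 0 \<Longrightarrow> \<exists>c'. ks c' \<subseteq> B 1 \<and> lin (d 1) c' = c"
    and ex1: "\<And>c. ks c \<subseteq> B 1 \<Longrightarrow> lin (d 1) c = 0 \<Longrightarrow> \<exists>c'. ks c' \<subseteq> B 2 \<and> lin (d 2) c' = c"
    and ex2: "\<And>c. ks c \<subseteq> B 2 \<Longrightarrow> lin (d 2) c = 0 \<Longrightarrow> \<exists>c'. ks c' \<subseteq> B 3 \<and> lin (d 3) c' = c"
    and dd: "\<And>b. b \<in> B 2 \<Longrightarrow> lin (d 1) (d 2 b) = 0"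
  shows "\<exists>N s. \<forall>b\<in>B 2. ks (N b) \<subseteq> B 2 \<and> (\<forall>k. \<epsilon> (lk (N b) k) = 0) \<and> ks (s b) \<subseteq> B 3 \<and>
     (\<forall>c. ks c \<subseteq> B 2 \<longrightarrow> lin (\<delta> 2) c = 0 \<longrightarrow> lin N c = c - lin (\<delta> 3) (lin s c))"
proof -
  \<comment> \<open>A coefficient of the integral boundary is the reduction of one of the twisted
    boundary, so its support cannot be larger.\<close>
  have ksd: "ks (d p b) \<subseteq> B (p - 1)" if "1 \<le> p" "b \<in> B p" for p b
  proof
    fix a assume "a \<in> ks (d p b)"
    then have "\<epsilon> (lk (\<delta> p b) a) \<noteq> 0"
      unfolding red[OF that, symmetric] by (simp add: in_keys_iff lk_red[OF \<epsilon>])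
    then have "a \<in> ks (\<delta> p b)" by (auto simp: in_keys_iff urh_simps[OF \<epsilon>])
    then show "a \<in> B (p - 1)" using ks[OF that] by blast
  qed
  \<comment> \<open>\<open>s0\<close>, \<open>s1\<close>, \<open>s2\<close> are built as a
    contraction of the integral complex: in each degree \<open>d s + s d\<close> is the identity on
    basis elements, the exactness hypotheses providing the next stage.\<close>
  obtain s0 where s0: "\<And>b. b \<in> B 0 \<Longrightarrow> ks (s0 b) \<subseteq> B 1" "\<And>b. b \<in> B 0 \<Longrightarrow> lin (d 1) (s0 b) = sg b 1"
    using ex0[of "sg _ 1"] by (metis (no_types, lifting) empty_subsetI insert_subset keys_single zero_neq_one)
  have "\<exists>c'. ks c' \<subseteq> B 2 \<and> lin (d 2) c' = sg b 1 - lin s0 (d 1 b)" if b: "b \<in> B 1" for b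
  proof (rule ex1)
    have kd: "ks (d 1 b) \<subseteq> B 0" using ksd[of 1 b] b by simp
    show "ks (sg b 1 - lin s0 (d 1 b)) \<subseteq> B 1"
      using b kd s0(1) by (intro keys_subset_diff keys_lext) auto
    have "lin (d 1) (lin s0 (d 1 b)) = lin (\<lambda>a. sg a 1) (d 1 b)"
      unfolding lin_lext using kd s0(2) by (intro lext_cong) blast
    then show "lin (d 1) (sg b 1 - lin s0 (d 1 b)) = 0"
      by (simp add: lin_simps lin_id)
  qed
  then obtain s1 where s1: "\<And>b. b \<in> B 1 \<Longrightarrow> ks (s1 b) \<subseteq> B 2"
    "\<And>b. b \<in> B 1 \<Longrightarrow> lin (d 2) (s1 b) = sg b 1 - lin s0 (d 1 b)" by metis
  have "\<exists>c'. ks c' \<subseteq> B 3 \<and> lin (d 3) c' = sg b 1 - lin s1 (d 2 b)" if b: "b \<in> B 2" for b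
  proof (rule ex2)
    have kd: "ks (d 2 b) \<subseteq> B 1" using ksd[of 2 b] b by (simp add: One_nat_def)
    show "ks (sg b 1 - lin s1 (d 2 b)) \<subseteq> B 2"
      using b kd s1(1) by (intro keys_subset_diff keys_lext) auto
    have "lin (d 2) (lin s1 (d 2 b)) = lin (\<lambda>a. sg a 1 - lin s0 (d 1 a)) (d 2 b)"
      unfolding lin_lext using kd s1(2) by (intro lext_cong) blast
    also have "\<dots> = d 2 b - lin s0 (lin (d 1) (d 2 b))"
      by (simp add: lext_fun_diff lin_id lin_lext)
    finally show "lin (d 2) (sg b 1 - lin s1 (d 2 b)) = 0"
      using dd[OF b] by (simp add: lin_simps)
  qed
  then obtain s2 where s2: "\<And>b. b \<in> B 2 \<Longrightarrow> ks (s2 b) \<subseteq> B 3"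
    "\<And>b. b \<in> B 2 \<Longrightarrow> lin (d 3) (s2 b) = sg b 1 - lin s1 (d 2 b)" by metis
  \<comment> \<open>A coefficientwise section of the reduction, which does not enlarge supports; it
    is not meant to commute with the boundaries.\<close>
  define up :: "('b \<Rightarrow>\<^sub>0 int) \<Rightarrow> ('b \<Rightarrow>\<^sub>0 'r)" where "up = lext of_int (\<lambda>a. sg a 1)"
  let ?red = "lext \<epsilon> (\<lambda>a. sg a (1::int))"
  have kup: "ks (up c) \<subseteq> ks c" for c unfolding up_def by (rule keys_lext) auto
  have eid: "(\<lambda>x. \<epsilon> (of_int x)) = (\<lambda>x::int. x)" by (simp add: urh_of_int_eq[OF \<epsilon>])
  have redup: "?red (up c) = c" for c
    unfolding up_def lext_lext[OF \<epsilon>] lext_single[OF \<epsilon>] eid by (simp add: urh_simps[OF \<epsilon>] lin_id)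
  define s where "s b = up (s2 b)" for b
  \<comment> \<open>The identity minus \<open>\<delta> s + s \<delta>\<close> for the lifted
    contraction. The part \<open>s \<delta>\<close> vanishes on twisted cycles, and the reduction of
    the whole is the identity minus \<open>d s + s d\<close>, that is 0.\<close>
  define N where "N b = sg b 1 - lin (\<delta> 3) (s b) - lin (\<lambda>a. up (s1 a)) (\<delta> 2 b)" for b
  have "ks (N b) \<subseteq> B 2 \<and> (\<forall>k. \<epsilon> (lk (N b) k) = 0) \<and> ks (s b) \<subseteq> B 3" if b: "b \<in> B 2" for b
  proof -
    have ks3: "ks (s b) \<subseteq> B 3" using kup s2(1)[OF b] by (auto simp: s_def)
    have d2: "ks (\<delta> 2 b) \<subseteq> B 1" using ks[of 2 b] b by (simp add: One_nat_def)
    have kN: "ks (N b) \<subseteq> B 2"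
      unfolding N_def using b ks3 ks[of 3] d2 kup s1(1)
      by (intro keys_subset_diff keys_lext) (auto simp: numeral_3_eq_3 numeral_2_eq_2, blast+)
    have "?red (lin (\<delta> 3) (s b)) = lext (\<lambda>x. \<epsilon> (of_int x)) (\<lambda>a. ?red (\<delta> 3 a)) (s2 b)"
      unfolding s_def up_def lin_lext lext_lext[OF \<epsilon>]
      by (simp add: lin_simps lext_single[OF \<epsilon>] urh_simps[OF \<epsilon>])
    also have "\<dots> = lin (d 3) (s2 b)"
      unfolding eid using s2(1)[OF b] red[of 3] by (intro lext_cong) auto
    finally have 1: "?red (lin (\<delta> 3) (s b)) = sg b 1 - lin s1 (d 2 b)" using s2(2)[OF b] by simp
    have "?red (lin (\<lambda>a. up (s1 a)) (\<delta> 2 b)) = lext \<epsilon> s1 (\<delta> 2 b)"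
      unfolding lext_lext[OF \<epsilon>] redup ..
    also have "\<dots> = lin s1 (?red (\<delta> 2 b))"
      unfolding lin_lext by (simp add: lin_simps)
    finally have 2: "?red (lin (\<lambda>a. up (s1 a)) (\<delta> 2 b)) = lin s1 (d 2 b)" using red[of 2 b] b by simp
    have "?red (N b) = 0"
      unfolding N_def lext_diff[OF \<epsilon>] 1 2 by (simp add: lext_single[OF \<epsilon>] urh_simps[OF \<epsilon>])
    then have "\<epsilon> (lk (N b) k) = 0" for k using lk_red[OF \<epsilon>, of "N b" k] by simp
    then show ?thesis using kN ks3 by blast
  qed
  moreover have "lin N c = c - lin (\<delta> 3) (lin s c)" if "lin (\<delta> 2) c = 0" for c
  proof -
    have "lin N c = c - lin (\<delta> 3) (lin s c) - lin (\<lambda>a. up (s1 a)) (lin (\<delta> 2) c)"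
      unfolding N_def by (simp add: lext_fun_diff lin_id lin_lext)
    then show ?thesis using that by simp
  qed
  ultimately show ?thesis by blast
qed

subsection \<open>The mapping cone\<close>

definition inl :: "('a \<Rightarrow>\<^sub>0 'r::comm_ring_1) \<Rightarrow> ('a + 'b \<Rightarrow>\<^sub>0 'r)" where
  "inl = lin (\<lambda>a. sg (Inl a) 1)"
definition inr :: "('b \<Rightarrow>\<^sub>0 'r::comm_ring_1) \<Rightarrow> ('a + 'b \<Rightarrow>\<^sub>0 'r)" where
  "inr = lin (\<lambda>a. sg (Inr a) 1)"
definition prl :: "('a + 'b \<Rightarrow>\<^sub>0 'r::comm_ring_1) \<Rightarrow> ('a \<Rightarrow>\<^sub>0 'r)" where
  "prl = lin (case_sum (\<lambda>a. sg a 1) (\<lambda>_. 0))"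
definition prr :: "('a + 'b \<Rightarrow>\<^sub>0 'r::comm_ring_1) \<Rightarrow> ('b \<Rightarrow>\<^sub>0 'r)" where
  "prr = lin (case_sum (\<lambda>_. 0) (\<lambda>a. sg a 1))"

lemma lmap_in: "lmap inl" "lmap inr" "lmap prl" "lmap prr"
  by (simp_all add: inl_def inr_def prl_def prr_def lmap_lin)

lemmas in_simps = lmap_in[THEN lmap_simps(1)] lmap_in[THEN lmap_simps(2)] lmap_in[THEN lmap_simps(3)]
  lmap_in[THEN lmap_simps(4)] lmap_in[THEN lmap_simps(5)]

lemma in_single: "inl (sg a r) = sg (Inl a) r" "inr (sg b r) = sg (Inr b) r"
  by (simp_all add: inl_def inr_def lin_simps)

lemma pr_in: "prl (inl c) = c" "prr (inr e) = e" "prl (inr e) = 0" "prr (inl c) = 0"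
  unfolding prl_def prr_def inl_def inr_def lin_lext by (simp_all add: lin_simps lin_id lext_fun_0)

lemma lin_split: "lin F c = lin (\<lambda>a. F (Inl a)) (prl c) + lin (\<lambda>a. F (Inr a)) (prr c)"
  unfolding prl_def prr_def lin_lext lext_fun_add[symmetric]
  by (rule lext_cong) (auto simp: lin_simps split: sum.splits)

lemma in_pr: "inl (prl c) + inr (prr c) = c"
  using lin_split[of "\<lambda>a. sg a 1" c] by (simp add: inl_def inr_def lin_id)

lemma keys_pr: "ks (prl c) \<subseteq> Inl -` ks c" "ks (prr c) \<subseteq> Inr -` ks c"
  unfolding prl_def prr_def by (intro keys_lext; auto split: sum.splits)+

lemma keys_in: "ks (inl c) \<subseteq> Inl ` ks c" "ks (inr e) \<subseteq> Inr ` ks e"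
  unfolding inl_def inr_def by (intro keys_lext; auto)+

text \<open>\<open>Inr \<tau>\<close> is the cone on a simplex of \<open>M\<close>, of degree one more than \<open>\<tau>\<close>. A cycle is thus a chain of \<open>W\<close>
  together with a cycle of \<open>M\<close> bounded by it.\<close>

definition cone_d :: "('w chain \<Rightarrow> 'r::comm_ring_1) \<Rightarrow> ('m chain \<Rightarrow> 'r) \<Rightarrow> ('m \<Rightarrow> 'w) \<Rightarrow> nat \<Rightarrow>
    'w simplex + 'm simplex \<Rightarrow> ('w simplex + 'm simplex \<Rightarrow>\<^sub>0 'r)" where
  "cone_d \<theta> \<theta>M i p = case_sum (\<lambda>\<sigma>. inl (tface \<theta> p \<sigma>))
     (\<lambda>\<tau>. - inl (sg (simplex_map (p - 1) i \<tau>) 1) - (if p = 1 then 0 else inr (tface \<theta>M (p - 1) \<tau>)))"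

abbreviation incl :: "nat \<Rightarrow> ('m \<Rightarrow> 'w) \<Rightarrow> ('m, 'r::comm_ring_1) twchain \<Rightarrow> ('w, 'r) twchain" where
  "incl p i \<equiv> push (\<lambda>x. x) p i (\<lambda>_. 1)"

lemma in_lin:
  "inl (incl q i e) = lin (\<lambda>\<tau>. inl (sg (simplex_map q i \<tau>) 1)) e"
  "inl (tbd \<theta> q a) = lin (\<lambda>\<sigma>. inl (tface \<theta> q \<sigma>)) a"
  "inr (tbd \<theta> q a) = lin (\<lambda>\<sigma>. inr (tface \<theta> q \<sigma>)) a"
  unfolding tbd_def push_def inl_def inr_def lin_lext by (rule refl)+

text \<open>The differential of the cone takes a pair (w, z) to the difference of the boundary of w
  and the image of z, together with minus the boundary of z. For p = 1 the chain z has degree 0, so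
  the second component is absent.\<close>

lemma lin_cone_d: "lin (cone_d \<theta> \<theta>M i p) c =
   inl (tbd \<theta> p (prl c) - incl (p - 1) i (prr c)) - (if p = 1 then 0 else inr (tbd \<theta>M (p - 1) (prr c)))"
proof -
  show ?thesis
    unfolding lin_split[of "cone_d \<theta> \<theta>M i p" c]
    by (simp add: cone_d_def in_simps lext_fun_diff lext_fun_minus lext_fun_0 in_lin)
qed

text \<open>Degree 0 is separated because \<open>p - 1\<close> is truncated there: 0-simplices of
  \<open>M\<close> first contribute in degree 1.\<close>

definition cone_basis :: "'w topology \<Rightarrow> 'm topology \<Rightarrow> nat \<Rightarrow> ('w simplex + 'm simplex) set" where
  "cone_basis W M p = Inl ` singular_simplex_set p W \<union> (if p = 0 then {} else Inr ` singular_simplex_set (p - 1) M)"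

lemma cone_basisD:
  assumes "ks c \<subseteq> cone_basis W M p"
  shows "tch p W (prl c)" "p \<noteq> 0 \<Longrightarrow> tch (p - 1) M (prr c)" "p = 0 \<Longrightarrow> prr c = 0"
proof -
  show "tch p W (prl c)" "p \<noteq> 0 \<Longrightarrow> tch (p - 1) M (prr c)"
    using keys_pr[of c] assms unfolding cone_basis_def by (auto split: if_splits)
  show "prr c = 0" if "p = 0"
  proof -
    have "ks (prr c) = {}" using keys_pr(2)[of c] assms that by (fastforce simp: cone_basis_def)
    then show ?thesis by simp
  qed
qed

lemma cone_basisI: "tch p W a \<Longrightarrow> p \<noteq> 0 \<Longrightarrow> tch (p - 1) M b \<Longrightarrow> ks (inl a + inr b) \<subseteq> cone_basis W M p"
  using order_trans[OF keys_in(1) image_mono, of a "singular_simplex_set p W"]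
    order_trans[OF keys_in(2) image_mono, of b "singular_simplex_set (p - 1) M"]
  unfolding cone_basis_def by (intro keys_subset_add) auto

text \<open>Pulling back to the universal simplex trivialises the coefficients, so the claim follows
  from the vanishing of the integral double boundary.\<close>

lemma tbd_tbd:
  assumes \<theta>: "char_sys X \<theta>" and c: "tch p X c" and p: "2 \<le> p"
  shows "tbd \<theta> (p - 1) (tbd \<theta> p c) = 0"
proof -
  let ?i = "frag_of (iota p)"
  have ch: "singular_chain p (simplex_space p) ?i"
    by (simp add: singular_chain_of singular_simplex_iota)
  have p': "1 \<le> p" "1 \<le> p - 1" using p by auto
  have ch1: "singular_chain (p - 1) (simplex_space p) (chain_boundary p ?i)"
    using singular_chain_boundary[OF ch] by (simp add: One_nat_def)
  have "tbd \<theta> (p - 1) (tface \<theta> p \<sigma>) = 0" if "\<sigma> \<in> ks c" for \<sigma>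
  proof -
    have \<sigma>: "singular_simplex p X \<sigma>" using that c by auto
    note co = compatible_transp[OF \<theta> \<sigma>]
    have "tface \<theta> p \<sigma> = tbd \<theta> p (push of_int p \<sigma> (transp \<theta> \<sigma>) ?i)"
      using push_iota[OF \<theta> \<sigma>] by (simp add: tbd_simps)
    also have "\<dots> = push of_int (p - 1) \<sigma> (transp \<theta> \<sigma>) (chain_boundary p ?i)"
      using tbd_push[OF urh_of_int p'(1) ch[unfolded singular_chain_def] co] by (simp add: tbd_int p')
    finally have "tbd \<theta> (p - 1) (tface \<theta> p \<sigma>) =
        push of_int (p - 1 - 1) \<sigma> (transp \<theta> \<sigma>) (chain_boundary (p - 1) (chain_boundary p ?i))"
      using tbd_push[OF urh_of_int p'(2) ch1[unfolded singular_chain_def] co] by (simp add: tbd_int p')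
    also have "chain_boundary (p - 1) (chain_boundary p ?i) = 0"
      using chain_boundary_boundary[OF ch] by (simp add: One_nat_def)
    finally show ?thesis by (simp add: push_simps[OF urh_of_int])
  qed
  then have "tbd \<theta> (p - 1) (tbd \<theta> p c) = lin (\<lambda>_. 0) c"
    unfolding tbd_def[of \<theta> p] tbd_lext[OF urh_id] by (intro lext_cong)
  then show ?thesis by (simp add: lext_fun_0)
qed

lemma incl_int: "incl p i c = chain_map p i c"
  by (simp add: push_def chain_map_def frag_extend_lin o_def)

lemma compatible_incl: "compatible (\<lambda>x. x) M (\<lambda>c. \<theta> (chain_map 1 i c)) \<theta> i (\<lambda>_. 1)"
  by (simp add: compatible_def)

lemma incl_simps:
  "incl p i (a + b) = incl p i a + incl p i b" "incl p i (a - b) = incl p i a - incl p i b"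
  "incl p i (- a) = - incl p i a" "incl p i 0 = 0" "incl p i (scale r a) = scale r (incl p i a)"
  by (simp_all add: push_simps[OF urh_id])

text \<open>A homology isomorphism split into injectivity and surjectivity on the level of cycles,
  the form in which acyclicity of the cone uses it.\<close>

locale homology_equiv =
  fixes W :: "'w topology" and M :: "'m topology" and i :: "'m \<Rightarrow> 'w"
  assumes cont: "continuous_map M W i"
    and inj_H: "\<And>p z. singular_relcycle p M {} z \<Longrightarrow> singular_relboundary p W {} (chain_map p i z)
        \<Longrightarrow> singular_relboundary p M {} z"
    and surj_H: "\<And>p w. singular_relcycle p W {} w \<Longrightarrow> \<exists>y. singular_relcycle p M {} y \<and>
        singular_relboundary p W {} (w - chain_map p i y)"
begin

abbreviation "B \<equiv> cone_basis W M"
abbreviation "dz \<equiv> cone_d (\<lambda>_. 1::int) (\<lambda>_. 1::int) i"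

text \<open>Every 0-chain is a cycle, so by surjectivity on homology it differs from a chain of
  \<open>M\<close> by a boundary of \<open>W\<close>.\<close>

lemma exact0: assumes "ks c \<subseteq> B 0" shows "\<exists>c'. ks c' \<subseteq> B 1 \<and> lin (dz 1) c' = c"
proof -
  have "singular_relcycle 0 W {} (prl c)"
    using cone_basisD(1)[OF assms] by (simp add: singular_cycle singular_chain_def chain_boundary_def)
  then obtain y where y: "singular_relcycle 0 M {} y" "singular_relboundary 0 W {} (prl c - chain_map 0 i y)"
    using surj_H by blast
  then obtain u where u: "singular_chain 1 W u" "chain_boundary 1 u = prl c - chain_map 0 i y"
    by (auto simp: singular_boundary One_nat_def)
  show ?thesis
  proof (intro exI conjI)
    show "ks (inl u + inr (- y)) \<subseteq> B 1"
      using y(1) u(1) by (intro cone_basisI) (auto simp: singular_chain_def singular_cycle keys_uminus)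
    show "lin (dz 1) (inl u + inr (- y)) = c"
      using u(2) in_pr[of c] cone_basisD(3)[OF assms]
      by (simp add: lin_cone_d in_simps pr_in tbd_int incl_int chain_map_minus)
  qed
qed

text \<open>A cycle (w, z) of the cone gives a cycle z of \<open>M\<close> that bounds in
  \<open>W\<close>, so z is the boundary of some z' in \<open>M\<close> by injectivity. Then w minus
  the image of z' is a cycle of \<open>W\<close>, which surjectivity moves to a cycle y of
  \<open>M\<close>. The minus sign in front of \<open>z' + y\<close> matches the sign of the cone
  differential.\<close>

lemma exact1:
  assumes c: "ks c \<subseteq> B p" "lin (dz p) c = 0" and p: "1 \<le> p"
  shows "\<exists>c'. ks c' \<subseteq> B (p + 1) \<and> lin (dz (p + 1)) c' = c"
proof -
  let ?w = "prl c" and ?z = "prr c"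
  have w: "singular_chain p W ?w" and z: "singular_chain (p - 1) M ?z"
    using cone_basisD[OF c(1)] p by (auto simp: singular_chain_def)
  have "prl (lin (dz p) c) = 0" "prr (lin (dz p) c) = 0" using c(2) by (simp_all add: in_simps)
  then have bw: "chain_boundary p ?w = chain_map (p - 1) i ?z" and bz: "chain_boundary (p - 1) ?z = 0"
    using p by (auto simp: lin_cone_d in_simps pr_in tbd_int incl_int chain_boundary_def[of 0] split: if_splits)
  have "singular_relboundary (p - 1) W {} (chain_map (p - 1) i ?z)"
    unfolding singular_boundary using w bw p by (auto simp: One_nat_def)
  then have "singular_relboundary (p - 1) M {} ?z"
    using inj_H z bz by (auto simp: singular_cycle)
  then obtain z' where z': "singular_chain p M z'" "chain_boundary p z' = ?z"
    using p by (auto simp: singular_boundary One_nat_def)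
  have "singular_relcycle p W {} (?w - chain_map p i z')"
    unfolding singular_cycle
    using w singular_chain_chain_map[OF z'(1) cont] bw z' chain_boundary_chain_map[OF z'(1), of i]
    by (auto simp: chain_boundary_diff One_nat_def intro: singular_chain_diff)
  then obtain y where y: "singular_relcycle p M {} y" "singular_relboundary p W {} (?w - chain_map p i z' - chain_map p i y)"
    using surj_H by blast
  then obtain u where u: "singular_chain (p + 1) W u" "chain_boundary (p + 1) u = ?w - chain_map p i z' - chain_map p i y"
    by (auto simp: singular_boundary Suc_eq_plus1[symmetric] simp del: Suc_eq_plus1)
  show ?thesis
  proof (intro exI conjI)
    have "singular_chain p M (- (z' + y))"
      using y(1) z'(1) by (intro singular_chain_minus[THEN iffD2] singular_chain_add) (auto simp: singular_cycle)
    then show "ks (inl u + inr (- (z' + y))) \<subseteq> B (p + 1)"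
      using u(1) by (intro cone_basisI) (auto simp: singular_chain_def)
    have "tbd (\<lambda>_. 1) (p + 1) u = chain_boundary (p + 1) u" "tbd (\<lambda>_. 1) p e = chain_boundary p e"
      for e :: "'m chain" using p by (simp_all add: tbd_int)
    then show "lin (dz (p + 1)) (inl u + inr (- (z' + y))) = c"
      using u(2) in_pr[of c] z' y(1) p
      by (simp add: lin_cone_d in_simps pr_in incl_int chain_map_minus chain_map_add chain_map_diff chain_boundary_diff
          chain_boundary_minus chain_boundary_add singular_cycle)
  qed
qed

lemma dd_int: assumes "b \<in> B 2" shows "lin (dz 1) (dz 2 b) = 0"
proof (cases b)
  case (Inl \<sigma>)
  then have \<sigma>: "singular_simplex 2 W \<sigma>" using assms by (auto simp: cone_basis_def)
  have "chain_boundary 1 (chain_boundary 2 (frag_of \<sigma>)) = 0"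
    using chain_boundary_boundary[of 2 W "frag_of \<sigma>"] \<sigma> by (simp add: singular_chain_of One_nat_def)
  moreover have "tface (\<lambda>_. 1) 2 \<sigma> = chain_boundary 2 (frag_of \<sigma>)"
    using tbd_int[of 2 "frag_of \<sigma>"] by (simp add: tbd_simps)
  ultimately show ?thesis
    unfolding lin_cone_d using Inl
    by (simp add: cone_d_def pr_in in_simps tbd_int incl_simps push_simps[OF urh_id])
next
  case (Inr \<tau>)
  then have \<tau>: "singular_simplex 1 M \<tau>" using assms by (auto simp: cone_basis_def One_nat_def)
  have "tface (\<lambda>_. 1) 1 \<tau> = chain_boundary 1 (frag_of \<tau>)"
    using tbd_int[of 1 "frag_of \<tau>"] by (simp add: tbd_simps)
  moreover have "chain_boundary 1 (frag_of (simplex_map 1 i \<tau>)) = chain_map 0 i (chain_boundary 1 (frag_of \<tau>))"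
    using chain_boundary_chain_map[of 1 M "frag_of \<tau>" i] \<tau> by (simp add: singular_chain_of)
  moreover have "(2::nat) - 1 = 1" by simp
  ultimately show ?thesis
    unfolding lin_cone_d using Inr
    by (simp add: cone_d_def pr_in in_simps in_single(1)[symmetric] tbd_int incl_simps push_simps[OF urh_id] chain_boundary_minus incl_int chain_map_minus One_nat_def)
qed

end

lemma scale_sum_left: "scale (sum f A) z = (\<Sum>a\<in>A. scale (f a) z)"
  by (induction A rule: infinite_finite_induct) (auto simp: scale_plus_left)

lemma small_lin:
  assumes "\<And>j. j \<in> ks x \<Longrightarrow> small p \<U> (F j)"
  shows "small p \<U> (lin F x)"
proof -
  have "ks (lin F x) \<subseteq> {\<sigma>. \<exists>U\<in>\<U>. \<sigma> ` standard_simplex p \<subseteq> U}"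
    using assms unfolding small_def by (intro keys_lext subsetI CollectI) simp
  then show ?thesis unfolding small_def by (simp add: subset_iff)
qed

lemma keys_prI: "Inl a \<in> ks e \<Longrightarrow> a \<in> ks (prl e)" "Inr b \<in> ks e \<Longrightarrow> b \<in> ks (prr e)"
  using keys_add[of "inl (prl e)" "inr (prr e)"] keys_in(1)[of "prl e"] keys_in(2)[of "prr e"]
  unfolding in_pr by auto

text \<open>Compactness gives a finite subcover, and one point in each of its members serves as
  centre; members are path connected, so the path to the centre stays inside.\<close>

lemma centres_exist:
  assumes X: "compact_space X" and \<U>: "open_cover X \<U>" "acyc_family X \<U>"
  shows "\<exists>P c D. finite P \<and> P \<subseteq> topspace X \<and> (\<forall>x\<in>topspace X. c x \<in> P \<and> singular_simplex 1 X (D x) \<and>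
     D x (vx 0) = x \<and> D x (vx 1) = c x \<and> (\<exists>U\<in>\<U>. D x ` standard_simplex 1 \<subseteq> U))"
proof -
  obtain \<F> where \<F>: "finite \<F>" "\<F> \<subseteq> \<U>" "topspace X \<subseteq> \<Union>\<F>"
    using X \<U>(1) unfolding compact_space_alt open_cover_def by meson
  define pick where "pick U = (SOME p. p \<in> U)" for U :: "'a set"
  have pick: "pick U \<in> U" if "x \<in> U" for x U using that unfolding pick_def by (rule someI)
  obtain A where A: "\<And>x. x \<in> topspace X \<Longrightarrow> A x \<in> \<F> \<and> x \<in> A x"
    using \<F>(3) by (meson UnionE subsetD)
  have sub: "A x \<subseteq> topspace X" if "x \<in> topspace X" for x
    using A[OF that] \<F>(2) \<U>(1) openin_subset unfolding open_cover_def by blast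
  have "\<exists>\<sigma>. singular_simplex 1 X \<sigma> \<and> \<sigma> (vx 0) = x \<and> \<sigma> (vx 1) = pick (A x) \<and> \<sigma> ` standard_simplex 1 \<subseteq> A x"
    if x: "x \<in> topspace X" for x
  proof -
    have ac: "acyc (subtopology X (A x))" using \<U>(2) A[OF x] \<F>(2) by (auto simp: acyc_family_def)
    have "x \<in> topspace (subtopology X (A x))" "pick (A x) \<in> topspace (subtopology X (A x))"
      using A[OF x] pick sub[OF x] x by auto
    from acyc_path[OF ac this] show ?thesis unfolding singular_simplex_subtopology by metis
  qed
  then obtain D where D: "\<And>x. x \<in> topspace X \<Longrightarrow> singular_simplex 1 X (D x) \<and> D x (vx 0) = x \<and>
     D x (vx 1) = pick (A x) \<and> D x ` standard_simplex 1 \<subseteq> A x" by metis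
  \<comment> \<open>Only members assigned to some point are used: they are nonempty, so
    \<open>pick\<close> does return an element of them.\<close>
  let ?P = "pick ` (\<F> \<inter> A ` topspace X)"
  have "finite ?P" using \<F>(1) by blast
  moreover have "?P \<subseteq> topspace X"
  proof
    fix p assume "p \<in> ?P"
    then obtain x where "x \<in> topspace X" "p = pick (A x)" by blast
    then show "p \<in> topspace X" using sub A pick by (metis subsetD)
  qed
  moreover have "\<forall>x\<in>topspace X. pick (A x) \<in> ?P \<and> singular_simplex 1 X (D x) \<and> D x (vx 0) = x \<and>
     D x (vx 1) = pick (A x) \<and> (\<exists>U\<in>\<U>. D x ` standard_simplex 1 \<subseteq> U)"
  proof
    fix x assume x: "x \<in> topspace X"
    then have "A x \<in> \<F>" "A x \<in> \<U>" using A \<F>(2) by auto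
    then show "pick (A x) \<in> ?P \<and> singular_simplex 1 X (D x) \<and> D x (vx 0) = x \<and>
       D x (vx 1) = pick (A x) \<and> (\<exists>U\<in>\<U>. D x ` standard_simplex 1 \<subseteq> U)"
      using D[OF x] x by blast
  qed
  ultimately show ?thesis by (intro exI[of _ ?P] exI[of _ "\<lambda>x. pick (A x)"] exI[of _ D] conjI)
qed

lemma chords_exist:
  assumes \<U>: "open_cover X \<U>" "acyc_family X \<U>"
  shows "\<exists>\<kappa>. \<forall>p q. close \<U> p q \<longrightarrow> singular_simplex 1 X (\<kappa> p q) \<and> \<kappa> p q (vx 0) = p \<and> \<kappa> p q (vx 1) = q \<and>
     (\<exists>U\<in>\<U>. \<kappa> p q ` standard_simplex 1 \<subseteq> U)"
proof -
  have "\<exists>\<sigma>. singular_simplex 1 X \<sigma> \<and> \<sigma> (vx 0) = p \<and> \<sigma> (vx 1) = q \<and> (\<exists>U\<in>\<U>. \<sigma> ` standard_simplex 1 \<subseteq> U)"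
    if "close \<U> p q" for p q
  proof -
    obtain U where U: "U \<in> \<U>" "p \<in> U" "q \<in> U" using \<open>close \<U> p q\<close> unfolding close_def by blast
    have ac: "acyc (subtopology X U)" using U \<U>(2) by (simp add: acyc_family_def)
    have "U \<subseteq> topspace X" using U \<U>(1) openin_subset by (auto simp: open_cover_def)
    then have "p \<in> topspace (subtopology X U)" "q \<in> topspace (subtopology X U)" using U by auto
    from acyc_path[OF ac this] show ?thesis using U(1) unfolding singular_simplex_subtopology by metis
  qed
  then show ?thesis by metis
qed

subsection \<open>Cycles of $M$ bounding in $W$\<close>

text \<open>\<open>inj\<close> allows choices made on \<open>M\<close> to be copied to its image in
  \<open>W\<close>. By \<open>\<epsilon>\<theta>\<close> the reduced character is trivial, which
  makes the reduced complex the integral one.\<close>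

locale homology_equiv_top = homology_equiv W M i
  for W :: "'w topology" and M :: "'m topology" and i :: "'m \<Rightarrow> 'w" +
  fixes \<theta> :: "'w chain \<Rightarrow> 'r::idom" and \<epsilon> :: "'r \<Rightarrow> int"
  assumes W: "compact_space W" "Hausdorff_space W" "loc_acyc W"
    and M: "compact_space M" "Hausdorff_space M" "loc_acyc M"
    and inj: "inj_on i (topspace M)"
    and \<theta>: "char_sys W \<theta>"
    and \<epsilon>: "unital_ring_hom \<epsilon>"
    and \<epsilon>\<theta>: "\<And>c. singular_chain 1 W c \<Longrightarrow> \<epsilon> (\<theta> c) = 1"
begin

definition \<theta>M :: "'m chain \<Rightarrow> 'r" where "\<theta>M c = \<theta> (chain_map 1 i c)"

lemma \<theta>M: "char_sys M \<theta>M"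
  using char_sys_pullback[OF \<theta> cont] by (simp add: \<theta>M_def[abs_def])

lemma co: "compatible (\<lambda>x. x) M \<theta>M \<theta> i (\<lambda>_. 1)"
  using compatible_incl[of M \<theta> i] by (simp add: \<theta>M_def[abs_def])

text \<open>The nerve maps of \<open>M\<close> and \<open>W\<close> must commute with
  \<open>i\<close> on the nose, so that cone cycles go to cone cycles. The data of \<open>M\<close>
  are therefore chosen first and copied to the image of \<open>M\<close>, and the covers of
  \<open>M\<close> at levels 0 and 1 refine the preimages of those of \<open>W\<close>, so that
  copied paths stay small.\<close>

lemma nerves_exist:
  "\<exists>(\<U>0::'w set set) \<U>1 \<U>2 P c D \<kappa> (\<V>0::'m set set) \<V>1 \<V>2 P' c' D' \<kappa>'.
     nerve_data W \<theta> \<U>0 \<U>1 \<U>2 P c D \<kappa> \<and> nerve_data M \<theta>M \<V>0 \<V>1 \<V>2 P' c' D' \<kappa>' \<and>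
     open_cover W \<U>0 \<and> open_cover M \<V>0 \<and> finite P \<and> finite P' \<and>
     (\<forall>x\<in>topspace M. c (i x) = i (c' x) \<and> D (i x) = simplex_map 1 i (D' x)) \<and>
     (\<forall>p\<in>P'. \<forall>q\<in>P'. close \<V>1 p q \<longrightarrow> \<kappa> (i p) (i q) = simplex_map 1 i (\<kappa>' p q))"
proof -
  let ?pre = "(\<lambda>U. {x \<in> topspace M. i x \<in> U})"
  have "open_cover W {topspace W}" by (simp add: open_cover_def)
  from star_refinement[OF W this] obtain \<U>2 where U2: "open_cover W \<U>2" "acyc_family W \<U>2" by blast
  from star_refinement[OF W U2(1)] obtain \<U>1 where U1: "open_cover W \<U>1" "acyc_family W \<U>1" "star_refines \<U>1 \<U>2" by blast
  from star_refinement[OF W U1(1)] obtain \<U>0 where U0: "open_cover W \<U>0" "acyc_family W \<U>0" "star_refines \<U>0 \<U>1" by blast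
  have "open_cover M {topspace M}" by (simp add: open_cover_def)
  from star_refinement[OF M this] obtain \<V>2 where V2: "open_cover M \<V>2" "acyc_family M \<V>2" by blast
  \<comment> \<open>Intersecting with the preimage of \<open>\<U>\<close> before star refining makes
    the new members of \<open>M\<close> small in \<open>W\<close> as well.\<close>
  have step: "\<exists>\<V>'. open_cover M \<V>' \<and> acyc_family M \<V>' \<and> star_refines \<V>' \<V> \<and>
      (\<forall>V\<in>\<V>'. V \<noteq> {} \<longrightarrow> (\<exists>U\<in>\<U>. V \<subseteq> ?pre U))"
    if "open_cover M \<V>" "open_cover W \<U>" for \<V> \<U>
  proof -
    have "open_cover M (?pre ` \<U>)" by (rule open_cover_preimage[OF cont that(2)])
    from star_refinement[OF M open_cover_Int[OF that(1) this]] obtain \<V>' where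
      V': "open_cover M \<V>'" "acyc_family M \<V>'" "star_refines \<V>' {U \<inter> V |U V. U \<in> \<V> \<and> V \<in> ?pre ` \<U>}" by blast
    have "star_refines \<V>' \<V>" by (rule star_refines_mono[OF V'(3)]) blast
    moreover have "\<exists>U\<in>\<U>. V \<subseteq> ?pre U" if V: "V \<in> \<V>'" "V \<noteq> {}" for V
    proof -
      obtain x where x: "x \<in> V" using V by blast
      obtain Y where "Y \<in> {U \<inter> V |U V. U \<in> \<V> \<and> V \<in> ?pre ` \<U>}" "V \<subseteq> Y"
        by (rule star_refinesD[OF V'(3) V(1) x])
      then show ?thesis by blast
    qed
    ultimately show ?thesis using V'(1,2) by blast
  qed
  obtain \<V>1 where V1a: "open_cover M \<V>1 \<and> acyc_family M \<V>1 \<and> star_refines \<V>1 \<V>2 \<and>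
      (\<forall>V\<in>\<V>1. V \<noteq> {} \<longrightarrow> (\<exists>U\<in>\<U>1. V \<subseteq> ?pre U))"
    using step[OF V2(1) U1(1)] by (elim exE)
  then have V1: "open_cover M \<V>1" "acyc_family M \<V>1" "star_refines \<V>1 \<V>2"
    "\<And>V. V \<in> \<V>1 \<Longrightarrow> V \<noteq> {} \<Longrightarrow> \<exists>U\<in>\<U>1. V \<subseteq> ?pre U" by simp_all
  obtain \<V>0 where V0a: "open_cover M \<V>0 \<and> acyc_family M \<V>0 \<and> star_refines \<V>0 \<V>1 \<and>
      (\<forall>V\<in>\<V>0. V \<noteq> {} \<longrightarrow> (\<exists>U\<in>\<U>0. V \<subseteq> ?pre U))"
    using step[OF V1(1) U0(1)] by (elim exE)
  then have V0: "open_cover M \<V>0" "acyc_family M \<V>0" "star_refines \<V>0 \<V>1"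
    "\<And>V. V \<in> \<V>0 \<Longrightarrow> V \<noteq> {} \<Longrightarrow> \<exists>U\<in>\<U>0. V \<subseteq> ?pre U" by simp_all
  obtain P' c' D' where cM: "finite P'" "P' \<subseteq> topspace M" "\<And>x. x \<in> topspace M \<Longrightarrow> c' x \<in> P' \<and> singular_simplex 1 M (D' x) \<and>
     D' x (vx 0) = x \<and> D' x (vx 1) = c' x \<and> (\<exists>U\<in>\<V>0. D' x ` standard_simplex 1 \<subseteq> U)"
    using centres_exist[OF M(1) V0(1,2)] by (elim exE conjE) blast
  obtain \<kappa>' where kM: "\<And>p q. close \<V>1 p q \<Longrightarrow> singular_simplex 1 M (\<kappa>' p q) \<and> \<kappa>' p q (vx 0) = p \<and> \<kappa>' p q (vx 1) = q \<and>
     (\<exists>U\<in>\<V>1. \<kappa>' p q ` standard_simplex 1 \<subseteq> U)"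
    using chords_exist[OF V1(1,2)] by metis
  obtain P1 c1 D1 where cW: "finite P1" "\<And>x. x \<in> topspace W \<Longrightarrow> c1 x \<in> P1 \<and> singular_simplex 1 W (D1 x) \<and>
     D1 x (vx 0) = x \<and> D1 x (vx 1) = c1 x \<and> (\<exists>U\<in>\<U>0. D1 x ` standard_simplex 1 \<subseteq> U)"
    using centres_exist[OF W(1) U0(1,2)] by (elim exE conjE) blast
  obtain \<kappa>1 where kW: "\<And>p q. close \<U>1 p q \<Longrightarrow> singular_simplex 1 W (\<kappa>1 p q) \<and> \<kappa>1 p q (vx 0) = p \<and> \<kappa>1 p q (vx 1) = q \<and>
     (\<exists>U\<in>\<U>1. \<kappa>1 p q ` standard_simplex 1 \<subseteq> U)"
    using chords_exist[OF U1(1,2)] by metis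
  define j where "j = inv_into (topspace M) i"
  have ji: "j (i x) = x" if "x \<in> topspace M" for x using inj that by (simp add: j_def)
  let ?I = "i ` topspace M"
  define c where "c w = (if w \<in> ?I then i (c' (j w)) else c1 w)" for w
  define D where "D w = (if w \<in> ?I then simplex_map 1 i (D' (j w)) else D1 w)" for w
  \<comment> \<open>Centres of \<open>M\<close> can be close in \<open>W\<close> without being close
    in \<open>M\<close>; then there is no chord of \<open>M\<close> to copy, and the chord chosen in
    \<open>W\<close> is kept.\<close>
  define \<kappa> where "\<kappa> p q = (if p \<in> i ` P' \<and> q \<in> i ` P' \<and> close \<V>1 (j p) (j q) then simplex_map 1 i (\<kappa>' (j p) (j q)) else \<kappa>1 p q)" for p q
  have ss: "singular_simplex 1 W (simplex_map 1 i \<sigma>)" if "singular_simplex 1 M \<sigma>" for \<sigma>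
    using singular_simplex_simplex_map[OF that cont] .
  have sub: "\<exists>U\<in>\<U>. simplex_map 1 i \<sigma> ` standard_simplex 1 \<subseteq> U"
    if inV: "\<exists>V\<in>\<V>. \<sigma> ` standard_simplex 1 \<subseteq> V" and ref: "\<And>V. V \<in> \<V> \<Longrightarrow> V \<noteq> {} \<Longrightarrow> \<exists>U\<in>\<U>. V \<subseteq> ?pre U" for \<sigma> \<V> and \<U> :: "'w set set"
  proof -
    obtain V where V: "V \<in> \<V>" "\<sigma> ` standard_simplex 1 \<subseteq> V" using inV by blast
    then have "V \<noteq> {}" using nonempty_standard_simplex by blast
    then obtain U where "U \<in> \<U>" "V \<subseteq> ?pre U" using ref[OF V(1)] by blast
    then show ?thesis using V(2) by (intro bexI[of _ U]) (auto simp: simplex_map_def)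
  qed
  have nW: "nerve_data W \<theta> \<U>0 \<U>1 \<U>2 (i ` P' \<union> P1) c D \<kappa>"
  proof
    show "char_sys W \<theta>" by (rule \<theta>)
    show "acyc_family W \<U>2" "star_refines \<U>0 \<U>1" "star_refines \<U>1 \<U>2" by fact+
    fix w assume w: "w \<in> topspace W"
    show "c w \<in> i ` P' \<union> P1" using cM(3) cW(2)[OF w] ji by (auto simp: c_def)
    show "singular_simplex 1 W (D w)" using cM(3) cW(2)[OF w] ji ss by (auto simp: D_def)
    show "D w (vx 0) = w" using cM(3) cW(2)[OF w] ji by (auto simp: D_def)
    show "D w (vx 1) = c w" using cM(3) cW(2)[OF w] ji by (auto simp: D_def c_def)
    show "\<exists>U\<in>\<U>0. D w ` standard_simplex 1 \<subseteq> U"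
    proof (cases "w \<in> ?I")
      case True
      then obtain x where x: "x \<in> topspace M" "w = i x" by blast
      then have "\<exists>V\<in>\<V>0. D' x ` standard_simplex 1 \<subseteq> V" using cM(3) by blast
      from sub[OF this V0(4)] show ?thesis using x ji by (simp add: D_def)
    next
      case False then show ?thesis using cW(2)[OF w] by (simp add: D_def)
    qed
  next
    fix p q assume cl: "close \<U>1 p q"
    show "singular_simplex 1 W (\<kappa> p q)" using kW[OF cl] kM ss by (auto simp: \<kappa>_def)
    have jp: "i (j p) = p" if "p \<in> i ` P'" for p using that cM(2) ji by auto
    show "\<kappa> p q (vx 0) = p" "\<kappa> p q (vx 1) = q" using kW[OF cl] kM[of "j p" "j q"] jp by (auto simp: \<kappa>_def)
    show "\<exists>U\<in>\<U>1. \<kappa> p q ` standard_simplex 1 \<subseteq> U"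
    proof (cases "p \<in> i ` P' \<and> q \<in> i ` P' \<and> close \<V>1 (j p) (j q)")
      case True
      then have "\<exists>V\<in>\<V>1. \<kappa>' (j p) (j q) ` standard_simplex 1 \<subseteq> V" using kM by blast
      from sub[OF this V1(4)] show ?thesis unfolding \<kappa>_def using True by simp
    next
      case False
      then have "\<kappa> p q = \<kappa>1 p q" unfolding \<kappa>_def by (rule if_not_P)
      then show ?thesis using kW[OF cl] by simp
    qed
  qed
  have nM: "nerve_data M \<theta>M \<V>0 \<V>1 \<V>2 P' c' D' \<kappa>'"
    by unfold_locales (use \<theta>M V2(2) V0(3) V1(3) cM(3) kM in auto)
  have "\<forall>x\<in>topspace M. c (i x) = i (c' x) \<and> D (i x) = simplex_map 1 i (D' x)"
    using ji by (auto simp: c_def D_def)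
  moreover have "\<forall>p\<in>P'. \<forall>q\<in>P'. close \<V>1 p q \<longrightarrow> \<kappa> (i p) (i q) = simplex_map 1 i (\<kappa>' p q)"
    using ji cM(2) by (auto simp: \<kappa>_def subset_iff)
  moreover have "finite (i ` P' \<union> P1)" using cM(1) cW(1) by simp
  ultimately show ?thesis using nW nM U0(1) V0(1) cM(1) by blast
qed

section \<open>Operators on relative 2-cycles that preserve the class of the component in
  \<open>M\<close>\<close>

definition bdry1 :: "('m, 'r) twchain \<Rightarrow> bool" where
  "bdry1 x \<longleftrightarrow> (\<exists>d. tch 2 M d \<and> tbd \<theta>M 2 d = x)"

lemma bdry1_add: "bdry1 x \<Longrightarrow> bdry1 y \<Longrightarrow> bdry1 (x + y)"
  unfolding bdry1_def by (metis keys_subset_add tbd_simps(1))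
lemma bdry1_scale: "bdry1 x \<Longrightarrow> bdry1 (scale r x)"
  unfolding bdry1_def by (metis keys_subset_scale tbd_simps(5))
lemma bdry1_0: "bdry1 0"
  unfolding bdry1_def by (intro exI[of _ 0]) (simp add: tbd_simps)
lemma bdry1_sum: "(\<And>a. a \<in> A \<Longrightarrow> bdry1 (f a)) \<Longrightarrow> bdry1 (sum f A)"
  by (induction A rule: infinite_finite_induct) (auto simp: bdry1_0 bdry1_add)

abbreviation "dR \<equiv> cone_d \<theta> \<theta>M i"

definition cyc2 :: "('w simplex + 'm simplex \<Rightarrow>\<^sub>0 'r) \<Rightarrow> bool" where
  "cyc2 c \<longleftrightarrow> ks c \<subseteq> B 2 \<and> tbd \<theta> 2 (prl c) = incl 1 i (prr c) \<and> tbd \<theta>M 1 (prr c) = 0"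

lemma tch_pr: assumes "ks c \<subseteq> B 2" shows "tch 2 W (prl c)" "tch 1 M (prr c)"
  using cone_basisD[OF assms] by (auto simp: One_nat_def)

lemma cyc2_d: "cyc2 c \<Longrightarrow> lin (dR 2) c = 0"
  unfolding cyc2_def lin_cone_d by (simp add: in_simps One_nat_def)

lemma incl_tbd: "1 \<le> p \<Longrightarrow> tch p M y \<Longrightarrow> tbd \<theta> p (incl p i y) = incl (p - 1) i (tbd \<theta>M p y)"
  by (rule tbd_push[OF urh_id _ _ co])

text \<open>On cone cycles \<open>N\<close> subtracts the cone boundary of a 3-chain. Its component
  in \<open>M\<close> is minus the boundary of a 2-chain of \<open>M\<close>, so the class of the
  cycle of \<open>M\<close> is unchanged.\<close>

lemma contraction_operator:
  "\<exists>N. (\<forall>b\<in>B 2. ks (N b) \<subseteq> B 2 \<and> (\<forall>k. \<epsilon> (lk (N b) k) = 0)) \<and>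
     (\<forall>c. cyc2 c \<longrightarrow> cyc2 (lin N c) \<and> bdry1 (prr c - prr (lin N c)))"
proof -
  have e: "\<epsilon> (\<theta> (frag_of (edge \<sigma>))) = 1" if "singular_simplex p W \<sigma>" "1 \<le> p" for p \<sigma>
    using \<epsilon>\<theta>[of "frag_of (edge \<sigma>)"] singular_simplex_edge[OF that] by (simp add: singular_chain_of)
  have eM: "\<epsilon> (\<theta>M (frag_of (edge \<sigma>))) = 1" if "singular_simplex p M \<sigma>" "1 \<le> p" for p \<sigma>
  proof -
    have "singular_chain 1 W (chain_map 1 i (frag_of (edge \<sigma>)))"
      using singular_simplex_edge[OF that] by (intro singular_chain_chain_map[OF _ cont]) (simp add: singular_chain_of)
    then show ?thesis using \<epsilon>\<theta> by (simp add: \<theta>M_def)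
  qed
  have pw: "\<epsilon> ((-1) ^ k) = (-1) ^ k" for k
    by (induction k) (auto simp: urh_simps[OF \<epsilon>])
  \<comment> \<open>Once the first edge has weight 1 under \<open>\<epsilon>\<close>, twisted faces
    reduce to ordinary ones.\<close>
  have tf: "lext \<epsilon> (\<lambda>a. sg a 1) (tface \<eta> p \<sigma>) = tface (\<lambda>_. 1) p \<sigma>" if "\<epsilon> (\<eta> (frag_of (edge \<sigma>))) = 1"
    for \<eta> :: "'x chain \<Rightarrow> 'r" and p \<sigma>
    unfolding tface_def lext_sum[OF \<epsilon>] lext_single[OF \<epsilon>] using that
    by (intro sum.cong) (auto simp: urh_simps[OF \<epsilon>] pw)
  have red_in: "lext \<epsilon> (\<lambda>a. sg a 1) (inl x) = inl (lext \<epsilon> (\<lambda>a. sg a 1) x)"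
    "lext \<epsilon> (\<lambda>a. sg a 1) (inr y) = inr (lext \<epsilon> (\<lambda>a. sg a 1) y)"
    for x :: "('w, 'r) twchain" and y :: "('m, 'r) twchain"
    unfolding inl_def inr_def lext_lext[OF \<epsilon>] lin_lext
    by (simp_all add: lext_single[OF \<epsilon>] urh_simps[OF \<epsilon>] lin_simps)
  have ksd: "ks (dR p b) \<subseteq> B (p - 1)" if p: "1 \<le> p" and b: "b \<in> B p" for p b
  proof (cases b)
    case (Inl \<sigma>)
    then have "singular_simplex p W \<sigma>" using b by (auto simp: cone_basis_def split: if_splits)
    then have "tch (p - 1) W (tface \<theta> p \<sigma>)" using tch_tface p by blast
    then have "ks (inl (tface \<theta> p \<sigma>)) \<subseteq> Inl ` singular_simplex_set (p - 1) W"
      using order_trans[OF keys_in(1) image_mono] by blast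
    then show ?thesis using Inl by (auto simp: cone_d_def cone_basis_def)
  next
    case (Inr \<tau>)
    then have \<tau>: "singular_simplex (p - 1) M \<tau>" using b by (auto simp: cone_basis_def split: if_splits)
    have 1: "ks (inl (sg (simplex_map (p - 1) i \<tau>) (1::'r))) \<subseteq> B (p - 1)"
      using singular_simplex_simplex_map[OF \<tau> cont] by (auto simp: in_single cone_basis_def)
    show ?thesis
    proof (cases "p = 1")
      case True then show ?thesis using 1 Inr by (simp add: cone_d_def keys_uminus)
    next
      case False
      then have "1 \<le> p - 1" using p by simp
      then have "tch (p - 1 - 1) M (tface \<theta>M (p - 1) \<tau>)" by (rule tch_tface[OF \<tau>])
      then have "ks (inr (tface \<theta>M (p - 1) \<tau>)) \<subseteq> Inr ` singular_simplex_set (p - 1 - 1) M"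
        using order_trans[OF keys_in(2) image_mono] by blast
      then have "ks (inr (tface \<theta>M (p - 1) \<tau>)) \<subseteq> B (p - 1)"
        using False p by (auto simp: cone_basis_def)
      then have "ks (- inl (sg (simplex_map (p - 1) i \<tau>) 1) - inr (tface \<theta>M (p - 1) \<tau>)) \<subseteq> B (p - 1)"
        using 1 by (intro keys_subset_diff) (simp_all add: keys_uminus)
      then show ?thesis using False Inr by (simp add: cone_d_def)
    qed
  qed
  have red: "lext \<epsilon> (\<lambda>a. sg a 1) (dR p b) = dz p b" if p: "1 \<le> p" and b: "b \<in> B p" for p b
  proof (cases b)
    case (Inl \<sigma>)
    then have "singular_simplex p W \<sigma>" using b by (auto simp: cone_basis_def split: if_splits)
    then show ?thesis using Inl tf[of \<theta> \<sigma> p] e p by (simp add: cone_d_def red_in)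
  next
    case (Inr \<tau>)
    then have "singular_simplex (p - 1) M \<tau>" using b by (auto simp: cone_basis_def split: if_splits)
    then have "p \<noteq> 1 \<Longrightarrow> \<epsilon> (\<theta>M (frag_of (edge \<tau>))) = 1" using p by (intro eM[of "p - 1"]) auto
    then show ?thesis using Inr tf[of \<theta>M \<tau> "p - 1"]
      by (simp add: cone_d_def lext_diff[OF \<epsilon>] lext_minus[OF \<epsilon>] red_in lext_single[OF \<epsilon>] urh_simps[OF \<epsilon>])
  qed
  have ex1: "\<exists>c'. ks c' \<subseteq> B 2 \<and> lin (dz 2) c' = c" if "ks c \<subseteq> B 1" "lin (dz 1) c = 0" for c
    using exact1[OF that] by (simp add: One_nat_def numeral_2_eq_2)
  have ex2: "\<exists>c'. ks c' \<subseteq> B 3 \<and> lin (dz 3) c' = c" if "ks c \<subseteq> B 2" "lin (dz 2) c = 0" for c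
    using exact1[OF that] by (simp add: One_nat_def numeral_2_eq_2 numeral_3_eq_3)
  obtain N s where Ns: "\<And>b. b \<in> B 2 \<Longrightarrow> ks (N b) \<subseteq> B 2 \<and> (\<forall>k. \<epsilon> (lk (N b) k) = 0) \<and> ks (s b) \<subseteq> B 3 \<and>
     (\<forall>c. ks c \<subseteq> B 2 \<longrightarrow> lin (dR 2) c = 0 \<longrightarrow> lin N c = c - lin (dR 3) (lin s c))"
    using contraction_lift[OF \<epsilon>, of B dR dz, OF ksd red exact0 ex1 ex2 dd_int] by blast
  have "cyc2 (lin N c) \<and> bdry1 (prr c - prr (lin N c))" if c: "cyc2 c" for c
  proof (cases "c = 0")
    case True then show ?thesis using c by (simp add: bdry1_0 in_simps)
  next
    case False
    \<comment> \<open>The identity for \<open>N\<close> is available only together with some basis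
      element \<open>b\<close>; a nonzero \<open>c\<close> supplies one.\<close>
    then obtain b where "b \<in> ks c" by fastforce
    then have b: "b \<in> B 2" using c by (auto simp: cyc2_def)
    have kc: "ks c \<subseteq> B 2" using c by (simp add: cyc2_def)
    then have ksN: "ks (lin N c) \<subseteq> B 2" "ks (lin s c) \<subseteq> B 3" using Ns by (intro keys_lext; blast)+
    let ?u = "prl (lin s c)" and ?y = "prr (lin s c)"
    have uy: "tch 3 W ?u" "tch 2 M ?y" using cone_basisD[OF ksN(2)] by (auto simp: One_nat_def numeral_2_eq_2 numeral_3_eq_3)
    have N: "lin N c = c - lin (dR 3) (lin s c)" using Ns[OF b] kc cyc2_d[OF c] by blast
    have d3: "lin (dR 3) (lin s c) = inl (tbd \<theta> 3 ?u - incl 2 i ?y) - inr (tbd \<theta>M 2 ?y)"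
      by (simp add: lin_cone_d)
    have l: "prl (lin N c) = prl c - (tbd \<theta> 3 ?u - incl 2 i ?y)" and r: "prr (lin N c) = prr c + tbd \<theta>M 2 ?y"
      unfolding N d3 by (simp_all add: in_simps pr_in)
    have dd: "tbd \<theta> 2 (tbd \<theta> 3 ?u) = 0" "tbd \<theta>M 1 (tbd \<theta>M 2 ?y) = 0"
      using tbd_tbd[OF \<theta> uy(1)] tbd_tbd[OF \<theta>M uy(2)] by (simp_all add: One_nat_def)
    have "tbd \<theta> 2 (incl 2 i ?y) = incl 1 i (tbd \<theta>M 2 ?y)" using incl_tbd[OF _ uy(2)] by (simp add: One_nat_def)
    then have "cyc2 (lin N c)"
      using c ksN dd unfolding cyc2_def l r by (simp add: tbd_simps incl_simps)
    moreover have "prr c - prr (lin N c) = tbd \<theta>M 2 (- ?y)" unfolding r by (simp add: tbd_simps)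
    then have "bdry1 (prr c - prr (lin N c))" using uy(2) unfolding bdry1_def by (metis keys_uminus)
    ultimately show ?thesis by blast
  qed
  then show ?thesis using Ns by blast
qed

definition sub2 :: "('w simplex + 'm simplex \<Rightarrow>\<^sub>0 'r) \<Rightarrow> ('w simplex + 'm simplex \<Rightarrow>\<^sub>0 'r)" where
  "sub2 c = inl (sdiv \<theta> 2 (prl c)) + inr (sdiv \<theta>M 1 (prr c))"

lemma lmap_sub2: "lmap sub2"
  unfolding lmap_def sub2_def by (simp add: in_simps sdiv_simps scale_add add_ac)

lemma sub2_pow: "prl ((sub2 ^^ n) c) = (sdiv \<theta> 2 ^^ n) (prl c)" "prr ((sub2 ^^ n) c) = (sdiv \<theta>M 1 ^^ n) (prr c)"
  by (induction n) (simp_all add: sub2_def in_simps pr_in)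

lemma keys_sub2: "ks c \<subseteq> B 2 \<Longrightarrow> ks (sub2 c) \<subseteq> B 2"
  unfolding sub2_def using tch_sdiv[OF tch_pr(1)[of c]] tch_sdiv[OF tch_pr(2)[of c]]
  by (intro cone_basisI) (simp_all add: One_nat_def)

lemma keys_sub2_pow: "ks c \<subseteq> B 2 \<Longrightarrow> ks ((sub2 ^^ n) c) \<subseteq> B 2"
  by (induction n) (simp_all add: keys_sub2)

text \<open>Naturality of subdivision under \<open>i\<close> keeps the two components matched, and
  \<open>sdiv_homotopy\<close> bounds the change of the component in \<open>M\<close>.\<close>

lemma cyc2_sub2:
  assumes c: "cyc2 c" shows "cyc2 (sub2 c) \<and> bdry1 (prr c - prr (sub2 c))"
proof -
  have t: "tch 2 W (prl c)" "tch 1 M (prr c)" using c tch_pr[of c] by (auto simp: cyc2_def)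
  have "tbd \<theta> 2 (sdiv \<theta> 2 (prl c)) = sdiv \<theta> 1 (incl 1 i (prr c))"
    using tbd_sdiv[OF \<theta> t(1)] c by (simp add: cyc2_def One_nat_def)
  also have "\<dots> = incl 1 i (sdiv \<theta>M 1 (prr c))" by (rule sdiv_push[OF urh_id t(2) co])
  finally have "cyc2 (sub2 c)"
    using c keys_sub2[of c] tbd_sdiv[OF \<theta>M t(2)] by (simp add: cyc2_def sub2_def in_simps pr_in sdiv_simps)
  moreover have "bdry1 (prr c - prr (sub2 c))"
    using sdiv_homotopy[OF \<theta>M t(2)] by (simp add: bdry1_def sub2_def in_simps pr_in)
  ultimately show ?thesis by blast
qed

lemma cyc2_sub2_pow: "cyc2 c \<Longrightarrow> cyc2 ((sub2 ^^ n) c) \<and> bdry1 (prr c - prr ((sub2 ^^ n) c))"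
proof (induction n)
  case (Suc n)
  then have "cyc2 ((sub2 ^^ n) c)" and 1: "bdry1 (prr c - prr ((sub2 ^^ n) c))" by auto
  then have 2: "cyc2 (sub2 ((sub2 ^^ n) c))" "bdry1 (prr ((sub2 ^^ n) c) - prr (sub2 ((sub2 ^^ n) c)))"
    using cyc2_sub2 by auto
  then show ?case using bdry1_add[OF 1 2(2)] by simp
qed (simp add: bdry1_0)

definition small2 where
  "small2 \<U> \<V> c \<longleftrightarrow> small 2 \<U> (prl c) \<and> small 1 \<V> (prr c)"

lemma sub2_small:
  assumes "ks c \<subseteq> B 2" "open_cover W \<U>" "open_cover M \<V>"
  shows "\<exists>n. \<forall>m\<ge>n. small2 \<U> \<V> ((sub2 ^^ m) c)"
proof -
  obtain n1 where "\<forall>m\<ge>n1. small 2 \<U> ((sdiv \<theta> 2 ^^ m) (prl c))"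
    using sdiv_small[OF \<theta> tch_pr(1)[OF assms(1)], of \<U>] assms(2) by (auto simp: open_cover_def)
  moreover obtain n2 where "\<forall>m\<ge>n2. small 1 \<V> ((sdiv \<theta>M 1 ^^ m) (prr c))"
    using sdiv_small[OF \<theta>M tch_pr(2)[OF assms(1)], of \<V>] assms(3) by (auto simp: open_cover_def)
  ultimately show ?thesis unfolding small2_def sub2_pow by (intro exI[of _ "max n1 n2"]) auto
qed

text \<open>The identity on classes factors through a finitely generated free module: replace a small simplex
  by the combinatorial data of its vertices in the nerve.\<close>

lemma finite_domination:
  "\<exists>(J :: ('w \<times> 'w \<times> 'w + 'm \<times> 'm) set) ev Q \<U> \<V>. finite J \<and> open_cover W \<U> \<and> open_cover M \<V> \<and>
     (\<forall>j\<in>J. ks (ev j) \<subseteq> B 2) \<and>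
     (\<forall>c. ks c \<subseteq> B 2 \<longrightarrow> small2 \<U> \<V> c \<longrightarrow> ks (lin Q c) \<subseteq> J) \<and>
     (\<forall>c. cyc2 c \<longrightarrow> small2 \<U> \<V> c \<longrightarrow> cyc2 (lin ev (lin Q c)) \<and> bdry1 (prr c - prr (lin ev (lin Q c))))"
proof -
  obtain \<U>0 \<U>1 \<U>2 P c D \<kappa> \<V>0 \<V>1 \<V>2 P' c' D' \<kappa>' where *:
    "nerve_data W \<theta> \<U>0 \<U>1 \<U>2 P c D \<kappa> \<and> nerve_data M \<theta>M \<V>0 \<V>1 \<V>2 P' c' D' \<kappa>' \<and>
     open_cover W \<U>0 \<and> open_cover M \<V>0 \<and> finite P \<and> finite P' \<and>
     (\<forall>x\<in>topspace M. c (i x) = i (c' x) \<and> D (i x) = simplex_map 1 i (D' x)) \<and>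
     (\<forall>p\<in>P'. \<forall>q\<in>P'. close \<V>1 p q \<longrightarrow> \<kappa> (i p) (i q) = simplex_map 1 i (\<kappa>' p q))"
    using nerves_exist by (elim exE)
  then interpret nW: nerve_data W \<theta> \<U>0 \<U>1 \<U>2 P c D \<kappa> by blast
  from * interpret nM: nerve_data M \<theta>M \<V>0 \<V>1 \<V>2 P' c' D' \<kappa>' by blast
  have oc: "open_cover W \<U>0" "open_cover M \<V>0" and fin: "finite P" "finite P'"
    and ci: "\<And>x. x \<in> topspace M \<Longrightarrow> c (i x) = i (c' x)" "\<And>x. x \<in> topspace M \<Longrightarrow> D (i x) = simplex_map 1 i (D' x)"
    and \<kappa>i: "\<And>p q. p \<in> P' \<Longrightarrow> q \<in> P' \<Longrightarrow> close \<V>1 p q \<Longrightarrow> \<kappa> (i p) (i q) = simplex_map 1 i (\<kappa>' p q)"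
    using * by auto
  define J where "J = Inl ` {(p,q,r). p \<in> P \<and> q \<in> P \<and> r \<in> P \<and> close3 \<U>1 p q r} \<union>
     Inr ` {(p,q). p \<in> P' \<and> q \<in> P' \<and> close \<V>1 p q}"
  have "finite J"
  proof -
    have "J \<subseteq> Inl ` (P \<times> P \<times> P) \<union> Inr ` (P' \<times> P')" by (auto simp: J_def)
    then show ?thesis using fin by (meson finite_SigmaI finite_UnI finite_imageI finite_subset)
  qed
  \<comment> \<open>\<open>ev\<close> realises a combinatorial simplex by its chosen filling or
    chord; \<open>Q\<close> below reads off the centres of the vertices, with the weight of the
    first vertex. The composite is thus \<open>q2\<close> on \<open>W\<close> and \<open>q1\<close>
    on \<open>M\<close>.\<close>
  define ev :: "'w \<times> 'w \<times> 'w + 'm \<times> 'm \<Rightarrow> ('w simplex + 'm simplex \<Rightarrow>\<^sub>0 'r)" where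
    "ev = case_sum (\<lambda>(p,q,r). inl (nW.K p q r)) (\<lambda>(p,q). inr (sg (\<kappa>' p q) 1))"
  define Q :: "'w simplex + 'm simplex \<Rightarrow> ('w \<times> 'w \<times> 'w + 'm \<times> 'm \<Rightarrow>\<^sub>0 'r)" where
    "Q = case_sum (\<lambda>\<sigma>. sg (Inl (c (\<sigma> (vx 0)), c (\<sigma> (vx 1)), c (\<sigma> (vx 2)))) (\<theta> (frag_of (D (\<sigma> (vx 0))))))
       (\<lambda>\<tau>. sg (Inr (c' (\<tau> (vx 0)), c' (\<tau> (vx 1)))) (\<theta>M (frag_of (D' (\<tau> (vx 0))))))"
  have 1: "ks (ev j) \<subseteq> B 2" if j: "j \<in> J" for j
  proof (cases j)
    case (Inl t)
    then obtain p q r where t: "t = (p,q,r)" "p \<in> P" "q \<in> P" "r \<in> P" "close3 \<U>1 p q r"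
      using j by (auto simp: J_def)
    have "ks (inl (nW.K p q r)) \<subseteq> Inl ` singular_simplex_set 2 W"
      using nW.K(1)[OF t(2-5)] order_trans[OF keys_in(1) image_mono] by blast
    then show ?thesis using Inl t by (auto simp: ev_def cone_basis_def)
  next
    case (Inr t)
    then obtain p q where t: "t = (p,q)" "p \<in> P'" "q \<in> P'" "close \<V>1 p q"
      using j by (auto simp: J_def)
    then show ?thesis using Inr nM.\<kappa>(1) by (auto simp: ev_def in_single cone_basis_def One_nat_def)
  qed
  have 2: "ks (lin Q e) \<subseteq> J" if e: "ks e \<subseteq> B 2" "small2 \<U>0 \<V>0 e" for e
  proof (rule keys_lext)
    fix b assume b: "b \<in> ks e"
    show "ks (Q b) \<subseteq> J"
    proof (cases b)
      case (Inl \<sigma>)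
      have "\<sigma> \<in> ks (prl e)"
        using b Inl keys_prI(1)[of \<sigma> e] by simp
      then have \<sigma>: "singular_simplex 2 W \<sigma>" "\<exists>U\<in>\<U>0. \<sigma> ` standard_simplex 2 \<subseteq> U"
        using e tch_pr(1)[OF e(1)] by (auto simp: small2_def small_def)
      have "c (\<sigma> (vx k)) \<in> P" if "k \<le> 2" for k using nW.cP[OF singular_simplex_vx[OF \<sigma>(1) that]] .
      moreover have "close3 \<U>1 (c (\<sigma> (vx 0))) (c (\<sigma> (vx 1))) (c (\<sigma> (vx 2)))"
        using nW.close_c(2)[OF \<sigma>, of 0 1 2] by simp
      ultimately show ?thesis using Inl by (auto simp: Q_def J_def)
    next
      case (Inr \<tau>)
      have "\<tau> \<in> ks (prr e)"
        using b Inr keys_prI(2)[of \<tau> e] by simp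
      then have \<tau>: "singular_simplex 1 M \<tau>" "\<exists>U\<in>\<V>0. \<tau> ` standard_simplex 1 \<subseteq> U"
        using e tch_pr(2)[OF e(1)] by (auto simp: small2_def small_def)
      have "c' (\<tau> (vx k)) \<in> P'" if "k \<le> 1" for k using nM.cP[OF singular_simplex_vx[OF \<tau>(1) that]] .
      moreover have "close \<V>1 (c' (\<tau> (vx 0))) (c' (\<tau> (vx 1)))"
        using nM.close_c(1)[OF \<tau>, of 0 1] by simp
      ultimately show ?thesis using Inr by (auto simp: Q_def J_def)
    qed
  qed
  have 3: "cyc2 (lin ev (lin Q e)) \<and> bdry1 (prr e - prr (lin ev (lin Q e)))"
    if e: "cyc2 e" "small2 \<U>0 \<V>0 e" for e
  proof -
    let ?w = "prl e" and ?z = "prr e"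
    have t: "tch 2 W ?w" "tch 1 M ?z" using e(1) tch_pr[of e] by (auto simp: cyc2_def)
    have sm: "small 2 \<U>0 ?w" "small 1 \<V>0 ?z" using e(2) by (auto simp: small2_def)
    have evQ: "lin ev (lin Q e) = inl (lin nW.q2 ?w) + inr (lin nM.q1 ?z)"
    proof -
      have "lin ev (lin Q e) = lin (\<lambda>\<sigma>. inl (nW.q2 \<sigma>)) ?w + lin (\<lambda>\<tau>. inr (nM.q1 \<tau>)) ?z"
        unfolding lin_lext lin_split[of "\<lambda>b. lin ev (Q b)" e]
        by (simp add: Q_def ev_def lin_simps nW.q2_def nM.q1_def in_simps in_single)
      then show ?thesis unfolding inl_def inr_def lin_lext .
    qed
    \<comment> \<open>This is where the data of \<open>W\<close> must restrict to those of
      \<open>M\<close>: it makes the nerve map of \<open>W\<close> on the image of an edge equal to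
      the image of the nerve map of \<open>M\<close>.\<close>
    have q: "nW.q1 (simplex_map 1 i \<tau>) = incl 1 i (nM.q1 \<tau>)" if "\<tau> \<in> ks ?z" for \<tau>
    proof -
      have \<tau>: "singular_simplex 1 M \<tau>" "\<exists>U\<in>\<V>0. \<tau> ` standard_simplex 1 \<subseteq> U"
        using that t(2) sm(2) by (auto simp: small_def)
      have v: "\<tau> (vx 0) \<in> topspace M" "\<tau> (vx 1) \<in> topspace M" using singular_simplex_vx[OF \<tau>(1)] by auto
      have "close \<V>1 (c' (\<tau> (vx 0))) (c' (\<tau> (vx 1)))" using nM.close_c(1)[OF \<tau>, of 0 1] by simp
      then have "\<kappa> (i (c' (\<tau> (vx 0)))) (i (c' (\<tau> (vx 1)))) = simplex_map 1 i (\<kappa>' (c' (\<tau> (vx 0))) (c' (\<tau> (vx 1))))"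
        using \<kappa>i nM.cP v by blast
      then show ?thesis
        unfolding nW.q1_def nM.q1_def using ci v
        by (simp add: push_simps[OF urh_id] \<theta>M_def)
    qed
    have "tbd \<theta> 2 (lin nW.q2 ?w) = lin nW.q1 (incl 1 i ?z)"
      using nW.tbd_q2[OF t(1) sm(1)] e(1) by (simp add: cyc2_def)
    also have "\<dots> = lin (\<lambda>\<tau>. incl 1 i (nM.q1 \<tau>)) ?z"
      unfolding push_def[of _ 1 i] lin_lext
      by (rule lext_cong) (simp add: lin_simps q[unfolded push_def])
    also have "\<dots> = incl 1 i (lin nM.q1 ?z)" by (rule push_lext[OF urh_id, symmetric])
    finally have d: "tbd \<theta> 2 (lin nW.q2 ?w) = incl 1 i (lin nM.q1 ?z)" .
    have z0: "tbd \<theta>M 1 ?z = 0" using e(1) by (simp add: cyc2_def)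
    have "ks (lin ev (lin Q e)) \<subseteq> B 2"
      using 1 2[of e] e by (intro keys_lext) (auto simp: cyc2_def)
    then have "cyc2 (lin ev (lin Q e))"
      using d nM.tbd_q1[OF t(2) sm(2)] z0 unfolding cyc2_def evQ by (simp add: in_simps pr_in)
    moreover have "bdry1 (prr e - prr (lin ev (lin Q e)))"
      using nM.q1_homologous[OF t(2) sm(2) z0] unfolding bdry1_def evQ by (simp add: in_simps pr_in)
    ultimately show ?thesis by blast
  qed
  show ?thesis using \<open>finite J\<close> oc 1 2 3 by blast
qed

lemma small2_lin:
  assumes "\<And>j. j \<in> ks x \<Longrightarrow> small2 \<U> \<V> (F j)"
  shows "small2 \<U> \<V> (lin F x)"
proof -
  have "small 2 \<U> (lin (\<lambda>j. prl (F j)) x)" "small 1 \<V> (lin (\<lambda>j. prr (F j)) x)"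
    using assms by (auto simp: small2_def intro!: small_lin)
  then show ?thesis unfolding small2_def prl_def prr_def lin_lext by simp
qed

text \<open>The operator \<open>T\<close> on a finitely generated free module does not change the
  class represented in \<open>M\<close>. Applying the vanishing polynomial in \<open>T\<close> to
  the vector representing \<open>z\<close> thus gives the sum of the coefficients of
  \<open>p\<close> times the class of \<open>z\<close>, and this sum is
  \<open>poly p 1\<close>.\<close>

theorem torsion_kernel:
  assumes z: "tch 1 M z" "tbd \<theta>M 1 z = 0" and w: "tch 2 W w" "tbd \<theta> 2 w = incl 1 i z"
  shows "\<exists>r. r \<noteq> 0 \<and> bdry1 (scale r z)"
proof -
  obtain J :: "('w \<times> 'w \<times> 'w + 'm \<times> 'm) set" and ev Q \<U> \<V> where *: "finite J \<and> open_cover W \<U> \<and> open_cover M \<V> \<and>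
     (\<forall>j\<in>J. ks (ev j) \<subseteq> B 2) \<and>
     (\<forall>c. ks c \<subseteq> B 2 \<longrightarrow> small2 \<U> \<V> c \<longrightarrow> ks (lin Q c) \<subseteq> J) \<and>
     (\<forall>c. cyc2 c \<longrightarrow> small2 \<U> \<V> c \<longrightarrow> cyc2 (lin ev (lin Q c)) \<and> bdry1 (prr c - prr (lin ev (lin Q c))))"
    using finite_domination by (elim exE)
  have J: "finite J" and oc: "open_cover W \<U>" "open_cover M \<V>"
    and ev: "\<And>j. j \<in> J \<Longrightarrow> ks (ev j) \<subseteq> B 2"
    and Q: "\<And>c. ks c \<subseteq> B 2 \<Longrightarrow> small2 \<U> \<V> c \<Longrightarrow> ks (lin Q c) \<subseteq> J"
    and Qcyc: "\<And>c. cyc2 c \<Longrightarrow> small2 \<U> \<V> c \<Longrightarrow> cyc2 (lin ev (lin Q c))"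
      "\<And>c. cyc2 c \<Longrightarrow> small2 \<U> \<V> c \<Longrightarrow> bdry1 (prr c - prr (lin ev (lin Q c)))"
    using * by simp_all
  obtain N where N: "\<And>b. b \<in> B 2 \<Longrightarrow> ks (N b) \<subseteq> B 2" "\<And>b k. b \<in> B 2 \<Longrightarrow> \<epsilon> (lk (N b) k) = 0"
    "\<And>c. cyc2 c \<Longrightarrow> cyc2 (lin N c)" "\<And>c. cyc2 c \<Longrightarrow> bdry1 (prr c - prr (lin N c))"
    using contraction_operator by blast
  have kNev: "ks (lin N (ev j)) \<subseteq> B 2" if "j \<in> J" for j
    using ev[OF that] N(1) by (intro keys_lext) blast
  obtain K where K: "\<And>j m. j \<in> J \<Longrightarrow> m \<ge> K j \<Longrightarrow> small2 \<U> \<V> ((sub2 ^^ m) (lin N (ev j)))"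
    using sub2_small[OF kNev oc] by metis
  \<comment> \<open>One number of subdivisions that works for all of the finite set
    \<open>J\<close>, so that \<open>T\<close> is a single linear map.\<close>
  define k where "k = Max (insert 0 (K ` J))"
  have k: "small2 \<U> \<V> ((sub2 ^^ k) (lin N (ev j)))" if "j \<in> J" for j
    using that J by (intro K) (auto simp: k_def)
  \<comment> \<open>From nerve data to chains by \<open>ev\<close>, then \<open>N\<close>, then back
    to nerve data. \<open>N\<close> makes all matrix entries reduce to 0, but its values need not be
    small, hence the subdivisions before \<open>Q\<close>.\<close>
  define T where "T x = lin Q ((sub2 ^^ k) (lin N (lin ev x)))" for x
  have lS: "lmap (sub2 ^^ k)" by (intro lmap_pow lmap_sub2)
  have lT: "lmap T"
    unfolding T_def by (intro lmap_comp[OF lmap_lin] lmap_comp[OF lS] lmap_comp[OF lmap_lin] lmap_lin)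
  define f where "f j = T (sg j 1)" for j
  have Tf: "T = lin f" unfolding f_def using lmap_eq_lin[OF lT] by blast
  have fj: "f j = lin Q ((sub2 ^^ k) (lin N (ev j)))" for j
    by (simp add: f_def T_def lin_simps)
  have "ks (f j) \<subseteq> J" if "j \<in> J" for j
    unfolding fj using that by (intro Q k keys_sub2_pow kNev)
  moreover have "\<epsilon> (lk (f j) a) = 0" if "j \<in> J" for j a
  proof -
    have "\<epsilon> (lk (lin N (ev j)) b) = 0" for b
      unfolding lk_lin using N(2) ev[OF that]
      by (simp add: urh_sum[OF \<epsilon>] urh_simps[OF \<epsilon>] subset_iff)
    then show ?thesis
      unfolding fj by (rule lmap_kernel[OF lmap_lin \<epsilon> lmap_kernel[OF lS \<epsilon>]])
  qed
  ultimately obtain p where p: "\<epsilon> (poly p 1) = 1" "\<And>x. ks x \<subseteq> J \<Longrightarrow> pact (lin f) p x = 0"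
    using determinant_trick[OF J _ \<epsilon>, of f] by blast
  have Tc: "ks (T x) \<subseteq> J \<and> cyc2 (lin ev (T x)) \<and> bdry1 (prr (lin ev x) - prr (lin ev (T x)))"
    if x: "ks x \<subseteq> J" "cyc2 (lin ev x)" for x
  proof -
    let ?c = "(sub2 ^^ k) (lin N (lin ev x))"
    have c1: "cyc2 (lin N (lin ev x))" "bdry1 (prr (lin ev x) - prr (lin N (lin ev x)))" using N(3,4) x by auto
    have c2: "cyc2 ?c" "bdry1 (prr (lin N (lin ev x)) - prr ?c)" using cyc2_sub2_pow[OF c1(1)] by auto
    have "?c = lin (\<lambda>j. (sub2 ^^ k) (lin N (ev j))) x"
      using lmap_eq_lin[OF lmap_comp[OF lS lmap_comp[OF lmap_lin[of N] lmap_lin[of ev]]], of x]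
      by (simp add: lin_simps)
    then have sm: "small2 \<U> \<V> ?c" using k x(1) by (auto intro!: small2_lin)
    have kc: "ks ?c \<subseteq> B 2" using c2(1) by (simp add: cyc2_def)
    have c3: "cyc2 (lin ev (T x))" "bdry1 (prr ?c - prr (lin ev (T x)))" "ks (T x) \<subseteq> J"
      unfolding T_def using Qcyc[OF c2(1) sm] Q[OF kc sm] by auto
    then show ?thesis using bdry1_add[OF bdry1_add[OF c1(2) c2(2)] c3(2)] by simp
  qed
  let ?c0 = "inl w + inr z"
  have c0: "cyc2 ?c0"
    using cone_basisI[of w 2 W z M] w z by (simp add: cyc2_def in_simps pr_in One_nat_def)
  then have "ks ?c0 \<subseteq> B 2" by (simp add: cyc2_def)
  \<comment> \<open>The given cycle has to be made small as well before \<open>Q\<close> can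
    represent it by a vector supported on \<open>J\<close>; the number of subdivisions here is
    unrelated to \<open>k\<close>.\<close>
  from sub2_small[OF this oc] obtain n where n: "small2 \<U> \<V> ((sub2 ^^ n) ?c0)" by blast
  define x where "x = lin Q ((sub2 ^^ n) ?c0)"
  have s0: "cyc2 ((sub2 ^^ n) ?c0)" "bdry1 (z - prr ((sub2 ^^ n) ?c0))"
    using cyc2_sub2_pow[OF c0, of n] by (auto simp: in_simps pr_in)
  have x: "ks x \<subseteq> J" "cyc2 (lin ev x)"
    unfolding x_def using Q[OF _ n] Qcyc(1)[OF s0(1) n] s0(1) by (auto simp: cyc2_def)
  have xz: "bdry1 (z - prr (lin ev x))"
    using bdry1_add[OF s0(2) Qcyc(2)[OF s0(1) n]] by (simp add: x_def)
  have iter: "ks ((T ^^ m) x) \<subseteq> J \<and> cyc2 (lin ev ((T ^^ m) x)) \<and> bdry1 (z - prr (lin ev ((T ^^ m) x)))" for m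
  proof (induction m)
    case 0 show ?case using x xz by simp
  next
    case (Suc m)
    then have "bdry1 (z - prr (lin ev ((T ^^ m) x)))" by blast
    from bdry1_add[OF this] Tc[of "(T ^^ m) x"] Suc show ?case by fastforce
  qed
  have "pact T p x = 0" using p(2)[OF x(1)] Tf by simp
  then have "0 = (\<Sum>m\<le>degree p. scale (coeff p m) (prr (lin ev ((T ^^ m) x))))"
    unfolding pact_def
    using lmap_sum[OF lmap_comp[OF lmap_in(4) lmap_lin[of ev]], of "\<lambda>m. scale (coeff p m) ((T ^^ m) x)" "{..degree p}"]
    by (simp add: lin_simps in_simps)
  \<comment> \<open>Subtracting the vanishing sum term by term turns \<open>poly p 1\<close> times
    \<open>z\<close> into a combination of differences, each of which is a boundary.\<close>
  then have "scale (poly p 1) z = (\<Sum>m\<le>degree p. scale (coeff p m) (z - prr (lin ev ((T ^^ m) x))))"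
    by (simp add: poly_altdef scale_diff sum_subtractf scale_sum_left)
  moreover have "bdry1 \<dots>" using iter by (intro bdry1_sum bdry1_scale) blast
  moreover have "poly p 1 \<noteq> 0" using p(1) urh_simps(4)[OF \<epsilon>] by auto
  ultimately show ?thesis by metis
qed

end

subsection \<open>Paths\<close>

abbreviation bnd :: "'a topology \<Rightarrow> 'a chain \<Rightarrow> bool" where
  "bnd X c \<equiv> singular_relboundary 1 X {} c"

abbreviation pc where "pc \<equiv> path_chain"

lemma hom_bnd: "homologous_rel 1 X {} a b \<longleftrightarrow> bnd X (a - b)"
  by (simp add: homologous_rel_def)

lemma bnd_add: "bnd X a \<Longrightarrow> bnd X b \<Longrightarrow> bnd X (a + b)"
  and bnd_diff: "bnd X a \<Longrightarrow> bnd X b \<Longrightarrow> bnd X (a - b)"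
  and bnd_minus: "bnd X (- a) \<longleftrightarrow> bnd X a"
  by (simp_all add: singular_relboundary_add singular_relboundary_diff singular_relboundary_minus)

lemma bnd_minus_commute: "bnd X (a - b) \<Longrightarrow> bnd X (b - a)"
  using bnd_minus[of X "a - b"] by simp

lemma pc_psimp: "pc \<gamma> = frag_of (psimp \<gamma>)"
  by (rule path_chain_psimp)

lemma psimp_cong: "(\<And>t. 0 \<le> t \<Longrightarrow> t \<le> 1 \<Longrightarrow> g t = g' t) \<Longrightarrow> psimp g = psimp g'"
  unfolding psimp_def standard_simplex_def by (auto simp: restrict_def fun_eq_iff)

lemma pc_cong: "(\<And>t. 0 \<le> t \<Longrightarrow> t \<le> 1 \<Longrightarrow> g t = g' t) \<Longrightarrow> pc g = pc g'"
  unfolding pc_psimp by (metis psimp_cong)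

lemma pc_chain: "pathin X \<gamma> \<Longrightarrow> singular_chain 1 X (pc \<gamma>)"
  by (simp add: pc_psimp singular_chain_of singular_simplex_psimp)

lemma simplex_map_psimp: "simplex_map 1 f (psimp \<gamma>) = psimp (f \<circ> \<gamma>)"
  by (auto simp: simplex_map_def psimp_def)

lemma chain_map_pc: "chain_map 1 f (pc \<gamma>) = pc (f \<circ> \<gamma>)"
  by (simp add: pc_psimp simplex_map_psimp)

lemma pc_boundary: "pathin X \<gamma> \<Longrightarrow> chain_boundary 1 (pc \<gamma>) = frag_of (pt (\<gamma> 1)) - frag_of (pt (\<gamma> 0))"
  using boundary_path[OF singular_simplex_psimp, of X \<gamma>] by (simp add: pc_psimp)

lemma acyc_bnd:
  assumes "acyc V" "continuous_map V X h" "singular_chain 1 V c" "chain_boundary 1 c = 0"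
  shows "bnd X (chain_map 1 h c)"
proof -
  have "bnd V c" using assms by (simp add: acyc_def singular_cycle)
  then show ?thesis using singular_relboundary_chain_map[OF _ assms(2)] by fastforce
qed

lemma bnd_subtopology: "bnd (subtopology X U) c \<Longrightarrow> bnd X c"
  using singular_boundary_mono[of U UNIV 1 X c] by (simp add: subtopology_UNIV)

lemma acyc_paths:
  assumes "acyc (subtopology X U)" "pathin (subtopology X U) \<eta>" "pathin (subtopology X U) \<zeta>"
    "\<eta> 0 = \<zeta> 0" "\<eta> 1 = \<zeta> 1"
  shows "bnd X (pc \<eta> - pc \<zeta>)"
proof -
  have "chain_boundary 1 (pc \<eta> - pc \<zeta>) = 0"
    using assms by (simp add: chain_boundary_diff pc_boundary)
  with singular_chain_diff[OF assms(2,3)[THEN pc_chain]]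
  have "bnd (subtopology X U) (pc \<eta> - pc \<zeta>)"
    using assms(1) by (simp add: acyc_def singular_cycle)
  then show ?thesis by (rule bnd_subtopology)
qed

text \<open>The portion of \<open>\<gamma>\<close> from time \<open>a\<close> to time
  \<open>b\<close>, reversed if \<open>b < a\<close> and constant if \<open>a = b\<close>;
  concatenation, reversal and constant paths all become instances of
  \<open>subp_add\<close>.\<close>

definition subp :: "real \<Rightarrow> real \<Rightarrow> (real \<Rightarrow> 'a) \<Rightarrow> real \<Rightarrow> 'a" where
  "subp a b \<gamma> t = \<gamma> ((1 - t) * a + t * b)"

lemma pathin_unit: "0 \<le> a \<Longrightarrow> a \<le> 1 \<Longrightarrow> 0 \<le> b \<Longrightarrow> b \<le> 1 \<Longrightarrow>
   pathin (top_of_set {0..1::real}) (\<lambda>t. (1 - t) * a + t * b)"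
  by (auto simp: pathin_def continuous_map_in_subtopology convex_bound_le intro!: continuous_intros)

lemma pathin_subp:
  assumes "pathin X \<gamma>" "0 \<le> a" "a \<le> 1" "0 \<le> b" "b \<le> 1" shows "pathin X (subp a b \<gamma>)"
proof -
  have "pathin X (\<gamma> \<circ> (\<lambda>t. (1 - t) * a + t * b))"
    using pathin_compose[OF pathin_unit[OF assms(2-)]] assms(1) by (simp add: pathin_def)
  then show ?thesis by (simp add: subp_def[abs_def] o_def)
qed

lemma subp_ends [simp]: "subp a b \<gamma> 0 = \<gamma> a" "subp a b \<gamma> 1 = \<gamma> b"
  by (simp_all add: subp_def)

lemma acyc_unit: "acyc (top_of_set {0..1::real})"
  by (intro contractible_imp_acyc)
     (simp only: contractible_space_top_of_set, intro convex_imp_contractible convex_real_interval)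

text \<open>The three portions are images under \<open>\<gamma>\<close> of paths in the unit
  interval that form a cycle there, and the interval is acyclic.\<close>

lemma subp_add:
  assumes \<gamma>: "pathin X \<gamma>" and ab: "0 \<le> a" "a \<le> 1" "0 \<le> b" "b \<le> 1" "0 \<le> c" "c \<le> 1"
  shows "bnd X (pc (subp a b \<gamma>) + pc (subp b c \<gamma>) - pc (subp a c \<gamma>))"
proof -
  let ?l = "\<lambda>a b t. (1 - t) * a + t * b :: real" and ?V = "top_of_set {0..1::real}"
  have p: "pathin ?V (?l a b)" "pathin ?V (?l b c)" "pathin ?V (?l a c)" using ab by (auto intro!: pathin_unit)
  let ?c = "pc (?l a b) + pc (?l b c) - pc (?l a c)"
  have "bnd X (chain_map 1 \<gamma> ?c)"
    by (rule acyc_bnd[OF acyc_unit])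
       (use \<gamma> p in \<open>auto simp: pathin_def[symmetric] chain_boundary_add chain_boundary_diff pc_boundary[OF p(1)]
          pc_boundary[OF p(2)] pc_boundary[OF p(3)] intro!: singular_chain_add singular_chain_diff pc_chain\<close>)
  then show ?thesis
    by (simp add: chain_map_add chain_map_diff chain_map_pc subp_def[abs_def] o_def)
qed

lemma subp_const: "pathin X \<gamma> \<Longrightarrow> 0 \<le> a \<Longrightarrow> a \<le> 1 \<Longrightarrow> bnd X (pc (subp a a \<gamma>))"
  using subp_add[of X \<gamma> a a a] by simp

lemma bnd_const: "x \<in> topspace X \<Longrightarrow> bnd X (pc (\<lambda>_. x))"
  using subp_const[of X "\<lambda>_. x" 0] by (simp add: pathin_def subp_def[abs_def])

lemma subp_rev: "pathin X \<gamma> \<Longrightarrow> 0 \<le> a \<Longrightarrow> a \<le> 1 \<Longrightarrow> 0 \<le> b \<Longrightarrow> b \<le> 1 \<Longrightarrow>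
   bnd X (pc (subp a b \<gamma>) + pc (subp b a \<gamma>))"
  using bnd_add[OF subp_add[of X \<gamma> a b a] subp_const[of X \<gamma> a]] by simp

lemma pc_subp_01: "pc (subp 0 1 \<gamma>) = pc \<gamma>"
  by (simp add: subp_def[abs_def])

definition joinp :: "(real \<Rightarrow> 'a) \<Rightarrow> (real \<Rightarrow> 'a) \<Rightarrow> real \<Rightarrow> 'a" where
  "joinp \<gamma> \<eta> t = (if t \<le> 1/2 then \<gamma> (2 * t) else \<eta> (2 * t - 1))"

lemma joinp_ends [simp]: "joinp \<gamma> \<eta> 0 = \<gamma> 0" "joinp \<gamma> \<eta> 1 = \<eta> 1"
  by (simp_all add: joinp_def)

lemma pathin_joinp:
  assumes "pathin X \<gamma>" "pathin X \<eta>" "\<gamma> 1 = \<eta> 0"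
  shows "pathin X (joinp \<gamma> \<eta>)"
  unfolding pathin_def joinp_def[abs_def]
proof (rule continuous_map_cases_le)
  let ?I = "top_of_set {0..1::real}"
  have c: "continuous_map ?I euclideanreal (\<lambda>t. t)" "continuous_map ?I euclideanreal (\<lambda>t. 2 * t)"
    "continuous_map ?I euclideanreal (\<lambda>t. 2 * t - 1)"
    by (auto intro!: continuous_intros)
  show "continuous_map ?I euclideanreal (\<lambda>t. t)" "continuous_map ?I euclideanreal (\<lambda>t. 1/2)" using c by auto
  have "continuous_map (subtopology ?I {t \<in> topspace ?I. t \<le> 1/2}) ?I (\<lambda>t. 2 * t)"
    by (rule continuous_map_into_subtopology[OF continuous_map_from_subtopology[OF c(2)]]) auto
  from continuous_map_compose[OF this assms(1)[unfolded pathin_def]]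
  show "continuous_map (subtopology ?I {t \<in> topspace ?I. t \<le> 1/2}) X (\<lambda>t. \<gamma> (2 * t))" by (simp add: o_def)
  have "continuous_map (subtopology ?I {t \<in> topspace ?I. 1/2 \<le> t}) ?I (\<lambda>t. 2 * t - 1)"
    by (rule continuous_map_into_subtopology[OF continuous_map_from_subtopology[OF c(3)]]) auto
  from continuous_map_compose[OF this assms(2)[unfolded pathin_def]]
  show "continuous_map (subtopology ?I {t \<in> topspace ?I. 1/2 \<le> t}) X (\<lambda>t. \<eta> (2 * t - 1))" by (simp add: o_def)
  show "\<gamma> (2 * t) = \<eta> (2 * t - 1)" if "t = 1/2" for t unfolding that using assms(3) by simp
qed

text \<open>The two halves of the concatenation are \<open>\<gamma>\<close> and
  \<open>\<eta>\<close> up to reparametrisation, so \<open>subp_add\<close> at the times 0, 1/2, 1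
  applies.\<close>

lemma joinp_bnd:
  assumes "pathin X \<gamma>" "pathin X \<eta>" "\<gamma> 1 = \<eta> 0"
  shows "bnd X (pc (joinp \<gamma> \<eta>) - (pc \<gamma> + pc \<eta>))"
proof -
  have 1: "pc (subp 0 (1/2) (joinp \<gamma> \<eta>)) = pc \<gamma>"
    by (rule pc_cong) (simp add: subp_def joinp_def)
  have 2: "pc (subp (1/2) 1 (joinp \<gamma> \<eta>)) = pc \<eta>"
  proof (rule pc_cong)
    fix t :: real assume t: "0 \<le> t" "t \<le> 1"
    have "(1 - t) * (1 / 2) + t * 1 = 1/2 + t/2" by (simp add: field_simps)
    \<comment> \<open>At \<open>t = 0\<close> the concatenation is still in its first branch; its
      value there is \<open>\<gamma> 1\<close>, which equals \<open>\<eta> 0\<close>.\<close>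
    then show "subp (1/2) 1 (joinp \<gamma> \<eta>) t = \<eta> t"
      using t assms(3) by (cases "t = 0") (auto simp: subp_def joinp_def)
  qed
  show ?thesis
    using subp_add[OF pathin_joinp[OF assms], of 0 "1/2" 1] 1 2
    by (simp add: pc_subp_01) (metis bnd_minus_commute)
qed

text \<open>The path runs along the edge with barycentric coordinates \<open>1 - t\<close> and
  \<open>t\<close>. Equality off the simplex holds because singular simplices are
  extensional.\<close>

lemma pathin_of_simplex:
  assumes "singular_simplex 1 X \<sigma>"
  shows "\<exists>\<gamma>. pathin X \<gamma> \<and> psimp \<gamma> = \<sigma>"
proof -
  let ?g = "\<lambda>t::real. \<lambda>i::nat. if i = 0 then 1 - t else if i = 1 then t else 0"
  have g: "?g t \<in> standard_simplex 1" if "0 \<le> t" "t \<le> 1" for t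
    using that by (auto simp: standard_simplex_def One_nat_def)
  have "continuous_map (top_of_set {0..1::real}) (powertop_real UNIV) ?g"
    unfolding continuous_map_componentwise_UNIV
  proof
    fix k :: nat
    show "continuous_map (top_of_set {0..1::real}) euclideanreal (\<lambda>t. ?g t k)"
      by (cases "k = 0"; cases "k = 1") (auto intro!: continuous_intros)
  qed
  then have "continuous_map (top_of_set {0..1::real}) (simplex_space 1) ?g"
    using g by (auto simp: continuous_map_in_subtopology)
  then have p: "pathin X (\<sigma> \<circ> ?g)"
    unfolding pathin_def using simplex_cont[OF assms] by (rule continuous_map_compose)
  have "psimp (\<sigma> \<circ> ?g) = \<sigma>"
  proof
    fix x
    show "psimp (\<sigma> \<circ> ?g) x = \<sigma> x"
    proof (cases "x \<in> standard_simplex 1")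
      case True
      have "?g (x 1) i = x i" for i
      proof -
        have "x 0 + x 1 = 1" "\<And>i. i > 1 \<Longrightarrow> x i = 0"
          using True by (auto simp: standard_simplex_def One_nat_def)
        then show ?thesis by (cases "i = 0"; cases "i = 1") auto
      qed
      then have "?g (x 1) = x" by blast
      then show ?thesis using True by (simp add: psimp_def)
    next
      case False
      then show ?thesis using assms by (auto simp: psimp_def singular_simplex_def extensional_def)
    qed
  qed
  then show ?thesis using p by blast
qed

text \<open>Acyclic neighbourhoods are path connected, so path components are open, and a connected
  space has at most one.\<close>

lemma loc_acyc_path_connected:
  assumes "loc_acyc X" "connected_space X" shows "path_connected_space X"
proof -
  have "\<exists>U. openin X U \<and> x \<in> U \<and> (\<forall>y\<in>U. path_component_of X x y)" if x: "x \<in> topspace X" for x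
  proof -
    obtain V where V: "openin X V" "x \<in> V" "acyc (subtopology X V)"
      using assms(1) x unfolding loc_acyc_def by (meson openin_topspace)
    have "path_component_of X x y" if "y \<in> V" for y
    proof -
      have "y \<in> topspace (subtopology X V)" "x \<in> topspace (subtopology X V)"
        using that V openin_subset by fastforce+
      then obtain g where "pathin (subtopology X V) g" "g 0 = x" "g 1 = y"
        using V(3) unfolding acyc_def path_connected_space_def by metis
      then show ?thesis unfolding path_component_of_def using pathin_subtopology by blast
    qed
    then show ?thesis using V by blast
  qed
  then have op: "openin X (Collect (path_component_of X x))" for x
    by (subst openin_subopen) (metis mem_Collect_eq path_component_of_equiv path_component_of_trans subsetI path_component_in_topspace)
  show ?thesis
    unfolding path_connected_space_iff_path_component
  proof (intro ballI)
    fix x y assume xy: "x \<in> topspace X" "y \<in> topspace X"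
    let ?A = "Collect (path_component_of X x)" and ?B = "\<Union>z\<in>topspace X - Collect (path_component_of X x). Collect (path_component_of X z)"
    have "openin X ?B" using op by (auto intro!: openin_Union)
    moreover have "topspace X \<subseteq> ?A \<union> ?B"
      using path_component_of_refl by fastforce
    moreover have "?A \<inter> ?B = {}"
      using path_component_of_sym path_component_of_trans by fastforce
    moreover have "?A \<noteq> {}" using xy path_component_of_refl by fastforce
    ultimately have "?B = {}" using assms(2) op[of x] unfolding connected_space_def by metis
    then show "path_component_of X x y" using xy path_component_of_refl by fastforce
  qed
qed

text \<open>Surjectivity of the Hurewicz map, in the form: every path can be modified by an arbitrary class.\<close>

definition based :: "(('a \<Rightarrow> real \<Rightarrow> 'a)) \<Rightarrow> 'a chain \<Rightarrow> 'a chain" where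
  "based \<gamma> c = c - frag_extend (\<lambda>\<pi>. pc (\<gamma> (\<pi> (vx 0)))) (chain_boundary 1 c)"

lemma based_simps: "based \<gamma> (a + b) = based \<gamma> a + based \<gamma> b" "based \<gamma> (a - b) = based \<gamma> a - based \<gamma> b"
  "based \<gamma> 0 = 0"
  by (simp_all add: based_def chain_boundary_add chain_boundary_diff frag_extend_add frag_extend_diff)

lemma based_cycle: "chain_boundary 1 c = 0 \<Longrightarrow> based \<gamma> c = c"
  by (simp add: based_def)

lemma based_simplex: "singular_simplex 1 X \<sigma> \<Longrightarrow>
   based \<gamma> (frag_of \<sigma>) = frag_of \<sigma> + pc (\<gamma> (\<sigma> (vx 0))) - pc (\<gamma> (\<sigma> (vx 1)))"
  by (simp add: based_def boundary_path frag_extend_diff)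

locale base_paths =
  fixes X :: "'a topology" and x0 :: 'a and \<gamma> :: "'a \<Rightarrow> real \<Rightarrow> 'a"
  assumes \<gamma>: "\<And>x. x \<in> topspace X \<Longrightarrow> pathin X (\<gamma> x) \<and> \<gamma> x 0 = x0 \<and> \<gamma> x 1 = x"
    and x0: "x0 \<in> topspace X"
begin

lemma based_cyc: "singular_chain 1 X c \<Longrightarrow> singular_relcycle 1 X {} (based \<gamma> c)"
  unfolding singular_chain_def
proof (induction c rule: frag_induction)
  case (one \<sigma>)
  then have \<sigma>: "singular_simplex 1 X \<sigma>" by simp
  have v: "\<sigma> (vx 0) \<in> topspace X" "\<sigma> (vx 1) \<in> topspace X" using singular_simplex_vx[OF \<sigma>] by auto
  show ?case
    unfolding based_simplex[OF \<sigma>] singular_cycle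
    using \<gamma>[OF v(1)] \<gamma>[OF v(2)] \<sigma> pc_boundary[of X] boundary_path[OF \<sigma>]
    by (auto simp: chain_boundary_add chain_boundary_diff singular_chain_of intro!: singular_chain_add singular_chain_diff pc_chain)
next
  case (diff a b)
  then show ?case by (simp only: based_simps singular_relcycle_diff)
qed (simp add: based_simps)

text \<open>An edge is closed up to a loop by the base paths at its ends. Differences of chains
  become concatenations with a reversed loop, so induction over the free abelian group goes
  through.\<close>

lemma based_loop:
  assumes "singular_chain 1 X c"
  shows "\<exists>l. pathin X l \<and> l 0 = x0 \<and> l 1 = x0 \<and> bnd X (pc l - based \<gamma> c)"
  using assms unfolding singular_chain_def
proof (induction c rule: frag_induction)
  case zero
  show ?case
    by (intro exI[of _ "\<lambda>_. x0"]) (use x0 bnd_const in \<open>auto simp: based_simps pathin_def\<close>)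
next
  case (one \<sigma>)
  then have \<sigma>: "singular_simplex 1 X \<sigma>" by simp
  have v: "\<sigma> (vx 0) \<in> topspace X" "\<sigma> (vx 1) \<in> topspace X" using singular_simplex_vx[OF \<sigma>] by auto
  obtain s where s: "pathin X s" "psimp s = \<sigma>" using pathin_of_simplex[OF \<sigma>] by blast
  have s01: "s 0 = \<sigma> (vx 0)" "s 1 = \<sigma> (vx 1)" using s(2) by auto
  let ?a = "\<gamma> (\<sigma> (vx 0))" and ?b = "subp 1 0 (\<gamma> (\<sigma> (vx 1)))"
  have a: "pathin X ?a" "?a 0 = x0" "?a 1 = s 0" and b': "pathin X (\<gamma> (\<sigma> (vx 1)))" "\<gamma> (\<sigma> (vx 1)) 0 = x0" "\<gamma> (\<sigma> (vx 1)) 1 = s 1"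
    using \<gamma>[OF v(1)] \<gamma>[OF v(2)] s01 by auto
  have b: "pathin X ?b" "?b 0 = s 1" "?b 1 = x0" using b' pathin_subp[OF b'(1), of 1 0] by auto
  let ?l = "joinp (joinp ?a s) ?b"
  have j: "pathin X (joinp ?a s)" using pathin_joinp a s(1) by metis
  have l: "pathin X ?l" by (rule pathin_joinp[OF j b(1)]) (simp add: b')
  have 1: "bnd X (pc ?l - (pc (joinp ?a s) + pc ?b))" by (rule joinp_bnd[OF j b(1)]) (simp add: b')
  have 2: "bnd X (pc (joinp ?a s) - (pc ?a + pc s))" by (rule joinp_bnd[OF a(1) s(1) a(3)])
  have 3: "bnd X (pc (\<gamma> (\<sigma> (vx 1))) + pc ?b)" using subp_rev[OF b'(1), of 0 1] by (simp add: pc_subp_01)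
  have "bnd X (pc ?l - based \<gamma> (frag_of \<sigma>))"
    using bnd_add[OF bnd_add[OF 1 2] 3] s(2) by (simp add: based_simplex[OF \<sigma>] pc_psimp algebra_simps)
  then show ?case using l a(2) b(3) by (intro exI[of _ ?l]) simp
next
  case (diff c d)
  then obtain l m where l: "pathin X l" "l 0 = x0" "l 1 = x0" "bnd X (pc l - based \<gamma> c)"
    and m: "pathin X m" "m 0 = x0" "m 1 = x0" "bnd X (pc m - based \<gamma> d)" by blast
  let ?m = "subp 1 0 m"
  have m': "pathin X ?m" "?m 0 = x0" "?m 1 = x0" using m pathin_subp[OF m(1), of 1 0] by auto
  have 1: "bnd X (pc (joinp l ?m) - (pc l + pc ?m))" by (rule joinp_bnd[OF l(1) m'(1)]) (simp add: l m)
  have 2: "bnd X (pc m + pc ?m)" using subp_rev[OF m(1), of 0 1] by (simp add: pc_subp_01)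
  have "bnd X (pc (joinp l ?m) - based \<gamma> (c - d))"
    using bnd_add[OF bnd_diff[OF bnd_add[OF 1 l(4)] m(4)] 2] by (simp add: based_simps algebra_simps)
  moreover have "pathin X (joinp l ?m)" by (rule pathin_joinp[OF l(1) m'(1)]) (simp add: l m)
  ultimately show ?case using l m' by (intro exI[of _ "joinp l ?m"]) simp
qed

text \<open>Closing up edges by base paths makes \<open>based\<close> a retraction of 1-chains onto
  1-cycles. Composing \<open>\<phi>\<close> with it extends a character of homology to a
  multiplicative function on all chains, still with values in \<open>G\<close>.\<close>

lemma char_of_hom:
  assumes \<phi>: "\<phi> \<in> hom (homology_group 1 X) (unit_group\<lparr>carrier := G\<rparr>)" and G: "subgroup G unit_group"
  defines "\<theta> \<equiv> \<lambda>c. \<phi> (homologous_rel_set 1 X {} (based \<gamma> c))"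
  shows "char_sys X \<theta>" "\<And>c. singular_chain 1 X c \<Longrightarrow> \<theta> c \<in> G"
    "\<And>c. singular_relcycle 1 X {} c \<Longrightarrow> \<theta> c = \<phi> (homologous_rel_set 1 X {} c)"
proof -
  have car: "homologous_rel_set 1 X {} c \<in> carrier (homology_group 1 X)" if "singular_relcycle 1 X {} c" for c
    using that carrier_relative_homology_group[of 1 X "{}"] by (auto simp: One_nat_def)
  have one: "\<phi> (homologous_rel_set 1 X {} 0) = 1"
  proof -
    have "\<phi> \<one>\<^bsub>homology_group 1 X\<^esub> = \<one>\<^bsub>unit_group\<lparr>carrier := G\<rparr>\<^esub>"
    proof (rule hom_one[OF \<phi>])
      show "group (homology_group 1 X)" by simp
      have "group (unit_group :: 'b monoid)"
      proof (rule groupI)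
        show "\<exists>y\<in>carrier unit_group. y \<otimes>\<^bsub>unit_group\<^esub> x = \<one>\<^bsub>unit_group\<^esub>" if "x \<in> carrier (unit_group :: 'b monoid)" for x
          using that by (auto simp: unit_group_def dvd_def mult.commute)
      qed (auto simp: unit_group_def mult.assoc intro: mult_dvd_mono[of _ 1 _ 1, simplified])
      then show "group (unit_group\<lparr>carrier := G\<rparr>)" using subgroup.subgroup_is_group[OF G] by simp
    qed
    then show ?thesis
      using one_relative_homology_group[of 1 X "{}"] homologous_rel_set_eq_relboundary[of 1 X "{}" 0]
      by (simp add: unit_group_def)
  qed
  \<comment> \<open>The product in the homology group is formulated as a sum of cosets; this puts it
    in terms of representatives.\<close>
  have sum: "(\<Union>r\<in>homologous_rel_set 1 X {} a. \<Union>s\<in>homologous_rel_set 1 X {} b. {r + s}) = homologous_rel_set 1 X {} (a + b)" for a b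
  proof
    show "homologous_rel_set 1 X {} (a + b) \<subseteq> (\<Union>r\<in>homologous_rel_set 1 X {} a. \<Union>s\<in>homologous_rel_set 1 X {} b. {r + s})"
    proof
      fix x assume "x \<in> homologous_rel_set 1 X {} (a + b)"
      then have "bnd X (b - (x - a))" by (simp add: hom_bnd algebra_simps)
      then have "a \<in> homologous_rel_set 1 X {} a" "x - a \<in> homologous_rel_set 1 X {} b" "x = a + (x - a)"
        by (simp_all add: hom_bnd)
      then show "x \<in> (\<Union>r\<in>homologous_rel_set 1 X {} a. \<Union>s\<in>homologous_rel_set 1 X {} b. {r + s})" by blast
    qed
    show "(\<Union>r\<in>homologous_rel_set 1 X {} a. \<Union>s\<in>homologous_rel_set 1 X {} b. {r + s}) \<subseteq> homologous_rel_set 1 X {} (a + b)"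
      using homologous_rel_add[of 1 X "{}" a _ b] by fast
  qed
  have mul: "\<phi> (homologous_rel_set 1 X {} (a + b)) = \<phi> (homologous_rel_set 1 X {} a) * \<phi> (homologous_rel_set 1 X {} b)"
    if "singular_relcycle 1 X {} a" "singular_relcycle 1 X {} b" for a b
    using hom_mult[OF \<phi> car[OF that(1)] car[OF that(2)]] mult_relative_homology_group[of 1 X "{}"] that sum
    by (simp add: unit_group_def)
  show cyc: "\<theta> c = \<phi> (homologous_rel_set 1 X {} c)" if "singular_relcycle 1 X {} c" for c
    using that by (simp add: \<theta>_def based_cycle singular_cycle)
  show "\<theta> c \<in> G" if "singular_chain 1 X c" for c
    using hom_in_carrier[OF \<phi> car[OF based_cyc[OF that]]] by (simp add: \<theta>_def)
  show "char_sys X \<theta>"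
    unfolding char_sys_def
  proof (intro conjI allI impI)
    show "\<theta> 0 = 1" using one by (simp add: \<theta>_def based_simps)
    show "\<theta> (a + b) = \<theta> a * \<theta> b" if "singular_chain 1 X a" "singular_chain 1 X b" for a b
      using mul[OF based_cyc[OF that(1)] based_cyc[OF that(2)]] by (simp add: \<theta>_def based_simps)
    fix c assume c: "singular_chain 2 X c"
    have b: "bnd X (chain_boundary 2 c)" unfolding singular_boundary using c by (auto simp: numeral_2_eq_2 One_nat_def)
    then have "homologous_rel_set 1 X {} (chain_boundary 2 c) = homologous_rel_set 1 X {} 0"
      by (simp add: homologous_rel_set_eq hom_bnd)
    then show "\<theta> (chain_boundary 2 c) = 1"
      using cyc[OF singular_relboundary_imp_relcycle[OF b]] one by simp
  qed
qed

end

lemma base_paths_exist: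
  assumes "path_connected_space X" "x0 \<in> topspace X"
  shows "\<exists>\<gamma>. base_paths X x0 \<gamma>"
  using assms unfolding path_connected_space_def base_paths_def by metis

subsection \<open>The maximal abelian cover\<close>

lemma paths_fromD: "\<gamma> \<in> paths_from X x0 \<Longrightarrow> pathin X \<gamma>" "\<gamma> \<in> paths_from X x0 \<Longrightarrow> \<gamma> 0 = x0"
  by (auto simp: paths_from_def)

lemma pathin_in: "pathin X \<gamma> \<Longrightarrow> 0 \<le> t \<Longrightarrow> t \<le> 1 \<Longrightarrow> \<gamma> t \<in> topspace X"
  by (force simp: pathin_def continuous_map_def)

lemma pathin_in_subtopology: "pathin (subtopology X U) \<gamma> \<Longrightarrow> 0 \<le> t \<Longrightarrow> t \<le> 1 \<Longrightarrow> \<gamma> t \<in> U"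
  using pathin_in[of "subtopology X U" \<gamma> t] by simp

lemma path_class_self: "pathin X \<gamma> \<Longrightarrow> \<gamma> \<in> path_class X \<gamma>"
  by (simp add: path_class_def)

lemma path_classD:
  assumes "\<gamma>' \<in> path_class X \<gamma>"
  shows "pathin X \<gamma>'" "\<gamma>' 0 = \<gamma> 0" "\<gamma>' 1 = \<gamma> 1" "bnd X (pc \<gamma>' - pc \<gamma>)"
  using assms by (auto simp: path_class_def hom_bnd)

lemma path_classI:
  "pathin X \<gamma>' \<Longrightarrow> \<gamma>' 0 = \<gamma> 0 \<Longrightarrow> \<gamma>' 1 = \<gamma> 1 \<Longrightarrow> bnd X (pc \<gamma>' - pc \<gamma>) \<Longrightarrow> \<gamma>' \<in> path_class X \<gamma>"
  by (auto simp: path_class_def hom_bnd)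

lemma path_class_eqI:
  assumes "\<gamma>' 0 = \<gamma> 0" "\<gamma>' 1 = \<gamma> 1" "bnd X (pc \<gamma>' - pc \<gamma>)"
  shows "path_class X \<gamma>' = path_class X \<gamma>"
proof -
  have "homologous_rel 1 X {} c (pc \<gamma>') \<longleftrightarrow> homologous_rel 1 X {} c (pc \<gamma>)" for c
    using assms(3) homologous_rel_trans homologous_rel_sym unfolding hom_bnd[symmetric] by metis
  then show ?thesis unfolding path_class_def using assms by simp
qed

lemma path_class_eq: "\<gamma>' \<in> path_class X \<gamma> \<Longrightarrow> path_class X \<gamma>' = path_class X \<gamma>"
  by (intro path_class_eqI path_classD)

definition sheets :: "'a topology \<Rightarrow> 'a \<Rightarrow> (real \<Rightarrow> 'a) set set set" where
  "sheets X x0 = {cover_sheet X U \<gamma> | U \<gamma>. openin X U \<and> \<gamma> \<in> paths_from X x0 \<and> \<gamma> 1 \<in> U}"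

lemma abelian_cover_sheets: "abelian_cover X x0 = topology_generated_by (sheets X x0)"
  by (simp add: abelian_cover_def sheets_def)

lemma cover_sheetI:
  assumes "\<gamma>' \<in> paths_from X (\<gamma> 0)" "pathin (subtopology X U) \<eta>" "\<eta> 0 = \<gamma> 1" "\<eta> 1 = \<gamma>' 1"
    "bnd X (pc \<gamma>' - (pc \<gamma> + pc \<eta>))"
  shows "path_class X \<gamma>' \<in> cover_sheet X U \<gamma>"
  using assms unfolding cover_sheet_def hom_bnd by blast

lemma cover_sheet_self:
  assumes "\<gamma> \<in> paths_from X x0" "openin X U" "\<gamma> 1 \<in> U"
  shows "path_class X \<gamma> \<in> cover_sheet X U \<gamma>"
proof (rule cover_sheetI)
  have t: "\<gamma> 1 \<in> topspace X" using assms openin_subset by blast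
  show "pathin (subtopology X U) (\<lambda>_. \<gamma> 1)" using t assms by (simp add: pathin_def)
  show "bnd X (pc \<gamma> - (pc \<gamma> + pc (\<lambda>_. \<gamma> 1)))" using bnd_const[OF t] by (simp add: bnd_minus)
qed (use assms in \<open>auto simp: paths_from_def\<close>)

lemma cover_sheetE:
  assumes "e \<in> cover_sheet X U \<gamma>"
  obtains \<gamma>' \<eta> where "e = path_class X \<gamma>'" "\<gamma>' \<in> paths_from X (\<gamma> 0)" "pathin (subtopology X U) \<eta>"
    "\<eta> 0 = \<gamma> 1" "\<eta> 1 = \<gamma>' 1" "bnd X (pc \<gamma>' - (pc \<gamma> + pc \<eta>))"
  using assms unfolding cover_sheet_def hom_bnd by blast

lemma topspace_cover: "topspace (abelian_cover X x0) = path_class X ` paths_from X x0"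
proof
  show "topspace (abelian_cover X x0) \<subseteq> path_class X ` paths_from X x0"
  proof
    fix e assume "e \<in> topspace (abelian_cover X x0)"
    then obtain U \<gamma> where "\<gamma> \<in> paths_from X x0" and e: "e \<in> cover_sheet X U \<gamma>"
      unfolding abelian_cover_sheets topology_generated_by_topspace sheets_def by blast
    moreover obtain \<gamma>' where "e = path_class X \<gamma>'" "\<gamma>' \<in> paths_from X (\<gamma> 0)"
      using e by (rule cover_sheetE)
    ultimately show "e \<in> path_class X ` paths_from X x0" by (simp add: paths_from_def)
  qed
  show "path_class X ` paths_from X x0 \<subseteq> topspace (abelian_cover X x0)"
  proof
    fix e assume "e \<in> path_class X ` paths_from X x0"
    then obtain \<gamma> where g: "\<gamma> \<in> paths_from X x0" "e = path_class X \<gamma>" by blast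
    have "\<gamma> 1 \<in> topspace X" using g by (auto simp: paths_from_def pathin_def continuous_map_def)
    then have "cover_sheet X (topspace X) \<gamma> \<in> sheets X x0" "e \<in> cover_sheet X (topspace X) \<gamma>"
      using g cover_sheet_self[OF g(1), of "topspace X"] by (auto simp: sheets_def)
    then show "e \<in> topspace (abelian_cover X x0)"
      unfolding abelian_cover_sheets topology_generated_by_topspace by blast
  qed
qed

lemma cover_point:
  assumes "e \<in> topspace (abelian_cover X x0)"
  obtains \<gamma> where "\<gamma> \<in> paths_from X x0" "e = path_class X \<gamma>" "\<gamma> \<in> e"
proof -
  obtain \<gamma> where g: "e = path_class X \<gamma>" "\<gamma> \<in> paths_from X x0"
    using assms unfolding topspace_cover by (rule imageE)
  then have "\<gamma> \<in> e" using path_class_self[OF paths_fromD(1)] by simp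
  then show thesis using that g by simp
qed

lemma cover_point_mem:
  assumes "e \<in> topspace (abelian_cover X x0)" "\<gamma> \<in> e"
  shows "\<gamma> \<in> paths_from X x0" "e = path_class X \<gamma>" "pathin X \<gamma>" "\<gamma> 0 = x0"
proof -
  obtain \<gamma>' where g: "\<gamma>' \<in> paths_from X x0" "e = path_class X \<gamma>'" using assms(1) by (rule cover_point)
  then show "e = path_class X \<gamma>" using path_class_eq[of \<gamma> X \<gamma>'] assms(2) by simp
  show "\<gamma> \<in> paths_from X x0" "pathin X \<gamma>" "\<gamma> 0 = x0"
    using path_classD[of \<gamma> X \<gamma>'] g assms(2) by (auto simp: paths_from_def)
qed

lemma openin_sheet: "openin X U \<Longrightarrow> \<gamma> \<in> paths_from X x0 \<Longrightarrow> \<gamma> 1 \<in> U \<Longrightarrow>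
   openin (abelian_cover X x0) (cover_sheet X U \<gamma>)"
  unfolding abelian_cover_sheets by (rule topology_generated_by_Basis) (auto simp: sheets_def)

definition cproj :: "(real \<Rightarrow> 'a) set \<Rightarrow> 'a" where
  "cproj e = (SOME \<gamma>. \<gamma> \<in> e) 1"

text \<open>Pulled back to the maximal abelian cover, the character becomes a coboundary, and this
  holonomy from the base point is its primitive. It does not depend on the representative, as
  representatives are homologous.\<close>

definition weight :: "('a chain \<Rightarrow> 'r) \<Rightarrow> (real \<Rightarrow> 'a) set \<Rightarrow> 'r" where
  "weight \<theta> e = \<theta> (pc (SOME \<gamma>. \<gamma> \<in> e))"

lemma cproj_class: "pathin X \<gamma> \<Longrightarrow> cproj (path_class X \<gamma>) = \<gamma> 1"
  unfolding cproj_def using path_class_self[of X \<gamma>] path_classD(3)[of _ X \<gamma>] by (metis someI)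

lemma weight_class:
  assumes "pathin X \<gamma>" "char_sys X \<theta>"
  shows "weight \<theta> (path_class X \<gamma>) = \<theta> (pc \<gamma>)"
proof -
  have "(SOME \<gamma>'. \<gamma>' \<in> path_class X \<gamma>) \<in> path_class X \<gamma>" using path_class_self[OF assms(1)] by (rule someI[where P="\<lambda>g. g \<in> path_class X \<gamma>"])
  then have "homologous_rel 1 X {} (pc (SOME \<gamma>'. \<gamma>' \<in> path_class X \<gamma>)) (pc \<gamma>)"
    using path_classD(4) by (simp add: hom_bnd)
  then show ?thesis unfolding weight_def using char_homologous[OF assms(2)] pc_chain[OF assms(1)] by blast
qed

lemma cproj_sheet:
  assumes "e \<in> cover_sheet X U \<gamma>" shows "cproj e \<in> U"
proof -
  obtain \<gamma>' \<eta> where "e = path_class X \<gamma>'" "\<gamma>' \<in> paths_from X (\<gamma> 0)" "pathin (subtopology X U) \<eta>" "\<eta> 1 = \<gamma>' 1"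
    using assms by (rule cover_sheetE)
  then show ?thesis using cproj_class[OF paths_fromD(1), of \<gamma>' X] pathin_in_subtopology[of X U \<eta> 1] by simp
qed

lemma continuous_cproj: "continuous_map (abelian_cover X x0) X cproj"
  unfolding continuous_map_def
proof (intro conjI allI impI)
  show "cproj \<in> topspace (abelian_cover X x0) \<rightarrow> topspace X"
    by (auto simp: topspace_cover cproj_class[OF paths_fromD(1)] pathin_in[OF paths_fromD(1)])
  fix U assume U: "openin X U"
  show "openin (abelian_cover X x0) {e \<in> topspace (abelian_cover X x0). cproj e \<in> U}"
  proof (subst openin_subopen, intro ballI)
    fix e assume e: "e \<in> {e \<in> topspace (abelian_cover X x0). cproj e \<in> U}"
    then have "e \<in> topspace (abelian_cover X x0)" by simp
    then obtain \<gamma> where g: "\<gamma> \<in> paths_from X x0" "e = path_class X \<gamma>" by (rule cover_point)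
    then have g1: "\<gamma> 1 \<in> U" using e cproj_class[OF paths_fromD(1)[OF g(1)]] by simp
    have o: "openin (abelian_cover X x0) (cover_sheet X U \<gamma>)" using openin_sheet[OF U g(1) g1] .
    then have "cover_sheet X U \<gamma> \<subseteq> {e \<in> topspace (abelian_cover X x0). cproj e \<in> U}"
      using cproj_sheet openin_subset by blast
    then show "\<exists>T. openin (abelian_cover X x0) T \<and> e \<in> T \<and> T \<subseteq> {e \<in> topspace (abelian_cover X x0). cproj e \<in> U}"
      using o cover_sheet_self[OF g(1) U g1] g(2) by blast
  qed
qed

text \<open>A path in the cover moves the class of a path by its projection. Small pieces of the path lie in
  one sheet over an acyclic open set; connectedness of the unit interval does the rest.\<close>

lemma cover_path:
  assumes X: "loc_acyc X" and a: "pathin (abelian_cover X x0) a"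
    and g: "\<gamma> \<in> a 0" "\<gamma>' \<in> a 1"
  shows "bnd X (pc \<gamma>' - (pc \<gamma> + pc (cproj \<circ> a)))"
proof -
  let ?E = "abelian_cover X x0" and ?I = "{0..1::real}"
  define b where "b = cproj \<circ> a"
  have b: "pathin X b" unfolding b_def by (rule pathin_compose[OF a continuous_cproj])
  have aE: "a t \<in> topspace ?E" if "t \<in> ?I" for t using a that by (auto simp: pathin_def continuous_map_def)
  have b1: "\<gamma> 1 = b t" if "\<gamma> \<in> a t" "t \<in> ?I" for \<gamma> t
    using cover_point_mem[OF aE[OF that(2)] that(1)] cproj_class[of X \<gamma>] by (simp add: b_def)
  define R where "R s t \<longleftrightarrow> (\<forall>\<gamma>\<in>a s. \<forall>\<gamma>'\<in>a t. bnd X (pc \<gamma>' - (pc \<gamma> + pc (subp s t b))))" for s t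
  have "R 0 1"
  proof (rule connected_equivalence_relation[of ?I])
    show "connected ?I" by (rule connected_Icc)
    show "R t s" if "R s t" "s \<in> ?I" "t \<in> ?I" for s t
      unfolding R_def
    proof (intro ballI)
      fix \<gamma> \<gamma>' assume "\<gamma> \<in> a t" "\<gamma>' \<in> a s"
      then have 1: "bnd X (pc \<gamma> - (pc \<gamma>' + pc (subp s t b)))" using that(1) by (simp add: R_def)
      have 2: "bnd X (pc (subp s t b) + pc (subp t s b))" using that subp_rev[OF b] by auto
      show "bnd X (pc \<gamma>' - (pc \<gamma> + pc (subp t s b)))"
        using bnd_minus[THEN iffD2, OF bnd_add[OF 1 2]] by (simp add: algebra_simps)
    qed
    show "R r t" if rs: "R r s" "R s t" "r \<in> ?I" "s \<in> ?I" "t \<in> ?I" for r s t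
      unfolding R_def
    proof (intro ballI)
      fix \<gamma> \<gamma>' assume g: "\<gamma> \<in> a r" "\<gamma>' \<in> a t"
      obtain \<delta> where d: "\<delta> \<in> a s" using aE[OF rs(4)] by (rule cover_point)
      have 1: "bnd X (pc \<delta> - (pc \<gamma> + pc (subp r s b)))" "bnd X (pc \<gamma>' - (pc \<delta> + pc (subp s t b)))"
        using rs g d by (auto simp: R_def)
      have 2: "bnd X (pc (subp r s b) + pc (subp s t b) - pc (subp r t b))" using rs subp_add[OF b] by auto
      show "bnd X (pc \<gamma>' - (pc \<gamma> + pc (subp r t b)))"
        using bnd_add[OF bnd_add[OF 1] 2] by (simp add: algebra_simps)
    qed
    fix t assume t: "t \<in> ?I"
    obtain \<gamma> where g: "\<gamma> \<in> paths_from X x0" "a t = path_class X \<gamma>" "\<gamma> \<in> a t" using aE[OF t] by (rule cover_point)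
    have gX: "\<gamma> 1 \<in> topspace X" using g(1) by (auto simp: paths_from_def pathin_def continuous_map_def)
    obtain U where U: "openin X U" "\<gamma> 1 \<in> U" "acyc (subtopology X U)"
      using X gX unfolding loc_acyc_def by (meson openin_topspace)
    let ?S = "cover_sheet X U \<gamma>"
    have "openin (top_of_set ?I) {s \<in> topspace (top_of_set ?I). a s \<in> ?S}"
      using a openin_sheet[OF U(1) g(1) U(2)] unfolding pathin_def by (rule openin_continuous_map_preimage)
    then have "openin (top_of_set ?I) {s \<in> ?I. a s \<in> ?S}" by simp
    moreover have "t \<in> {s \<in> ?I. a s \<in> ?S}" using t cover_sheet_self[OF g(1) U(1,2)] g(2) by simp
    ultimately obtain \<delta> where \<delta>: "\<delta> > 0" "\<And>s. s \<in> ?I \<Longrightarrow> dist s t < \<delta> \<Longrightarrow> a s \<in> ?S"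
      unfolding openin_euclidean_subtopology_iff by blast
    have "R t s" if s: "s \<in> ?I" "dist s t < \<delta>" for s
      unfolding R_def
    proof (intro ballI)
      fix \<gamma>1 \<gamma>2 assume g12: "\<gamma>1 \<in> a t" "\<gamma>2 \<in> a s"
      obtain \<gamma>' \<eta> where h: "a s = path_class X \<gamma>'" "\<gamma>' \<in> paths_from X (\<gamma> 0)" "pathin (subtopology X U) \<eta>"
        "\<eta> 0 = \<gamma> 1" "\<eta> 1 = \<gamma>' 1" "bnd X (pc \<gamma>' - (pc \<gamma> + pc \<eta>))"
        using \<delta>(2)[OF s] by (rule cover_sheetE)
      have 1: "bnd X (pc \<gamma>1 - pc \<gamma>)" "bnd X (pc \<gamma>2 - pc \<gamma>')"
        using g12 g(2) h(1) path_classD(4) by auto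
      \<comment> \<open>While the lifted path stays in the sheet its projection stays in the acyclic
        \<open>U\<close>, so it may be exchanged for the path \<open>\<eta>\<close> that the sheet
        provides.\<close>
      have "pathin (subtopology X U) (subp t s b)"
      proof -
        have "a ((1 - r) * t + r * s) \<in> ?S" if "r \<in> ?I" for r
        proof (rule \<delta>(2))
          show "(1 - r) * t + r * s \<in> ?I" using t s(1) that by (auto simp: convex_bound_le)
          have "dist ((1 - r) * t + r * s) t = r * dist s t"
            using that by (simp add: dist_real_def abs_mult algebra_simps flip: abs_mult)
               (metis abs_mult abs_of_nonneg right_diff_distrib)
          also have "\<dots> \<le> dist s t" using that by (intro mult_left_le_one_le) auto
          finally show "dist ((1 - r) * t + r * s) t < \<delta>" using s(2) by simp
        qed
        then have "subp t s b r \<in> U" if "r \<in> ?I" for r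
          using cproj_sheet[OF \<open>\<And>r. r \<in> ?I \<Longrightarrow> a ((1 - r) * t + r * s) \<in> ?S\<close>[OF that]] by (simp add: subp_def b_def)
        moreover have "pathin X (subp t s b)" using t s(1) by (intro pathin_subp[OF b]) auto
        ultimately show ?thesis by (auto simp: pathin_def continuous_map_in_subtopology)
      qed
      moreover have "\<eta> 0 = subp t s b 0" using h(4) b1[OF g(3) t] by simp
      moreover have "\<eta> 1 = subp t s b 1"
        using h(1,2,5) b1[of \<gamma>' s] s(1) path_class_self[OF paths_fromD(1)[OF h(2)]] by simp
      ultimately have 2: "bnd X (pc \<eta> - pc (subp t s b))" using acyc_paths[OF U(3) h(3)] by blast
      show "bnd X (pc \<gamma>2 - (pc \<gamma>1 + pc (subp t s b)))"
        using bnd_diff[OF bnd_add[OF bnd_add[OF h(6) 1(2)] 2] 1(1)] by (simp add: algebra_simps)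
    qed
    moreover have "openin (top_of_set ?I) {s \<in> ?I. dist s t < \<delta>}"
    proof -
      have "{s \<in> ?I. dist s t < \<delta>} = ?I \<inter> ball t \<delta>" by (auto simp: dist_commute)
      then show ?thesis by (metis open_ball openin_open_Int)
    qed
    ultimately show "\<exists>T. openin (top_of_set ?I) T \<and> t \<in> T \<and> (\<forall>x\<in>T. R t x)"
      using t \<delta>(1) by (intro exI[of _ "{s \<in> ?I. dist s t < \<delta>}"]) auto
  qed auto
  then show ?thesis using g by (simp add: R_def pc_subp_01 b_def)
qed

lemma cover_simplex1:
  assumes X: "loc_acyc X" and a: "singular_simplex 1 (abelian_cover X x0) \<alpha>"
    and g: "\<gamma> \<in> \<alpha> (vx 0)" "\<gamma>' \<in> \<alpha> (vx 1)"
  shows "bnd X (pc \<gamma>' - (pc \<gamma> + frag_of (simplex_map 1 cproj \<alpha>)))"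
proof -
  obtain a where a': "pathin (abelian_cover X x0) a" "psimp a = \<alpha>" using pathin_of_simplex[OF a] by blast
  then show ?thesis using cover_path[OF X a'(1), of \<gamma> \<gamma>'] g by (auto simp: pc_psimp simplex_map_psimp)
qed

text \<open>By \<open>cover_simplex1\<close> a path representing the end of an edge is homologous to
  one representing its start followed by the projected edge. Multiplicativity of
  \<open>\<theta>\<close> turns this into the gauge condition, with trivial holonomy
  upstairs.\<close>

lemma compatible_weight:
  assumes X: "loc_acyc X" and \<theta>: "char_sys X \<theta>"
  shows "compatible of_int (abelian_cover X x0) (\<lambda>_. 1) \<theta> cproj (weight \<theta>)"
  unfolding compatible_def
proof (intro allI impI)
  fix \<alpha> assume a: "singular_simplex 1 (abelian_cover X x0) \<alpha>"
  have t: "\<alpha> (vx 0) \<in> topspace (abelian_cover X x0)" "\<alpha> (vx 1) \<in> topspace (abelian_cover X x0)"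
    using singular_simplex_vx[OF a] by auto
  obtain \<gamma> where g: "\<gamma> \<in> paths_from X x0" "\<alpha> (vx 0) = path_class X \<gamma>" "\<gamma> \<in> \<alpha> (vx 0)" using t(1) by (rule cover_point)
  obtain \<gamma>' where g': "\<gamma>' \<in> paths_from X x0" "\<alpha> (vx 1) = path_class X \<gamma>'" "\<gamma>' \<in> \<alpha> (vx 1)" using t(2) by (rule cover_point)
  let ?s = "frag_of (simplex_map 1 cproj \<alpha>)"
  have s: "singular_chain 1 X ?s" using singular_simplex_simplex_map[OF a continuous_cproj] by (simp add: singular_chain_of)
  have "bnd X (pc \<gamma>' - (pc \<gamma> + ?s))" by (rule cover_simplex1[OF X a g(3) g'(3)])
  then have "homologous_rel 1 X {} (pc \<gamma>') (pc \<gamma> + ?s)" by (simp add: hom_bnd)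
  then have "\<theta> (pc \<gamma>') = \<theta> (pc \<gamma> + ?s)"
    using s pc_chain[OF paths_fromD(1)[OF g(1)]] by (intro char_homologous[OF \<theta>]) (auto intro: singular_chain_add)
  also have "\<dots> = \<theta> (pc \<gamma>) * \<theta> ?s" using char_add[OF \<theta> pc_chain[OF paths_fromD(1)[OF g(1)]] s] .
  finally show "weight \<theta> (\<alpha> (vx 0)) * \<theta> ?s = of_int 1 * weight \<theta> (\<alpha> (vx 1))"
    using weight_class[OF paths_fromD(1)[OF g(1)] \<theta>] weight_class[OF paths_fromD(1)[OF g'(1)] \<theta>] g(2) g'(2) by simp
qed

text \<open>A basic neighbourhood in the product constrains finitely many coordinates only; the
  least of their radii gives a box, which is convex.\<close>

lemma openin_box:
  assumes "openin (powertop_real UNIV) T" "x \<in> T"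
  obtains I \<delta> where "finite (I :: 'i set)" "\<delta> > 0" "{y. \<forall>i\<in>I. \<bar>y i - x i\<bar> < \<delta>} \<subseteq> T"
proof -
  obtain Z where Z: "x \<in> (\<Pi>\<^sub>E i\<in>UNIV. Z i)" "\<And>i. openin euclideanreal (Z i)"
    "finite {i. Z i \<noteq> topspace euclideanreal}" "(\<Pi>\<^sub>E i\<in>UNIV. Z i) \<subseteq> T"
    using product_topology_open_contains_basis[OF assms] by (elim exE conjE) simp
  have "\<exists>d>0. \<forall>r. \<bar>r - x i\<bar> < d \<longrightarrow> r \<in> Z i" for i
  proof -
    have "open (Z i)" "x i \<in> Z i" using Z(2)[of i] Z(1) by (simp_all add: PiE_iff)
    then show ?thesis unfolding open_dist dist_real_def by blast
  qed
  then obtain d where d: "\<And>i. d i > 0" "\<And>i r. \<bar>r - x i\<bar> < d i \<Longrightarrow> r \<in> Z i" by metis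
  let ?I = "{i. Z i \<noteq> topspace euclideanreal}"
  let ?d = "Min (insert 1 (d ` ?I))"
  have "?d > 0" using Z(3) d(1) by simp
  moreover have "{y. \<forall>i\<in>?I. \<bar>y i - x i\<bar> < ?d} \<subseteq> T"
  proof
    fix y assume y: "y \<in> {y. \<forall>i\<in>?I. \<bar>y i - x i\<bar> < ?d}"
    have "y i \<in> Z i" for i
    proof (cases "i \<in> ?I")
      case True
      have "?d \<le> d i" using True Z(3) by (intro Min_le) auto
      then show ?thesis using y True d(2) by fastforce
    qed auto
    then show "y \<in> T" using Z(4) by (auto simp: PiE_iff)
  qed
  ultimately show thesis by (rule that[OF Z(3)])
qed

lemma box_convex:
  assumes "\<And>i. i \<in> I \<Longrightarrow> \<bar>y i - x i\<bar> < \<delta>" "\<And>i. i \<in> I \<Longrightarrow> \<bar>z i - x i\<bar> < \<delta>" "0 \<le> u" "u \<le> (1::real)" "i \<in> I"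
  shows "\<bar>((1 - u) * y i + u * z i) - x i\<bar> < \<delta>"
proof -
  have "((1 - u) * y i + u * z i) - x i = (1 - u) * (y i - x i) + u * (z i - x i)" by (simp add: algebra_simps)
  then have "\<bar>((1 - u) * y i + u * z i) - x i\<bar> \<le> (1 - u) * \<bar>y i - x i\<bar> + u * \<bar>z i - x i\<bar>"
    using assms(3,4) by (metis abs_mult abs_of_nonneg abs_triangle_ineq diff_ge_0_iff_ge)
  also have "\<dots> < \<delta>" using convex_bound_lt[of "\<bar>y i - x i\<bar>" \<delta> "\<bar>z i - x i\<bar>" "1 - u" u] assms by auto
  finally show ?thesis .
qed

subsection \<open>Covering transformations\<close>

lemma homology_class:
  assumes "h \<in> carrier (homology_group 1 X)"
  obtains c where "singular_relcycle 1 X {} c" "h = homologous_rel_set 1 X {} c"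
  using assms carrier_relative_homology_group[of 1 X "{}"] by auto

lemma homologous_rel_set_iff: "homologous_rel_set 1 X {} a = homologous_rel_set 1 X {} b \<longleftrightarrow> bnd X (a - b)"
  by (simp add: homologous_rel_set_eq hom_bnd)

lemma deck_class:
  assumes g: "\<gamma> \<in> paths_from X x0" "\<gamma>' \<in> paths_from X x0" "\<gamma>' 1 = \<gamma> 1"
    and h: "h = homologous_rel_set 1 X {} c" "bnd X (pc \<gamma>' - pc \<gamma> - c)"
  shows "deck X h (path_class X \<gamma>) = path_class X \<gamma>'"
proof (rule Set.set_eqI)
  fix \<delta>
  have ends: "\<gamma>' 0 = \<gamma> 0" using g by (auto simp: paths_from_def)
  show "\<delta> \<in> deck X h (path_class X \<gamma>) \<longleftrightarrow> \<delta> \<in> path_class X \<gamma>'"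
  proof
    assume "\<delta> \<in> deck X h (path_class X \<gamma>)"
    then obtain \<eta> where d: "pathin X \<delta>" "\<eta> \<in> path_class X \<gamma>" "\<delta> 0 = \<eta> 0" "\<delta> 1 = \<eta> 1" "bnd X (pc \<delta> - pc \<eta> - c)"
      unfolding deck_def h(1) homologous_rel_set_iff by blast
    note e = path_classD[OF d(2)]
    have "bnd X (pc \<delta> - pc \<gamma>')"
      using bnd_diff[OF bnd_add[OF d(5) e(4)] h(2)] by (simp add: algebra_simps)
    then show "\<delta> \<in> path_class X \<gamma>'" using d e g(3) ends by (intro path_classI) auto
  next
    assume d: "\<delta> \<in> path_class X \<gamma>'"
    note e = path_classD[OF d]
    have "bnd X (pc \<delta> - pc \<gamma> - c)" using bnd_add[OF e(4) h(2)] by (simp add: algebra_simps)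
    then show "\<delta> \<in> deck X h (path_class X \<gamma>)"
      unfolding deck_def h(1) homologous_rel_set_iff
      using e g(3) ends path_class_self[OF paths_fromD(1)[OF g(1)]] by auto
  qed
qed

text \<open>The class \<open>h\<close> is represented by a loop at \<open>x0\<close> by
  \<open>based_loop\<close>, and the new path runs through this loop before following
  \<open>\<gamma>\<close>.\<close>

lemma deck_path:
  assumes X: "path_connected_space X" and h: "h \<in> carrier (homology_group 1 X)" and g: "\<gamma> \<in> paths_from X x0"
  obtains \<gamma>' c where "\<gamma>' \<in> paths_from X x0" "\<gamma>' 1 = \<gamma> 1" "singular_relcycle 1 X {} c"
    "h = homologous_rel_set 1 X {} c" "bnd X (pc \<gamma>' - pc \<gamma> - c)"
    "deck X h (path_class X \<gamma>) = path_class X \<gamma>'"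
proof -
  have x0: "x0 \<in> topspace X" using pathin_in[OF paths_fromD(1)[OF g], of 0] paths_fromD(2)[OF g] by simp
  obtain \<beta> where "base_paths X x0 \<beta>" using base_paths_exist[OF X x0] by blast
  then interpret base_paths X x0 \<beta> .
  obtain c where c: "singular_relcycle 1 X {} c" "h = homologous_rel_set 1 X {} c" using h by (rule homology_class)
  obtain l where l: "pathin X l" "l 0 = x0" "l 1 = x0" "bnd X (pc l - c)"
    using based_loop[of c] c(1) by (auto simp: based_cycle singular_cycle)
  have e: "l 1 = \<gamma> 0" using l paths_fromD(2)[OF g] by simp
  let ?g = "joinp l \<gamma>"
  have g': "?g \<in> paths_from X x0" "?g 1 = \<gamma> 1"
    using pathin_joinp[OF l(1) paths_fromD(1)[OF g] e] l(2) by (auto simp: paths_from_def)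
  have "bnd X (pc ?g - pc \<gamma> - c)"
    using bnd_add[OF joinp_bnd[OF l(1) paths_fromD(1)[OF g] e] l(4)] by (simp add: algebra_simps)
  then show thesis using that g' c deck_class[OF g g' c(2)] by blast
qed

subsection \<open>Lifts of simplices\<close>

text \<open>Points of the cover are path classes, so a lift can be written down: over
  \<open>y\<close> stands the class of \<open>\<gamma>\<close> followed by the image of the straight
  segment from the first vertex to \<open>y\<close>.\<close>

definition lift_simplex :: "'a topology \<Rightarrow> (real \<Rightarrow> 'a) \<Rightarrow> nat \<Rightarrow> 'a simplex \<Rightarrow> (real \<Rightarrow> 'a) set simplex" where
  "lift_simplex X \<gamma> p \<sigma> = restrict (\<lambda>y. {\<gamma>'. pathin X \<gamma>' \<and> \<gamma>' 0 = \<gamma> 0 \<and> \<gamma>' 1 = \<sigma> y \<and>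
      bnd X (pc \<gamma>' - (pc \<gamma> + frag_of (simplex_map 1 \<sigma> (seg y))))}) (standard_simplex p)"

lemma simplex_paths:
  assumes \<sigma>: "singular_simplex p X \<sigma>" and a: "singular_chain 1 (simplex_space p) c" "chain_boundary 1 c = 0"
  shows "bnd X (chain_map 1 \<sigma> c)"
  by (rule acyc_bnd[OF acyc_simplex_space simplex_cont[OF \<sigma>] a])

lemma lift_simplex_class:
  assumes \<sigma>: "singular_simplex p X \<sigma>" and g: "\<gamma> \<in> paths_from X x0" "\<gamma> 1 = \<sigma> (vx 0)" and y: "y \<in> standard_simplex p"
  obtains \<gamma>' where "\<gamma>' \<in> paths_from X x0" "\<gamma>' 1 = \<sigma> y" "bnd X (pc \<gamma>' - (pc \<gamma> + frag_of (simplex_map 1 \<sigma> (seg y))))"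
    "lift_simplex X \<gamma> p \<sigma> y = path_class X \<gamma>'"
proof -
  have s: "singular_simplex 1 X (simplex_map 1 \<sigma> (seg y))"
    by (rule singular_simplex_simplex_map[OF singular_simplex_seg[OF y] simplex_cont[OF \<sigma>]])
  obtain s where s': "pathin X s" "psimp s = simplex_map 1 \<sigma> (seg y)" using pathin_of_simplex[OF s] by blast
  have s0: "s 0 = \<sigma> (vx 0)" "s 1 = \<sigma> y" using s'(2) psimp_vx(1)[of s] psimp_vx(2)[of s] by simp_all
  let ?g = "joinp \<gamma> s"
  have e: "\<gamma> 1 = s 0" using g s0 by simp
  have g': "?g \<in> paths_from X x0" "?g 1 = \<sigma> y"
    using pathin_joinp[OF paths_fromD(1)[OF g(1)] s'(1) e] paths_fromD(2)[OF g(1)] s0 by (auto simp: paths_from_def)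
  have b: "bnd X (pc ?g - (pc \<gamma> + frag_of (simplex_map 1 \<sigma> (seg y))))"
    using joinp_bnd[OF paths_fromD(1)[OF g(1)] s'(1) e] s'(2) by (simp add: pc_psimp)
  have "\<delta> \<in> lift_simplex X \<gamma> p \<sigma> y \<longleftrightarrow> \<delta> \<in> path_class X ?g" for \<delta>
  proof
    assume "\<delta> \<in> lift_simplex X \<gamma> p \<sigma> y"
    then have d: "pathin X \<delta>" "\<delta> 0 = \<gamma> 0" "\<delta> 1 = \<sigma> y" "bnd X (pc \<delta> - (pc \<gamma> + frag_of (simplex_map 1 \<sigma> (seg y))))"
      using y by (auto simp: lift_simplex_def)
    have "bnd X (pc \<delta> - pc ?g)" using bnd_diff[OF d(4) b] by simp
    then show "\<delta> \<in> path_class X ?g" using d g' s0 by (intro path_classI) auto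
  next
    assume "\<delta> \<in> path_class X ?g"
    note d = path_classD[OF this]
    have "bnd X (pc \<delta> - (pc \<gamma> + frag_of (simplex_map 1 \<sigma> (seg y))))" using bnd_add[OF d(4) b] by (simp add: algebra_simps)
    then show "\<delta> \<in> lift_simplex X \<gamma> p \<sigma> y" using d g' s0 y by (auto simp: lift_simplex_def)
  qed
  then have "lift_simplex X \<gamma> p \<sigma> y = path_class X ?g" by blast
  then show thesis using that g' b by blast
qed

text \<open>Serves twice: with \<open>S\<close> a standard simplex, for the continuity of lifts, and
  with \<open>S\<close> a half-space, for contractible neighbourhoods in manifolds.\<close>

lemma openin_convex:
  fixes S :: "('i \<Rightarrow> real) set"
  assumes S: "\<forall>x\<in>S. \<forall>y\<in>S. \<forall>u. 0 \<le> u \<longrightarrow> u \<le> 1 \<longrightarrow> (\<lambda>i. (1 - u) * x i + u * y i) \<in> S"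
    and N: "openin (subtopology (powertop_real UNIV) S) N" "y \<in> N"
  obtains N' where "openin (subtopology (powertop_real UNIV) S) N'" "y \<in> N'" "N' \<subseteq> N"
    "\<And>x z u. x \<in> N' \<Longrightarrow> z \<in> N' \<Longrightarrow> 0 \<le> u \<Longrightarrow> u \<le> 1 \<Longrightarrow> (\<lambda>i. (1 - u) * x i + u * z i) \<in> N'"
proof -
  obtain T where T: "openin (powertop_real UNIV) T" "N = T \<inter> S"
    using N(1) by (auto simp: openin_subtopology)
  have yT: "y \<in> T" using N(2) T by blast
  obtain I \<delta> where I: "finite I" "\<delta> > 0" "{z. \<forall>i\<in>I. \<bar>z i - y i\<bar> < \<delta>} \<subseteq> T" using openin_box[OF T(1) yT] .
  let ?B = "{z. \<forall>i\<in>I. \<bar>z i - y i\<bar> < \<delta>}"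
  have oB: "openin (powertop_real UNIV) ?B"
  proof -
    have "openin (powertop_real UNIV) {z \<in> topspace (powertop_real UNIV). z i \<in> {y i - \<delta><..<y i + \<delta>}}" for i
      by (rule openin_continuous_map_preimage[of _ euclideanreal]) (auto intro: continuous_map_product_projection)
    moreover have "?B = (if I = {} then UNIV else \<Inter>i\<in>I. {z \<in> topspace (powertop_real UNIV). z i \<in> {y i - \<delta><..<y i + \<delta>}})"
      by (auto simp: abs_less_iff algebra_simps)
    moreover have "openin (powertop_real UNIV) (UNIV :: ('i \<Rightarrow> real) set)"
      using openin_topspace[of "powertop_real (UNIV :: 'i set)"] by simp
    ultimately show ?thesis using I(1) by (auto intro!: openin_Inter)
  qed
  show thesis
  proof
    show "openin (subtopology (powertop_real UNIV) S) (?B \<inter> S)"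
      using oB by (auto simp: openin_subtopology)
    show "y \<in> ?B \<inter> S" using N(2) T I(2) by auto
    show "?B \<inter> S \<subseteq> N" using I(3) T(2) by blast
    show "(\<lambda>i. (1 - u) * x i + u * z i) \<in> ?B \<inter> S"
      if "x \<in> ?B \<inter> S" "z \<in> ?B \<inter> S" "0 \<le> u" "u \<le> 1" for x z u
      using that box_convex[of I x y \<delta> z u] S by simp
  qed
qed

lemma standard_simplex_convex:
  "\<forall>x\<in>standard_simplex p. \<forall>y\<in>standard_simplex p. \<forall>u. 0 \<le> u \<longrightarrow> u \<le> 1 \<longrightarrow>
     (\<lambda>i. (1 - u) * x i + u * y i) \<in> standard_simplex p"
  using convex_standard_simplex by blast

text \<open>For z in a convex neighbourhood of y mapped into \<open>U\<close>, the image of the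
  segment from y to z extends the path in \<open>U\<close> that puts the point over y in the sheet;
  so the point over z lies in the same sheet.\<close>

lemma singular_simplex_lift:
  assumes \<sigma>: "singular_simplex p X \<sigma>" and g: "\<gamma> \<in> paths_from X x0" "\<gamma> 1 = \<sigma> (vx 0)"
  shows "singular_simplex p (abelian_cover X x0) (lift_simplex X \<gamma> p \<sigma>)"
  unfolding singular_simplex_def
proof
  let ?L = "lift_simplex X \<gamma> p \<sigma>" and ?E = "abelian_cover X x0" and ?D = "simplex_space p"
  show "?L \<in> extensional (standard_simplex p)" by (simp add: lift_simplex_def)
  show "continuous_map ?D ?E ?L"
    unfolding abelian_cover_sheets
  proof (rule continuous_on_generated_topo)
    show "?L ` topspace ?D \<subseteq> \<Union>(sheets X x0)"
    proof
      fix e assume "e \<in> ?L ` topspace ?D"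
      then obtain y where y: "y \<in> standard_simplex p" "e = ?L y" by auto
      obtain \<gamma>' where "\<gamma>' \<in> paths_from X x0" "?L y = path_class X \<gamma>'"
        using lift_simplex_class[OF \<sigma> g y(1)] by metis
      then have "e \<in> topspace ?E" using y(2) by (auto simp: topspace_cover)
      then show "e \<in> \<Union>(sheets X x0)" by (simp add: abelian_cover_sheets)
    qed
    fix S assume "S \<in> sheets X x0"
    then obtain U \<gamma>0 where S: "S = cover_sheet X U \<gamma>0" "openin X U" "\<gamma>0 \<in> paths_from X x0" "\<gamma>0 1 \<in> U"
      by (auto simp: sheets_def)
    show "openin ?D (?L -` S \<inter> topspace ?D)"
    proof (subst openin_subopen, intro ballI)
      fix y assume "y \<in> ?L -` S \<inter> topspace ?D"
      then have y: "y \<in> standard_simplex p" "?L y \<in> S" by auto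
      obtain \<gamma>1 where g1: "\<gamma>1 \<in> paths_from X x0" "\<gamma>1 1 = \<sigma> y" "bnd X (pc \<gamma>1 - (pc \<gamma> + frag_of (simplex_map 1 \<sigma> (seg y))))"
        "?L y = path_class X \<gamma>1" using lift_simplex_class[OF \<sigma> g y(1)] .
      obtain \<gamma>2 \<eta> where g2: "?L y = path_class X \<gamma>2" "\<gamma>2 \<in> paths_from X (\<gamma>0 0)" "pathin (subtopology X U) \<eta>"
        "\<eta> 0 = \<gamma>0 1" "\<eta> 1 = \<gamma>2 1" "bnd X (pc \<gamma>2 - (pc \<gamma>0 + pc \<eta>))" using y(2) unfolding S(1) by (rule cover_sheetE)
      have "\<gamma>1 \<in> path_class X \<gamma>2" using g1(4) g2(1) path_class_self[OF paths_fromD(1)[OF g1(1)]] by simp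
      note g12 = path_classD[OF this]
      have \<sigma>y: "\<sigma> y \<in> U" using g12(3) g1(2) g2(5) pathin_in_subtopology[OF g2(3), of 1] by simp
      have oN: "openin ?D {x \<in> topspace ?D. \<sigma> x \<in> U}" using openin_continuous_map_preimage[OF simplex_cont[OF \<sigma>] S(2)] .
      have yN: "y \<in> {x \<in> topspace ?D. \<sigma> x \<in> U}" using y(1) \<sigma>y by simp
      obtain N where N: "openin ?D N" "y \<in> N" "N \<subseteq> {x \<in> topspace ?D. \<sigma> x \<in> U}"
        "\<And>x z u. x \<in> N \<Longrightarrow> z \<in> N \<Longrightarrow> 0 \<le> u \<Longrightarrow> u \<le> 1 \<Longrightarrow> (\<lambda>i. (1 - u) * x i + u * z i) \<in> N"
        by (rule openin_convex[OF standard_simplex_convex oN yN]) (rule that)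
      have "?L z \<in> S" if z: "z \<in> N" for z
      proof -
        have zp: "z \<in> standard_simplex p" using z N(3) by auto
        obtain \<gamma>3 where g3: "\<gamma>3 \<in> paths_from X x0" "\<gamma>3 1 = \<sigma> z" "bnd X (pc \<gamma>3 - (pc \<gamma> + frag_of (simplex_map 1 \<sigma> (seg z))))"
          "?L z = path_class X \<gamma>3" using lift_simplex_class[OF \<sigma> g zp] .
        let ?l = "\<lambda>u i. (1 - u) * y i + u * z i"
        have lN: "?l u \<in> N" if "0 \<le> u" "u \<le> 1" for u using N(2,4) z that by blast
        have "continuous_map (top_of_set {0..1::real}) (powertop_real UNIV) ?l"
          unfolding continuous_map_componentwise_UNIV by (force intro: continuous_intros)
        then have l: "pathin ?D ?l" using lN N(3)
          by (auto simp: pathin_def continuous_map_in_subtopology subset_iff)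
        \<comment> \<open>The triangle formed by the two segments from the first vertex and the
          segment from \<open>y\<close> to \<open>z\<close> bounds in the simplex, which compares
          the lifts over \<open>y\<close> and \<open>z\<close>.\<close>
        have "chain_boundary 1 (frag_of (seg y) + pc ?l - frag_of (seg z)) = 0"
          using pc_boundary[OF l] boundary_path[OF singular_simplex_seg[OF y(1)]] boundary_path[OF singular_simplex_seg[OF zp]]
          by (simp add: chain_boundary_add chain_boundary_diff)
        then have "bnd X (chain_map 1 \<sigma> (frag_of (seg y) + pc ?l - frag_of (seg z)))"
          using singular_simplex_seg[OF y(1)] singular_simplex_seg[OF zp] pc_chain[OF l]
          by (intro simplex_paths[OF \<sigma>] singular_chain_add singular_chain_diff) (auto simp: singular_chain_of)
        then have 1: "bnd X (frag_of (simplex_map 1 \<sigma> (seg y)) + pc (\<sigma> \<circ> ?l) - frag_of (simplex_map 1 \<sigma> (seg z)))"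
          by (simp add: chain_map_add chain_map_diff chain_map_pc)
        have "pathin X (\<sigma> \<circ> ?l)" by (rule pathin_compose[OF l simplex_cont[OF \<sigma>]])
        then have s: "pathin (subtopology X U) (\<sigma> \<circ> ?l)"
          using subsetD[OF N(3) lN] by (simp add: pathin_def continuous_map_in_subtopology Pi_iff)
        have e: "\<eta> 1 = (\<sigma> \<circ> ?l) 0" using g2(5) g12(3) g1(2) by simp
        have j: "pathin (subtopology X U) (joinp \<eta> (\<sigma> \<circ> ?l))" by (rule pathin_joinp[OF g2(3) s e])
        have "bnd (subtopology X U) (pc (joinp \<eta> (\<sigma> \<circ> ?l)) - (pc \<eta> + pc (\<sigma> \<circ> ?l)))" by (rule joinp_bnd[OF g2(3) s e])
        then have 2: "bnd X (pc (joinp \<eta> (\<sigma> \<circ> ?l)) - (pc \<eta> + pc (\<sigma> \<circ> ?l)))" by (rule bnd_subtopology)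
        have "bnd X (pc \<gamma>3 - (pc \<gamma>0 + pc (joinp \<eta> (\<sigma> \<circ> ?l))))"
          using bnd_diff[OF bnd_diff[OF bnd_add[OF bnd_add[OF g3(3) g12(4)] g2(6)] bnd_add[OF g1(3) 1]] 2]
          by (simp add: algebra_simps)
        then have "path_class X \<gamma>3 \<in> cover_sheet X U \<gamma>0"
          using g3(1,2) S(3) g2(4) by (intro cover_sheetI[OF _ j]) (auto simp: paths_from_def)
        then show ?thesis using g3(4) S(1) by simp
      qed
      then have "N \<subseteq> ?L -` S \<inter> topspace ?D" using N(3) by blast
      then show "\<exists>T. openin ?D T \<and> y \<in> T \<and> T \<subseteq> ?L -` S \<inter> topspace ?D" using N(1,2) by blast
    qed
  qed
qed

lemma lift_simplex_start:
  assumes \<sigma>: "singular_simplex p X \<sigma>" and g: "\<gamma> \<in> paths_from X x0" "\<gamma> 1 = \<sigma> (vx 0)"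
  shows "lift_simplex X \<gamma> p \<sigma> (vx 0) = path_class X \<gamma>"
proof -
  have v: "vx 0 \<in> standard_simplex p" by simp
  obtain \<gamma>' where g': "\<gamma>' \<in> paths_from X x0" "\<gamma>' 1 = \<sigma> (vx 0)" "bnd X (pc \<gamma>' - (pc \<gamma> + frag_of (simplex_map 1 \<sigma> (seg (vx 0)))))"
    "lift_simplex X \<gamma> p \<sigma> (vx 0) = path_class X \<gamma>'" using lift_simplex_class[OF \<sigma> g v] .
  have "bnd X (chain_map 1 \<sigma> (frag_of (seg (vx 0))))"
    using boundary_path[OF singular_simplex_seg[OF v]] singular_simplex_seg[OF v]
    by (intro simplex_paths[OF \<sigma>]) (auto simp: singular_chain_of)
  then have "bnd X (pc \<gamma>' - pc \<gamma>)" using bnd_add[OF g'(3)] by fastforce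
  then show ?thesis using g' g by (simp add: paths_from_def path_class_eqI)
qed

lemma cproj_lift:
  assumes \<sigma>: "singular_simplex p X \<sigma>" and g: "\<gamma> \<in> paths_from X x0" "\<gamma> 1 = \<sigma> (vx 0)"
  shows "simplex_map p cproj (lift_simplex X \<gamma> p \<sigma>) = \<sigma>"
proof
  fix y
  show "simplex_map p cproj (lift_simplex X \<gamma> p \<sigma>) y = \<sigma> y"
  proof (cases "y \<in> standard_simplex p")
    case True
    obtain \<gamma>' where g': "\<gamma>' \<in> paths_from X x0" "\<gamma>' 1 = \<sigma> y" "lift_simplex X \<gamma> p \<sigma> y = path_class X \<gamma>'"
      using lift_simplex_class[OF \<sigma> g True] by metis
    then show ?thesis using True cproj_class[OF paths_fromD(1)[OF g'(1)]] by (simp add: simplex_map_def)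
  next
    case False
    then show ?thesis using \<sigma> by (auto simp: simplex_map_def singular_simplex_def extensional_def)
  qed
qed

text \<open>Both simplices have the same projection, and a path class over any point is determined
  by the one over the first vertex and the projected segment between them. The difference of the
  paths over the first vertex therefore prescribes one translation for all points.\<close>

lemma simplex_eq_deck_lift:
  assumes X: "loc_acyc X" and \<sigma>: "singular_simplex p (abelian_cover X x0) \<sigma>"
    and g: "\<gamma> \<in> paths_from X x0" "\<gamma> 1 = cproj (\<sigma> (vx 0))"
    and g': "\<gamma>' \<in> \<sigma> (vx 0)"
  shows "\<sigma> = simplex_map p (deck X (homologous_rel_set 1 X {} (pc \<gamma>' - pc \<gamma>)))
     (lift_simplex X \<gamma> p (simplex_map p cproj \<sigma>))"
proof
  let ?E = "abelian_cover X x0"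
  let ?s = "simplex_map p cproj \<sigma>" and ?h = "homologous_rel_set 1 X {} (pc \<gamma>' - pc \<gamma>)"
  have s: "singular_simplex p X ?s" by (rule singular_simplex_simplex_map[OF \<sigma> continuous_cproj])
  have g1: "\<gamma> 1 = ?s (vx 0)" using g(2) by simp
  fix y
  show "\<sigma> y = simplex_map p (deck X ?h) (lift_simplex X \<gamma> p ?s) y"
  proof (cases "y \<in> standard_simplex p")
    case True
    obtain \<gamma>1 where h: "\<gamma>1 \<in> paths_from X x0" "\<gamma>1 1 = ?s y" "bnd X (pc \<gamma>1 - (pc \<gamma> + frag_of (simplex_map 1 ?s (seg y))))"
      "lift_simplex X \<gamma> p ?s y = path_class X \<gamma>1" using lift_simplex_class[OF s g(1) g1 True] .
    have "\<sigma> y \<in> topspace ?E" using \<sigma> True by (auto simp: singular_simplex_def continuous_map_def)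
    then obtain \<gamma>2 where g2: "\<gamma>2 \<in> paths_from X x0" "\<sigma> y = path_class X \<gamma>2" "\<gamma>2 \<in> \<sigma> y" by (rule cover_point)
    let ?a = "simplex_map 1 \<sigma> (seg y)"
    have a: "singular_simplex 1 ?E ?a"
      by (rule singular_simplex_simplex_map[OF singular_simplex_seg[OF True] simplex_cont[OF \<sigma>]])
    have sy: "seg y x \<in> standard_simplex p" if "x \<in> standard_simplex 1" for x
      using singular_simplex_seg[OF True] that by (auto simp: singular_simplex_def continuous_map_def)
    have "simplex_map 1 cproj ?a = simplex_map 1 ?s (seg y)"
      using sy by (auto simp: simplex_map_def fun_eq_iff)
    then have 1: "bnd X (pc \<gamma>2 - (pc \<gamma>' + frag_of (simplex_map 1 ?s (seg y))))"
      using cover_simplex1[OF X a, of \<gamma>' \<gamma>2] g' g2(3) by simp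
    have "cproj (\<sigma> y) = \<gamma>2 1" using cproj_class[OF paths_fromD(1)[OF g2(1)]] g2(2) by simp
    then have e: "\<gamma>2 1 = \<gamma>1 1" using h(2) True by (simp add: simplex_map_def)
    have "bnd X (pc \<gamma>2 - pc \<gamma>1 - (pc \<gamma>' - pc \<gamma>))"
      using bnd_diff[OF 1 h(3)] by (simp add: algebra_simps)
    then have "deck X ?h (path_class X \<gamma>1) = path_class X \<gamma>2"
      by (intro deck_class[OF h(1) g2(1) e refl])
    then show ?thesis using True g2(2) h(4) by (simp add: simplex_map_def)
  next
    case False
    then show ?thesis using \<sigma> by (auto simp: simplex_map_def singular_simplex_def extensional_def)
  qed
qed

subsection \<open>Twisted homology via twisted chains\<close>

interpretation sc: Modules.module "scale :: 'r::comm_ring_1 \<Rightarrow> ('c \<Rightarrow>\<^sub>0 'r) \<Rightarrow> ('c \<Rightarrow>\<^sub>0 'r)"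
  by (rule module_scale)

lemma tensor_map_lin: "tensor_map f z = lin (\<lambda>c. sg (f c) 1) z"
  by (simp add: tensor_map_def lext_def)

lemma rel_simps:
  "a \<in> tensor_relations p X x0 A \<phi> \<Longrightarrow> b \<in> tensor_relations p X x0 A \<phi> \<Longrightarrow> a + b \<in> tensor_relations p X x0 A \<phi>"
  "a \<in> tensor_relations p X x0 A \<phi> \<Longrightarrow> b \<in> tensor_relations p X x0 A \<phi> \<Longrightarrow> a - b \<in> tensor_relations p X x0 A \<phi>"
  "a \<in> tensor_relations p X x0 A \<phi> \<Longrightarrow> - a \<in> tensor_relations p X x0 A \<phi>"
  "0 \<in> tensor_relations p X x0 A \<phi>"
  "a \<in> tensor_relations p X x0 A \<phi> \<Longrightarrow> scale r a \<in> tensor_relations p X x0 A \<phi>"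
  by (simp_all add: tensor_relations_def Let_def sc.span_add sc.span_diff sc.span_neg sc.span_zero sc.span_scale)

lemma rel_sum: "(\<And>a. a \<in> S \<Longrightarrow> f a \<in> tensor_relations p X x0 A \<phi>) \<Longrightarrow> sum f S \<in> tensor_relations p X x0 A \<phi>"
  by (induction S rule: infinite_finite_induct) (auto simp: rel_simps)

lemma rel_lin: "(\<And>a. a \<in> ks c \<Longrightarrow> F a \<in> tensor_relations p X x0 A \<phi>) \<Longrightarrow> lin F c \<in> tensor_relations p X x0 A \<phi>"
  unfolding lext_def by (intro rel_sum rel_simps(5))

lemma rel_add:
  assumes "singular_chain p (abelian_cover X x0) c" "singular_chain p (abelian_cover X x0) c'"
  shows "sg (c + c') 1 - sg c 1 - sg c' 1 \<in> tensor_relations p X x0 A \<phi>"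
  unfolding tensor_relations_def Let_def using assms by (intro sc.span_base) blast

lemma rel_deck:
  assumes "h \<in> carrier (homology_group 1 X)" "singular_chain p (abelian_cover X x0) c"
  shows "sg (chain_map p (deck X h) c) 1 - sg c (\<phi> h) \<in> tensor_relations p X x0 A \<phi>"
  unfolding tensor_relations_def Let_def using assms by (intro sc.span_base) blast

lemma rel_sub:
  assumes "singular_chain p (subtopology (abelian_cover X x0) (cover_fibre X x0 A)) c"
  shows "sg c 1 \<in> tensor_relations p X x0 A \<phi>"
  unfolding tensor_relations_def Let_def using assms by (intro sc.span_base) blast

text \<open>Span induction: linear statements about relations are checked on the three generating
  families separately.\<close>

lemma rel_induct:
  assumes n: "n \<in> tensor_relations p X x0 A \<phi>"
    and add: "\<And>c c'. singular_chain p (abelian_cover X x0) c \<Longrightarrow> singular_chain p (abelian_cover X x0) c' \<Longrightarrow>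
        T (sg (c + c') 1 - sg c 1 - sg c' 1)"
    and deck: "\<And>h c. h \<in> carrier (homology_group 1 X) \<Longrightarrow> singular_chain p (abelian_cover X x0) c \<Longrightarrow>
        T (sg (chain_map p (deck X h) c) 1 - sg c (\<phi> h))"
    and sub: "\<And>c. singular_chain p (subtopology (abelian_cover X x0) (cover_fibre X x0 A)) c \<Longrightarrow> T (sg c 1)"
    and lin: "T 0" "\<And>a b. T a \<Longrightarrow> T b \<Longrightarrow> T (a + b)" "\<And>r a. T a \<Longrightarrow> T (scale r a)"
  shows "T n"
proof -
  have "sc.subspace {n. T n}" unfolding sc.subspace_def using lin by simp
  then have "tensor_relations p X x0 A \<phi> \<subseteq> {n. T n}"
    unfolding tensor_relations_def Let_def using add deck sub by (intro sc.span_minimal) auto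
  then show ?thesis using n by blast
qed

lemma tensor_gens_lin: "(\<And>c. c \<in> ks z \<Longrightarrow> singular_chain p (abelian_cover X x0) (f c)) \<Longrightarrow>
   lin (\<lambda>c. sg (f c) (g c)) z \<in> tensor_gens p X x0"
proof -
  assume a: "\<And>c. c \<in> ks z \<Longrightarrow> singular_chain p (abelian_cover X x0) (f c)"
  have "ks (lin (\<lambda>c. sg (f c) (g c)) z) \<subseteq> {c. singular_chain p (abelian_cover X x0) c}"
    using a by (intro keys_lext) auto
  then show ?thesis by (auto simp: tensor_gens_def)
qed

lemma tensor_gens_simps:
  "a \<in> tensor_gens p X x0 \<Longrightarrow> b \<in> tensor_gens p X x0 \<Longrightarrow> a + b \<in> tensor_gens p X x0"
  "a \<in> tensor_gens p X x0 \<Longrightarrow> b \<in> tensor_gens p X x0 \<Longrightarrow> a - b \<in> tensor_gens p X x0"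
  "a \<in> tensor_gens p X x0 \<Longrightarrow> scale r a \<in> tensor_gens p X x0" "0 \<in> tensor_gens p X x0"
proof -
  have e: "tensor_gens p X x0 = {z. ks z \<subseteq> {c. singular_chain p (abelian_cover X x0) c}}"
    by (auto simp: tensor_gens_def)
  show "a \<in> tensor_gens p X x0 \<Longrightarrow> b \<in> tensor_gens p X x0 \<Longrightarrow> a + b \<in> tensor_gens p X x0"
    "a \<in> tensor_gens p X x0 \<Longrightarrow> b \<in> tensor_gens p X x0 \<Longrightarrow> a - b \<in> tensor_gens p X x0"
    "a \<in> tensor_gens p X x0 \<Longrightarrow> scale r a \<in> tensor_gens p X x0" "0 \<in> tensor_gens p X x0"
    unfolding e by (simp_all add: keys_subset_add keys_subset_diff keys_subset_scale)
qed

lemma tensor_map_simps: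
  "tensor_map f (a + b) = tensor_map f a + tensor_map f b" "tensor_map f (a - b) = tensor_map f a - tensor_map f b"
  "tensor_map f (scale r a) = scale r (tensor_map f a)" "tensor_map f (sg c r) = sg (f c) r"
  "tensor_map f 0 = 0" "tensor_map f (- a) = - tensor_map f a"
  by (simp_all add: tensor_map_lin lin_simps)

lemma tensor_map_comp: "tensor_map f (tensor_map g z) = tensor_map (\<lambda>c. f (g c)) z"
  unfolding tensor_map_lin lin_lext by (simp add: lin_simps)

lemma tensor_map_cong: "(\<And>c. c \<in> ks z \<Longrightarrow> f c = g c) \<Longrightarrow> tensor_map f z = tensor_map g z"
  unfolding tensor_map_lin by (intro lext_cong) simp

text \<open>\<open>\<theta>\<close> extends \<open>\<phi>\<close> from cycles to all chains. The
  base paths serve to select one lift for each simplex of \<open>X\<close>.\<close>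

locale twisted_space = base_paths X x0 \<gamma> for X :: "'a topology" and x0 \<gamma> +
  fixes \<phi> :: "'a chain set \<Rightarrow> 'r::comm_ring_1" and \<theta> :: "'a chain \<Rightarrow> 'r" and A :: "'a set"
  assumes X: "loc_acyc X" "path_connected_space X"
    and \<theta>: "char_sys X \<theta>"
    and \<phi>\<theta>: "\<And>c. singular_relcycle 1 X {} c \<Longrightarrow> \<phi> (homologous_rel_set 1 X {} c) = \<theta> c"
begin

abbreviation "E \<equiv> abelian_cover X x0"
abbreviation "rel p \<equiv> tensor_relations p X x0 A \<phi>"
abbreviation "P p \<equiv> push (of_int :: int \<Rightarrow> 'r) p cproj (weight \<theta>)"

text \<open>Multiplying a projected simplex by the weight of its first vertex turns covering transformations
  into the scalars given by \<open>\<phi>\<close>. The inverse, up to relations, uses the lifts along the base paths.\<close>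

definition Phi :: "nat \<Rightarrow> ('a, 'r) tchain \<Rightarrow> ('a, 'r) twchain" where
  "Phi p = lin (P p)"

lemma lmap_Phi: "lmap (Phi p)" by (simp add: Phi_def lmap_lin)

lemma Phi_single: "Phi p (sg c r) = scale r (P p c)"
  by (simp add: Phi_def lin_simps)

lemmas P_simps = push_simps[OF urh_of_int, where p=p and h=cproj and f="weight \<theta>" for p]

text \<open>Prefixing a path with a loop of class \<open>h\<close> leaves its end point alone and
  multiplies its holonomy by the value of \<open>\<theta>\<close> on the loop, which is
  \<open>\<phi> h\<close>.\<close>

lemma P_deck:
  assumes h: "h \<in> carrier (homology_group 1 X)" and c: "singular_chain p E c"
  shows "P p (chain_map p (deck X h) c) = scale (\<phi> h) (P p c)"
  using c unfolding singular_chain_def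
proof (induction c rule: frag_induction)
  case (one \<sigma>)
  then have \<sigma>: "singular_simplex p E \<sigma>" by simp
  have pt: "cproj (deck X h e) = cproj e \<and> weight \<theta> (deck X h e) = \<phi> h * weight \<theta> e" if e: "e \<in> topspace E" for e
  proof -
    obtain \<beta> where b: "\<beta> \<in> paths_from X x0" "e = path_class X \<beta>" using e by (rule cover_point)
    obtain \<beta>' c where b': "\<beta>' \<in> paths_from X x0" "\<beta>' 1 = \<beta> 1" "singular_relcycle 1 X {} c"
      "h = homologous_rel_set 1 X {} c" "bnd X (pc \<beta>' - pc \<beta> - c)" "deck X h (path_class X \<beta>) = path_class X \<beta>'"
      using deck_path[OF X(2) h b(1)] .
    have ch: "singular_chain 1 X c" "singular_chain 1 X (pc \<beta>)"
      using b'(3) pc_chain[OF paths_fromD(1)[OF b(1)]] by (auto simp: singular_cycle)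
    have "homologous_rel 1 X {} (pc \<beta>') (c + pc \<beta>)" using b'(5) by (simp add: hom_bnd algebra_simps)
    then have "\<theta> (pc \<beta>') = \<theta> c * \<theta> (pc \<beta>)"
      using char_homologous[OF \<theta>] char_add[OF \<theta> ch] ch singular_chain_add by metis
    then show ?thesis
      using b b' \<phi>\<theta>[OF b'(3)] by (simp add: cproj_class weight_class[OF _ \<theta>] paths_fromD(1))
  qed
  have "simplex_map p cproj (simplex_map p (deck X h) \<sigma>) = simplex_map p cproj \<sigma>"
  proof
    fix y show "simplex_map p cproj (simplex_map p (deck X h) \<sigma>) y = simplex_map p cproj \<sigma> y"
      using pt[of "\<sigma> y"] \<sigma> by (auto simp: simplex_map_def singular_simplex_def continuous_map_def)
  qed
  then show ?case using pt[OF singular_simplex_vx[OF \<sigma>, of 0]] by (simp add: P_simps)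
qed (simp_all add: P_simps chain_map_diff scale_diff)

lemma P_sub:
  assumes "singular_chain p (subtopology E (cover_fibre X x0 A)) c"
  shows "tch p (subtopology X A) (P p c)"
proof (rule tch_push)
  show "tch p (subtopology E (cover_fibre X x0 A)) c" using assms by (simp add: singular_chain_def)
  have "cproj e \<in> A" if e: "e \<in> cover_fibre X x0 A" for e
  proof -
    obtain \<gamma> where "e = path_class X \<gamma>" "\<gamma> \<in> paths_from X x0" "\<gamma> 1 \<in> A" using e by (auto simp: cover_fibre_def)
    then show ?thesis using cproj_class[OF paths_fromD(1)] by metis
  qed
  then show "continuous_map (subtopology E (cover_fibre X x0 A)) (subtopology X A) cproj"
    by (intro continuous_map_into_subtopology continuous_map_from_subtopology continuous_cproj) auto
qed

text \<open>Additivity and covering transformations are respected exactly, so their relations go to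
  0; what survives comes from chains over \<open>A\<close>.\<close>

lemma Phi_rel: assumes "n \<in> rel p" shows "tch p (subtopology X A) (Phi p n)"
proof (rule rel_induct[OF assms])
  fix c assume "singular_chain p (subtopology E (cover_fibre X x0 A)) c"
  then show "tch p (subtopology X A) (Phi p (sg c 1))" using P_sub by (simp add: Phi_single)
next
  fix h c assume "h \<in> carrier (homology_group 1 X)" "singular_chain p E c"
  then show "tch p (subtopology X A) (Phi p (sg (chain_map p (deck X h) c) 1 - sg c (\<phi> h)))"
    using P_deck by (simp add: lmap_simps[OF lmap_Phi] Phi_single)
qed (simp_all add: lmap_simps[OF lmap_Phi] Phi_single P_simps keys_subset_add keys_subset_scale)

lemma Phi_boundary:
  assumes "z \<in> tensor_gens p X x0" "1 \<le> p"
  shows "Phi (p - 1) (tensor_map (chain_boundary p) z) = tbd \<theta> p (Phi p z)"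
proof -
  have "P (p - 1) (chain_boundary p c) = tbd \<theta> p (P p c)" if "c \<in> ks z" for c
  proof -
    have "tch p E c" using assms(1) that by (auto simp: tensor_gens_def singular_chain_def)
    then show ?thesis
      using tbd_push[OF urh_of_int assms(2) _ compatible_weight[OF X(1) \<theta>]] tbd_int[OF assms(2), of c] by metis
  qed
  then have "lin (\<lambda>c. P (p - 1) (chain_boundary p c)) z = lin (\<lambda>c. tbd \<theta> p (P p c)) z"
    by (intro lext_cong)
  then show ?thesis
    unfolding Phi_def tensor_map_lin lin_lext tbd_lext[OF urh_id] by (simp add: lin_simps)
qed

text \<open>The inverse of \<open>weight \<theta>\<close> at the class of the base path to
  \<open>x\<close>, obtained from the negative chain because \<open>\<theta>\<close> is
  multiplicative.\<close>

definition wt' :: "'a \<Rightarrow> 'r" where "wt' x = \<theta> (- pc (\<gamma> x))"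
definition lft :: "nat \<Rightarrow> 'a simplex \<Rightarrow> (real \<Rightarrow> 'a) set simplex" where
  "lft p \<sigma> = lift_simplex X (\<gamma> (\<sigma> (vx 0))) p \<sigma>"
definition Psi :: "nat \<Rightarrow> ('a, 'r) twchain \<Rightarrow> ('a, 'r) tchain" where
  "Psi p = lin (\<lambda>\<sigma>. sg (frag_of (lft p \<sigma>)) (wt' (\<sigma> (vx 0))))"

lemma lmap_Psi: "lmap (Psi p)" by (simp add: Psi_def lmap_lin)

lemma gam: "x \<in> topspace X \<Longrightarrow> \<gamma> x \<in> paths_from X x0" "x \<in> topspace X \<Longrightarrow> \<gamma> x 1 = x"
  using \<gamma> by (auto simp: paths_from_def)

lemma lft:
  assumes "singular_simplex p X \<sigma>"
  shows "singular_simplex p E (lft p \<sigma>)" "simplex_map p cproj (lft p \<sigma>) = \<sigma>"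
    "lft p \<sigma> (vx 0) = path_class X (\<gamma> (\<sigma> (vx 0)))" "weight \<theta> (lft p \<sigma> (vx 0)) * wt' (\<sigma> (vx 0)) = 1"
proof -
  have v: "\<sigma> (vx 0) \<in> topspace X" using singular_simplex_vx[OF assms] by simp
  show "singular_simplex p E (lft p \<sigma>)" "simplex_map p cproj (lft p \<sigma>) = \<sigma>"
    and s: "lft p \<sigma> (vx 0) = path_class X (\<gamma> (\<sigma> (vx 0)))"
    unfolding lft_def using singular_simplex_lift[OF assms gam(1)[OF v]] cproj_lift[OF assms gam(1)[OF v]]
      lift_simplex_start[OF assms gam(1)[OF v]] gam(2)[OF v] by auto
  show "weight \<theta> (lft p \<sigma> (vx 0)) * wt' (\<sigma> (vx 0)) = 1"
    unfolding s wt'_def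
    using weight_class[OF paths_fromD(1)[OF gam(1)[OF v]] \<theta>] char_minus[OF \<theta> pc_chain[OF paths_fromD(1)[OF gam(1)[OF v]]]]
    by simp
qed

lemma Phi_Psi: assumes "tch p X y" shows "Phi p (Psi p y) = y"
proof -
  have "Phi p (Psi p y) = lin (\<lambda>\<sigma>. sg \<sigma> 1) y"
    unfolding Phi_def Psi_def lin_lext
  proof (rule lext_cong)
    fix \<sigma> assume "\<sigma> \<in> ks y"
    then have \<sigma>: "singular_simplex p X \<sigma>" using assms by auto
    show "lin (P p) (sg (frag_of (lft p \<sigma>)) (wt' (\<sigma> (vx 0)))) = sg \<sigma> 1"
      using lft(2,4)[OF \<sigma>] by (simp add: lin_simps P_simps mult.commute)
  qed
  then show ?thesis by (simp add: lin_id)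
qed

lemma Psi_gens: "tch p X y \<Longrightarrow> Psi p y \<in> tensor_gens p X x0"
  unfolding Psi_def using lft(1) by (intro tensor_gens_lin) (auto simp: singular_chain_of)

lemma Psi_A: assumes "tch p (subtopology X A) a" shows "Psi p a \<in> rel p"
  unfolding Psi_def
proof (rule rel_lin)
  fix \<sigma> assume "\<sigma> \<in> ks a"
  then have \<sigma>: "singular_simplex p X \<sigma>" "\<sigma> ` standard_simplex p \<subseteq> A"
    using assms unfolding singular_simplex_subtopology by auto
  have v: "\<sigma> (vx 0) \<in> topspace X" using singular_simplex_vx[OF \<sigma>(1)] by simp
  have "lft p \<sigma> y \<in> cover_fibre X x0 A" if y: "y \<in> standard_simplex p" for y
  proof -
    obtain \<gamma>' where "\<gamma>' \<in> paths_from X x0" "\<gamma>' 1 = \<sigma> y" "lift_simplex X (\<gamma> (\<sigma> (vx 0))) p \<sigma> y = path_class X \<gamma>'"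
      using lift_simplex_class[OF \<sigma>(1) gam(1)[OF v] gam(2)[OF v] y] by metis
    then show ?thesis using \<sigma>(2) y unfolding lft_def cover_fibre_def by blast
  qed
  then have "singular_simplex p (subtopology E (cover_fibre X x0 A)) (lft p \<sigma>)"
    using lft(1)[OF \<sigma>(1)] by (auto simp: singular_simplex_subtopology)
  then have "sg (frag_of (lft p \<sigma>)) 1 \<in> rel p" by (intro rel_sub) (simp add: singular_chain_of)
  from rel_simps(5)[OF this, of "wt' (\<sigma> (vx 0))"]
  show "sg (frag_of (lft p \<sigma>)) (wt' (\<sigma> (vx 0))) \<in> rel p" by simp
qed

lemma Psi_P: assumes "singular_chain p E c" shows "sg c 1 - Psi p (P p c) \<in> rel p"
proof -
  have "singular_chain p E c \<and> sg c 1 - Psi p (P p c) \<in> rel p"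
    using assms[unfolded singular_chain_def]
  proof (induction c rule: frag_induction)
    case zero
    \<comment> \<open>In the free module on chains the zero chain is an honest basis element; the
      additivity relation for \<open>0 + 0\<close> is its negative.\<close>
    have "sg (0 + 0) 1 - sg 0 1 - sg 0 1 \<in> rel p" by (rule rel_add) auto
    from rel_simps(3)[OF this] have "sg 0 1 \<in> rel p" by simp
    then show ?case by (simp add: P_simps lmap_simps[OF lmap_Psi])
  next
    case (one \<sigma>)
    then have \<sigma>: "singular_simplex p E \<sigma>" by simp
    let ?s = "simplex_map p cproj \<sigma>" and ?x = "cproj (\<sigma> (vx 0))"
    have v: "\<sigma> (vx 0) \<in> topspace E" using singular_simplex_vx[OF \<sigma>] by simp
    then have x: "?x \<in> topspace X" using continuous_cproj[of X x0] by (auto simp: continuous_map_def)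
    obtain \<gamma>' where g': "\<gamma>' \<in> paths_from X x0" "\<sigma> (vx 0) = path_class X \<gamma>'" "\<gamma>' \<in> \<sigma> (vx 0)" using v by (rule cover_point)
    let ?d = "pc \<gamma>' - pc (\<gamma> ?x)" let ?h = "homologous_rel_set 1 X {} ?d"
    have p: "pathin X \<gamma>'" "\<gamma>' 0 = x0" "\<gamma>' 1 = ?x" "pathin X (\<gamma> ?x)" "\<gamma> ?x 0 = x0" "\<gamma> ?x 1 = ?x"
      using g' gam[OF x] \<gamma>[OF x] cproj_class[OF paths_fromD(1)[OF g'(1)]] by (auto simp: paths_from_def)
    have cyc: "singular_relcycle 1 X {} ?d"
      unfolding singular_cycle using p singular_chain_diff[OF pc_chain[OF p(1)] pc_chain[OF p(4)]]
      by (simp add: chain_boundary_diff pc_boundary[OF p(1)] pc_boundary[OF p(4)])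
    have h: "?h \<in> carrier (homology_group 1 X)"
      using cyc carrier_relative_homology_group[of 1 X "{}"] by auto
    have s: "singular_simplex p X ?s" by (rule singular_simplex_simplex_map[OF \<sigma> continuous_cproj])
    \<comment> \<open>An arbitrary simplex of the cover is a translate of the selected lift, and the
      factor that its covering transformation contributes is the product of \<open>weight\<close>
      and \<open>wt'\<close>.\<close>
    have eq: "\<sigma> = simplex_map p (deck X ?h) (lft p ?s)"
      unfolding lft_def using simplex_eq_deck_lift[OF X(1) \<sigma> gam(1)[OF x] _ g'(3)] gam(2)[OF x] by simp
    have "\<phi> ?h = \<theta> ?d" by (rule \<phi>\<theta>[OF cyc])
    also have "\<dots> = \<theta> (pc \<gamma>') * wt' ?x"
      using char_add[OF \<theta> pc_chain[OF p(1)] singular_chain_minus[THEN iffD2, OF pc_chain[OF p(4)]]]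
      by (simp add: wt'_def)
    finally have ph: "\<phi> ?h = weight \<theta> (\<sigma> (vx 0)) * wt' ?x"
      using weight_class[OF p(1) \<theta>] g'(2) by simp
    have "sg (chain_map p (deck X ?h) (frag_of (lft p ?s))) 1 - sg (frag_of (lft p ?s)) (\<phi> ?h) \<in> rel p"
      using lft(1)[OF s] by (intro rel_deck[OF h]) (simp add: singular_chain_of)
    moreover have "chain_map p (deck X ?h) (frag_of (lft p ?s)) = frag_of \<sigma>" using eq by simp
    moreover have "Psi p (P p (frag_of \<sigma>)) = sg (frag_of (lft p ?s)) (\<phi> ?h)"
      by (simp add: P_simps Psi_def lin_simps ph)
    ultimately show ?case using \<sigma> by (simp add: singular_chain_of)
  next
    case (diff a b)
    have ab: "singular_chain p E (a - b)" "singular_chain p E b" using diff by (auto intro: singular_chain_diff)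
    \<comment> \<open>The relations speak of sums, so a difference is treated by applying additivity
      to \<open>a - b\<close> and \<open>b\<close>.\<close>
    have "sg ((a - b) + b) 1 - sg (a - b) 1 - sg b 1 \<in> rel p" by (rule rel_add[OF ab])
    then have 1: "sg a 1 - sg (a - b) 1 - sg b 1 \<in> rel p" by simp
    have 2: "sg a 1 - Psi p (P p a) \<in> rel p" "sg b 1 - Psi p (P p b) \<in> rel p" using diff by auto
    have eq: "sg (a - b) 1 - Psi p (P p (a - b)) =
      (sg a 1 - Psi p (P p a)) - (sg b 1 - Psi p (P p b)) - (sg a 1 - sg (a - b) 1 - sg b 1)"
      by (simp add: P_simps lmap_simps[OF lmap_Psi])
    show ?case unfolding eq using rel_simps(2)[OF rel_simps(2)[OF 2] 1] ab by blast
  qed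
  then show ?thesis by blast
qed

lemma Psi_Phi: assumes "z \<in> tensor_gens p X x0" shows "z - Psi p (Phi p z) \<in> rel p"
proof -
  have "z - Psi p (Phi p z) = lin (\<lambda>c. sg c 1 - Psi p (P p c)) z"
    unfolding Phi_def Psi_def lin_lext by (simp add: lext_fun_diff lin_id)
  also have "\<dots> \<in> rel p"
    using assms by (intro rel_lin Psi_P) (auto simp: tensor_gens_def)
  finally show ?thesis .
qed

lemma boundaries_imp:
  assumes "z \<in> tboundaries1 X x0 A \<phi>"
  shows "\<exists>w a. tch 2 X w \<and> tch 1 (subtopology X A) a \<and> Phi 1 z = tbd \<theta> 2 w + a"
proof -
  obtain w n where w: "z = tensor_map (chain_boundary 2) w + n" "w \<in> tensor_gens 2 X x0" "n \<in> rel 1"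
    using assms by (auto simp: tboundaries1_def)
  have "Phi 1 z = tbd \<theta> 2 (Phi 2 w) + Phi 1 n"
    unfolding w(1) lmap_simps[OF lmap_Phi] using Phi_boundary[OF w(2)] by (simp add: One_nat_def)
  moreover have "tch 2 X (Phi 2 w)"
    unfolding Phi_def using w(2)
    by (intro keys_lext tch_push[OF _ continuous_cproj]) (auto simp: tensor_gens_def singular_chain_def)
  ultimately show ?thesis using Phi_rel[OF w(3)] by blast
qed

text \<open>The filling is lifted by \<open>Psi\<close>. Since \<open>Psi\<close> inverts
  \<open>Phi\<close> only modulo relations, the boundary of the lifted filling differs from
  \<open>z\<close> by relations, which are allowed in a boundary.\<close>

lemma boundaries_if:
  assumes z: "z \<in> tensor_gens 1 X x0" and w: "tch 2 X w" and a: "tch 1 (subtopology X A) a"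
    and eq: "Phi 1 z = tbd \<theta> 2 w + a"
  shows "z \<in> tboundaries1 X x0 A \<phi>"
proof -
  let ?w = "Psi 2 w"
  have w': "?w \<in> tensor_gens 2 X x0" by (rule Psi_gens[OF w])
  let ?b = "tensor_map (chain_boundary 2) ?w"
  have b: "?b \<in> tensor_gens 1 X x0"
    unfolding tensor_map_lin using w' singular_chain_boundary[of 2]
    by (intro tensor_gens_lin) (auto simp: tensor_gens_def One_nat_def)
  have "Phi 1 ?b = tbd \<theta> 2 w"
    using Phi_boundary[OF w'] Phi_Psi[OF w] by (simp add: One_nat_def)
  then have 1: "?b - Psi 1 (tbd \<theta> 2 w) \<in> rel 1" using Psi_Phi[OF b] by simp
  have 2: "z - (Psi 1 (tbd \<theta> 2 w) + Psi 1 a) \<in> rel 1"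
    using Psi_Phi[OF z] eq by (simp add: lmap_simps[OF lmap_Psi])
  have "z - ?b = (z - (Psi 1 (tbd \<theta> 2 w) + Psi 1 a)) + Psi 1 a - (?b - Psi 1 (tbd \<theta> 2 w))" by simp
  then have "z - ?b \<in> rel 1" using rel_simps(2)[OF rel_simps(1)[OF 2 Psi_A[OF a]] 1] by simp
  moreover have "z = ?b + (z - ?b)" by simp
  ultimately show ?thesis unfolding tboundaries1_def using w' by blast
qed

end

subsection \<open>Manifolds and gluings\<close>

text \<open>A chart identifies neighbourhoods of a point with open subsets of a half-space, a convex
  subset of a product of lines; the preimage of a small convex neighbourhood there is
  contractible.\<close>

lemma manifold_loc_acyc:
  assumes "compact_manifold n X" shows "loc_acyc X"
  unfolding loc_acyc_def
proof (intro ballI allI impI)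
  fix x U0 assume x: "x \<in> topspace X" and U0: "openin X U0" "x \<in> U0"
  define H :: "(nat \<Rightarrow> real) set" where "H = {x. \<forall>i\<ge>n. x i = 0} \<inter> {x. 0 \<le> x 0}"
  have Hs: "half_space n = subtopology (powertop_real UNIV) H"
    by (simp add: half_space_def Euclidean_space_def subtopology_subtopology H_def)
  have Hc: "\<forall>x\<in>H. \<forall>y\<in>H. \<forall>u. 0 \<le> u \<longrightarrow> u \<le> 1 \<longrightarrow> (\<lambda>i. (1 - u) * x i + u * y i) \<in> H"
    by (auto simp: H_def)
  obtain U V where U: "openin X U" "x \<in> U" "openin (half_space n) V"
    "subtopology X U homeomorphic_space subtopology (half_space n) V"
    using assms x unfolding compact_manifold_def locally_like_def by blast
  then obtain f where f: "homeomorphic_map (subtopology X U) (subtopology (half_space n) V) f"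
    unfolding homeomorphic_space by blast
  have US: "U \<subseteq> topspace X" "V \<subseteq> topspace (half_space n)" using U openin_subset by auto
  have "openin (subtopology X U) (U \<inter> U0)" using U0(1) by (auto simp: openin_subtopology_alt)
  then have "openin (subtopology (half_space n) V) (f ` (U \<inter> U0))"
    using f US by (subst (asm) homeomorphic_map_openness[OF f, symmetric]) auto
  then have o: "openin (subtopology (powertop_real UNIV) H) (f ` (U \<inter> U0))"
    using U(3) unfolding Hs[symmetric] by (meson openin_trans_full)
  have fx: "f x \<in> f ` (U \<inter> U0)" using U U0 by blast
  obtain N where N: "openin (subtopology (powertop_real UNIV) H) N" "f x \<in> N" "N \<subseteq> f ` (U \<inter> U0)"
    "\<And>x z u. x \<in> N \<Longrightarrow> z \<in> N \<Longrightarrow> 0 \<le> u \<Longrightarrow> u \<le> 1 \<Longrightarrow> (\<lambda>i. (1 - u) * x i + u * z i) \<in> N"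
    by (rule openin_convex[OF Hc o fx]) (rule that)
  define A where "A = {y \<in> U. f y \<in> N}"
  have finj: "inj_on f U" using f US by (auto simp: homeomorphic_map_def homeomorphic_imp_injective_map[OF f, simplified] Int_absorb1 dest: homeomorphic_imp_injective_map)
  have fA: "f ` A = N" using N(3) by (auto simp: A_def)
  have AU: "A \<subseteq> U0"
  proof
    fix y assume y: "y \<in> A"
    then obtain z where "z \<in> U" "z \<in> U0" "f y = f z" using N(3) by (auto simp: A_def)
    then show "y \<in> U0" using finj y by (auto simp: A_def inj_on_def)
  qed
  have NV: "N \<subseteq> V" using N(3) homeomorphic_imp_surjective_map[OF f] US by auto
  have cf: "continuous_map (subtopology X U) (subtopology (half_space n) V) f" using f by (rule homeomorphic_imp_continuous_map)
  have "openin (subtopology (half_space n) V) N" using N(1) NV Hs by (metis openin_subset_topspace_eq openin_open_subtopology U(3))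
  then have "openin (subtopology X U) {y \<in> topspace (subtopology X U). f y \<in> N}" by (rule openin_continuous_map_preimage[OF cf])
  moreover have "{y \<in> topspace (subtopology X U). f y \<in> N} = A" using US by (auto simp: A_def)
  ultimately have oA: "openin X A" using U(1) by (metis openin_trans_full)
  have "homeomorphic_map (subtopology (subtopology X U) A) (subtopology (subtopology (half_space n) V) N) f"
  proof (rule homeomorphic_map_subtopologies[OF f])
    have "topspace (subtopology X U) \<inter> A = A" "topspace (subtopology (half_space n) V) \<inter> N = N"
      using US NV by (auto simp: A_def)
    then show "f ` (topspace (subtopology X U) \<inter> A) = topspace (subtopology (half_space n) V) \<inter> N" using fA by simp
  qed
  moreover have "subtopology (subtopology X U) A = subtopology X A"
    by (simp add: subtopology_subtopology A_def Int_absorb1 Collect_conj_eq inf.absorb2)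
  moreover have "subtopology (subtopology (half_space n) V) N = subtopology (powertop_real UNIV) N"
    using NV N(1) openin_subset[OF N(1)] by (simp add: Hs subtopology_subtopology inf.absorb2)
  ultimately have "subtopology X A homeomorphic_space subtopology (powertop_real UNIV) N"
    unfolding homeomorphic_space by metis
  moreover have "contractible_space (subtopology (powertop_real UNIV) N)" by (rule contractible_convex) (rule N(4))
  ultimately have "contractible_space (subtopology X A)" using homeomorphic_space_contractibility by blast
  then have "acyc (subtopology X A)" by (rule contractible_imp_acyc)
  moreover have "x \<in> A" using U(2) N(2) by (simp add: A_def)
  ultimately show "\<exists>V. openin X V \<and> x \<in> V \<and> V \<subseteq> U0 \<and> acyc (subtopology X V)" using oA AU by blast
qed

section \<open>Disjoint sums, quotients and the gluing of two pieces\<close>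

lemma topspace_disjoint_sum: "topspace (disjoint_sum X Y) = Inl ` topspace X \<union> Inr ` topspace Y"
proof
  have "openin (disjoint_sum X Y) (Inl ` topspace X \<union> Inr ` topspace Y)"
  proof -
    have "Inl -` (Inl ` topspace X \<union> Inr ` topspace Y) = topspace X" "Inr -` (Inl ` topspace X \<union> Inr ` topspace Y) = topspace Y"
      by auto
    then show ?thesis by (simp add: openin_disjoint_sum)
  qed
  then show "Inl ` topspace X \<union> Inr ` topspace Y \<subseteq> topspace (disjoint_sum X Y)" by (rule openin_subset)
  show "topspace (disjoint_sum X Y) \<subseteq> Inl ` topspace X \<union> Inr ` topspace Y"
  proof
    fix z assume z: "z \<in> topspace (disjoint_sum X Y)"
    have "openin (disjoint_sum X Y) (topspace (disjoint_sum X Y))" by simp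
    then have "Inl -` topspace (disjoint_sum X Y) \<subseteq> topspace X" "Inr -` topspace (disjoint_sum X Y) \<subseteq> topspace Y"
      unfolding openin_disjoint_sum using openin_subset by blast+
    then show "z \<in> Inl ` topspace X \<union> Inr ` topspace Y" using z by (cases z) auto
  qed
qed

lemma continuous_Inl: "continuous_map X (disjoint_sum X Y) Inl"
  and continuous_Inr: "continuous_map Y (disjoint_sum X Y) Inr"
proof -
  have "{x \<in> topspace X. Inl x \<in> U} = Inl -` U" "{y \<in> topspace Y. Inr y \<in> U} = Inr -` U"
    if "openin (disjoint_sum X Y) U" for U
    using that openin_subset unfolding openin_disjoint_sum by fastforce+
  then show "continuous_map X (disjoint_sum X Y) Inl" "continuous_map Y (disjoint_sum X Y) Inr"
    unfolding continuous_map_def topspace_disjoint_sum by (auto simp: openin_disjoint_sum)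
qed

lemma topspace_quotient_space: "topspace (quotient_space X E) = topspace X // gluing X E"
proof
  have "\<Union>(topspace X // gluing X E) = topspace X" by (rule Union_quotient[OF equiv_gluing])
  then have "openin (quotient_space X E) (topspace X // gluing X E)" by (simp add: openin_quotient_space)
  then show "topspace X // gluing X E \<subseteq> topspace (quotient_space X E)" by (rule openin_subset)
  show "topspace (quotient_space X E) \<subseteq> topspace X // gluing X E"
    using openin_topspace[of "quotient_space X E"] unfolding openin_quotient_space by blast
qed

lemma glue_class_in: "x \<in> topspace X \<Longrightarrow> glue_class X E x \<in> topspace X // gluing X E"
  by (simp add: glue_class_def quotientI)

lemma continuous_glue_class: "continuous_map X (quotient_space X E) (glue_class X E)"
  unfolding continuous_map_def topspace_quotient_space
proof (intro conjI allI impI)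
  show "glue_class X E \<in> topspace X \<rightarrow> topspace X // gluing X E" by (auto simp: glue_class_in)
  fix U assume U: "openin (quotient_space X E) U"
  then have U': "U \<subseteq> topspace X // gluing X E" "openin X (\<Union>U)" by (auto simp: openin_quotient_space)
  have "{x \<in> topspace X. glue_class X E x \<in> U} = \<Union>U"
  proof
    show "{x \<in> topspace X. glue_class X E x \<in> U} \<subseteq> \<Union>U"
    proof
      fix x assume "x \<in> {x \<in> topspace X. glue_class X E x \<in> U}"
      then have "x \<in> glue_class X E x" "glue_class X E x \<in> U"
        using equiv_class_self[OF equiv_gluing] by (auto simp: glue_class_def)
      then show "x \<in> \<Union>U" by blast
    qed
    show "\<Union>U \<subseteq> {x \<in> topspace X. glue_class X E x \<in> U}"
    proof
      fix x assume "x \<in> \<Union>U"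
      then obtain C where C: "C \<in> U" "x \<in> C" by blast
      then obtain y where "y \<in> topspace X" "C = gluing X E `` {y}" using U'(1) by (meson quotientE subsetD)
      then have "(y, x) \<in> gluing X E" using C by blast
      then have "gluing X E `` {y} = gluing X E `` {x}" "x \<in> topspace X"
        by (rule equiv_class_eq[OF equiv_gluing]) (use \<open>(y, x) \<in> gluing X E\<close> in \<open>simp add: gluing_def\<close>)
      then show "x \<in> {x \<in> topspace X. glue_class X E x \<in> U}"
        using C \<open>C = gluing X E `` {y}\<close> by (simp add: glue_class_def)
    qed
  qed
  then show "openin X {x \<in> topspace X. glue_class X E x \<in> U}" using U'(2) by simp
qed

lemma glue_class_eq:
  assumes "(x, y) \<in> E" "x \<in> topspace X" "y \<in> topspace X"
  shows "glue_class X E x = glue_class X E y"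
  unfolding glue_class_def
  by (rule equiv_class_eq[OF equiv_gluing]) (use assms in \<open>auto simp: gluing_def\<close>)

lemma glue_class_eqD:
  assumes "glue_class X E x = glue_class X E y" "x \<in> topspace X" "y \<in> topspace X"
  shows "(x, y) \<in> (E \<union> E\<inverse>)\<^sup>*"
  using eq_equiv_class[OF assms(1)[unfolded glue_class_def] equiv_gluing assms(3)] by (simp add: gluing_def)

text \<open>With both parametrisations injective, a second identification can only undo the first
  one, so zigzags collapse and each class has at most one point on either side.\<close>

lemma double_glue_path:
  assumes "(z, z') \<in> ({(Inl (p x), Inr (q x)) | x. x \<in> S} \<union> {(Inl (p x), Inr (q x)) | x. x \<in> S}\<inverse>)\<^sup>*"
    and "inj_on p S" "inj_on q S"
  shows "z' = z \<or> (\<exists>x\<in>S. z = Inl (p x) \<and> z' = Inr (q x)) \<or> (\<exists>x\<in>S. z = Inr (q x) \<and> z' = Inl (p x))"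
  using assms(1)
proof (induction rule: rtrancl_induct)
  case (step y z')
  have pq: "p a = p b \<Longrightarrow> a \<in> S \<Longrightarrow> b \<in> S \<Longrightarrow> a = b" "q a = q b \<Longrightarrow> a \<in> S \<Longrightarrow> b \<in> S \<Longrightarrow> a = b" for a b
    using assms(2,3) by (auto simp: inj_on_def)
  from step(2) obtain a where a: "a \<in> S" "y = Inl (p a) \<and> z' = Inr (q a) \<or> y = Inr (q a) \<and> z' = Inl (p a)" by auto
  from step.IH show ?case
  proof (elim disjE bexE conjE)
    assume "y = z" then show ?thesis using a by blast
  next
    fix x assume x: "x \<in> S" "z = Inl (p x)" "y = Inr (q x)"
    then have "q a = q x" "z' = Inl (p a)" using a(2) by auto
    then show ?thesis using pq(2) a(1) x by blast
  next
    fix x assume x: "x \<in> S" "z = Inr (q x)" "y = Inl (p x)"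
    then have "p a = p x" "z' = Inr (q a)" using a(2) by auto
    then show ?thesis using pq(1) a(1) x by blast
  qed
qed simp

lemma homology_iso_equiv:
  assumes "homology_iso M W i" shows "homology_equiv W M i"
proof -
  have c: "continuous_map M W i" and iso: "hom_induced p M {} W {} i \<in> iso (homology_group p M) (homology_group p W)" for p
    using assms by (auto simp: homology_iso_def)
  have hi: "hom_induced (int p) M {} W {} i (homologous_rel_set p M {} z) = homologous_rel_set p W {} (chain_map p i z)"
    if "singular_relcycle p M {} z" for p z
    using hom_induced_chain_map[OF c _ that] by simp
  have car: "homologous_rel_set p Y {} z \<in> carrier (homology_group (int p) Y)" if "singular_relcycle p Y {} z" for p z and Y :: "'z topology"
    using that carrier_relative_homology_group[of p Y "{}"] by auto
  show ?thesis
  proof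
    show "continuous_map M W i" by (rule c)
    fix p z assume z: "singular_relcycle p M {} z" and b: "singular_relboundary p W {} (chain_map p i z)"
    have "hom_induced (int p) M {} W {} i (homologous_rel_set p M {} z) = hom_induced (int p) M {} W {} i (homologous_rel_set p M {} 0)"
    proof -
      have "homologous_rel_set p W {} (chain_map p i z) = homologous_rel_set p W {} 0"
        by (subst homologous_rel_set_eq) (simp add: homologous_rel_def b)
      then show ?thesis using hi[OF z] hi[of p 0] by simp
    qed
    moreover have "inj_on (hom_induced (int p) M {} W {} i) (carrier (homology_group (int p) M))"
      using iso[of "int p"] by (simp add: iso_def bij_betw_def)
    ultimately have "homologous_rel_set p M {} z = homologous_rel_set p M {} 0"
      using car[OF z] car[of p M 0] by (auto dest: inj_onD)
    then have "homologous_rel p M {} z 0" by (subst (asm) homologous_rel_set_eq)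
    then show "singular_relboundary p M {} z" by (simp add: homologous_rel_def)
  next
    fix p w assume w: "singular_relcycle p W {} w"
    have "hom_induced (int p) M {} W {} i ` carrier (homology_group (int p) M) = carrier (homology_group (int p) W)"
      using iso[of "int p"] by (simp add: iso_def bij_betw_def)
    then have "homologous_rel_set p W {} w \<in> hom_induced (int p) M {} W {} i ` carrier (homology_group (int p) M)"
      using car[OF w] by (simp only:)
    then obtain h where h: "homologous_rel_set p W {} w = hom_induced (int p) M {} W {} i h" "h \<in> carrier (homology_group (int p) M)"
      by (rule imageE)
    then obtain y where y: "singular_relcycle p M {} y" "h = homologous_rel_set p M {} y"
      using carrier_relative_homology_group[of p M "{}"] h(2) by auto
    then have "homologous_rel_set p W {} w = homologous_rel_set p W {} (chain_map p i y)"
      using h(1) hi[OF y(1)] by (simp only:)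
    then have "homologous_rel p W {} w (chain_map p i y)" by (subst (asm) homologous_rel_set_eq)
    then have "singular_relboundary p W {} (w - chain_map p i y)" by (simp add: homologous_rel_def)
    then show "\<exists>y. singular_relcycle p M {} y \<and> singular_relboundary p W {} (w - chain_map p i y)" using y(1) by blast
  qed
qed

lemma manifold_path_connected:
  "compact_manifold n X \<Longrightarrow> connected_space X \<Longrightarrow> path_connected_space X"
  by (intro loc_acyc_path_connected manifold_loc_acyc)

section \<open>Maps induced on covers and on twisted chains\<close>

lemma push_chain_map: "push of_int p h f (chain_map p L c) = push of_int p (h \<circ> L) (f \<circ> L) c"
proof -
  have "simplex_map p h (simplex_map p L \<sigma>) = simplex_map p (h \<circ> L) \<sigma>" for \<sigma>
    by (simp add: simplex_map_compose)
  then show ?thesis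
    unfolding push_def chain_map_def lext_frag_extend[OF urh_of_int]
    by (simp add: lext_frag_of[OF urh_of_int] o_def)
qed

lemma push_cong:
  assumes "singular_chain p E c" "\<And>e. e \<in> topspace E \<Longrightarrow> h e = h' e" "\<And>e. e \<in> topspace E \<Longrightarrow> f e = f' e"
  shows "push of_int p h f c = push of_int p h' f' c"
  unfolding push_def
proof (rule lext_cong)
  fix \<tau> assume "\<tau> \<in> ks c"
  then have \<tau>: "singular_simplex p E \<tau>" using assms(1) by (auto simp: singular_chain_def)
  then have "\<tau> (vx 0) \<in> topspace E" using singular_simplex_vx by blast
  moreover have "simplex_map p h \<tau> = simplex_map p h' \<tau>" by (rule simplex_map_eq[OF \<tau> assms(2)])
  ultimately show "sg (simplex_map p h \<tau>) (f (\<tau> (vx 0))) = sg (simplex_map p h' \<tau>) (f' (\<tau> (vx 0)))"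
    using assms(3) by simp
qed

lemma incl_push: "incl p i (push of_int p h f c) = push of_int p (i \<circ> h) f c"
proof -
  have "simplex_map p i (simplex_map p h \<sigma>) = simplex_map p (i \<circ> h) \<sigma>" for \<sigma>
    by (simp add: simplex_map_compose)
  then show ?thesis
    unfolding push_def lin_lext by (simp add: lin_simps)
qed

lemma bnd_chain_map:
  assumes "bnd X c" "continuous_map X Y f" shows "bnd Y (chain_map 1 f c)"
  using singular_relboundary_chain_map[OF assms(1,2)] by fastforce

text \<open>\<open>S\<close> stands for a bottom or top surface and \<open>f\<close> for
  \<open>m_minus\<close> or \<open>m_plus\<close>. The path \<open>\<alpha>\<close> accounts for the
  cover of \<open>M\<close> being based at the bottom: it is constant for the bottom surface and the
  vertical arc for the top one.\<close>

locale induced_map = twisted_space M x0 \<gamma> \<phi> \<theta> A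
  for M :: "'a topology" and x0 \<gamma> and \<phi> :: "'a chain set \<Rightarrow> 'r::comm_ring_1" and \<theta> A +
  fixes S :: "'s topology" and s0 :: 's and \<phi>S :: "'s chain set \<Rightarrow> 'r" and f :: "'s \<Rightarrow> 'a" and \<alpha> :: "real \<Rightarrow> 'a"
  assumes S: "path_connected_space S"
    and f: "continuous_map S M f"
    and \<alpha>: "pathin M \<alpha>" "\<alpha> 0 = x0" "\<alpha> 1 = f s0"
    and \<phi>S: "\<And>h. h \<in> carrier (homology_group 1 S) \<Longrightarrow> \<phi> (hom_induced 1 S {} M {} f h) = \<phi>S h"
    and A: "f s0 \<in> A"
begin

abbreviation "ES \<equiv> abelian_cover S s0"
abbreviation "L \<equiv> cover_lift M f \<alpha>"
abbreviation "relS p \<equiv> tensor_relations p S s0 {s0} \<phi>S"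

lemma push_path:
  assumes "\<beta> \<in> paths_from S s0"
  shows "pathin M (f \<circ> \<beta>)" "\<alpha> 1 = (f \<circ> \<beta>) 0" "joinp \<alpha> (f \<circ> \<beta>) \<in> paths_from M x0"
    "bnd M (pc (joinp \<alpha> (f \<circ> \<beta>)) - (pc \<alpha> + pc (f \<circ> \<beta>)))"
proof -
  show 1: "pathin M (f \<circ> \<beta>)" "\<alpha> 1 = (f \<circ> \<beta>) 0"
    using pathin_compose[OF paths_fromD(1)[OF assms] f] paths_fromD(2)[OF assms] \<alpha> by auto
  show "joinp \<alpha> (f \<circ> \<beta>) \<in> paths_from M x0"
    unfolding paths_from_def using pathin_joinp[OF \<alpha>(1) 1] \<alpha>(2) by (simp del: o_apply add: joinp_ends)
  show "bnd M (pc (joinp \<alpha> (f \<circ> \<beta>)) - (pc \<alpha> + pc (f \<circ> \<beta>)))" by (rule joinp_bnd[OF \<alpha>(1) 1])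
qed

lemma L_class:
  assumes b: "\<beta> \<in> paths_from S s0"
  shows "L (path_class S \<beta>) = path_class M (joinp \<alpha> (f \<circ> \<beta>))"
proof (rule Set.set_eqI)
  fix \<delta>
  note p = push_path[OF b]
  show "\<delta> \<in> L (path_class S \<beta>) \<longleftrightarrow> \<delta> \<in> path_class M (joinp \<alpha> (f \<circ> \<beta>))"
  proof
    assume "\<delta> \<in> L (path_class S \<beta>)"
    then obtain \<eta> where d: "pathin M \<delta>" "\<delta> 0 = \<alpha> 0" "\<eta> \<in> path_class S \<beta>" "\<delta> 1 = f (\<eta> 1)"
      "bnd M (pc \<delta> - (pc \<alpha> + pc (f \<circ> \<eta>)))" unfolding cover_lift_def hom_bnd by blast
    note e = path_classD[OF d(3)]
    have "bnd M (pc (f \<circ> \<eta>) - pc (f \<circ> \<beta>))"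
      using bnd_chain_map[OF e(4) f] by (simp add: chain_map_diff chain_map_pc)
    from bnd_diff[OF bnd_add[OF d(5) this] p(4)]
    have "bnd M (pc \<delta> - pc (joinp \<alpha> (f \<circ> \<beta>)))" by (simp add: algebra_simps)
    then show "\<delta> \<in> path_class M (joinp \<alpha> (f \<circ> \<beta>))" using d e by (intro path_classI) auto
  next
    assume "\<delta> \<in> path_class M (joinp \<alpha> (f \<circ> \<beta>))"
    note e = path_classD[OF this]
    have "bnd M (pc \<delta> - (pc \<alpha> + pc (f \<circ> \<beta>)))" using bnd_add[OF e(4) p(4)] by (simp add: algebra_simps)
    then show "\<delta> \<in> L (path_class S \<beta>)"
      unfolding cover_lift_def hom_bnd using e path_class_self[OF paths_fromD(1)[OF b]] by auto
  qed
qed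

lemma L_in: "e \<in> topspace ES \<Longrightarrow> L e \<in> topspace E"
  using push_path(3) L_class unfolding topspace_cover by auto

text \<open>Around a point mapped into a sheet over \<open>U\<close>, the sheet over the preimage of
  \<open>U\<close> is mapped into it: images of its short paths prolong the path within
  \<open>U\<close>.\<close>

lemma continuous_L: "continuous_map ES E L"
  unfolding abelian_cover_sheets[of M]
proof (rule continuous_on_generated_topo)
  show "L ` topspace ES \<subseteq> \<Union>(sheets M x0)"
    using L_in by (auto simp: abelian_cover_sheets[of M])
  fix Z assume "Z \<in> sheets M x0"
  then obtain U \<gamma>0 where Z: "Z = cover_sheet M U \<gamma>0" "openin M U" "\<gamma>0 \<in> paths_from M x0" "\<gamma>0 1 \<in> U"
    by (auto simp: sheets_def)
  let ?U = "{x \<in> topspace S. f x \<in> U}"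
  have U': "openin S ?U" by (rule openin_continuous_map_preimage[OF f Z(2)])
  show "openin ES (L -` Z \<inter> topspace ES)"
  proof (subst openin_subopen, intro ballI)
    fix e assume "e \<in> L -` Z \<inter> topspace ES"
    then have e: "L e \<in> Z" "e \<in> topspace ES" by auto
    obtain \<beta> where b: "\<beta> \<in> paths_from S s0" "e = path_class S \<beta>" using e(2) by (rule cover_point)
    note p = push_path[OF b(1)]
    obtain \<gamma>2 \<eta> where g2: "L e = path_class M \<gamma>2" "\<gamma>2 \<in> paths_from M (\<gamma>0 0)" "pathin (subtopology M U) \<eta>"
      "\<eta> 0 = \<gamma>0 1" "\<eta> 1 = \<gamma>2 1" "bnd M (pc \<gamma>2 - (pc \<gamma>0 + pc \<eta>))" using e(1) unfolding Z(1) by (rule cover_sheetE)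
    have "joinp \<alpha> (f \<circ> \<beta>) \<in> path_class M \<gamma>2"
      using g2(1) b(2) L_class[OF b(1)] path_class_self[OF paths_fromD(1)[OF p(3)]] by simp
    note c = path_classD[OF this]
    have b1: "f (\<beta> 1) \<in> U" using c(3) g2(5) pathin_in_subtopology[OF g2(3), of 1] by simp
    then have bU: "\<beta> 1 \<in> ?U" using pathin_in[OF paths_fromD(1)[OF b(1)], of 1] by simp
    have "L e' \<in> Z" if e': "e' \<in> cover_sheet S ?U \<beta>" for e'
    proof -
      obtain \<beta>' \<zeta> where b': "e' = path_class S \<beta>'" "\<beta>' \<in> paths_from S (\<beta> 0)" "pathin (subtopology S ?U) \<zeta>"
        "\<zeta> 0 = \<beta> 1" "\<zeta> 1 = \<beta>' 1" "bnd S (pc \<beta>' - (pc \<beta> + pc \<zeta>))" using e' by (rule cover_sheetE)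
      have b's: "\<beta>' \<in> paths_from S s0" using b'(2) b(1) by (simp add: paths_from_def)
      note p' = push_path[OF b's]
      have "continuous_map (subtopology S ?U) (subtopology M U) f"
        by (intro continuous_map_into_subtopology continuous_map_from_subtopology[OF f]) auto
      then have fz: "pathin (subtopology M U) (f \<circ> \<zeta>)" using pathin_compose[OF b'(3)] by blast
      have j: "\<eta> 1 = (f \<circ> \<zeta>) 0" using c(3) g2(5) b'(4) by simp
      have 1: "bnd M (pc (f \<circ> \<beta>') - (pc (f \<circ> \<beta>) + pc (f \<circ> \<zeta>)))"
        using bnd_chain_map[OF b'(6) f] by (simp add: chain_map_diff chain_map_add chain_map_pc)
      have 2: "bnd M (pc (joinp \<eta> (f \<circ> \<zeta>)) - (pc \<eta> + pc (f \<circ> \<zeta>)))"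
        by (rule bnd_subtopology[OF joinp_bnd[OF g2(3) fz j]])
      have "bnd M (pc (joinp \<alpha> (f \<circ> \<beta>')) - (pc \<gamma>0 + pc (joinp \<eta> (f \<circ> \<zeta>))))"
        using bnd_diff[OF bnd_add[OF bnd_add[OF bnd_add[OF p'(4) 1] c(4)] g2(6)] bnd_add[OF p(4) 2]]
        by (simp add: algebra_simps)
      moreover have "joinp \<alpha> (f \<circ> \<beta>') \<in> paths_from M (\<gamma>0 0)" using p'(3) Z(3) by (simp add: paths_from_def)
      ultimately have "path_class M (joinp \<alpha> (f \<circ> \<beta>')) \<in> cover_sheet M U \<gamma>0"
        using b'(5) g2(4) by (intro cover_sheetI[OF _ pathin_joinp[OF g2(3) fz j]]) (simp_all add: o_def)
      then show ?thesis using b'(1) L_class[OF b's] Z(1) by simp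
    qed
    moreover have o: "openin ES (cover_sheet S ?U \<beta>)" by (rule openin_sheet[OF U' b(1) bU])
    ultimately have "cover_sheet S ?U \<beta> \<subseteq> L -` Z \<inter> topspace ES" using openin_subset by blast
    then show "\<exists>T. openin ES T \<and> e \<in> T \<and> T \<subseteq> L -` Z \<inter> topspace ES"
      using o cover_sheet_self[OF b(1) U' bU] b(2) by blast
  qed
qed

lemma hom_induced_f:
  "singular_relcycle 1 S {} c \<Longrightarrow> hom_induced 1 S {} M {} f (homologous_rel_set 1 S {} c) = homologous_rel_set 1 M {} (chain_map 1 f c)"
  using hom_induced_chain_map[OF f, of "{}" "{}" 1 c] by simp

text \<open>Inserting a loop of class \<open>h\<close> in \<open>S\<close> inserts its image after
  \<open>\<alpha>\<close>; up to homology it does not matter where along the path the loop is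
  inserted.\<close>

lemma L_deck:
  assumes h: "h \<in> carrier (homology_group 1 S)" and e: "e \<in> topspace ES"
  shows "L (deck S h e) = deck M (hom_induced 1 S {} M {} f h) (L e)"
proof -
  obtain \<beta> where b: "\<beta> \<in> paths_from S s0" "e = path_class S \<beta>" using e by (rule cover_point)
  obtain \<beta>' c where b': "\<beta>' \<in> paths_from S s0" "\<beta>' 1 = \<beta> 1" "singular_relcycle 1 S {} c"
    "h = homologous_rel_set 1 S {} c" "bnd S (pc \<beta>' - pc \<beta> - c)" "deck S h (path_class S \<beta>) = path_class S \<beta>'"
    using deck_path[OF S h b(1)] .
  note p = push_path[OF b(1)] and p' = push_path[OF b'(1)]
  have "bnd M (pc (f \<circ> \<beta>') - pc (f \<circ> \<beta>) - chain_map 1 f c)"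
    using bnd_chain_map[OF b'(5) f] by (simp add: chain_map_diff chain_map_pc)
  then have "bnd M (pc (joinp \<alpha> (f \<circ> \<beta>')) - pc (joinp \<alpha> (f \<circ> \<beta>)) - chain_map 1 f c)"
    using bnd_diff[OF bnd_add[OF _ p'(4)] p(4)] by (fastforce simp: algebra_simps)
  then have "deck M (hom_induced 1 S {} M {} f h) (path_class M (joinp \<alpha> (f \<circ> \<beta>))) = path_class M (joinp \<alpha> (f \<circ> \<beta>'))"
    using b'(2) hom_induced_f[OF b'(3)] b'(4) by (intro deck_class[OF p(3) p'(3)]) auto
  then show ?thesis using b(2) b'(6) L_class[OF b(1)] L_class[OF b'(1)] by simp
qed

definition T :: "nat \<Rightarrow> ('s, 'r) tchain \<Rightarrow> ('a, 'r) tchain" where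
  "T p = tensor_map (chain_map p L)"

lemma T_simps: "T p (a + b) = T p a + T p b" "T p (a - b) = T p a - T p b" "T p (scale r a) = scale r (T p a)"
  "T p (sg c r) = sg (chain_map p L c) r" "T p 0 = 0" "T p (- a) = - T p a"
  by (simp_all add: T_def tensor_map_simps)

text \<open>Each family of relations goes to the same family: additivity as the lift
  \<open>L\<close> is continuous, translations by \<open>L_deck\<close> and \<open>\<phi>S\<close>,
  and chains over \<open>s0\<close> because \<open>f s0\<close> belongs to \<open>A\<close>.\<close>

lemma T_rel: assumes "n \<in> relS p" shows "T p n \<in> rel p"
proof (rule rel_induct[OF assms])
  fix c c' assume "singular_chain p ES c" "singular_chain p ES c'"
  then show "T p (sg (c + c') 1 - sg c 1 - sg c' 1) \<in> rel p"
    unfolding T_simps chain_map_add by (intro rel_add singular_chain_chain_map[OF _ continuous_L])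
next
  fix h c assume h: "h \<in> carrier (homology_group 1 S)" and c: "singular_chain p ES c"
  let ?h = "hom_induced 1 S {} M {} f h"
  have "chain_map p L (chain_map p (deck S h) c) = chain_map p (\<lambda>e. L (deck S h e)) c"
    by (simp add: fun_cong[OF chain_map_compose, unfolded o_apply, symmetric] comp_def)
  also have "\<dots> = chain_map p (\<lambda>e. deck M ?h (L e)) c"
    by (rule chain_map_eq[OF c L_deck[OF h]])
  also have "\<dots> = chain_map p (deck M ?h) (chain_map p L c)"
    by (simp add: fun_cong[OF chain_map_compose, unfolded o_apply, symmetric] comp_def)
  finally have eq: "chain_map p L (chain_map p (deck S h) c) = chain_map p (deck M ?h) (chain_map p L c)" .
  have "?h \<in> carrier (homology_group 1 M)" by (rule hom_induced_carrier)
  then have "sg (chain_map p (deck M ?h) (chain_map p L c)) 1 - sg (chain_map p L c) (\<phi> ?h) \<in> rel p"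
    by (intro rel_deck singular_chain_chain_map[OF c continuous_L])
  then show "T p (sg (chain_map p (deck S h) c) 1 - sg c (\<phi>S h)) \<in> rel p"
    unfolding T_simps eq \<phi>S[OF h] .
next
  fix c assume c: "singular_chain p (subtopology ES (cover_fibre S s0 {s0})) c"
  have "L e \<in> cover_fibre M x0 A" if e: "e \<in> cover_fibre S s0 {s0}" for e
  proof -
    obtain \<beta> where b: "e = path_class S \<beta>" "\<beta> \<in> paths_from S s0" "\<beta> 1 = s0" using e by (auto simp: cover_fibre_def)
    then show ?thesis using push_path(3)[OF b(2)] L_class[OF b(2)] A unfolding cover_fibre_def by force
  qed
  then have "continuous_map (subtopology ES (cover_fibre S s0 {s0})) (subtopology E (cover_fibre M x0 A)) L"
    by (intro continuous_map_into_subtopology continuous_map_from_subtopology continuous_L) auto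
  then show "T p (sg c 1) \<in> rel p"
    unfolding T_simps by (intro rel_sub singular_chain_chain_map[OF c])
qed (simp_all add: T_simps rel_simps)

lemma T_gens: "z \<in> tensor_gens p S s0 \<Longrightarrow> T p z \<in> tensor_gens p M x0"
  unfolding T_def tensor_map_lin
  by (intro tensor_gens_lin singular_chain_chain_map[OF _ continuous_L]) (auto simp: tensor_gens_def)

lemma T_boundary:
  assumes "z \<in> tensor_gens p S s0"
  shows "tensor_map (chain_boundary p) (T p z) = T (p - 1) (tensor_map (chain_boundary p) z)"
  unfolding T_def tensor_map_comp
  by (rule tensor_map_cong) (use assms chain_boundary_chain_map[of p ES _ L] in \<open>auto simp: tensor_gens_def One_nat_def\<close>)

lemma T_boundaries: assumes "z \<in> tboundaries1 S s0 {s0} \<phi>S" shows "T 1 z \<in> tboundaries1 M x0 A \<phi>"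
proof -
  obtain w n where w: "z = tensor_map (chain_boundary 2) w + n" "w \<in> tensor_gens 2 S s0" "n \<in> relS 1"
    using assms by (auto simp: tboundaries1_def)
  have "T 1 z = tensor_map (chain_boundary 2) (T 2 w) + T 1 n"
    unfolding w(1) T_simps T_boundary[OF w(2)] by (simp add: One_nat_def)
  then show ?thesis using T_gens[OF w(2)] T_rel[OF w(3)] by (auto simp: tboundaries1_def)
qed

lemma T_cycles: assumes "z \<in> tcycles1 S s0 {s0} \<phi>S" shows "T 1 z \<in> tcycles1 M x0 A \<phi>"
  using assms T_gens[of z 1] T_boundary[of z 1] T_rel[of "tensor_map (chain_boundary 1) z" 0]
  by (auto simp: tcycles1_def)

text \<open>The right-hand side involves \<open>M\<close> only through the composites of
  \<open>i\<close> with \<open>f\<close> and with \<open>\<alpha>\<close>. Two cobordisms whose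
  boundary parametrisations agree in \<open>W\<close> hence give the same chain of
  \<open>W\<close>.\<close>

lemma incl_Phi_T:
  assumes i: "continuous_map M W i" and \<theta>W: "char_sys W \<theta>W" "\<And>c. \<theta> c = \<theta>W (chain_map 1 i c)"
    and z: "z \<in> tensor_gens 1 S s0"
  shows "incl 1 i (Phi 1 (T 1 z)) = lin (\<lambda>c. push of_int 1 (i \<circ> f \<circ> cproj)
    (\<lambda>e. \<theta>W (pc (i \<circ> \<alpha>)) * \<theta>W (pc (i \<circ> f \<circ> (SOME \<beta>. \<beta> \<in> e)))) c) z"
proof -
  have pt: "(i \<circ> (cproj \<circ> L)) e = (i \<circ> f \<circ> cproj) e \<and>
     (weight \<theta> \<circ> L) e = \<theta>W (pc (i \<circ> \<alpha>)) * \<theta>W (pc (i \<circ> f \<circ> (SOME \<beta>. \<beta> \<in> e)))" if e: "e \<in> topspace ES" for e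
  proof -
    obtain \<beta>0 where "\<beta>0 \<in> e" using e by (rule cover_point)
    then have "(SOME \<beta>. \<beta> \<in> e) \<in> e" by (rule someI[where P="\<lambda>b. b \<in> e"])
    then obtain \<beta> where b: "\<beta> = (SOME \<beta>. \<beta> \<in> e)" "\<beta> \<in> paths_from S s0" "e = path_class S \<beta>"
      using cover_point_mem[OF e] by blast
    note p = push_path[OF b(2)]
    have Le: "L e = path_class M (joinp \<alpha> (f \<circ> \<beta>))" using L_class[OF b(2)] b(3) by simp
    have "cproj (L e) = f (\<beta> 1)" "cproj e = \<beta> 1"
      unfolding Le using cproj_class[OF paths_fromD(1)[OF p(3)]] cproj_class[OF paths_fromD(1)[OF b(2)]] b(3) by auto
    moreover have "weight \<theta> (L e) = \<theta> (pc \<alpha>) * \<theta> (pc (f \<circ> \<beta>))"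
    proof -
      have "weight \<theta> (L e) = \<theta> (pc (joinp \<alpha> (f \<circ> \<beta>)))"
        unfolding Le by (rule weight_class[OF paths_fromD(1)[OF p(3)] \<theta>])
      also have "\<dots> = \<theta> (pc \<alpha> + pc (f \<circ> \<beta>))"
        using p(4) pc_chain[OF \<alpha>(1)] pc_chain[OF p(1)]
        by (intro char_homologous[OF \<theta>]) (auto simp: hom_bnd intro: singular_chain_add)
      also have "\<dots> = \<theta> (pc \<alpha>) * \<theta> (pc (f \<circ> \<beta>))" by (rule char_add[OF \<theta> pc_chain[OF \<alpha>(1)] pc_chain[OF p(1)]])
      finally show ?thesis .
    qed
    ultimately show ?thesis using b(1) by (simp add: \<theta>W(2) chain_map_pc o_assoc)
  qed
  have "incl 1 i (Phi 1 (T 1 z)) = lin (\<lambda>c. push of_int 1 (i \<circ> (cproj \<circ> L)) (weight \<theta> \<circ> L) c) z"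
    unfolding Phi_def T_def tensor_map_lin lin_lext push_lext[OF urh_id]
    by (simp add: lin_simps push_chain_map incl_push o_assoc)
  also have "\<dots> = lin (\<lambda>c. push of_int 1 (i \<circ> f \<circ> cproj)
    (\<lambda>e. \<theta>W (pc (i \<circ> \<alpha>)) * \<theta>W (pc (i \<circ> f \<circ> (SOME \<beta>. \<beta> \<in> e)))) c) z"
    using pt z by (intro lext_cong push_cong[of 1 ES]) (auto simp: tensor_gens_def)
  finally show ?thesis .
qed

end

section \<open>Cosets modulo boundaries and the module operations on them\<close>

lemma tb_simps:
  "a \<in> tboundaries1 X x0 A \<phi> \<Longrightarrow> b \<in> tboundaries1 X x0 A \<phi> \<Longrightarrow> a + b \<in> tboundaries1 X x0 A \<phi>"
  "a \<in> tboundaries1 X x0 A \<phi> \<Longrightarrow> b \<in> tboundaries1 X x0 A \<phi> \<Longrightarrow> a - b \<in> tboundaries1 X x0 A \<phi>"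
  "a \<in> tboundaries1 X x0 A \<phi> \<Longrightarrow> scale r a \<in> tboundaries1 X x0 A \<phi>"
  "0 \<in> tboundaries1 X x0 A \<phi>"
proof -
  let ?B = "tboundaries1 X x0 A \<phi>"
  have I: "tensor_map (chain_boundary 2) w + n \<in> ?B" if "w \<in> tensor_gens 2 X x0" "n \<in> tensor_relations 1 X x0 A \<phi>" for w n
    using that by (auto simp: tboundaries1_def)
  have E: "\<exists>w n. a = tensor_map (chain_boundary 2) w + n \<and> w \<in> tensor_gens 2 X x0 \<and> n \<in> tensor_relations 1 X x0 A \<phi>" if "a \<in> ?B" for a
    using that by (auto simp: tboundaries1_def)
  show "0 \<in> ?B" using I[of 0 0] by (simp add: tensor_gens_simps rel_simps tensor_map_simps)
  show "scale r a \<in> ?B" if a: "a \<in> ?B"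
  proof -
    obtain w n where w: "a = tensor_map (chain_boundary 2) w + n" "w \<in> tensor_gens 2 X x0" "n \<in> tensor_relations 1 X x0 A \<phi>"
      using E[OF a] by blast
    show ?thesis using I[OF tensor_gens_simps(3)[OF w(2)] rel_simps(5)[OF w(3)], of r r]
      by (simp add: w(1) tensor_map_simps scale_add)
  qed
  show "a + b \<in> ?B" "a - b \<in> ?B" if a: "a \<in> ?B" and b: "b \<in> ?B"
  proof -
    obtain w n where w: "a = tensor_map (chain_boundary 2) w + n" "w \<in> tensor_gens 2 X x0" "n \<in> tensor_relations 1 X x0 A \<phi>"
      using E[OF a] by blast
    obtain v m where v: "b = tensor_map (chain_boundary 2) v + m" "v \<in> tensor_gens 2 X x0" "m \<in> tensor_relations 1 X x0 A \<phi>"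
      using E[OF b] by blast
    show "a + b \<in> ?B" using I[OF tensor_gens_simps(1)[OF w(2) v(2)] rel_simps(1)[OF w(3) v(3)]]
      by (simp add: w(1) v(1) tensor_map_simps algebra_simps)
    show "a - b \<in> ?B" using I[OF tensor_gens_simps(2)[OF w(2) v(2)] rel_simps(2)[OF w(3) v(3)]]
      by (simp add: w(1) v(1) tensor_map_simps algebra_simps)
  qed
qed

lemma tcycles_simps:
  "a \<in> tcycles1 X x0 A \<phi> \<Longrightarrow> b \<in> tcycles1 X x0 A \<phi> \<Longrightarrow> a + b \<in> tcycles1 X x0 A \<phi>"
  "a \<in> tcycles1 X x0 A \<phi> \<Longrightarrow> scale r a \<in> tcycles1 X x0 A \<phi>"
  by (simp_all add: tcycles1_def tensor_gens_simps tensor_map_simps rel_simps)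

lemma tcycles_minus: "a \<in> tcycles1 X x0 A \<phi> \<Longrightarrow> - a \<in> tcycles1 X x0 A \<phi>"
  using tcycles_simps(2)[of a X x0 A \<phi> "-1"] by (simp add: scale_m1)

definition tcoset :: "'a topology \<Rightarrow> 'a \<Rightarrow> 'a set \<Rightarrow> ('a chain set \<Rightarrow> 'r::comm_ring_1) \<Rightarrow> ('a, 'r) tchain \<Rightarrow> ('a, 'r) tchain set" where
  "tcoset X x0 A \<phi> u = (+) u ` tboundaries1 X x0 A \<phi>"

lemma mem_tcoset: "x \<in> tcoset X x0 A \<phi> u \<longleftrightarrow> x - u \<in> tboundaries1 X x0 A \<phi>"
  by (force simp: tcoset_def)

lemma tcoset_eq: "tcoset X x0 A \<phi> u = tcoset X x0 A \<phi> v \<longleftrightarrow> u - v \<in> tboundaries1 X x0 A \<phi>"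
proof
  assume "tcoset X x0 A \<phi> u = tcoset X x0 A \<phi> v"
  then show "u - v \<in> tboundaries1 X x0 A \<phi>"
    using mem_tcoset[of u X x0 A \<phi> u] mem_tcoset[of u X x0 A \<phi> v] by (simp add: tb_simps)
next
  assume a: "u - v \<in> tboundaries1 X x0 A \<phi>"
  show "tcoset X x0 A \<phi> u = tcoset X x0 A \<phi> v"
    using tb_simps(1)[OF _ a] tb_simps(2)[OF _ a] by (force simp: mem_tcoset)
qed

lemma tcoset_add: "{a + b | a b. a \<in> tcoset X x0 A \<phi> u \<and> b \<in> tcoset X x0 A \<phi> v} = tcoset X x0 A \<phi> (u + v)"
proof
  show "{a + b | a b. a \<in> tcoset X x0 A \<phi> u \<and> b \<in> tcoset X x0 A \<phi> v} \<subseteq> tcoset X x0 A \<phi> (u + v)"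
  proof clarify
    fix a b assume ab: "a \<in> tcoset X x0 A \<phi> u" "b \<in> tcoset X x0 A \<phi> v"
    have "a + b - (u + v) = (a - u) + (b - v)" by simp
    then show "a + b \<in> tcoset X x0 A \<phi> (u + v)" using ab tb_simps(1) unfolding mem_tcoset by metis
  qed
  show "tcoset X x0 A \<phi> (u + v) \<subseteq> {a + b | a b. a \<in> tcoset X x0 A \<phi> u \<and> b \<in> tcoset X x0 A \<phi> v}"
  proof
    fix x assume "x \<in> tcoset X x0 A \<phi> (u + v)"
    then have "x = (x - v) + v" "x - v \<in> tcoset X x0 A \<phi> u" "v \<in> tcoset X x0 A \<phi> v"
      by (simp_all add: mem_tcoset tb_simps algebra_simps)
    then show "x \<in> {a + b | a b. a \<in> tcoset X x0 A \<phi> u \<and> b \<in> tcoset X x0 A \<phi> v}" by blast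
  qed
qed

text \<open>Stated for a general additive \<open>T\<close>, since scalar multiplication and induced
  maps are formed by the same saturation with boundaries.\<close>

lemma tcoset_image:
  assumes T: "\<And>a b. T (a - b) = T a - T b" "\<And>b. b \<in> tboundaries1 X x0 A \<phi> \<Longrightarrow> T b \<in> tboundaries1 Y y0 A' \<phi>'"
  shows "{T a + b | a b. a \<in> tcoset X x0 A \<phi> u \<and> b \<in> tboundaries1 Y y0 A' \<phi>'} = tcoset Y y0 A' \<phi>' (T u)"
proof
  show "{T a + b | a b. a \<in> tcoset X x0 A \<phi> u \<and> b \<in> tboundaries1 Y y0 A' \<phi>'} \<subseteq> tcoset Y y0 A' \<phi>' (T u)"
  proof clarify
    fix a b assume a: "a \<in> tcoset X x0 A \<phi> u" and b: "b \<in> tboundaries1 Y y0 A' \<phi>'"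
    have "T a + b - T u = T (a - u) + b" by (simp add: T(1))
    then show "T a + b \<in> tcoset Y y0 A' \<phi>' (T u)" using a b T(2) tb_simps(1) unfolding mem_tcoset by metis
  qed
  show "tcoset Y y0 A' \<phi>' (T u) \<subseteq> {T a + b | a b. a \<in> tcoset X x0 A \<phi> u \<and> b \<in> tboundaries1 Y y0 A' \<phi>'}"
  proof
    fix x assume "x \<in> tcoset Y y0 A' \<phi>' (T u)"
    then have "x = T u + (x - T u)" "x - T u \<in> tboundaries1 Y y0 A' \<phi>'" "u \<in> tcoset X x0 A \<phi> u"
      by (simp_all add: mem_tcoset tb_simps)
    then show "x \<in> {T a + b | a b. a \<in> tcoset X x0 A \<phi> u \<and> b \<in> tboundaries1 Y y0 A' \<phi>'}" by blast
  qed
qed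

lemma twisted_H1_simps:
  "carrier (twisted_H1 X x0 A \<phi>) = tcoset X x0 A \<phi> ` tcycles1 X x0 A \<phi>"
  "\<zero>\<^bsub>twisted_H1 X x0 A \<phi>\<^esub> = tcoset X x0 A \<phi> 0"
  "tcoset X x0 A \<phi> u \<oplus>\<^bsub>twisted_H1 X x0 A \<phi>\<^esub> tcoset X x0 A \<phi> v = tcoset X x0 A \<phi> (u + v)"
  "r \<odot>\<^bsub>twisted_H1 X x0 A \<phi>\<^esub> tcoset X x0 A \<phi> u = tcoset X x0 A \<phi> (scale r u)"
proof -
  show "carrier (twisted_H1 X x0 A \<phi>) = tcoset X x0 A \<phi> ` tcycles1 X x0 A \<phi>"
    by (auto simp: twisted_H1_def Let_def tcoset_def)
  show "\<zero>\<^bsub>twisted_H1 X x0 A \<phi>\<^esub> = tcoset X x0 A \<phi> 0"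
    by (simp add: twisted_H1_def Let_def tcoset_def)
  show "tcoset X x0 A \<phi> u \<oplus>\<^bsub>twisted_H1 X x0 A \<phi>\<^esub> tcoset X x0 A \<phi> v = tcoset X x0 A \<phi> (u + v)"
    using tcoset_add[of X x0 A \<phi> u v] by (simp add: twisted_H1_def Let_def)
  show "r \<odot>\<^bsub>twisted_H1 X x0 A \<phi>\<^esub> tcoset X x0 A \<phi> u = tcoset X x0 A \<phi> (scale r u)"
    unfolding twisted_H1_def Let_def module.select_convs
    by (rule tcoset_image) (simp_all add: scale_diff tb_simps(3))
qed

text \<open>The inverse is a definite description, so uniqueness is part of the claim: a coset whose
  sum with that of \<open>u\<close> is zero must be the coset of \<open>- u\<close>.\<close>

lemma twisted_H1_a_inv:
  assumes u: "u \<in> tcycles1 X x0 A \<phi>"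
  shows "\<ominus>\<^bsub>twisted_H1 X x0 A \<phi>\<^esub> tcoset X x0 A \<phi> u = tcoset X x0 A \<phi> (- u)"
  unfolding a_inv_def m_inv_def
proof (rule the_equality)
  let ?H = "twisted_H1 X x0 A \<phi>" and ?K = "tcoset X x0 A \<phi>"
  show "?K (- u) \<in> carrier (add_monoid ?H) \<and> ?K u \<otimes>\<^bsub>add_monoid ?H\<^esub> ?K (- u) = \<one>\<^bsub>add_monoid ?H\<^esub> \<and>
      ?K (- u) \<otimes>\<^bsub>add_monoid ?H\<^esub> ?K u = \<one>\<^bsub>add_monoid ?H\<^esub>"
    using tcycles_minus[OF u] by (simp add: twisted_H1_simps)
  fix y assume y: "y \<in> carrier (add_monoid ?H) \<and> ?K u \<otimes>\<^bsub>add_monoid ?H\<^esub> y = \<one>\<^bsub>add_monoid ?H\<^esub> \<and>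
      y \<otimes>\<^bsub>add_monoid ?H\<^esub> ?K u = \<one>\<^bsub>add_monoid ?H\<^esub>"
  then obtain v where v: "y = ?K v" by (auto simp: twisted_H1_simps)
  then have "?K (u + v) = ?K 0" using y by (simp add: twisted_H1_simps)
  then have "v - (- u) \<in> tboundaries1 X x0 A \<phi>" unfolding tcoset_eq by (simp add: add.commute)
  then show "y = ?K (- u)" unfolding v tcoset_eq .
qed

section \<open>Transfer of boundaries from one cobordism to the other through
  \<open>W\<close>\<close>

lemma embedding_inverse:
  assumes "compact_space M" "Hausdorff_space W" "continuous_map M W i" "inj_on i (topspace M)"
  shows "continuous_map (subtopology W (i ` topspace M)) M (inv_into (topspace M) i)"
proof -
  \<comment> \<open>A continuous map from a compact to a Hausdorff space is closed, so an injective
    one is an embedding.\<close>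
  have "closed_map M W i" by (rule continuous_imp_closed_map[OF assms(3,1,2)])
  then have "embedding_map M W i"
    by (rule injective_closed_imp_embedding_map[OF assms(3) _ assms(4)])
  then have "homeomorphic_map M (subtopology W (i ` topspace M)) i" by (simp add: embedding_map_def)
  then obtain g where g: "homeomorphic_maps M (subtopology W (i ` topspace M)) i g"
    by (auto simp: homeomorphic_map_maps)
  have "continuous_map (subtopology W (i ` topspace M)) M g" using g by (simp add: homeomorphic_maps_def)
  then show ?thesis
  proof (rule continuous_map_eq)
    fix y assume "y \<in> topspace (subtopology W (i ` topspace M))"
    then obtain x where x: "x \<in> topspace M" "y = i x" by auto
    then show "g y = inv_into (topspace M) i y"
      using g by (simp add: homeomorphic_maps_def inv_into_f_f[OF assms(4)])
  qed
qed

lemma incl_incl: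
  assumes "tch p Y c" "\<And>y. y \<in> topspace Y \<Longrightarrow> i (g y) = y"
  shows "incl p i (incl p g c) = c"
proof -
  have "incl p i (incl p g c) = lin (\<lambda>\<sigma>. sg (simplex_map p i (simplex_map p g \<sigma>)) 1) c"
    unfolding push_def lin_lext by (simp add: lin_simps)
  also have "\<dots> = lin (\<lambda>\<sigma>. sg \<sigma> 1) c"
  proof (rule lext_cong)
    fix \<sigma> assume "\<sigma> \<in> ks c"
    then have s: "singular_simplex p Y \<sigma>" using assms(1) by auto
    have "simplex_map p i (simplex_map p g \<sigma>) = simplex_map p (i \<circ> g) \<sigma>" by (simp add: simplex_map_compose)
    also have "\<dots> = \<sigma>" by (rule simplex_map_id_gen[OF s]) (simp add: assms(2))
    finally show "sg (simplex_map p i (simplex_map p g \<sigma>)) 1 = sg \<sigma> 1" by simp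
  qed
  finally show ?thesis by (simp add: lin_id)
qed

text \<open>A filling in \<open>M1\<close> is pushed into \<open>W\<close>. It fills the image of
  \<open>Z2\<close> up to a chain \<open>a\<close> on the arc, which is carried back to
  \<open>M2\<close> along the inverse of \<open>i2\<close> and subtracted; the difference is an
  absolute cycle of \<open>M2\<close> that bounds in \<open>W\<close>, as
  \<open>torsion_kernel\<close> demands.\<close>

lemma boundary_transfer:
  fixes \<theta> :: "'w chain \<Rightarrow> 'r::idom"
  assumes W2: "homology_equiv_top W M2 i2 \<theta> \<epsilon>" and i1: "continuous_map M1 W i1"
    and T1: "twisted_space M1 x1 \<gamma>1 \<phi>1 (\<lambda>c. \<theta> (chain_map 1 i1 c))"
    and T2: "twisted_space M2 x2 \<gamma>2 \<phi>2 (\<lambda>c. \<theta> (chain_map 1 i2 c))"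
    and A: "i1 ` A1 \<subseteq> i2 ` A2" "A2 \<subseteq> topspace M2"
    and Z1: "Z1 \<in> tboundaries1 M1 x1 A1 \<phi>1" and Z2: "Z2 \<in> tensor_gens 1 M2 x2"
    and eq: "incl 1 i1 (twisted_space.Phi (\<lambda>c. \<theta> (chain_map 1 i1 c)) 1 Z1) =
             incl 1 i2 (twisted_space.Phi (\<lambda>c. \<theta> (chain_map 1 i2 c)) 1 Z2)"
  shows "\<exists>r. r \<noteq> 0 \<and> scale r Z2 \<in> tboundaries1 M2 x2 A2 \<phi>2"
proof -
  interpret W2: homology_equiv_top W M2 i2 \<theta> \<epsilon> by (rule W2)
  interpret T1: twisted_space M1 x1 \<gamma>1 \<phi>1 "\<lambda>c. \<theta> (chain_map 1 i1 c)" A1 by (rule T1)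
  interpret T2: twisted_space M2 x2 \<gamma>2 \<phi>2 "\<lambda>c. \<theta> (chain_map 1 i2 c)" A2 by (rule T2)
  have \<theta>M: "W2.\<theta>M = (\<lambda>c. \<theta> (chain_map 1 i2 c))" by (simp add: W2.\<theta>M_def[abs_def])
  let ?g = "inv_into (topspace M2) i2"
  have ig: "i2 (?g y) = y" if "y \<in> i2 ` topspace M2" for y using that by (rule f_inv_into_f)
  have gi: "?g (i2 x) = x" if "x \<in> topspace M2" for x using that by (rule inv_into_f_f[OF W2.inj])
  have g: "continuous_map (subtopology W (i2 ` topspace M2)) M2 ?g"
    by (rule embedding_inverse[OF W2.M(1) W2.W(2) W2.cont W2.inj])
  have gA: "continuous_map (subtopology W (i2 ` A2)) (subtopology M2 A2) ?g"
  proof (intro continuous_map_into_subtopology)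
    have "subtopology W (i2 ` A2) = subtopology (subtopology W (i2 ` topspace M2)) (i2 ` A2)"
      using A(2) by (simp add: subtopology_subtopology Int_absorb1 image_mono)
    then show "continuous_map (subtopology W (i2 ` A2)) M2 ?g"
      using continuous_map_from_subtopology[OF g] by simp
    show "?g \<in> topspace (subtopology W (i2 ` A2)) \<rightarrow> A2" using A(2) gi by (auto simp: subset_iff)
  qed
  obtain w a where w: "tch 2 M1 w" and a: "tch 1 (subtopology M1 A1) a"
    and wa: "T1.Phi 1 Z1 = tbd (\<lambda>c. \<theta> (chain_map 1 i1 c)) 2 w + a"
    using T1.boundaries_imp[OF Z1] by blast
  let ?w = "incl 2 i1 w" and ?a = "incl 1 ?g (incl 1 i1 a)"
  have w': "tch 2 W ?w" by (rule tch_push[OF w i1])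
  have "continuous_map (subtopology M1 A1) (subtopology W (i2 ` A2)) i1"
    using A(1) by (intro continuous_map_into_subtopology continuous_map_from_subtopology[OF i1]) auto
  from tch_push[OF a this] have a1: "tch 1 (subtopology W (i2 ` A2)) (incl 1 i1 a)" .
  have a2: "tch 1 (subtopology M2 A2) ?a" by (rule tch_push[OF a1 gA])
  then have a2': "tch 1 M2 ?a" by (auto simp: singular_simplex_subtopology)
  have ia: "incl 1 i2 ?a = incl 1 i1 a"
    by (rule incl_incl[OF a1]) (use A(2) in \<open>auto intro!: ig\<close>)
  have P2: "tch 1 M2 (T2.Phi 1 Z2)"
    unfolding T2.Phi_def using Z2
    by (intro keys_lext tch_push[OF _ continuous_cproj]) (auto simp: tensor_gens_def singular_chain_def)
  let ?z = "T2.Phi 1 Z2 - ?a"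
  have z: "tch 1 M2 ?z" by (rule keys_subset_diff[OF P2 a2'])
  have dw: "tbd \<theta> 2 ?w = incl 1 i1 (tbd (\<lambda>c. \<theta> (chain_map 1 i1 c)) 2 w)"
    using tbd_push[OF urh_id _ w compatible_incl] by (simp add: One_nat_def)
  have iz: "tbd \<theta> 2 ?w = incl 1 i2 ?z"
    using eq unfolding wa by (simp add: incl_simps ia dw eq_diff_eq)
  \<comment> \<open>\<open>?z\<close> is a cycle because its image in \<open>W\<close> is a boundary
    and \<open>i2\<close> has an inverse on its image, so that inclusion of chains is
    injective.\<close>
  have "incl 0 i2 (tbd W2.\<theta>M 1 ?z) = tbd \<theta> 1 (incl 1 i2 ?z)"
    using W2.incl_tbd[OF _ z] by simp
  also have "\<dots> = 0"
    using tbd_tbd[OF W2.\<theta> w'] by (simp add: iz One_nat_def)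
  finally have "incl 0 ?g (incl 0 i2 (tbd W2.\<theta>M 1 ?z)) = 0" by (simp add: incl_simps)
  moreover have "tch 0 M2 (tbd W2.\<theta>M 1 ?z)" using tch_tbd[OF z] by simp
  then have "incl 0 ?g (incl 0 i2 (tbd W2.\<theta>M 1 ?z)) = tbd W2.\<theta>M 1 ?z" by (rule incl_incl) (rule gi)
  ultimately have "tbd W2.\<theta>M 1 ?z = 0" by (simp only:)
  from W2.torsion_kernel[OF z this w' iz] obtain r d where r: "r \<noteq> 0"
    and d: "tch 2 M2 d" "tbd W2.\<theta>M 2 d = scale r ?z" unfolding W2.bdry1_def by blast
  have "T2.Phi 1 (scale r Z2) = tbd W2.\<theta>M 2 d + scale r ?a"
    using d(2) by (simp add: lmap_simps[OF T2.lmap_Phi] scale_diff)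
  then have "scale r Z2 \<in> tboundaries1 M2 x2 A2 \<phi>2"
    unfolding \<theta>M by (rule T2.boundaries_if[OF tensor_gens_simps(3)[OF Z2] d(1) keys_subset_scale[OF a2]])
  then show ?thesis using r by blast
qed

subsection \<open>Homology concordant cobordisms\<close>

lemma surface_props:
  assumes "model_surfaces F s"
  shows "s \<in> topspace circle" "continuous_map circle (surf_space (F g)) (surf_bdry (F g))"
    "path_connected_space (surf_space (F g))" "loc_acyc (surf_space (F g))"
proof -
  obtain \<omega> where *: "compact_manifold 2 (surf_space (F g))" "connected_space (surf_space (F g))"
    "oriented_boundary_map 1 circle \<omega> (surf_space (F g)) (surf_orient (F g)) (surf_bdry (F g))"
    using assms unfolding model_surfaces_def by blast
  show "s \<in> topspace circle" using assms by (simp add: model_surfaces_def)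
  show "continuous_map circle (surf_space (F g)) (surf_bdry (F g))"
    using *(3) homeomorphic_imp_continuous_map continuous_map_in_subtopology
    unfolding oriented_boundary_map_def Let_def by blast
  show "path_connected_space (surf_space (F g))" "loc_acyc (surf_space (F g))"
    using manifold_path_connected[OF *(1,2)] manifold_loc_acyc[OF *(1)] by auto
qed

lemma base_pt_in: "model_surfaces F s \<Longrightarrow> base_pt (F g) s \<in> topspace (surf_space (F g))"
  using surface_props(1,2) continuous_map_image_subset_topspace by fast

lemma continuous_pieces:
  "continuous_map (surf_space (F gm)) (bdry_surface F gm gp) (in_bottom F gm gp)"
  "continuous_map (prod_topology circle (subtopology euclideanreal {-1..1})) (bdry_surface F gm gp) (in_side F gm gp)"
  "continuous_map (surf_space (F gp)) (bdry_surface F gm gp) (in_top F gm gp)"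
proof -
  note g = continuous_glue_class[of "pieces F gm gp" "pieces_glue F gm gp", folded bdry_surface_def]
  have e: "in_bottom F gm gp = glue_class (pieces F gm gp) (pieces_glue F gm gp) \<circ> Inl"
    "in_side F gm gp = glue_class (pieces F gm gp) (pieces_glue F gm gp) \<circ> (Inr \<circ> Inl)"
    "in_top F gm gp = glue_class (pieces F gm gp) (pieces_glue F gm gp) \<circ> (Inr \<circ> Inr)"
    by (simp_all add: fun_eq_iff in_bottom_def in_side_def in_top_def)
  show "continuous_map (surf_space (F gm)) (bdry_surface F gm gp) (in_bottom F gm gp)"
    unfolding e by (rule continuous_map_compose[OF _ g]) (simp add: pieces_def continuous_Inl)
  show "continuous_map (prod_topology circle (subtopology euclideanreal {-1..1})) (bdry_surface F gm gp) (in_side F gm gp)"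
    unfolding e by (rule continuous_map_compose[OF _ g])
      (simp add: pieces_def continuous_map_compose[OF continuous_Inl continuous_Inr])
  show "continuous_map (surf_space (F gp)) (bdry_surface F gm gp) (in_top F gm gp)"
    unfolding e by (rule continuous_map_compose[OF _ g])
      (simp add: pieces_def continuous_map_compose[OF continuous_Inr continuous_Inr])
qed

lemma pieces_glued:
  assumes ms: "model_surfaces F s" and z: "z \<in> topspace circle"
  shows "in_side F gm gp (z, -1) = in_bottom F gm gp (surf_bdry (F gm) z)"
    "in_side F gm gp (z, 1) = in_top F gm gp (surf_bdry (F gp) z)"
proof -
  have b: "surf_bdry (F g) z \<in> topspace (surf_space (F g))" for g
    using continuous_map_image_subset_topspace[OF surface_props(2)[OF ms]] z by blast
  show "in_side F gm gp (z, -1) = in_bottom F gm gp (surf_bdry (F gm) z)"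
    unfolding in_side_def in_bottom_def
    by (rule glue_class_eq[symmetric])
      (use z b in \<open>auto simp: pieces_glue_def pieces_def topspace_disjoint_sum\<close>)
  show "in_side F gm gp (z, 1) = in_top F gm gp (surf_bdry (F gp) z)"
    unfolding in_side_def in_top_def
    by (rule glue_class_eq[symmetric])
      (use z b in \<open>auto simp: pieces_glue_def pieces_def topspace_disjoint_sum\<close>)
qed

lemma side_path:
  assumes ms: "model_surfaces F s"
  shows "pathin (bdry_surface F gm gp) (\<lambda>t. in_side F gm gp (s, 2 * t - 1))"
proof -
  have "continuous_map (top_of_set {0..1}) (prod_topology circle (top_of_set {-1..1}))
     (\<lambda>t::real. (s, 2 * t - 1))"
    using surface_props(1)[OF ms]
    by (auto simp: continuous_map_pairwise o_def continuous_map_in_subtopology intro!: continuous_intros)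
  from continuous_map_compose[OF this continuous_pieces(2)]
  show ?thesis by (simp add: pathin_def o_def)
qed

lemma cobordism_props:
  assumes "is_cobordism F gm gp M"
  shows "compact_space (cob_space M)" "Hausdorff_space (cob_space M)" "loc_acyc (cob_space M)"
    "path_connected_space (cob_space M)" "continuous_map (bdry_surface F gm gp) (cob_space M) (cob_param M)"
    "inj_on (cob_param M) (topspace (bdry_surface F gm gp))"
proof -
  have m: "compact_manifold 3 (cob_space M)" "connected_space (cob_space M)"
    and h: "homeomorphic_map (bdry_surface F gm gp) (subtopology (cob_space M) (mfd_boundary (Suc 2) (cob_space M))) (cob_param M)"
    using assms unfolding is_cobordism_def oriented_boundary_map_def Let_def by auto
  show "continuous_map (bdry_surface F gm gp) (cob_space M) (cob_param M)"
    using homeomorphic_imp_continuous_map[OF h] by (simp add: continuous_map_in_subtopology)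
  show "inj_on (cob_param M) (topspace (bdry_surface F gm gp))"
    by (rule homeomorphic_imp_injective_map[OF h])
  show "compact_space (cob_space M)" "Hausdorff_space (cob_space M)" "loc_acyc (cob_space M)"
    "path_connected_space (cob_space M)"
    using m manifold_path_connected manifold_loc_acyc by (auto simp: compact_manifold_def)
qed

lemma cobordism_maps:
  assumes ms: "model_surfaces F s" and cob: "is_cobordism F gm gp M"
  shows "continuous_map (surf_space (F gm)) (cob_space M) (m_minus F gm gp M)"
    "continuous_map (surf_space (F gp)) (cob_space M) (m_plus F gm gp M)"
    "pathin (cob_space M) (\<lambda>t. m_side F gm gp M (s, 2 * t - 1))"
    "m_side F gm gp M (s, -1) = m_minus F gm gp M (base_pt (F gm) s)"
    "m_side F gm gp M (s, 1) = m_plus F gm gp M (base_pt (F gp) s)"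
    "m_minus F gm gp M (base_pt (F gm) s) \<in> cob_arc F s gm gp M"
    "m_plus F gm gp M (base_pt (F gp) s) \<in> cob_arc F s gm gp M"
    "cob_arc F s gm gp M = cob_param M ` (\<lambda>t. in_side F gm gp (s, t)) ` {-1..1}"
    "(\<lambda>t. in_side F gm gp (s, t)) ` {-1..1} \<subseteq> topspace (bdry_surface F gm gp)"
    "m_minus F gm gp M (base_pt (F gm) s) \<in> topspace (cob_space M)"
proof -
  note c = cobordism_props(5)[OF cob] and sc = surface_props(1)[OF ms]
  show 1: "continuous_map (surf_space (F gm)) (cob_space M) (m_minus F gm gp M)"
    "continuous_map (surf_space (F gp)) (cob_space M) (m_plus F gm gp M)"
    unfolding m_minus_def m_plus_def
    by (rule continuous_map_compose[OF continuous_pieces(1) c], rule continuous_map_compose[OF continuous_pieces(3) c])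
  show "pathin (cob_space M) (\<lambda>t. m_side F gm gp M (s, 2 * t - 1))"
    using pathin_compose[OF side_path[OF ms] c] by (simp add: m_side_def o_def)
  show 2: "m_side F gm gp M (s, -1) = m_minus F gm gp M (base_pt (F gm) s)"
    "m_side F gm gp M (s, 1) = m_plus F gm gp M (base_pt (F gp) s)"
    using pieces_glued[OF ms sc] by (simp_all add: m_side_def m_minus_def m_plus_def)
  show "m_minus F gm gp M (base_pt (F gm) s) \<in> cob_arc F s gm gp M"
    "m_plus F gm gp M (base_pt (F gp) s) \<in> cob_arc F s gm gp M"
    unfolding cob_arc_def 2[symmetric] by (rule image_eqI[OF refl], simp)+
  show "cob_arc F s gm gp M = cob_param M ` (\<lambda>t. in_side F gm gp (s, t)) ` {-1..1}"
    by (auto simp: cob_arc_def m_side_def)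
  show "(\<lambda>t. in_side F gm gp (s, t)) ` {-1..1} \<subseteq> topspace (bdry_surface F gm gp)"
  proof (rule image_subsetI)
    fix t :: real assume "t \<in> {-1..1}"
    then have "(s, t) \<in> topspace (prod_topology circle (top_of_set {-1..1}))" using sc by simp
    then show "in_side F gm gp (s, t) \<in> topspace (bdry_surface F gm gp)"
      using continuous_map_image_subset_topspace[OF continuous_pieces(2)] by blast
  qed
  show "m_minus F gm gp M (base_pt (F gm) s) \<in> topspace (cob_space M)"
    using continuous_map_image_subset_topspace[OF 1(1)] base_pt_in[OF ms] by blast
qed

lemma concordance:
  assumes c1: "is_cobordism F gm gp M1" and c2: "is_cobordism F gm gp M2"
    and conc: "homology_concordant TYPE('w) F gm gp (M1, \<phi>1) (M2, \<phi>2)"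
  obtains W :: "'w topology" and i1 i2 where "compact_space W" "Hausdorff_space W" "loc_acyc W" "path_connected_space W"
    "homology_iso (cob_space M1) W i1" "homology_iso (cob_space M2) W i2"
    "inj_on i1 (topspace (cob_space M1))" "inj_on i2 (topspace (cob_space M2))"
    "\<And>x. x \<in> topspace (bdry_surface F gm gp) \<Longrightarrow> i1 (cob_param M1 x) = i2 (cob_param M2 x)"
    "\<And>h. h \<in> carrier (homology_group 1 W) \<Longrightarrow>
       \<phi>1 (inv_into (carrier (homology_group 1 (cob_space M1))) (hom_induced 1 (cob_space M1) {} W {} i1) h) =
       \<phi>2 (inv_into (carrier (homology_group 1 (cob_space M2))) (hom_induced 1 (cob_space M2) {} W {} i2) h)"
proof -
  let ?f1 = "in_first F gm gp M1 M2" and ?f2 = "in_second F gm gp M1 M2"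
  obtain W :: "'w topology" and \<mu> \<nu> j where W: "compact_manifold 4 W" "connected_space W"
    and j: "oriented_boundary_map 3 (double F gm gp M1 M2) \<nu> W \<mu> j"
    and iso: "homology_iso (cob_space M1) W (j \<circ> ?f1)" "homology_iso (cob_space M2) W (j \<circ> ?f2)"
    and \<phi>: "\<forall>h \<in> carrier (homology_group 1 W).
       \<phi>1 (inv_into (carrier (homology_group 1 (cob_space M1))) (hom_induced 1 (cob_space M1) {} W {} (j \<circ> ?f1)) h) =
       \<phi>2 (inv_into (carrier (homology_group 1 (cob_space M2))) (hom_induced 1 (cob_space M2) {} W {} (j \<circ> ?f2)) h)"
    using conc unfolding homology_concordant_def Let_def split by blast
  let ?S = "topspace (bdry_surface F gm gp)"
  let ?D = "disjoint_sum (cob_space M1) (cob_space M2)"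
  have jinj: "inj_on j (topspace (double F gm gp M1 M2))"
    using j homeomorphic_imp_injective_map unfolding oriented_boundary_map_def Let_def by blast
  have pin: "cob_param M1 x \<in> topspace (cob_space M1)" "cob_param M2 x \<in> topspace (cob_space M2)" if "x \<in> ?S" for x
    using that continuous_map_image_subset_topspace[OF cobordism_props(5)[OF c1]]
      continuous_map_image_subset_topspace[OF cobordism_props(5)[OF c2]] by auto
  note path = double_glue_path[of _ _ "cob_param M1" "cob_param M2" ?S, folded double_glue_def,
      OF _ cobordism_props(6)[OF c1] cobordism_props(6)[OF c2]]
  have in_D: "glue_class ?D (double_glue F gm gp M1 M2) z \<in> topspace (double F gm gp M1 M2)" if "z \<in> topspace ?D" for z
    unfolding double_def topspace_quotient_space by (rule glue_class_in[OF that])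
  \<comment> \<open>Equal images in \<open>W\<close> come from one gluing class of the double, and
    such a class contains no two distinct points of the same piece; this makes both inclusions
    injective.\<close>
  have inj: "z = z' \<or> (\<exists>x\<in>?S. z = Inl (cob_param M1 x) \<and> z' = Inr (cob_param M2 x)) \<or>
      (\<exists>x\<in>?S. z = Inr (cob_param M2 x) \<and> z' = Inl (cob_param M1 x))"
    if "j (glue_class ?D (double_glue F gm gp M1 M2) z) = j (glue_class ?D (double_glue F gm gp M1 M2) z')"
      "z \<in> topspace ?D" "z' \<in> topspace ?D" for z z'
    using path[OF glue_class_eqD[OF inj_onD[OF jinj that(1) in_D[OF that(2)] in_D[OF that(3)]] that(2,3)]] by blast
  show ?thesis
  proof (rule that[of W "j \<circ> ?f1" "j \<circ> ?f2"])
    show "compact_space W" "Hausdorff_space W" "loc_acyc W" "path_connected_space W"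
      using W manifold_path_connected manifold_loc_acyc by (auto simp: compact_manifold_def)
    show "inj_on (j \<circ> ?f1) (topspace (cob_space M1))"
    proof (rule inj_onI)
      fix x y assume "x \<in> topspace (cob_space M1)" "y \<in> topspace (cob_space M1)" "(j \<circ> ?f1) x = (j \<circ> ?f1) y"
      then show "x = y" using inj[of "Inl x" "Inl y"] by (simp add: in_first_def topspace_disjoint_sum)
    qed
    show "inj_on (j \<circ> ?f2) (topspace (cob_space M2))"
    proof (rule inj_onI)
      fix x y assume "x \<in> topspace (cob_space M2)" "y \<in> topspace (cob_space M2)" "(j \<circ> ?f2) x = (j \<circ> ?f2) y"
      then show "x = y" using inj[of "Inr x" "Inr y"] by (simp add: in_second_def topspace_disjoint_sum)
    qed
    fix x assume "x \<in> ?S"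
    then have "?f1 (cob_param M1 x) = ?f2 (cob_param M2 x)"
      unfolding in_first_def in_second_def using pin
      by (intro glue_class_eq) (auto simp: double_glue_def topspace_disjoint_sum)
    then show "(j \<circ> ?f1) (cob_param M1 x) = (j \<circ> ?f2) (cob_param M2 x)" by simp
  qed (use iso \<phi> in auto)
qed

text \<open>Both sides are rewritten by \<open>incl_Phi_T\<close> to expressions in the composite
  maps into \<open>W\<close>, which agree on the surface and along the arc.\<close>

lemma incl_Phi_T_eq:
  fixes \<theta> :: "'w chain \<Rightarrow> 'r::comm_ring_1"
  assumes I1: "induced_map M1 x1 \<gamma>1 \<phi>1 (\<lambda>c. \<theta> (chain_map 1 i1 c)) A1 S s0 \<phi>S f1 \<alpha>1"
    and I2: "induced_map M2 x2 \<gamma>2 \<phi>2 (\<lambda>c. \<theta> (chain_map 1 i2 c)) A2 S s0 \<phi>S f2 \<alpha>2"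
    and i: "continuous_map M1 W i1" "continuous_map M2 W i2" and \<theta>: "char_sys W \<theta>"
    and eq: "\<And>x. x \<in> topspace S \<Longrightarrow> i1 (f1 x) = i2 (f2 x)" "\<And>t. 0 \<le> t \<Longrightarrow> t \<le> 1 \<Longrightarrow> i1 (\<alpha>1 t) = i2 (\<alpha>2 t)"
    and z: "z \<in> tensor_gens 1 S s0"
  shows "incl 1 i1 (twisted_space.Phi (\<lambda>c. \<theta> (chain_map 1 i1 c)) 1 (induced_map.T M1 f1 \<alpha>1 1 z)) =
         incl 1 i2 (twisted_space.Phi (\<lambda>c. \<theta> (chain_map 1 i2 c)) 1 (induced_map.T M2 f2 \<alpha>2 1 z))"
proof -
  interpret I1: induced_map M1 x1 \<gamma>1 \<phi>1 "\<lambda>c. \<theta> (chain_map 1 i1 c)" A1 S s0 \<phi>S f1 \<alpha>1 by (rule I1)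
  interpret I2: induced_map M2 x2 \<gamma>2 \<phi>2 "\<lambda>c. \<theta> (chain_map 1 i2 c)" A2 S s0 \<phi>S f2 \<alpha>2 by (rule I2)
  show ?thesis
    unfolding I1.incl_Phi_T[OF i(1) \<theta> refl z] I2.incl_Phi_T[OF i(2) \<theta> refl z]
  proof (rule lext_cong, rule push_cong)
    fix c assume "c \<in> ks z"
    then show "singular_chain 1 (abelian_cover S s0) c" using z by (simp add: tensor_gens_def)
  next
    fix e assume e: "e \<in> topspace (abelian_cover S s0)"
    have "cproj e \<in> topspace S"
      using continuous_map_image_subset_topspace[OF continuous_cproj[of S s0]] e by (simp add: image_subset_iff)
    then show "(i1 \<circ> f1 \<circ> cproj) e = (i2 \<circ> f2 \<circ> cproj) e" by (simp add: eq(1))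
    obtain \<beta>0 where "\<beta>0 \<in> e" using e by (rule cover_point)
    then have "(SOME \<beta>. \<beta> \<in> e) \<in> e" by (rule someI[where P="\<lambda>b. b \<in> e"])
    then have p: "pathin S (SOME \<beta>. \<beta> \<in> e)" using cover_point_mem[OF e] paths_fromD(1) by blast
    have 1: "pc (i1 \<circ> \<alpha>1) = pc (i2 \<circ> \<alpha>2)" by (rule pc_cong) (simp add: eq(2))
    have 2: "pc (i1 \<circ> f1 \<circ> (SOME \<beta>. \<beta> \<in> e)) = pc (i2 \<circ> f2 \<circ> (SOME \<beta>. \<beta> \<in> e))"
      by (rule pc_cong) (simp add: eq(1)[OF pathin_in[OF p]])
    show "\<theta> (pc (i1 \<circ> \<alpha>1)) * \<theta> (pc (i1 \<circ> f1 \<circ> (SOME \<beta>. \<beta> \<in> e))) =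
        \<theta> (pc (i2 \<circ> \<alpha>2)) * \<theta> (pc (i2 \<circ> f2 \<circ> (SOME \<beta>. \<beta> \<in> e)))"
      unfolding 1 2 ..
  qed
qed

abbreviation "surf_coset S s \<phi> \<equiv> tcoset (surf_space S) (base_pt S s) {base_pt S s} \<phi>"
abbreviation "surf_cycles S s \<phi> \<equiv> tcycles1 (surf_space S) (base_pt S s) {base_pt S s} \<phi>"
abbreviation "cob_base F s gm gp M \<equiv> m_minus F gm gp M (base_pt (F gm) s)"
abbreviation "T_minus F s gm gp M \<equiv> induced_map.T (cob_space M) (m_minus F gm gp M) (\<lambda>t. cob_base F s gm gp M) 1"
abbreviation "T_plus F s gm gp M \<equiv> induced_map.T (cob_space M) (m_plus F gm gp M) (\<lambda>t. m_side F gm gp M (s, 2 * t - 1)) 1"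

text \<open>One system of base paths is used at both ends, so that chains coming from the two
  surfaces are compared in a single \<open>twisted_space\<close>.\<close>

lemma induced_maps_exist:
  assumes ms: "model_surfaces F s" and mor: "is_cob_morphism F G (gm, \<phi>m) (gp, \<phi>p) (M, \<phi>)"
    and \<theta>: "char_sys (cob_space M) \<theta>"
    and \<phi>\<theta>: "\<And>c. singular_relcycle 1 (cob_space M) {} c \<Longrightarrow> \<phi> (homologous_rel_set 1 (cob_space M) {} c) = \<theta> c"
  obtains \<gamma> where
    "induced_map (cob_space M) (cob_base F s gm gp M) \<gamma> \<phi> \<theta> (cob_arc F s gm gp M)
       (surf_space (F gm)) (base_pt (F gm) s) \<phi>m (m_minus F gm gp M) (\<lambda>t. cob_base F s gm gp M)"
    "induced_map (cob_space M) (cob_base F s gm gp M) \<gamma> \<phi> \<theta> (cob_arc F s gm gp M)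
       (surf_space (F gp)) (base_pt (F gp) s) \<phi>p (m_plus F gm gp M) (\<lambda>t. m_side F gm gp M (s, 2 * t - 1))"
proof -
  have cob: "is_cobordism F gm gp M" using mor by (simp add: is_cob_morphism_def)
  note m = cobordism_maps[OF ms cob] and c = cobordism_props[OF cob] and S = surface_props[OF ms]
  obtain \<gamma> where "base_paths (cob_space M) (cob_base F s gm gp M) \<gamma>"
    using base_paths_exist[OF c(4) m(10)] by blast
  then have tw: "twisted_space (cob_space M) (cob_base F s gm gp M) \<gamma> \<phi> \<theta>"
    by (intro twisted_space.intro twisted_space_axioms.intro) (use c \<theta> \<phi>\<theta> in auto)
  show ?thesis
  proof (rule that[of \<gamma>])
    show "induced_map (cob_space M) (cob_base F s gm gp M) \<gamma> \<phi> \<theta> (cob_arc F s gm gp M)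
       (surf_space (F gm)) (base_pt (F gm) s) \<phi>m (m_minus F gm gp M) (\<lambda>t. cob_base F s gm gp M)"
      by (intro induced_map.intro tw induced_map_axioms.intro m S refl)
        (use m(10) mor in \<open>auto simp: is_cob_morphism_def pathin_def\<close>)
    show "induced_map (cob_space M) (cob_base F s gm gp M) \<gamma> \<phi> \<theta> (cob_arc F s gm gp M)
       (surf_space (F gp)) (base_pt (F gp) s) \<phi>p (m_plus F gm gp M) (\<lambda>t. m_side F gm gp M (s, 2 * t - 1))"
      by (intro induced_map.intro tw induced_map_axioms.intro m S)
        (use m(4,5) mor in \<open>auto simp: is_cob_morphism_def\<close>)
  qed
qed

text \<open>In terms of representing cycles, the kernel and its closure merge into one condition: a
  nonzero multiple of the difference of the two images is a boundary.\<close>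

lemma Mag_eq:
  assumes Im: "induced_map (cob_space M) (cob_base F s gm gp M) \<gamma> \<phi> \<theta> (cob_arc F s gm gp M)
       (surf_space (F gm)) (base_pt (F gm) s) \<phi>m (m_minus F gm gp M) (\<lambda>t. cob_base F s gm gp M)"
    and Ip: "induced_map (cob_space M) (cob_base F s gm gp M) \<gamma> \<phi> \<theta> (cob_arc F s gm gp M)
       (surf_space (F gp)) (base_pt (F gp) s) \<phi>p (m_plus F gm gp M) (\<lambda>t. m_side F gm gp M (s, 2 * t - 1))"
  shows "Mag F s (gm, \<phi>m) (gp, \<phi>p) (M, \<phi>) =
    {(surf_coset (F gm) s \<phi>m x, surf_coset (F gp) s \<phi>p y) | x y.
       x \<in> surf_cycles (F gm) s \<phi>m \<and> y \<in> surf_cycles (F gp) s \<phi>p \<and>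
       (\<exists>r. r \<noteq> 0 \<and> scale r (T_plus F s gm gp M y - T_minus F s gm gp M x) \<in>
          tboundaries1 (cob_space M) (cob_base F s gm gp M) (cob_arc F s gm gp M) \<phi>)}"
proof -
  interpret m: induced_map "cob_space M" "cob_base F s gm gp M" \<gamma> \<phi> \<theta> "cob_arc F s gm gp M"
    "surf_space (F gm)" "base_pt (F gm) s" \<phi>m "m_minus F gm gp M" "\<lambda>t. cob_base F s gm gp M" by (rule Im)
  interpret p: induced_map "cob_space M" "cob_base F s gm gp M" \<gamma> \<phi> \<theta> "cob_arc F s gm gp M"
    "surf_space (F gp)" "base_pt (F gp) s" \<phi>p "m_plus F gm gp M" "\<lambda>t. m_side F gm gp M (s, 2 * t - 1)" by (rule Ip)
  let ?Km = "surf_coset (F gm) s \<phi>m" and ?Kp = "surf_coset (F gp) s \<phi>p" and ?H = "cob_H1 F s gm gp M \<phi>"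
  let ?Cm = "surf_cycles (F gm) s \<phi>m" and ?Cp = "surf_cycles (F gp) s \<phi>p"
  let ?B = "tboundaries1 (cob_space M) (cob_base F s gm gp M) (cob_arc F s gm gp M) \<phi>"
  let ?K = "tcoset (cob_space M) (cob_base F s gm gp M) (cob_arc F s gm gp M) \<phi>"
  let ?D = "module_sum (surf_H1 (F gm) s \<phi>m) (surf_H1 (F gp) s \<phi>p)"
  have star: "m_minus_star F s gm gp M \<phi> (?Km x) = ?K (m.T 1 x)" "m_plus_star F s gm gp M \<phi> (?Kp y) = ?K (p.T 1 y)" for x y
    unfolding m_minus_star_def m_plus_star_def twisted_induced_def m.T_def[symmetric] p.T_def[symmetric]
    by (rule tcoset_image, rule m.T_simps(2), erule m.T_boundaries)
      (rule tcoset_image, rule p.T_simps(2), erule p.T_boundaries)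
  have ker: "(\<ominus>\<^bsub>?H\<^esub> m_minus_star F s gm gp M \<phi> (?Km x)) \<oplus>\<^bsub>?H\<^esub> m_plus_star F s gm gp M \<phi> (?Kp y) = \<zero>\<^bsub>?H\<^esub> \<longleftrightarrow>
      p.T 1 y - m.T 1 x \<in> ?B" if "x \<in> ?Cm" for x y
    unfolding star cob_H1_def twisted_H1_a_inv[OF m.T_cycles[OF that]] twisted_H1_simps tcoset_eq
    by simp
  have smult: "r \<odot>\<^bsub>?D\<^esub> (?Km x, ?Kp y) = (?Km (scale r x), ?Kp (scale r y))" for r x y
    by (simp add: module_sum_def surf_H1_def twisted_H1_simps)
  have car: "(?Km x, ?Kp y) \<in> carrier ?D" if "x \<in> ?Cm" "y \<in> ?Cp" for x y
    using that by (simp add: module_sum_def surf_H1_def twisted_H1_simps)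
  have car': "\<exists>x\<in>?Cm. \<exists>y\<in>?Cp. v = (?Km x, ?Kp y)" if "v \<in> carrier ?D" for v
    using that by (auto simp: module_sum_def surf_H1_def twisted_H1_simps)
  let ?N = "{(x, y) \<in> carrier ?D. (\<ominus>\<^bsub>?H\<^esub> m_minus_star F s gm gp M \<phi> x) \<oplus>\<^bsub>?H\<^esub> m_plus_star F s gm gp M \<phi> y = \<zero>\<^bsub>?H\<^esub>}"
  have N: "r \<odot>\<^bsub>?D\<^esub> (?Km x, ?Kp y) \<in> ?N \<longleftrightarrow> scale r (p.T 1 y - m.T 1 x) \<in> ?B" if "x \<in> ?Cm" "y \<in> ?Cp" for r x y
    using ker[OF tcycles_simps(2)[OF that(1)], of r "scale r y"] car[OF tcycles_simps(2)[OF that(1)] tcycles_simps(2)[OF that(2)]]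
    unfolding smult by (simp add: m.T_simps p.T_simps scale_diff)
  have Mag: "Mag F s (gm, \<phi>m) (gp, \<phi>p) (M, \<phi>) = {v \<in> carrier ?D. \<exists>r. r \<noteq> 0 \<and> r \<odot>\<^bsub>?D\<^esub> v \<in> ?N}"
    by (simp add: Mag_def Let_def submodule_cl_def)
  show ?thesis
  proof (rule Set.set_eqI)
    fix v
    show "v \<in> Mag F s (gm, \<phi>m) (gp, \<phi>p) (M, \<phi>) \<longleftrightarrow> v \<in> {(?Km x, ?Kp y) | x y. x \<in> ?Cm \<and> y \<in> ?Cp \<and>
       (\<exists>r. r \<noteq> 0 \<and> scale r (p.T 1 y - m.T 1 x) \<in> ?B)}" (is "_ \<longleftrightarrow> v \<in> ?R")
    proof
      assume "v \<in> Mag F s (gm, \<phi>m) (gp, \<phi>p) (M, \<phi>)"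
      then have "v \<in> carrier ?D \<and> (\<exists>r. r \<noteq> 0 \<and> r \<odot>\<^bsub>?D\<^esub> v \<in> ?N)"
        unfolding Mag by (rule CollectD)
      then obtain r where v: "v \<in> carrier ?D" "r \<noteq> 0" "r \<odot>\<^bsub>?D\<^esub> v \<in> ?N" by (elim conjE exE)
      obtain x y where xy: "x \<in> ?Cm" "y \<in> ?Cp" "v = (?Km x, ?Kp y)" using car'[OF v(1)] by blast
      have "scale r (p.T 1 y - m.T 1 x) \<in> ?B" using v(3) unfolding xy(3) by (rule N[OF xy(1,2), THEN iffD1])
      then show "v \<in> ?R" using xy v(2) by blast
    next
      assume "v \<in> ?R"
      then obtain x y r where xy: "v = (?Km x, ?Kp y)" "x \<in> ?Cm" "y \<in> ?Cp" "r \<noteq> 0"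
        "scale r (p.T 1 y - m.T 1 x) \<in> ?B" by blast
      have n: "r \<odot>\<^bsub>?D\<^esub> v \<in> ?N" unfolding xy(1) by (rule N[OF xy(2,3), THEN iffD2, OF xy(5)])
      have c: "v \<in> carrier ?D" unfolding xy(1) by (rule car[OF xy(2,3)])
      show "v \<in> Mag F s (gm, \<phi>m) (gp, \<phi>p) (M, \<phi>)"
        unfolding Mag by (rule CollectI, rule conjI[OF c], rule exI[of _ r], rule conjI[OF xy(4) n])
    qed
  qed
qed

text \<open>Fillings are pushed forward from \<open>M1\<close> along the continuous
  \<open>i1\<close>; the homology isomorphism for \<open>M2\<close> then pulls them back from
  \<open>W\<close>, at the price of a nonzero scalar.\<close>

lemma Mag_subset:
  fixes \<theta> :: "'w chain \<Rightarrow> 'r::idom" and \<epsilon> :: "'r \<Rightarrow> int"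
  assumes ms: "model_surfaces F s"
    and mor1: "is_cob_morphism F G (gm, \<phi>m) (gp, \<phi>p) (M1, \<phi>1)"
    and mor2: "is_cob_morphism F G (gm, \<phi>m) (gp, \<phi>p) (M2, \<phi>2)"
    and W: "compact_space W" "Hausdorff_space W" "loc_acyc W"
    and \<theta>: "char_sys W \<theta>" and \<epsilon>: "unital_ring_hom \<epsilon>" "\<And>c. singular_chain 1 W c \<Longrightarrow> \<epsilon> (\<theta> c) = 1"
    and i1: "continuous_map (cob_space M1) W i1"
    and i2: "homology_iso (cob_space M2) W i2" "inj_on i2 (topspace (cob_space M2))"
    and agree: "\<And>x. x \<in> topspace (bdry_surface F gm gp) \<Longrightarrow> i1 (cob_param M1 x) = i2 (cob_param M2 x)"
    and \<phi>1: "\<And>c. singular_relcycle 1 (cob_space M1) {} c \<Longrightarrow>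
        \<phi>1 (homologous_rel_set 1 (cob_space M1) {} c) = \<theta> (chain_map 1 i1 c)"
    and \<phi>2: "\<And>c. singular_relcycle 1 (cob_space M2) {} c \<Longrightarrow>
        \<phi>2 (homologous_rel_set 1 (cob_space M2) {} c) = \<theta> (chain_map 1 i2 c)"
  shows "Mag F s (gm, \<phi>m) (gp, \<phi>p) (M1, \<phi>1) \<subseteq> Mag F s (gm, \<phi>m) (gp, \<phi>p) (M2, \<phi>2)"
proof -
  have c1: "is_cobordism F gm gp M1" and c2: "is_cobordism F gm gp M2"
    using mor1 mor2 by (simp_all add: is_cob_morphism_def)
  have ci2: "continuous_map (cob_space M2) W i2" using i2(1) by (simp add: homology_iso_def)
  let ?\<theta>1 = "\<lambda>c. \<theta> (chain_map 1 i1 c)" and ?\<theta>2 = "\<lambda>c. \<theta> (chain_map 1 i2 c)"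
  obtain \<gamma>1 where I1: "induced_map (cob_space M1) (cob_base F s gm gp M1) \<gamma>1 \<phi>1 ?\<theta>1 (cob_arc F s gm gp M1)
       (surf_space (F gm)) (base_pt (F gm) s) \<phi>m (m_minus F gm gp M1) (\<lambda>t. cob_base F s gm gp M1)"
    "induced_map (cob_space M1) (cob_base F s gm gp M1) \<gamma>1 \<phi>1 ?\<theta>1 (cob_arc F s gm gp M1)
       (surf_space (F gp)) (base_pt (F gp) s) \<phi>p (m_plus F gm gp M1) (\<lambda>t. m_side F gm gp M1 (s, 2 * t - 1))"
    by (rule induced_maps_exist[OF ms mor1 char_sys_pullback[OF \<theta> i1] \<phi>1])
  obtain \<gamma>2 where I2: "induced_map (cob_space M2) (cob_base F s gm gp M2) \<gamma>2 \<phi>2 ?\<theta>2 (cob_arc F s gm gp M2)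
       (surf_space (F gm)) (base_pt (F gm) s) \<phi>m (m_minus F gm gp M2) (\<lambda>t. cob_base F s gm gp M2)"
    "induced_map (cob_space M2) (cob_base F s gm gp M2) \<gamma>2 \<phi>2 ?\<theta>2 (cob_arc F s gm gp M2)
       (surf_space (F gp)) (base_pt (F gp) s) \<phi>p (m_plus F gm gp M2) (\<lambda>t. m_side F gm gp M2 (s, 2 * t - 1))"
    by (rule induced_maps_exist[OF ms mor2 char_sys_pullback[OF \<theta> ci2] \<phi>2])
  interpret m1: induced_map "cob_space M1" "cob_base F s gm gp M1" \<gamma>1 \<phi>1 ?\<theta>1 "cob_arc F s gm gp M1"
    "surf_space (F gm)" "base_pt (F gm) s" \<phi>m "m_minus F gm gp M1" "\<lambda>t. cob_base F s gm gp M1" by (rule I1)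
  interpret p1: induced_map "cob_space M1" "cob_base F s gm gp M1" \<gamma>1 \<phi>1 ?\<theta>1 "cob_arc F s gm gp M1"
    "surf_space (F gp)" "base_pt (F gp) s" \<phi>p "m_plus F gm gp M1" "\<lambda>t. m_side F gm gp M1 (s, 2 * t - 1)" by (rule I1)
  interpret m2: induced_map "cob_space M2" "cob_base F s gm gp M2" \<gamma>2 \<phi>2 ?\<theta>2 "cob_arc F s gm gp M2"
    "surf_space (F gm)" "base_pt (F gm) s" \<phi>m "m_minus F gm gp M2" "\<lambda>t. cob_base F s gm gp M2" by (rule I2)
  interpret p2: induced_map "cob_space M2" "cob_base F s gm gp M2" \<gamma>2 \<phi>2 ?\<theta>2 "cob_arc F s gm gp M2"
    "surf_space (F gp)" "base_pt (F gp) s" \<phi>p "m_plus F gm gp M2" "\<lambda>t. m_side F gm gp M2 (s, 2 * t - 1)" by (rule I2)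
  note a1 = cobordism_maps[OF ms c1] and a2 = cobordism_maps[OF ms c2]
  have em: "i1 (m_minus F gm gp M1 x) = i2 (m_minus F gm gp M2 x)" if "x \<in> topspace (surf_space (F gm))" for x
    using agree continuous_map_image_subset_topspace[OF continuous_pieces(1)[of F gm gp]] that
    by (simp add: m_minus_def image_subset_iff)
  have ep: "i1 (m_plus F gm gp M1 x) = i2 (m_plus F gm gp M2 x)" if "x \<in> topspace (surf_space (F gp))" for x
    using agree continuous_map_image_subset_topspace[OF continuous_pieces(3)[of F gp gm]] that
    by (simp add: m_plus_def image_subset_iff)
  have es: "i1 (m_side F gm gp M1 (s, 2 * t - 1)) = i2 (m_side F gm gp M2 (s, 2 * t - 1))" if "0 \<le> t" "t \<le> 1" for t
    using agree a1(9) that by (simp add: m_side_def image_subset_iff)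
  have arc: "i1 ` cob_arc F s gm gp M1 \<subseteq> i2 ` cob_arc F s gm gp M2"
    unfolding a1(8) a2(8) using agree a1(9) by (auto simp: image_subset_iff)
  have arc2: "cob_arc F s gm gp M2 \<subseteq> topspace (cob_space M2)"
    unfolding a2(8)
    by (rule order_trans[OF image_mono[OF a1(9)] continuous_map_image_subset_topspace[OF cobordism_props(5)[OF c2]]])
  have het: "homology_equiv_top W (cob_space M2) i2 \<theta> \<epsilon>"
    by (intro homology_equiv_top.intro homology_iso_equiv[OF i2(1)] homology_equiv_top_axioms.intro)
      (use W cobordism_props[OF c2] i2(2) \<theta> \<epsilon> in auto)
  have same_m: "incl 1 i1 (m1.Phi 1 (m1.T 1 x)) = incl 1 i2 (m2.Phi 1 (m2.T 1 x))"
    if "x \<in> surf_cycles (F gm) s \<phi>m" for x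
    by (rule incl_Phi_T_eq[OF I1(1) I2(1) i1 ci2 \<theta> em])
      (use that em[OF base_pt_in[OF ms]] in \<open>auto simp: tcycles1_def\<close>)
  have same_p: "incl 1 i1 (m1.Phi 1 (p1.T 1 y)) = incl 1 i2 (m2.Phi 1 (p2.T 1 y))"
    if "y \<in> surf_cycles (F gp) s \<phi>p" for y
    by (rule incl_Phi_T_eq[OF I1(2) I2(2) i1 ci2 \<theta> ep es]) (use that in \<open>auto simp: tcycles1_def\<close>)
  show ?thesis
    unfolding Mag_eq[OF I1] Mag_eq[OF I2]
  proof clarify
    fix x y r assume x: "x \<in> surf_cycles (F gm) s \<phi>m" and y: "y \<in> surf_cycles (F gp) s \<phi>p" and r: "r \<noteq> 0"
      and Z: "scale r (p1.T 1 y - m1.T 1 x) \<in> tboundaries1 (cob_space M1) (cob_base F s gm gp M1) (cob_arc F s gm gp M1) \<phi>1"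
    have Z2: "scale r (p2.T 1 y - m2.T 1 x) \<in> tensor_gens 1 (cob_space M2) (cob_base F s gm gp M2)"
      using x y by (intro tensor_gens_simps m2.T_gens p2.T_gens) (auto simp: tcycles1_def)
    have "incl 1 i1 (m1.Phi 1 (scale r (p1.T 1 y - m1.T 1 x))) = incl 1 i2 (m2.Phi 1 (scale r (p2.T 1 y - m2.T 1 x)))"
      unfolding lmap_simps[OF m1.lmap_Phi] lmap_simps[OF m2.lmap_Phi] incl_simps same_m[OF x] same_p[OF y] ..
    from boundary_transfer[OF het i1 m1.twisted_space_axioms m2.twisted_space_axioms arc arc2 Z Z2 this]
    obtain r' where r': "r' \<noteq> 0" "scale r' (scale r (p2.T 1 y - m2.T 1 x)) \<in>
      tboundaries1 (cob_space M2) (cob_base F s gm gp M2) (cob_arc F s gm gp M2) \<phi>2" by blast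
    \<comment> \<open>The scalar from the closure in \<open>Mag\<close> and the one from
      \<open>boundary_transfer\<close> are multiplied, and R is an integral domain.\<close>
    have "r' * r \<noteq> 0" using r r'(1) by simp
    moreover have "scale (r' * r) (p2.T 1 y - m2.T 1 x) \<in>
      tboundaries1 (cob_space M2) (cob_base F s gm gp M2) (cob_arc F s gm gp M2) \<phi>2"
      using r'(2) by (simp add: scale_scale)
    ultimately show "\<exists>x' y'. (surf_coset (F gm) s \<phi>m x, surf_coset (F gp) s \<phi>p y) = (surf_coset (F gm) s \<phi>m x', surf_coset (F gp) s \<phi>p y') \<and>
      x' \<in> surf_cycles (F gm) s \<phi>m \<and> y' \<in> surf_cycles (F gp) s \<phi>p \<and>
      (\<exists>r. r \<noteq> 0 \<and> scale r (p2.T 1 y' - m2.T 1 x') \<in>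
        tboundaries1 (cob_space M2) (cob_base F s gm gp M2) (cob_arc F s gm gp M2) \<phi>2)" using x y by blast
  qed
qed

text \<open>A class of \<open>M\<close> is recovered from its image in \<open>W\<close> by the
  inverse isomorphism, so the character of \<open>W\<close> pulls back to the given one on
  cycles.\<close>

lemma character_pullback:
  assumes i: "homology_iso M W i"
    and \<phi>W: "\<And>h. h \<in> carrier (homology_group 1 W) \<Longrightarrow>
       \<phi>W h = \<phi> (inv_into (carrier (homology_group 1 M)) (hom_induced 1 M {} W {} i) h)"
    and c: "singular_relcycle 1 M {} c"
  shows "\<phi> (homologous_rel_set 1 M {} c) = \<phi>W (homologous_rel_set 1 W {} (chain_map 1 i c))"
    "singular_relcycle 1 W {} (chain_map 1 i c)"
proof -
  have ci: "continuous_map M W i" and iso: "hom_induced 1 M {} W {} i \<in> iso (homology_group 1 M) (homology_group 1 W)"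
    using i by (auto simp: homology_iso_def)
  show cW: "singular_relcycle 1 W {} (chain_map 1 i c)"
    using singular_relcycle_chain_map[OF c ci, of "{}"] by simp
  have car: "homologous_rel_set 1 Y {} d \<in> carrier (homology_group 1 Y)" if "singular_relcycle 1 Y {} d" for d and Y :: "'z topology"
    using that carrier_relative_homology_group[of 1 Y "{}"] by (auto simp: One_nat_def)
  have h: "hom_induced 1 M {} W {} i (homologous_rel_set 1 M {} c) = homologous_rel_set 1 W {} (chain_map 1 i c)"
    using hom_induced_chain_map[OF ci _ c] by simp
  have "inj_on (hom_induced 1 M {} W {} i) (carrier (homology_group 1 M))"
    using iso by (simp add: iso_def bij_betw_def)
  from inv_into_f_f[OF this car[OF c]]
  show "\<phi> (homologous_rel_set 1 M {} c) = \<phi>W (homologous_rel_set 1 W {} (chain_map 1 i c))"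
    unfolding \<phi>W[OF car[OF cW]] h by simp
qed

theorem proposition4p5:
  fixes G :: "'r::idom set" and bar :: "'r \<Rightarrow> 'r" and \<epsilon> :: "'r \<Rightarrow> int"
    and F :: "nat \<Rightarrow> 'f surface" and s :: complex
    and gm gp :: nat and \<phi>m \<phi>p :: "'f chain set \<Rightarrow> 'r"
    and M1 :: "('f, 'm) cobordism" and \<phi>1 :: "'m chain set \<Rightarrow> 'r"
    and M2 :: "('f, 'n) cobordism" and \<phi>2 :: "'n chain set \<Rightarrow> 'r"
  assumes "ring_data G bar"
    and "unital_ring_hom \<epsilon>" and "\<epsilon> ` G = {1}"
    and "model_surfaces F s"
    and "is_cob_morphism F G (gm, \<phi>m) (gp, \<phi>p) (M1, \<phi>1)"
    and "is_cob_morphism F G (gm, \<phi>m) (gp, \<phi>p) (M2, \<phi>2)"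
    and "homology_concordant TYPE('w) F gm gp (M1, \<phi>1) (M2, \<phi>2)"
  shows "Mag F s (gm, \<phi>m) (gp, \<phi>p) (M1, \<phi>1) = Mag F s (gm, \<phi>m) (gp, \<phi>p) (M2, \<phi>2)"
proof -
  note ms = assms(4) and mor1 = assms(5) and mor2 = assms(6)
  have c1: "is_cobordism F gm gp M1" and c2: "is_cobordism F gm gp M2"
    and \<phi>1: "\<phi>1 \<in> hom (homology_group 1 (cob_space M1)) (unit_group\<lparr>carrier := G\<rparr>)"
    using mor1 mor2 by (simp_all add: is_cob_morphism_def H1_homs_def)
  have G: "subgroup G unit_group" using assms(1) by (simp add: ring_data_def)
  obtain W :: "'w topology" and i1 i2 where W: "compact_space W" "Hausdorff_space W" "loc_acyc W" "path_connected_space W"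
    and i1: "homology_iso (cob_space M1) W i1" "inj_on i1 (topspace (cob_space M1))"
    and i2: "homology_iso (cob_space M2) W i2" "inj_on i2 (topspace (cob_space M2))"
    and agree: "\<And>x. x \<in> topspace (bdry_surface F gm gp) \<Longrightarrow> i1 (cob_param M1 x) = i2 (cob_param M2 x)"
    and \<phi>12: "\<And>h. h \<in> carrier (homology_group 1 W) \<Longrightarrow>
       \<phi>1 (inv_into (carrier (homology_group 1 (cob_space M1))) (hom_induced 1 (cob_space M1) {} W {} i1) h) =
       \<phi>2 (inv_into (carrier (homology_group 1 (cob_space M2))) (hom_induced 1 (cob_space M2) {} W {} i2) h)"
    by (rule concordance[OF c1 c2 assms(7)]) (rule that)
  have ci: "continuous_map (cob_space M1) W i1" "continuous_map (cob_space M2) W i2"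
    using i1(1) i2(1) by (auto simp: homology_iso_def)
  \<comment> \<open>Concordance says that the characters of the two cobordisms induce the same
    character on the homology of \<open>W\<close>; it is written here through
    \<open>M1\<close>.\<close>
  define \<phi>W where "\<phi>W = \<phi>1 \<circ> inv_into (carrier (homology_group 1 (cob_space M1))) (hom_induced 1 (cob_space M1) {} W {} i1)"
  have "hom_induced 1 (cob_space M1) {} W {} i1 \<in> iso (homology_group 1 (cob_space M1)) (homology_group 1 W)"
    using i1(1) by (simp add: homology_iso_def)
  from group.iso_set_sym[OF group_relative_homology_group this]
  have "inv_into (carrier (homology_group 1 (cob_space M1))) (hom_induced 1 (cob_space M1) {} W {} i1)
      \<in> hom (homology_group 1 W) (homology_group 1 (cob_space M1))" by (simp add: iso_def)
  from hom_compose[OF this \<phi>1] have \<phi>W: "\<phi>W \<in> hom (homology_group 1 W) (unit_group\<lparr>carrier := G\<rparr>)"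
    by (simp add: \<phi>W_def)
  have "i1 (cob_base F s gm gp M1) \<in> topspace W"
    using cobordism_maps(10)[OF ms c1] continuous_map_image_subset_topspace[OF ci(1)] by blast
  then obtain \<gamma> where "base_paths W (i1 (cob_base F s gm gp M1)) \<gamma>" using base_paths_exist[OF W(4)] by blast
  note ch = base_paths.char_of_hom[OF this \<phi>W G]
  \<comment> \<open>The extension to chains is made once, on \<open>W\<close>, and pulled back to
    both cobordisms, so their local systems agree wherever their images meet. Its values lie in
    \<open>G\<close>, where \<open>\<epsilon>\<close> is 1.\<close>
  define \<theta> where "\<theta> = (\<lambda>c. \<phi>W (homologous_rel_set 1 W {} (based \<gamma> c)))"
  have \<theta>: "char_sys W \<theta>" and \<theta>G: "\<And>c. singular_chain 1 W c \<Longrightarrow> \<theta> c \<in> G"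
    and \<theta>c: "\<And>c. singular_relcycle 1 W {} c \<Longrightarrow> \<theta> c = \<phi>W (homologous_rel_set 1 W {} c)"
    unfolding \<theta>_def by (fact ch)+
  have \<epsilon>: "\<epsilon> (\<theta> c) = 1" if "singular_chain 1 W c" for c
    using \<theta>G[OF that] assms(3) by blast
  have p1: "\<phi>1 (homologous_rel_set 1 (cob_space M1) {} c) = \<theta> (chain_map 1 i1 c)"
    if "singular_relcycle 1 (cob_space M1) {} c" for c
    using character_pullback[OF i1(1) _ that, of \<phi>W \<phi>1] \<theta>c by (simp add: \<phi>W_def)
  have p2: "\<phi>2 (homologous_rel_set 1 (cob_space M2) {} c) = \<theta> (chain_map 1 i2 c)"
    if "singular_relcycle 1 (cob_space M2) {} c" for c
    using character_pullback[OF i2(1) _ that, of \<phi>W \<phi>2] \<theta>c \<phi>12 by (simp add: \<phi>W_def)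
  \<comment> \<open>The character \<open>\<theta>\<close> is symmetric in the two cobordisms, so the
    inclusion can be applied in both directions.\<close>
  show ?thesis
    using Mag_subset[OF ms mor1 mor2 W(1-3) \<theta> assms(2) \<epsilon> ci(1) i2 agree p1 p2]
      Mag_subset[OF ms mor2 mor1 W(1-3) \<theta> assms(2) \<epsilon> ci(2) i1 agree[symmetric] p2 p1] by blast
qed

end
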